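(* Let $\Psi_k\colon\mathrm{Emb}_d^{op}\to\mathrm{Top}$ be the sheaf of $k$-dimensional submanifolds that are closed as subsets, and let $M$ be a (collared) $d$-dimensional manifold with boundary. If $\partial M=N\times\mathbb{R}$ for some $(d-2)$-manifold $N$ without boundary, then $\Psi_k$ is group like at $M$.
   Context: **The sheaf $\Psi_k$.** $\mathrm{Emb}_d$ is the category of smooth $d$-manifolds without boundary and smooth embeddings, enriched in spaces by the $C^\infty$-topology. For a $d$-manifold $W$ without boundary, $\Psi_k(W)$ is the set of closed subsets of $W$ which are smooth $k$-dimensional submanifolds without boundary, topologized by the neighborhoods of $P_0\in\Psi_k(W)$ $$\mathcal{V}_{K,A}(P_0)=\{P\in\Psi_k(W)\mid P\cap K=j(P_0)\cap K\text{ for some }j\in A\},$$ for $K\subset W$ compact and $A\subset\mathrm{Emb}(P_0,W)$ a neighborhood of the inclusion in the $C^\infty$-topology. An embedding $e\colon W\to W'$ induces $e^\ast(G)=e^{-1}(G)$; sheaf gluing, denoted $\cup$, is union of subsets. **Conventions for a sheaf $\Psi$ on $\mathrm{Emb}_d$.** For a $d$-manifold $M$ with boundary (with a chosen collar), put $\Psi(\partial M):=\Psi(\partial M\times\mathbb{R})$; for $G\in\Psi(\partial M)$ and $I\subset\mathbb{R}$ open, $G|_I$ is the restriction of $G$ to $\partial M\times I$. For a smooth embedding $\alpha\colon J'\to J$ of open subsets of $\mathbb{R}$, $\alpha^\ast=(\mathrm{id}_{\partial M}\times\alpha)^\ast\colon\Psi(\partial M\times J)\to\Psi(\partial M\times J')$;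 $t_u\colon\mathbb{R}\to\mathbb{R}$ is $t_u(x)=x+u$. For $I\subset\mathbb{R}$ open, $\Psi(\partial M)^{\bot_I}\subset\Psi(\partial M)$ is the subspace of elements $G$ orthogonal to $\partial M$ on $I$, i.e. such that $G|_{J'}=\alpha^\ast(G|_J)$ for all open intervals $J,J'\subset I$ and all orientation preserving diffeomorphisms $\alpha\colon J'\to J$. For $a\in\mathbb{R}$, $\Psi(\partial M)^{\bot_a}=\operatorname{colim}_{\epsilon>0}\Psi(\partial M)^{\bot_{(a-\epsilon,a+\epsilon)}}$ and $\Psi(\partial M)^{\bot_{0,1}}=\Psi(\partial M)^{\bot_0}\cap\Psi(\partial M)^{\bot_1}$. **Group like.** (In each condition $\epsilon>0$ is some sufficiently small number.) A right inverse for $G\in\Psi(\partial M)^{\bot_{0,1}}$ is an $R\in\Psi(\partial M)$ such that i) $R|_{(1-\epsilon,1+\epsilon)}=G|_{(1-\epsilon,1+\epsilon)}$; ii) $t_2^\ast(R)|_{(-\epsilon,\epsilon)}=G|_{(-\epsilon,\epsilon)}$; iii) there is a path $\gamma\colon[0,1]\to\Psi(\partial M)$ with $\gamma(0)=G|_{(-\infty,1+\epsilon)}\cup R|_{(1-\epsilon,\infty)}$, $\gamma(1)\in\Psi(\partial M)^{\bot_{(-\epsilon,2+\epsilon)}}$, and $\gamma(t)|_{(-\infty,\epsilon)}=G|_{(-\infty,\epsilon)}$, $\gamma(t)|_{(2-\epsilon,\infty)}=R|_{(2-\epsilon,\infty)}$ for all $t$. A left inverse for $G$ is an $L\in\Psi(\partial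 M)$ such that i) $L|_{(-\epsilon,\epsilon)}=G|_{(-\epsilon,\epsilon)}$; ii) $t_{-2}^\ast(L)|_{(1-\epsilon,1+\epsilon)}=G|_{(1-\epsilon,1+\epsilon)}$; iii) there is a path $\delta\colon[0,1]\to\Psi(\partial M)$ with $\delta(0)=L|_{(-\infty,\epsilon)}\cup G|_{(-\epsilon,\infty)}$, $\delta(1)\in\Psi(\partial M)^{\bot_{(-1-\epsilon,1+\epsilon)}}$, and $\delta(t)|_{(-\infty,-1+\epsilon)}=L|_{(-\infty,-1+\epsilon)}$, $\delta(t)|_{(1-\epsilon,\infty)}=G|_{(1-\epsilon,\infty)}$ for all $t$. $\Psi$ is group like at $M$ if every $G\in\Psi(\partial M)^{\bot_{(-\infty,\epsilon)}}\cap\Psi(\partial M)^{\bot_{(1-\epsilon,\infty)}}$ (for some $\epsilon>0$) has both a right and a left inverse. *)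

theory Defs
  imports "HOL-Analysis.Analysis"
begin

section \<open>Smooth functions\<close>

text \<open>
  Euclidean \<open>n\<close>-space is the library topology \<^term>\<open>Euclidean_space n\<close>, whose points are the
  \<open>x :: nat \<Rightarrow> real\<close> with \<open>x i = 0\<close> for \<open>i \<ge> n\<close>. The dimension is thus a number, possibly \<open>0\<close>, and
  Euclidean \<open>k\<close>-space is the standard linear subspace of Euclidean \<open>n\<close>-space for \<open>k \<le> n\<close>.
\<close>

definition partial_deriv :: "nat \<Rightarrow> ((nat \<Rightarrow> real) \<Rightarrow> real) \<Rightarrow> (nat \<Rightarrow> real) \<Rightarrow> real" where
  "partial_deriv i f x = deriv (\<lambda>t. f (x(i := t))) (x i)"

definition partial_derivs :: "nat list \<Rightarrow> ((nat \<Rightarrow> real) \<Rightarrow> real) \<Rightarrow> (nat \<Rightarrow> real) \<Rightarrow> real" where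
  "partial_derivs is f = foldr partial_deriv is f"

definition smooth_open :: "nat \<Rightarrow> (nat \<Rightarrow> real) set \<Rightarrow> ((nat \<Rightarrow> real) \<Rightarrow> real) \<Rightarrow> bool" where
  "smooth_open n U f \<longleftrightarrow> openin (Euclidean_space n) U \<and>
     (\<forall>is. set is \<subseteq> {..<n} \<longrightarrow>
        continuous_map (subtopology (Euclidean_space n) U) euclideanreal (partial_derivs is f) \<and>
        (\<forall>i<n. \<forall>x\<in>U. (\<lambda>t. partial_derivs is f (x(i := t))) field_differentiable at (x i)))"

text \<open>On subsets that are not open, such as open subsets of a half space, smoothness means local
  extendability to a smooth function.\<close>

definition smooth_on :: "nat \<Rightarrow> (nat \<Rightarrow> real) set \<Rightarrow> ((nat \<Rightarrow> real) \<Rightarrow> nat \<Rightarrow> real) \<Rightarrow> bool" where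
  "smooth_on n S F \<longleftrightarrow>
     (\<forall>j. \<forall>x\<in>S. \<exists>U g. x \<in> U \<and> smooth_open n U g \<and> (\<forall>y\<in>U \<inter> S. F y j = g y))"

definition smooth_real :: "real set \<Rightarrow> (real \<Rightarrow> real) \<Rightarrow> bool" where
  "smooth_real J \<alpha> \<longleftrightarrow> (\<forall>m. \<forall>t\<in>J. (deriv ^^ m) \<alpha> field_differentiable at t)"

section \<open>Smooth manifolds\<close>

text \<open>A chart is a pair \<open>(U, \<phi>)\<close>; only the values of \<open>\<phi>\<close> on \<open>U\<close> matter. Atlases are not assumed
  to be maximal.\<close>

type_synonym 'a chart = "'a set \<times> ('a \<Rightarrow> nat \<Rightarrow> real)"

record 'a manifold =
  mdim :: nat
  mtop :: "'a topology"
  matlas :: "'a chart set"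

definition half_space :: "nat \<Rightarrow> (nat \<Rightarrow> real) topology" where
  "half_space n = subtopology (Euclidean_space n) {x. x (n - 1) \<ge> 0}"

definition is_chart :: "(nat \<Rightarrow> real) topology \<Rightarrow> 'a topology \<Rightarrow> 'a chart \<Rightarrow> bool" where
  "is_chart H X = (\<lambda>(U, \<phi>). openin X U \<and> openin H (\<phi> ` U) \<and>
     homeomorphic_map (subtopology X U) (subtopology H (\<phi> ` U)) \<phi>)"

definition smooth_transition :: "nat \<Rightarrow> 'a chart \<Rightarrow> 'a chart \<Rightarrow> bool" where
  "smooth_transition n = (\<lambda>(U, \<phi>) (V, \<psi>). smooth_on n (\<phi> ` (U \<inter> V)) (\<lambda>x. \<psi> (inv_into U \<phi> x)))"

definition second_countable_space :: "'a topology \<Rightarrow> bool" where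
  "second_countable_space X \<longleftrightarrow>
     (\<exists>\<B>. countable \<B> \<and> (\<forall>B\<in>\<B>. openin X B) \<and>
          (\<forall>U x. openin X U \<and> x \<in> U \<longrightarrow> (\<exists>B\<in>\<B>. x \<in> B \<and> B \<subseteq> U)))"

definition modelled_on :: "(nat \<Rightarrow> real) topology \<Rightarrow> 'a manifold \<Rightarrow> bool" where
  "modelled_on H M \<longleftrightarrow>
     Hausdorff_space (mtop M) \<and> second_countable_space (mtop M) \<and>
     (\<forall>c\<in>matlas M. is_chart H (mtop M) c) \<and>
     (\<Union>(U, \<phi>)\<in>matlas M. U) = topspace (mtop M) \<and>
     (\<forall>c\<in>matlas M. \<forall>c'\<in>matlas M. smooth_transition (mdim M) c c')"

definition manifold_without_boundary :: "'a manifold \<Rightarrow> bool" where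
  "manifold_without_boundary M \<longleftrightarrow> modelled_on (Euclidean_space (mdim M)) M"

definition manifold_with_boundary :: "'a manifold \<Rightarrow> bool" where
  "manifold_with_boundary M \<longleftrightarrow> 0 < mdim M \<and> modelled_on (half_space (mdim M)) M"

definition smooth_map :: "'a manifold \<Rightarrow> 'b manifold \<Rightarrow> ('a \<Rightarrow> 'b) \<Rightarrow> bool" where
  "smooth_map M N f \<longleftrightarrow> continuous_map (mtop M) (mtop N) f \<and>
     (\<forall>(U, \<phi>)\<in>matlas M. \<forall>(V, \<psi>)\<in>matlas N.
        smooth_on (mdim M) (\<phi> ` {p \<in> U. f p \<in> V}) (\<lambda>x. \<psi> (f (inv_into U \<phi> x))))"

definition diffeomorphism :: "'a manifold \<Rightarrow> 'b manifold \<Rightarrow> ('a \<Rightarrow> 'b) \<Rightarrow> bool" where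
  "diffeomorphism M N f \<longleftrightarrow> homeomorphic_map (mtop M) (mtop N) f \<and>
     smooth_map M N f \<and> smooth_map N M (inv_into (topspace (mtop M)) f)"

definition diffeomorphic :: "'a manifold \<Rightarrow> 'b manifold \<Rightarrow> bool" where
  "diffeomorphic M N \<longleftrightarrow> (\<exists>f. diffeomorphism M N f)"

text \<open>The maximal atlas of a manifold without boundary.\<close>

definition max_atlas :: "'a manifold \<Rightarrow> 'a chart set" where
  "max_atlas M = {c. is_chart (Euclidean_space (mdim M)) (mtop M) c \<and>
     (\<forall>c'\<in>matlas M. smooth_transition (mdim M) c c' \<and> smooth_transition (mdim M) c' c)}"

definition open_submanifold :: "'a manifold \<Rightarrow> 'a set \<Rightarrow> 'a manifold" where
  "open_submanifold M C =
     \<lparr>mdim = mdim M, mtop = subtopology (mtop M) C, matlas = (\<lambda>(U, \<phi>). (U \<inter> C, \<phi>)) ` matlas M\<rparr>"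

text \<open>The product \<open>B \<times> J\<close> for an interval (or an open subset of the line) \<open>J\<close>; the coordinate of
  \<open>J\<close> becomes the last one. For \<open>J = [0,1)\<close> its charts take values in the half space.\<close>

definition times_interval :: "'a manifold \<Rightarrow> real set \<Rightarrow> ('a \<times> real) manifold" where
  "times_interval B J =
     \<lparr>mdim = Suc (mdim B),
      mtop = prod_topology (mtop B) (subtopology euclideanreal J),
      matlas = (\<lambda>(U, \<phi>). (U \<times> J, \<lambda>(x, t). (\<phi> x)(mdim B := t))) ` matlas B\<rparr>"

definition boundary_points :: "'a manifold \<Rightarrow> 'a set" where
  "boundary_points M = {p. \<exists>(U, \<phi>)\<in>matlas M. p \<in> U \<and> \<phi> p (mdim M - 1) = 0}"

definition boundary :: "'a manifold \<Rightarrow> 'a manifold" where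
  "boundary M =
     \<lparr>mdim = mdim M - 1,
      mtop = subtopology (mtop M) (boundary_points M),
      matlas = (\<lambda>(U, \<phi>). (U \<inter> boundary_points M, \<phi>)) ` matlas M\<rparr>"

definition collar :: "'a manifold \<Rightarrow> ('a \<times> real \<Rightarrow> 'a) \<Rightarrow> bool" where
  "collar M c \<longleftrightarrow>
     (let C = c ` (boundary_points M \<times> {0..<1}) in
        openin (mtop M) C \<and>
        diffeomorphism (times_interval (boundary M) {0..<1}) (open_submanifold M C) c \<and>
        (\<forall>p\<in>boundary_points M. c (p, 0) = p))"

section \<open>Embeddings and the \<open>C\<^sup>\<infinity>\<close>-topology\<close>

definition immersion :: "'a manifold \<Rightarrow> 'b manifold \<Rightarrow> ('a \<Rightarrow> 'b) \<Rightarrow> bool" where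
  "immersion P W f \<longleftrightarrow> smooth_map P W f \<and>
     (\<forall>(U, \<phi>)\<in>matlas P. \<forall>(V, \<psi>)\<in>matlas W. \<forall>p\<in>U. f p \<in> V \<longrightarrow>
        (\<forall>v. (\<forall>j<mdim W.
                (\<Sum>i<mdim P. v i * partial_deriv i (\<lambda>x. \<psi> (f (inv_into U \<phi> x)) j) (\<phi> p)) = 0)
             \<longrightarrow> (\<forall>i<mdim P. v i = 0)))"

definition embeddings :: "'a manifold \<Rightarrow> 'b manifold \<Rightarrow> ('a \<Rightarrow> 'b) set" where
  "embeddings P W = {f. immersion P W f \<and> embedding_map (mtop P) (mtop W) f}"

text \<open>
  The \<open>C\<^sup>\<infinity>\<close>-topology on smooth maps is the Whitney (strong) one: it is the union of the strong
  \<open>C\<^sup>r\<close>-topologies for \<open>r < \<infinity>\<close>. A basic neighbourhood of \<open>f\<close> is given by a family of tuples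
  \<open>(U, \<phi>, C, V, \<psi>, e)\<close> in which \<open>(U, \<phi>)\<close> and \<open>(V, \<psi>)\<close> are charts of the source and the target, the
  \<open>U\<close> are locally finite, \<open>C \<subseteq> U\<close> is compact, \<open>f\<close> maps \<open>C\<close> to \<open>V\<close>, and \<open>e > 0\<close>.
  With the compact-open (weak) topology instead, the parts of a noncompact \<open>P\<^sub>0\<close> that are far away
  could be moved into \<open>K\<close> by elements of every neighbourhood of the inclusion, so that the sets
  \<open>\<V>\<^sub>K\<^sub>,\<^sub>A(P\<^sub>0)\<close> below would not separate, say, one line in the plane from two parallel lines.
\<close>

type_synonym ('a, 'b) strong_data =
  "('a set \<times> ('a \<Rightarrow> nat \<Rightarrow> real) \<times> 'a set \<times> 'b set \<times> ('b \<Rightarrow> nat \<Rightarrow> real) \<times> real) set"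

definition is_strong_data ::
  "'a manifold \<Rightarrow> 'b manifold \<Rightarrow> ('a \<Rightarrow> 'b) \<Rightarrow> ('a, 'b) strong_data \<Rightarrow> bool" where
  "is_strong_data P W f D \<longleftrightarrow>
     (\<forall>(U, \<phi>, C, V, \<psi>, e)\<in>D. (U, \<phi>) \<in> max_atlas P \<and> (V, \<psi>) \<in> max_atlas W \<and>
        compactin (mtop P) C \<and> C \<subseteq> U \<and> f ` C \<subseteq> V \<and> 0 < e) \<and>
     (\<forall>p\<in>topspace (mtop P). \<exists>G. openin (mtop P) G \<and> p \<in> G \<and> finite {(U, z) \<in> D. U \<inter> G \<noteq> {}})"

definition strong_basic ::
  "'a manifold \<Rightarrow> 'b manifold \<Rightarrow> ('a \<Rightarrow> 'b) \<Rightarrow> ('a, 'b) strong_data \<Rightarrow> nat \<Rightarrow> ('a \<Rightarrow> 'b) set" where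
  "strong_basic P W f D r =
     {g. smooth_map P W g \<and>
         (\<forall>(U, \<phi>, C, V, \<psi>, e)\<in>D. g ` C \<subseteq> V \<and>
            (\<forall>x\<in>\<phi> ` C. \<forall>is. set is \<subseteq> {..<mdim P} \<and> length is \<le> r \<longrightarrow> (\<forall>j<mdim W.
               \<bar>partial_derivs is (\<lambda>y. \<psi> (g (inv_into U \<phi> y)) j) x
                - partial_derivs is (\<lambda>y. \<psi> (f (inv_into U \<phi> y)) j) x\<bar> < e)))}"

definition emb_neighbourhood :: "'a manifold \<Rightarrow> 'b manifold \<Rightarrow> ('a \<Rightarrow> 'b) \<Rightarrow> ('a \<Rightarrow> 'b) set \<Rightarrow> bool" where
  "emb_neighbourhood P W f A \<longleftrightarrow> A \<subseteq> embeddings P W \<and>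
     (\<exists>D r. is_strong_data P W f D \<and> strong_basic P W f D r \<inter> embeddings P W \<subseteq> A)"

section \<open>The spaces \<open>\<Psi>\<^sub>k(W)\<close>\<close>

text \<open>Charts of \<open>W\<close> that flatten \<open>P\<close>. The condition \<open>k \<le> mdim W\<close> is not redundant, because
  \<^term>\<open>topspace (Euclidean_space k)\<close> contains Euclidean \<open>n\<close>-space for \<open>n \<le> k\<close>.\<close>

definition slice_charts :: "nat \<Rightarrow> 'a manifold \<Rightarrow> 'a set \<Rightarrow> 'a chart set" where
  "slice_charts k W P = {(U, \<phi>) \<in> max_atlas W. k \<le> mdim W \<and>
     \<phi> ` (U \<inter> P) = \<phi> ` U \<inter> topspace (Euclidean_space k)}"

definition is_submanifold :: "nat \<Rightarrow> 'a manifold \<Rightarrow> 'a set \<Rightarrow> bool" where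
  "is_submanifold k W P \<longleftrightarrow> P \<subseteq> topspace (mtop W) \<and> (\<forall>p\<in>P. \<exists>(U, \<phi>)\<in>slice_charts k W P. p \<in> U)"

definition submanifold :: "nat \<Rightarrow> 'a manifold \<Rightarrow> 'a set \<Rightarrow> 'a manifold" where
  "submanifold k W P =
     \<lparr>mdim = k, mtop = subtopology (mtop W) P, matlas = (\<lambda>(U, \<phi>). (U \<inter> P, \<phi>)) ` slice_charts k W P\<rparr>"

definition Psi_set :: "nat \<Rightarrow> 'a manifold \<Rightarrow> 'a set set" where
  "Psi_set k W = {P. closedin (mtop W) P \<and> is_submanifold k W P}"

definition Psi_nbhd :: "nat \<Rightarrow> 'a manifold \<Rightarrow> 'a set \<Rightarrow> ('a \<Rightarrow> 'a) set \<Rightarrow> 'a set \<Rightarrow> 'a set set" where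
  "Psi_nbhd k W K A P0 = {P \<in> Psi_set k W. \<exists>j\<in>A. P \<inter> K = j ` P0 \<inter> K}"

definition Psi_open :: "nat \<Rightarrow> 'a manifold \<Rightarrow> 'a set set \<Rightarrow> bool" where
  "Psi_open k W \<U> \<longleftrightarrow> \<U> \<subseteq> Psi_set k W \<and>
     (\<forall>P0\<in>\<U>. \<exists>K A. compactin (mtop W) K \<and>
        emb_neighbourhood (submanifold k W P0) W (\<lambda>x. x) A \<and> Psi_nbhd k W K A P0 \<subseteq> \<U>)"

definition Psi_space :: "nat \<Rightarrow> 'a manifold \<Rightarrow> 'a set topology" where
  "Psi_space k W = topology (Psi_open k W)"

lemma emb_neighbourhood_Int:
  assumes "emb_neighbourhood P W f A" "emb_neighbourhood P W f B"
  shows "emb_neighbourhood P W f (A \<inter> B)"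
proof -
  obtain D r D' r' where D: "is_strong_data P W f D" "strong_basic P W f D r \<inter> embeddings P W \<subseteq> A"
    and D': "is_strong_data P W f D'" "strong_basic P W f D' r' \<inter> embeddings P W \<subseteq> B"
    using assms unfolding emb_neighbourhood_def by blast
  have fin: "\<exists>G. openin (mtop P) G \<and> p \<in> G \<and> finite {(U, z) \<in> D \<union> D'. U \<inter> G \<noteq> {}}"
    if p: "p \<in> topspace (mtop P)" for p
  proof -
    obtain G where G: "openin (mtop P) G" "p \<in> G" "finite {(U, z) \<in> D. U \<inter> G \<noteq> {}}"
      using D(1) p unfolding is_strong_data_def by blast
    obtain G' where G': "openin (mtop P) G'" "p \<in> G'" "finite {(U, z) \<in> D'. U \<inter> G' \<noteq> {}}"
      using D'(1) p unfolding is_strong_data_def by blast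
    have "{(U, z) \<in> D \<union> D'. U \<inter> (G \<inter> G') \<noteq> {}}
        \<subseteq> {(U, z) \<in> D. U \<inter> G \<noteq> {}} \<union> {(U, z) \<in> D'. U \<inter> G' \<noteq> {}}"
      by auto
    then have "finite {(U, z) \<in> D \<union> D'. U \<inter> (G \<inter> G') \<noteq> {}}"
      using G(3) G'(3) by (meson finite_UnI finite_subset)
    with G(1,2) G'(1,2) show ?thesis
      by (intro exI[of _ "G \<inter> G'"]) auto
  qed
  have "is_strong_data P W f (D \<union> D')"
    unfolding is_strong_data_def ball_Un[of D D']
    by (rule conjI[OF conjI[OF D(1)[unfolded is_strong_data_def, THEN conjunct1]
            D'(1)[unfolded is_strong_data_def, THEN conjunct1]] ballI[OF fin]])
  moreover have "strong_basic P W f (D \<union> D') (max r r')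
      \<subseteq> strong_basic P W f D r \<inter> strong_basic P W f D' r'"
    unfolding strong_basic_def ball_Un[of D D'] by (auto simp: case_prod_beta)
  ultimately show ?thesis
    using assms D(2) D'(2) unfolding emb_neighbourhood_def by blast
qed

lemma istopology_Psi_open: "istopology (Psi_open k W)"
  unfolding istopology_def
proof (intro conjI allI impI)
  fix S T assume S: "Psi_open k W S" and T: "Psi_open k W T"
  show "Psi_open k W (S \<inter> T)"
    unfolding Psi_open_def
  proof (intro conjI ballI)
    show "S \<inter> T \<subseteq> Psi_set k W" using S unfolding Psi_open_def by blast
    fix P0 assume P0: "P0 \<in> S \<inter> T"
    obtain K A where 1: "compactin (mtop W) K"
      "emb_neighbourhood (submanifold k W P0) W (\<lambda>x. x) A" "Psi_nbhd k W K A P0 \<subseteq> S"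
      using S P0 unfolding Psi_open_def by blast
    obtain K' A' where 2: "compactin (mtop W) K'"
      "emb_neighbourhood (submanifold k W P0) W (\<lambda>x. x) A'" "Psi_nbhd k W K' A' P0 \<subseteq> T"
      using T P0 unfolding Psi_open_def by blast
    have "P \<in> Psi_nbhd k W K A P0 \<inter> Psi_nbhd k W K' A' P0"
      if P: "P \<in> Psi_nbhd k W (K \<union> K') (A \<inter> A') P0" for P
    proof -
      obtain j where j: "P \<in> Psi_set k W" "j \<in> A" "j \<in> A'" "P \<inter> (K \<union> K') = j ` P0 \<inter> (K \<union> K')"
        using P unfolding Psi_nbhd_def by blast
      have "P \<inter> K = j ` P0 \<inter> K" "P \<inter> K' = j ` P0 \<inter> K'"
        using j(4) by blast+
      with j(1-3) show ?thesis unfolding Psi_nbhd_def by blast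
    qed
    then have "Psi_nbhd k W (K \<union> K') (A \<inter> A') P0 \<subseteq> S \<inter> T"
      using 1(3) 2(3) by blast
    then show "\<exists>K A. compactin (mtop W) K \<and>
        emb_neighbourhood (submanifold k W P0) W (\<lambda>x. x) A \<and> Psi_nbhd k W K A P0 \<subseteq> S \<inter> T"
      using compactin_Un[OF 1(1) 2(1)] emb_neighbourhood_Int[OF 1(2) 2(2)] by blast
  qed
next
  fix \<K> assume K: "\<forall>S\<in>\<K>. Psi_open k W S"
  show "Psi_open k W (\<Union>\<K>)"
    unfolding Psi_open_def
  proof (intro conjI ballI)
    show "\<Union>\<K> \<subseteq> Psi_set k W" using K unfolding Psi_open_def by blast
    fix P0 assume "P0 \<in> \<Union>\<K>"
    then obtain S where S: "S \<in> \<K>" "P0 \<in> S" by blast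
    with K obtain K A where "compactin (mtop W) K"
      "emb_neighbourhood (submanifold k W P0) W (\<lambda>x. x) A" "Psi_nbhd k W K A P0 \<subseteq> S"
      unfolding Psi_open_def by blast
    with S show "\<exists>K A. compactin (mtop W) K \<and>
        emb_neighbourhood (submanifold k W P0) W (\<lambda>x. x) A \<and> Psi_nbhd k W K A P0 \<subseteq> \<Union>\<K>"
      by blast
  qed
qed

lemma openin_Psi_space: "openin (Psi_space k W) = Psi_open k W"
  unfolding Psi_space_def by (rule topology_inverse'[OF istopology_Psi_open])

lemma topspace_Psi_space: "topspace (Psi_space k W) = Psi_set k W"
proof -
  have "emb_neighbourhood P W (\<lambda>x. x) (embeddings P W)" for P :: "'a manifold"
    unfolding emb_neighbourhood_def is_strong_data_def
    by (intro conjI exI[of _ "{}"]) auto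
  then have "\<exists>K A. compactin (mtop W) K \<and>
      emb_neighbourhood (submanifold k W P0) W (\<lambda>x. x) A \<and> Psi_nbhd k W K A P0 \<subseteq> Psi_set k W" for P0
    unfolding Psi_nbhd_def by (metis (no_types, lifting) compactin_empty mem_Collect_eq subsetI)
  then have "Psi_open k W (Psi_set k W)"
    unfolding Psi_open_def by blast
  moreover have "S \<subseteq> Psi_set k W" if "Psi_open k W S" for S
    using that unfolding Psi_open_def by blast
  ultimately show ?thesis
    unfolding topspace_def openin_Psi_space by blast
qed

section \<open>Sheaves on manifolds and the group like condition\<close>

text \<open>The data of a sheaf, on the manifolds without boundary whose points have type \<open>'a\<close>:
  \<open>sections F W\<close> is the space \<open>F(W)\<close>, \<open>pull F W W' e\<close> is the map from \<open>F(W')\<close> to \<open>F(W)\<close> induced by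
  an embedding \<open>e\<close> of \<open>W\<close> in \<open>W'\<close>, and \<open>glue F\<close> glues two sections which agree on the overlap.\<close>

record ('a, 's) emb_sheaf =
  sections :: "'a manifold \<Rightarrow> 's topology"
  pull :: "'a manifold \<Rightarrow> 'a manifold \<Rightarrow> ('a \<Rightarrow> 'a) \<Rightarrow> 's \<Rightarrow> 's"
  glue :: "'s \<Rightarrow> 's \<Rightarrow> 's"

definition Psi :: "nat \<Rightarrow> ('a, 'a set) emb_sheaf" where
  "Psi k =
     \<lparr>sections = Psi_space k,
      pull = (\<lambda>W W' e G. {x \<in> topspace (mtop W). e x \<in> G}),
      glue = (\<union>)\<rparr>"

context
  fixes F :: "('a \<times> real, 's) emb_sheaf"
    and B :: "'a manifold"
begin

text \<open>Throughout, \<open>B\<close> plays the role of \<open>\<partial>M\<close>.\<close>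

definition bd_sections :: "'s topology" where
  "bd_sections = sections F (times_interval B UNIV)"

definition restr :: "'s \<Rightarrow> real set \<Rightarrow> 's" where
  "restr G I = pull F (times_interval B I) (times_interval B UNIV) (\<lambda>x. x) G"

definition pull_line :: "real set \<Rightarrow> real set \<Rightarrow> (real \<Rightarrow> real) \<Rightarrow> 's \<Rightarrow> 's" where
  "pull_line J' J \<alpha> G = pull F (times_interval B J') (times_interval B J) (\<lambda>(x, t). (x, \<alpha> t)) G"

definition translate :: "real \<Rightarrow> 's \<Rightarrow> 's" where
  "translate u = pull_line UNIV UNIV (\<lambda>t. t + u)"

definition perp :: "real set \<Rightarrow> 's set" where
  "perp I = {G \<in> topspace bd_sections. \<forall>J J' \<alpha>.
     open J \<and> is_interval J \<and> J \<subseteq> I \<and> open J' \<and> is_interval J' \<and> J' \<subseteq> I \<and>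
     bij_betw \<alpha> J' J \<and> strict_mono_on J' \<alpha> \<and> smooth_real J' \<alpha> \<and> smooth_real J (inv_into J' \<alpha>)
     \<longrightarrow> restr G J' = pull_line J' J \<alpha> (restr G J)}"

definition perp_at :: "real \<Rightarrow> 's set" where
  "perp_at a = (\<Union>\<epsilon>\<in>{0<..}. perp {a - \<epsilon><..<a + \<epsilon>})"

text \<open>All conditions on \<open>\<epsilon>\<close> are inherited by smaller \<open>\<epsilon>\<close>, so that a common one can be used.\<close>

definition right_inverse :: "'s \<Rightarrow> 's \<Rightarrow> bool" where
  "right_inverse G R \<longleftrightarrow> G \<in> perp_at 0 \<inter> perp_at 1 \<and> R \<in> topspace bd_sections \<and>
     (\<exists>\<epsilon>>0.
        restr R {1 - \<epsilon><..<1 + \<epsilon>} = restr G {1 - \<epsilon><..<1 + \<epsilon>} \<and>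
        restr (translate 2 R) {- \<epsilon><..<\<epsilon>} = restr G {- \<epsilon><..<\<epsilon>} \<and>
        (\<exists>\<gamma>. pathin bd_sections \<gamma> \<and>
           \<gamma> 0 = glue F (restr G {..<1 + \<epsilon>}) (restr R {1 - \<epsilon><..}) \<and>
           \<gamma> 1 \<in> perp {- \<epsilon><..<2 + \<epsilon>} \<and>
           (\<forall>t\<in>{0..1}. restr (\<gamma> t) {..<\<epsilon>} = restr G {..<\<epsilon>} \<and>
                       restr (\<gamma> t) {2 - \<epsilon><..} = restr R {2 - \<epsilon><..})))"

definition left_inverse :: "'s \<Rightarrow> 's \<Rightarrow> bool" where
  "left_inverse G L \<longleftrightarrow> G \<in> perp_at 0 \<inter> perp_at 1 \<and> L \<in> topspace bd_sections \<and>
     (\<exists>\<epsilon>>0.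
        restr L {- \<epsilon><..<\<epsilon>} = restr G {- \<epsilon><..<\<epsilon>} \<and>
        restr (translate (- 2) L) {1 - \<epsilon><..<1 + \<epsilon>} = restr G {1 - \<epsilon><..<1 + \<epsilon>} \<and>
        (\<exists>\<delta>. pathin bd_sections \<delta> \<and>
           \<delta> 0 = glue F (restr L {..<\<epsilon>}) (restr G {- \<epsilon><..}) \<and>
           \<delta> 1 \<in> perp {- 1 - \<epsilon><..<1 + \<epsilon>} \<and>
           (\<forall>t\<in>{0..1}. restr (\<delta> t) {..<- 1 + \<epsilon>} = restr L {..<- 1 + \<epsilon>} \<and>
                       restr (\<delta> t) {1 - \<epsilon><..} = restr G {1 - \<epsilon><..})))"

end

definition group_like :: "('a \<times> real, 's) emb_sheaf \<Rightarrow> 'a manifold \<Rightarrow> bool" where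
  "group_like F M \<longleftrightarrow>
     (\<forall>G. (\<exists>\<epsilon>>0. G \<in> perp F (boundary M) {..<\<epsilon>} \<inter> perp F (boundary M) {1 - \<epsilon><..}) \<longrightarrow>
          (\<exists>R. right_inverse F (boundary M) G R) \<and> (\<exists>L. left_inverse F (boundary M) G L))"

end

theory Submission
  imports Defs "HOL-Homology.Invariance_of_Domain"
begin

text \<open>
  Let \<open>s\<close> be the coordinate of the factor \<open>\<real>\<close> of \<open>\<partial>M = N \<times> \<real>\<close> and \<open>t\<close> the coordinate of the line, and let
  \<open>G\<close> be a product for \<open>t < \<epsilon>\<close>. Choose an immersion \<open>F\<close> of the \<open>(s, t)\<close>-plane into itself which is the
  identity for \<open>t \<le> 1\<close>, then compresses the \<open>s\<close>-line to a short interval, leads this channel to the right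
  and down to \<open>t < 0\<close>, and there widens it to the full line again. The right inverse of \<open>G\<close> is \<open>F\<^sup>-\<^sup>1(G)\<close>,
  which is also the glued section at which the path has to start. The path has three stages. First the part
  of \<open>F\<close> in \<open>0 < t \<le> 1\<close> is compressed in the \<open>s\<close>-direction as well, which makes \<open>F\<close> injective where something
  moves afterwards. Then \<open>G\<close> is replaced by its preimages under an isotopy of embeddings that ends with
  the line \<open>{t}\<close> inside \<open>{t < \<epsilon>}\<close>, where \<open>G\<close> is a product. At this point only the first coordinate of \<open>F\<close>
  matters, and it is moved linearly to \<open>s\<close>. Left inverses are obtained by the reflection \<open>t \<mapsto> 1 - t\<close>.

  All moves change a single real coordinate monotonically. On a compact set such a move is realized by an
  ambient isotopy of compact support, whose restriction to the submanifold is small in the strong topology.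
\<close>

section \<open>Smooth functions on open subsets of Euclidean space\<close>

text \<open>Continuity of a path of noncompact submanifolds cannot be checked on compact sets alone:
  a basic neighbourhood asks for an embedding of the whole submanifold close to the inclusion in the
  strong topology, although the result is compared on a compact set only. A move that is cut off
  outside a compact set agrees with the path there and disturbs only finitely many members of a
  locally finite family of charts.

  \<open>F\<close> is not injective: on its way down the channel crosses the strip
  \<open>0 < t \<le> 1\<close>, which the identity part of \<open>F\<close> covers as well.
  Submanifolds pull back along every local diffeomorphism, but an ambient isotopy of the target
  lifts only over a set on which \<open>F\<close> is injective. After the compression the strip lies
  over \<open>0 < s < 1\<close>, while the channel descends over \<open>3 < s < 7\<close>; the
  overlaps that remain lie where \<open>G\<close> is a product and nothing moves.

  The inverse function theorem is used only for maps that change one coordinate monotonically. There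
  invariance of domain supplies the continuous inverse, and implicit differentiation does the
  rest.\<close>

definition cube :: "nat \<Rightarrow> (nat \<Rightarrow> real) \<Rightarrow> real \<Rightarrow> (nat \<Rightarrow> real) set" where
  "cube n x r = {y. (\<forall>i\<ge>n. y i = 0) \<and> (\<forall>i<n. \<bar>y i - x i\<bar> < r)}"

lemma powertop_real_euclidean: "powertop_real UNIV = (euclidean :: (nat \<Rightarrow> real) topology)"
  by (simp add: euclidean_product_topology)

lemma openin_Euclidean_space_iff:
  "openin (Euclidean_space n) U \<longleftrightarrow> (\<exists>T. open T \<and> U = T \<inter> {x. \<forall>i\<ge>n. x i = 0})"
  unfolding Euclidean_space_def powertop_real_euclidean openin_subtopology
  by auto

lemma openin_cube: "openin (Euclidean_space n) (cube n x r)"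
proof -
  have "open (\<Inter>i<n. (\<lambda>y::nat\<Rightarrow>real. y i) -` {x i - r<..<x i + r})"
    by (intro open_INT) (auto intro!: open_vimage continuous_intros)
  moreover have "cube n x r = (\<Inter>i<n. (\<lambda>y. y i) -` {x i - r<..<x i + r}) \<inter> {x. \<forall>i\<ge>n. x i = 0}"
    unfolding cube_def abs_diff_less_iff by auto
  ultimately show ?thesis
    unfolding openin_Euclidean_space_iff by blast
qed

lemma openin_contains_cube:
  assumes "openin (Euclidean_space n) U" "x \<in> U"
  obtains r where "r > 0" "cube n x r \<subseteq> U"
proof -
  obtain T where T: "open T" "U = T \<inter> {x. \<forall>i\<ge>n. x i = 0}"
    using assms(1)[unfolded openin_Euclidean_space_iff] by blast
  have "openin (powertop_real UNIV) T"
    using T unfolding powertop_real_euclidean by simp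
  then obtain V where V: "finite {i. V i \<noteq> UNIV}" "\<And>i. open (V i)" "x \<in> Pi\<^sub>E UNIV V" "Pi\<^sub>E UNIV V \<subseteq> T"
    unfolding openin_product_topology_alt using assms(2) T(2) by force
  have "\<exists>r>0. \<forall>y. \<bar>y - x i\<bar> < r \<longrightarrow> y \<in> V i" for i
    using V(2)[of i] V(3) unfolding open_dist by (auto simp: dist_real_def PiE_iff)
  then obtain \<rho> where \<rho>: "\<And>i. \<rho> i > 0" "\<And>i y. \<bar>y - x i\<bar> < \<rho> i \<Longrightarrow> y \<in> V i"
    by metis
  define r where "r = Min (insert 1 (\<rho> ` {..<n}))"
  have r: "r > 0" "\<And>i. i < n \<Longrightarrow> r \<le> \<rho> i"
    unfolding r_def using \<rho>(1) by (auto simp: Min_le_iff)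
  have "y \<in> U" if y: "y \<in> cube n x r" for y
  proof -
    have "y i \<in> V i" for i
    proof (cases "i < n")
      case True
      then show ?thesis using \<rho>(2)[of "y i" i] y r(2)[of i] by (auto simp: cube_def)
    next
      case False
      then have "y i = x i" using y T(2) assms(2) by (auto simp: cube_def)
      then show ?thesis using V(3) by (auto simp: PiE_iff)
    qed
    then show ?thesis using V(4) T(2) y by (auto simp: cube_def PiE_iff)
  qed
  then show thesis using that r(1) by blast
qed

lemma openin_Euclidean_space_cube:
  "openin (Euclidean_space n) U \<longleftrightarrow>
     U \<subseteq> topspace (Euclidean_space n) \<and> (\<forall>x\<in>U. \<exists>r>0. cube n x r \<subseteq> U)"
proof
  assume "openin (Euclidean_space n) U"
  then show "U \<subseteq> topspace (Euclidean_space n) \<and> (\<forall>x\<in>U. \<exists>r>0. cube n x r \<subseteq> U)"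
    by (meson openin_contains_cube openin_subset)
next
  assume R: "U \<subseteq> topspace (Euclidean_space n) \<and> (\<forall>x\<in>U. \<exists>r>0. cube n x r \<subseteq> U)"
  show "openin (Euclidean_space n) U"
  proof (subst openin_subopen, intro ballI)
    fix x assume x: "x \<in> U"
    then obtain r where "r > 0" "cube n x r \<subseteq> U" using R by blast
    moreover have "x \<in> cube n x r"
      using R x \<open>r > 0\<close> by (auto simp: cube_def topspace_Euclidean_space)
    ultimately show "\<exists>T. openin (Euclidean_space n) T \<and> x \<in> T \<and> T \<subseteq> U"
      using openin_cube by blast
  qed
qed

lemma continuous_Euclidean_cube:
  assumes U: "openin (Euclidean_space n) U"
  shows "continuous_map (subtopology (Euclidean_space n) U) euclideanreal f \<longleftrightarrow>
     (\<forall>x\<in>U. \<forall>e>0. \<exists>r>0. \<forall>y\<in>cube n x r. \<bar>f y - f x\<bar> < e)"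
proof
  assume c: "continuous_map (subtopology (Euclidean_space n) U) euclideanreal f"
  show "\<forall>x\<in>U. \<forall>e>0. \<exists>r>0. \<forall>y\<in>cube n x r. \<bar>f y - f x\<bar> < e"
  proof (intro ballI allI impI)
    fix x e assume x: "x \<in> U" and e: "(e::real) > 0"
    have "openin (subtopology (Euclidean_space n) U)
        {z \<in> topspace (subtopology (Euclidean_space n) U). f z \<in> ball (f x) e}"
      by (rule openin_continuous_map_preimage[OF c]) auto
    moreover have "{z \<in> topspace (subtopology (Euclidean_space n) U). f z \<in> ball (f x) e} =
        {z \<in> U. \<bar>f z - f x\<bar> < e}"
      unfolding topspace_subtopology_subset[OF openin_subset[OF U]] mem_ball dist_real_def
      by (simp add: abs_minus_commute)
    ultimately have "openin (Euclidean_space n) {z \<in> U. \<bar>f z - f x\<bar> < e}"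
      using U by (simp add: openin_open_subtopology)
    moreover have "x \<in> {z \<in> U. \<bar>f z - f x\<bar> < e}" using x e by simp
    ultimately obtain r where "r > 0" "cube n x r \<subseteq> {z \<in> U. \<bar>f z - f x\<bar> < e}"
      by (rule openin_contains_cube)
    then show "\<exists>r>0. \<forall>y\<in>cube n x r. \<bar>f y - f x\<bar> < e" by blast
  qed
next
  assume R: "\<forall>x\<in>U. \<forall>e>0. \<exists>r>0. \<forall>y\<in>cube n x r. \<bar>f y - f x\<bar> < e"
  show "continuous_map (subtopology (Euclidean_space n) U) euclideanreal f"
    unfolding continuous_map
  proof (intro conjI allI impI)
    fix V :: "real set" assume V: "openin euclideanreal V"
    have "openin (Euclidean_space n) {x \<in> U. f x \<in> V}"
      unfolding openin_Euclidean_space_cube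
    proof (intro conjI ballI)
      show "{x \<in> U. f x \<in> V} \<subseteq> topspace (Euclidean_space n)" using openin_subset[OF U] by auto
      fix x assume x: "x \<in> {x \<in> U. f x \<in> V}"
      then obtain e where e: "e > 0" "\<And>z. \<bar>z - f x\<bar> < e \<Longrightarrow> z \<in> V"
        using V by (auto simp: open_dist dist_real_def)
      obtain r1 where r1: "r1 > 0" "cube n x r1 \<subseteq> U" using U x openin_contains_cube by blast
      obtain r where r: "r > 0" "\<And>y. y \<in> cube n x r \<Longrightarrow> \<bar>f y - f x\<bar> < e" using R x e by blast
      show "\<exists>r>0. cube n x r \<subseteq> {x \<in> U. f x \<in> V}"
        using r1 r e by (intro exI[of _ "min r r1"]) (auto simp: cube_def subset_iff)
    qed
    then show "openin (subtopology (Euclidean_space n) U)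
        {x \<in> topspace (subtopology (Euclidean_space n) U). f x \<in> V}"
      using U openin_subset[OF U]
      by (auto simp: openin_open_subtopology Int_absorb1)
  qed auto
qed

lemma cube_upd:
  assumes "openin (Euclidean_space n) U" "x \<in> U" "i < n"
  shows "\<forall>\<^sub>F t in nhds (x i). x(i := t) \<in> U"
proof -
  obtain r where r: "r > 0" "cube n x r \<subseteq> U" using assms openin_contains_cube by blast
  have x: "\<And>j. j \<ge> n \<Longrightarrow> x j = 0"
    using assms openin_subset[of "Euclidean_space n" U] by (auto simp: topspace_Euclidean_space)
  have "\<forall>\<^sub>F t in nhds (x i). dist t (x i) < r"
    using r(1) eventually_nhds_metric by blast
  then show ?thesis
    by (rule eventually_mono) (use r x assms(3) in \<open>auto simp: cube_def dist_real_def subset_iff\<close>)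
qed

lemma partial_deriv_unique:
  "((\<lambda>t. f (x(i := t))) has_real_derivative D) (at (x i)) \<Longrightarrow> partial_deriv i f x = D"
  unfolding partial_deriv_def by (rule DERIV_imp_deriv)

lemma has_partial_cong:
  assumes "openin (Euclidean_space n) U" "x \<in> U" "i < n" "\<And>y. y \<in> U \<Longrightarrow> f y = g y"
  shows "((\<lambda>t. f (x(i := t))) has_real_derivative D) (at (x i)) \<longleftrightarrow>
         ((\<lambda>t. g (x(i := t))) has_real_derivative D) (at (x i))"
  using cube_upd[OF assms(1-3)] assms(2,4)
  by (intro DERIV_cong_ev) (auto elim!: eventually_mono)

lemma partial_derivs_Cons: "partial_derivs (i # is) f = partial_deriv i (partial_derivs is f)"
  by (simp add: partial_derivs_def)

lemma partial_derivs_Nil[simp]: "partial_derivs [] f = f"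
  by (simp add: partial_derivs_def)

lemma partial_derivs_snoc: "partial_derivs (is @ [i]) f = partial_derivs is (partial_deriv i f)"
  by (simp add: partial_derivs_def)

lemma smooth_open_imp_openin: "smooth_open n U f \<Longrightarrow> openin (Euclidean_space n) U"
  by (simp add: smooth_open_def)

lemma smooth_open_partial_deriv: "smooth_open n U f \<Longrightarrow> i < n \<Longrightarrow> smooth_open n U (partial_deriv i f)"
  unfolding smooth_open_def by (simp flip: partial_derivs_snoc)

lemma smooth_open_has_partial:
  assumes "smooth_open n U f" "i < n" "x \<in> U"
  shows "((\<lambda>t. f (x(i := t))) has_real_derivative partial_deriv i f x) (at (x i))"
proof -
  have "(\<lambda>t. f (x(i := t))) field_differentiable at (x i)"
    using assms unfolding smooth_open_def by (metis empty_subsetI list.set(1) partial_derivs_Nil)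
  then show ?thesis
    by (simp add: partial_deriv_def DERIV_deriv_iff_field_differentiable)
qed

lemma smooth_open_imp_continuous:
  "smooth_open n U f \<Longrightarrow> continuous_map (subtopology (Euclidean_space n) U) euclideanreal f"
  unfolding smooth_open_def by (metis empty_subsetI list.set(1) partial_derivs_Nil)

text \<open>All iterated partial derivatives of \<open>f\<close> stay in a class \<open>X\<close>
  that is closed under differentiation, up to equality on \<open>U\<close>. Choosing a suitable
  \<open>X\<close> replaces an induction over lists of indices in the later smoothness
  proofs.\<close>

lemma smooth_open_coinduct:
  assumes U: "openin (Euclidean_space n) U" and f: "X f"
    and c: "\<And>h. X h \<Longrightarrow> continuous_map (subtopology (Euclidean_space n) U) euclideanreal h"
    and d: "\<And>h i. X h \<Longrightarrow> i < n \<Longrightarrow>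
        \<exists>k. X k \<and> (\<forall>x\<in>U. ((\<lambda>t. h (x(i := t))) has_real_derivative k x) (at (x i)))"
  shows "smooth_open n U f"
proof -
  have *: "\<exists>k. X k \<and> (\<forall>x\<in>U. partial_derivs is f x = k x)" if "set is \<subseteq> {..<n}" for "is"
    using that
  proof (induction "is")
    case Nil
    then show ?case using f by auto
  next
    case (Cons i "is")
    then obtain k where k: "X k" "\<And>x. x \<in> U \<Longrightarrow> partial_derivs is f x = k x" by auto
    obtain l where l: "X l" "\<And>x. x \<in> U \<Longrightarrow> ((\<lambda>t. k (x(i := t))) has_real_derivative l x) (at (x i))"
      using d[OF k(1), of i] Cons.prems by auto
    have "partial_derivs (i # is) f x = l x" if x: "x \<in> U" for x
      unfolding partial_derivs_Cons
      by (rule partial_deriv_unique, subst has_partial_cong[OF U x _ k(2)])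
         (use Cons.prems l(2)[OF x] in auto)
    then show ?case using l(1) by blast
  qed
  show ?thesis
    unfolding smooth_open_def
  proof (intro conjI U allI impI ballI)
    fix "is" assume i: "set is \<subseteq> {..<n}"
    obtain k where k: "X k" "\<And>x. x \<in> U \<Longrightarrow> partial_derivs is f x = k x" using *[OF i] by blast
    show "continuous_map (subtopology (Euclidean_space n) U) euclideanreal (partial_derivs is f)"
      by (rule continuous_map_eq[OF c[OF k(1)]]) (use k(2) in auto)
    fix i x assume ix: "i < n" "x \<in> U"
    obtain l where l: "((\<lambda>t. k (x(i := t))) has_real_derivative l) (at (x i))"
      using d[OF k(1) ix(1)] ix by blast
    have "((\<lambda>t. partial_derivs is f (x(i := t))) has_real_derivative l) (at (x i))"
      by (subst has_partial_cong[OF U ix(2,1) k(2)]) (use l in auto)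
    then show "(\<lambda>t. partial_derivs is f (x(i := t))) field_differentiable at (x i)"
      using field_differentiable_def by blast
  qed
qed

text \<open>The function algebra generated by \<open>A\<close>. By the sum and product rules it is a
  class as required by \<open>smooth_open_coinduct\<close> as soon as the derivatives of the
  generators lie in it.\<close>

inductive alg :: "('a \<Rightarrow> real) set \<Rightarrow> ('a \<Rightarrow> real) \<Rightarrow> bool" for A where
  alg_gen: "h \<in> A \<Longrightarrow> alg A h"
| alg_add: "alg A g \<Longrightarrow> alg A h \<Longrightarrow> alg A (\<lambda>x. g x + h x)"
| alg_mult: "alg A g \<Longrightarrow> alg A h \<Longrightarrow> alg A (\<lambda>x. g x * h x)"

lemma alg_sum:
  assumes "finite I" "(\<lambda>x. 0) \<in> A" "\<And>i. i \<in> I \<Longrightarrow> alg A (h i)"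
  shows "alg A (\<lambda>x. \<Sum>i\<in>I. h i x)"
  using assms by (induction I rule: finite_induct) (auto intro: alg.intros)

lemma smooth_open_alg:
  assumes U: "openin (Euclidean_space n) U"
    and c: "\<And>h. h \<in> A \<Longrightarrow> continuous_map (subtopology (Euclidean_space n) U) euclideanreal h"
    and d: "\<And>h i. h \<in> A \<Longrightarrow> i < n \<Longrightarrow>
        \<exists>k. alg A k \<and> (\<forall>x\<in>U. ((\<lambda>t. h (x(i := t))) has_real_derivative k x) (at (x i)))"
    and f: "alg A f"
  shows "smooth_open n U f"
proof (rule smooth_open_coinduct[OF U, where X = "alg A"])
  show "alg A f" by fact
  show "continuous_map (subtopology (Euclidean_space n) U) euclideanreal h" if "alg A h" for h
    using that by induction (auto intro: c continuous_map_real_mult continuous_map_add)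
  show "\<exists>k. alg A k \<and> (\<forall>x\<in>U. ((\<lambda>t. h (x(i := t))) has_real_derivative k x) (at (x i)))"
    if "alg A h" "i < n" for h i
    using that(1)
  proof induction
    case (alg_gen h)
    then show ?case using d that(2) by blast
  next
    case (alg_add g h)
    then obtain k l where "alg A k" "alg A l"
      "\<And>x. x \<in> U \<Longrightarrow> ((\<lambda>t. g (x(i := t))) has_real_derivative k x) (at (x i))"
      "\<And>x. x \<in> U \<Longrightarrow> ((\<lambda>t. h (x(i := t))) has_real_derivative l x) (at (x i))" by blast
    then show ?case
      by (intro exI[of _ "\<lambda>x. k x + l x"] conjI ballI alg.alg_add DERIV_add)
  next
    case (alg_mult g h)
    then obtain k l where "alg A k" "alg A l"
      "\<And>x. x \<in> U \<Longrightarrow> ((\<lambda>t. g (x(i := t))) has_real_derivative k x) (at (x i))"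
      "\<And>x. x \<in> U \<Longrightarrow> ((\<lambda>t. h (x(i := t))) has_real_derivative l x) (at (x i))" by blast
    then show ?case using alg_mult.hyps
      by (intro exI[of _ "\<lambda>x. k x * h x + l x * g x"] conjI ballI alg.alg_add alg.alg_mult
          DERIV_mult[THEN DERIV_cong]) (assumption | simp)+
  qed
qed

lemma smooth_open_const: "openin (Euclidean_space n) U \<Longrightarrow> smooth_open n U (\<lambda>x. c)"
  by (rule smooth_open_coinduct[where X = "\<lambda>h. \<exists>c. h = (\<lambda>x. c)"])
     (auto intro!: exI[of _ "\<lambda>x. 0"])

lemma smooth_open_self: "smooth_open n U f \<Longrightarrow> alg {h. smooth_open n U h} f"
  by (auto intro: alg.intros)

lemma smooth_open_alg_self:
  assumes "openin (Euclidean_space n) U" "alg {h. smooth_open n U h} f"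
  shows "smooth_open n U f"
  by (rule smooth_open_alg[OF assms(1) _ _ assms(2)])
     (auto intro!: smooth_open_imp_continuous alg_gen smooth_open_partial_deriv smooth_open_has_partial)

lemma smooth_open_add:
  "smooth_open n U f \<Longrightarrow> smooth_open n U g \<Longrightarrow> smooth_open n U (\<lambda>x. f x + g x)"
  by (rule smooth_open_alg_self[OF smooth_open_imp_openin alg_add[OF smooth_open_self smooth_open_self]])

lemma smooth_open_mult:
  "smooth_open n U f \<Longrightarrow> smooth_open n U g \<Longrightarrow> smooth_open n U (\<lambda>x. f x * g x)"
  by (rule smooth_open_alg_self[OF smooth_open_imp_openin alg_mult[OF smooth_open_self smooth_open_self]])

text \<open>A partial derivative at a point of an open set depends only on nearby values. Hence the
  functions that locally agree with smooth ones form a class closed under differentiation.\<close>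

lemma smooth_open_local:
  assumes "openin (Euclidean_space n) U"
    and "\<And>x. x \<in> U \<Longrightarrow> \<exists>V g. x \<in> V \<and> smooth_open n V g \<and> (\<forall>y\<in>U \<inter> V. f y = g y)"
  shows "smooth_open n U f"
proof (rule smooth_open_coinduct[OF assms(1), where X =
    "\<lambda>f. \<forall>x\<in>U. \<exists>V g. x \<in> V \<and> smooth_open n V g \<and> (\<forall>y\<in>U \<inter> V. f y = g y)"])
  show "\<forall>x\<in>U. \<exists>V g. x \<in> V \<and> smooth_open n V g \<and> (\<forall>y\<in>U \<inter> V. f y = g y)" using assms by blast
  fix h assume h: "\<forall>x\<in>U. \<exists>V g. x \<in> V \<and> smooth_open n V g \<and> (\<forall>y\<in>U \<inter> V. h y = g y)"
  show "continuous_map (subtopology (Euclidean_space n) U) euclideanreal h"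
    unfolding continuous_Euclidean_cube[OF assms(1)]
  proof (intro ballI allI impI)
    fix x e assume x: "x \<in> U" and e: "(e::real) > 0"
    obtain V g where V: "x \<in> V" "smooth_open n V g" "\<forall>y\<in>U \<inter> V. h y = g y" using h x by blast
    obtain r where r: "r > 0" "\<forall>y\<in>cube n x r. \<bar>g y - g x\<bar> < e"
      using smooth_open_imp_continuous[OF V(2)] V(1) e
      unfolding continuous_Euclidean_cube[OF smooth_open_imp_openin[OF V(2)]] by blast
    obtain r1 where r1: "r1 > 0" "cube n x r1 \<subseteq> U \<inter> V"
      using openin_contains_cube[of n "U \<inter> V" x] assms(1) smooth_open_imp_openin[OF V(2)] x V(1) by blast
    show "\<exists>r>0. \<forall>y\<in>cube n x r. \<bar>h y - h x\<bar> < e"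
      using r r1 V(3) x V(1) by (intro exI[of _ "min r r1"]) (auto simp: cube_def subset_iff)
  qed
  fix i assume i: "i < n"
  define k where "k x = partial_deriv i h x" for x
  have kk: "((\<lambda>t. h (x(i := t))) has_real_derivative partial_deriv i g x) (at (x i))"
    if "x \<in> U" "x \<in> V" "smooth_open n V g" "\<forall>y\<in>U \<inter> V. h y = g y" for x V g
  proof -
    have op: "openin (Euclidean_space n) (U \<inter> V)"
      using assms(1) smooth_open_imp_openin[OF that(3)] by blast
    show ?thesis
      by (subst has_partial_cong[OF op, of x i h g])
         (use that i smooth_open_has_partial[OF that(3) i] in auto)
  qed
  have "\<exists>V g. x \<in> V \<and> smooth_open n V g \<and> (\<forall>y\<in>U \<inter> V. k y = g y)" if x: "x \<in> U" for x
  proof -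
    obtain V g where V: "x \<in> V" "smooth_open n V g" "\<forall>y\<in>U \<inter> V. h y = g y" using h x by blast
    then show ?thesis
      using kk[of _ V g] i
      by (intro exI[of _ V] exI[of _ "partial_deriv i g"])
         (auto simp: k_def intro: smooth_open_partial_deriv partial_deriv_unique)
  qed
  moreover have "\<forall>x\<in>U. ((\<lambda>t. h (x(i := t))) has_real_derivative k x) (at (x i))"
  proof
    fix x assume x: "x \<in> U"
    obtain V g where V: "x \<in> V" "smooth_open n V g" "\<forall>y\<in>U \<inter> V. h y = g y" using h x by blast
    show "((\<lambda>t. h (x(i := t))) has_real_derivative k x) (at (x i))"
      using kk[OF x V] partial_deriv_unique[OF kk[OF x V]] by (simp add: k_def)
  qed
  ultimately show "\<exists>k. (\<forall>x\<in>U. \<exists>V g. x \<in> V \<and> smooth_open n V g \<and> (\<forall>y\<in>U \<inter> V. k y = g y)) \<and>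
      (\<forall>x\<in>U. ((\<lambda>t. h (x(i := t))) has_real_derivative k x) (at (x i)))"
    by blast
qed

lemma smooth_open_subset:
  assumes "smooth_open n U f" "openin (Euclidean_space n) V" "V \<subseteq> U" "\<And>x. x \<in> V \<Longrightarrow> f x = g x"
  shows "smooth_open n V g"
  by (rule smooth_open_local[OF assms(2)]) (use assms(1,3,4) in \<open>blast intro: sym\<close>)

lemma smooth_open_coord:
  assumes "openin (Euclidean_space n) U"
  shows "smooth_open n U (\<lambda>x. x j)"
proof (rule smooth_open_coinduct[OF assms, where X = "\<lambda>h. h = (\<lambda>x. x j) \<or> (\<exists>c. h = (\<lambda>x. c))"])
  fix h :: "(nat \<Rightarrow> real) \<Rightarrow> real" and i
  assume h: "h = (\<lambda>x. x j) \<or> (\<exists>c. h = (\<lambda>x. c))"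
  have "continuous_map (subtopology (Euclidean_space n) U) euclideanreal (\<lambda>x. x j)"
    unfolding Euclidean_space_def powertop_real_euclidean subtopology_subtopology
      continuous_map_iff_continuous
    by (rule continuous_on_product_coordinates[THEN continuous_on_subset]) simp
  with h show "continuous_map (subtopology (Euclidean_space n) U) euclideanreal h" by auto
  show "\<exists>k. (k = (\<lambda>x. x j) \<or> (\<exists>c. k = (\<lambda>x. c))) \<and>
      (\<forall>x\<in>U. ((\<lambda>t. h (x(i := t))) has_real_derivative k x) (at (x i)))"
    using h by (intro exI[of _ "\<lambda>x. if h = (\<lambda>x. x j) \<and> i = j then 1 else 0"])
      (auto split: if_splits)
qed auto

text \<open>The coefficients \<open>\<beta>\<close> come from the mean value theorem along the edges of the box spanned
  by \<open>x\<close> and \<open>y\<close>.\<close>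

lemma caratheodory_partial:
  assumes f: "smooth_open n U f" and x: "x \<in> U"
  obtains \<beta> where "\<And>y. y \<in> topspace (Euclidean_space n) \<Longrightarrow> f y - f x = (\<Sum>i<n. \<beta> i y * (y i - x i))"
    "\<And>e i. e > 0 \<Longrightarrow> i < n \<Longrightarrow> \<exists>r>0. \<forall>y\<in>cube n x r. \<bar>\<beta> i y - partial_deriv i f x\<bar> < e"
proof -
  have op: "openin (Euclidean_space n) U" using f by (rule smooth_open_imp_openin)
  have x0: "\<And>j. j \<ge> n \<Longrightarrow> x j = 0" using op x openin_subset by (fastforce simp: topspace_Euclidean_space)
  define z where "z y i = (\<lambda>m. if m < i then y m else x m)" for y :: "nat \<Rightarrow> real" and i :: nat
  define \<beta> where "\<beta> i y = (if y i = x i then partial_deriv i f x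
      else (f (z y (Suc i)) - f (z y i)) / (y i - x i))" for i y
  have zS: "z y (Suc i) = (z y i)(i := y i)" for y i by (auto simp: z_def)
  have zz: "z y i = (z y i)(i := x i)" for y i by (auto simp: z_def)
  have "f y - f x = (\<Sum>i<n. \<beta> i y * (y i - x i))" if "y \<in> topspace (Euclidean_space n)" for y
  proof -
    have "\<beta> i y * (y i - x i) = f (z y (Suc i)) - f (z y i)" for i
      using zS[of y i] zz[of y i] by (auto simp: \<beta>_def)
    then have "(\<Sum>i<n. \<beta> i y * (y i - x i)) = f (z y n) - f (z y 0)"
      by (simp add: sum_lessThan_telescope[of "\<lambda>i. f (z y i)"])
    moreover have "z y n = y" using that x0 by (auto simp: z_def topspace_Euclidean_space)
    moreover have "z y 0 = x" by (auto simp: z_def)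
    ultimately show ?thesis by simp
  qed
  moreover have "\<exists>r>0. \<forall>y\<in>cube n x r. \<bar>\<beta> i y - partial_deriv i f x\<bar> < e" if e: "e > 0" and i: "i < n" for e i
  proof -
    obtain r where r: "r > 0" "\<forall>y\<in>cube n x r. \<bar>partial_deriv i f y - partial_deriv i f x\<bar> < e"
      using smooth_open_imp_continuous[OF smooth_open_partial_deriv[OF f i]] x e
      unfolding continuous_Euclidean_cube[OF op] by blast
    obtain r1 where r1: "r1 > 0" "cube n x r1 \<subseteq> U" using openin_contains_cube op x by blast
    have "\<bar>\<beta> i y - partial_deriv i f x\<bar> < e" if y: "y \<in> cube n x (min r r1)" for y
    proof (cases "y i = x i")
      case True
      then show ?thesis using e by (simp add: \<beta>_def)
    next
      case False
      define a b where "a = min (x i) (y i)" and "b = max (x i) (y i)"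
      have ab: "a < b" using False by (auto simp: a_def b_def)
      have cu: "(z y i)(i := \<xi>) \<in> cube n x (min r r1)" if "a \<le> \<xi>" "\<xi> \<le> b" for \<xi>
        using y that x0 i r(1) r1(1) unfolding a_def b_def
        by (auto simp: z_def cube_def min_def max_def split: if_splits)
      have cU: "(z y i)(i := \<xi>) \<in> U" if "a \<le> \<xi>" "\<xi> \<le> b" for \<xi>
        using cu[OF that] r1(2) by (auto simp: cube_def)
      have D: "((\<lambda>t. f ((z y i)(i := t))) has_real_derivative partial_deriv i f ((z y i)(i := \<xi>))) (at \<xi>)"
        if "a \<le> \<xi>" "\<xi> \<le> b" for \<xi>
        using smooth_open_has_partial[OF f i cU[OF that]] by simp
      obtain \<xi> where \<xi>: "a < \<xi>" "\<xi> < b"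
        "f ((z y i)(i := b)) - f ((z y i)(i := a)) = (b - a) * partial_deriv i f ((z y i)(i := \<xi>))"
        using MVT2[OF ab, of "\<lambda>t. f ((z y i)(i := t))" "\<lambda>\<xi>. partial_deriv i f ((z y i)(i := \<xi>))"] D
        by auto
      have "f (z y (Suc i)) - f (z y i) = (y i - x i) * partial_deriv i f ((z y i)(i := \<xi>))"
      proof (cases "x i < y i")
        case True
        then show ?thesis using \<xi>(3) zS[of y i] zz[of y i] by (simp add: a_def b_def)
      next
        case F: False
        then have "f (z y i) - f (z y (Suc i)) = (x i - y i) * partial_deriv i f ((z y i)(i := \<xi>))"
          using \<xi>(3) zS[of y i] zz[of y i] by (simp add: a_def b_def)
        then show ?thesis by (simp add: algebra_simps)
      qed
      then have "\<beta> i y = partial_deriv i f ((z y i)(i := \<xi>))" using False by (simp add: \<beta>_def)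
      moreover have "(z y i)(i := \<xi>) \<in> cube n x r" using cu[of \<xi>] \<xi> by (auto simp: cube_def)
      ultimately show ?thesis using r(2) by auto
    qed
    then show ?thesis using r(1) r1(1) by (intro exI[of _ "min r r1"]) auto
  qed
  ultimately show thesis using that by blast
qed

section \<open>The chain rule\<close>

lemma tendsto_cube:
  fixes \<beta> :: "(nat \<Rightarrow> real) \<Rightarrow> real"
  assumes lim: "\<And>i. i < n \<Longrightarrow> ((\<lambda>t. g t i) \<longlongrightarrow> x i) F"
    and top: "\<forall>\<^sub>F t in F. g t \<in> topspace (Euclidean_space n)"
    and b: "\<And>e. e > 0 \<Longrightarrow> \<exists>r>0. \<forall>y\<in>cube n x r. \<bar>\<beta> y - l\<bar> < e"
  shows "((\<lambda>t. \<beta> (g t)) \<longlongrightarrow> l) F"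
proof (rule tendstoI, goal_cases)
  case (1 e)
  with b obtain r where r: "r > 0" "\<forall>y\<in>cube n x r. \<bar>\<beta> y - l\<bar> < e" using b by blast
  have "\<forall>\<^sub>F t in F. \<forall>i\<in>{..<n}. dist (g t i) (x i) < r"
    by (rule eventually_ball_finite) (use lim r(1) in \<open>auto dest: tendstoD\<close>)
  with top show "\<forall>\<^sub>F t in F. dist (\<beta> (g t)) l < e"
    by eventually_elim (use r(2) in \<open>auto simp: dist_real_def cube_def topspace_Euclidean_space\<close>)
qed

text \<open>With the coefficients of \<open>caratheodory_partial\<close> the difference quotient
  along the curve is a finite sum of products with known limits. The coordinates of the curve have
  to be differentiable at the single point \<open>t0\<close> only, which suits the inverse map in
  \<open>smooth_open_fibre_inverse\<close>, whose smoothness is still to be shown there.\<close>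

lemma smooth_open_has_derivative_along:
  assumes f: "smooth_open n U f" and x: "g t0 \<in> U"
    and top: "\<forall>\<^sub>F t in at t0. g t \<in> topspace (Euclidean_space n)"
    and d: "\<And>i. i < n \<Longrightarrow> ((\<lambda>t. g t i) has_real_derivative g' i) (at t0)"
  shows "((\<lambda>t. f (g t)) has_real_derivative (\<Sum>i<n. partial_deriv i f (g t0) * g' i)) (at t0)"
proof -
  obtain \<beta> where \<beta>: "\<And>y. y \<in> topspace (Euclidean_space n) \<Longrightarrow> f y - f (g t0) = (\<Sum>i<n. \<beta> i y * (y i - g t0 i))"
    "\<And>e i. e > 0 \<Longrightarrow> i < n \<Longrightarrow> \<exists>r>0. \<forall>y\<in>cube n (g t0) r. \<bar>\<beta> i y - partial_deriv i f (g t0)\<bar> < e"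
    using caratheodory_partial[OF f x] by blast
  have lim: "((\<lambda>t. g t i) \<longlongrightarrow> g t0 i) (at t0)" if "i < n" for i
    using DERIV_isCont[OF d[OF that]] isCont_def by blast
  have "((\<lambda>t. \<Sum>i<n. \<beta> i (g t) * ((g t i - g t0 i) / (t - t0))) \<longlongrightarrow>
      (\<Sum>i<n. partial_deriv i f (g t0) * g' i)) (at t0)"
  proof (intro tendsto_sum tendsto_mult)
    fix i assume i: "i \<in> {..<n}"
    show "((\<lambda>t. \<beta> i (g t)) \<longlongrightarrow> partial_deriv i f (g t0)) (at t0)"
      by (rule tendsto_cube[OF lim top]) (use i \<beta>(2) in auto)
    show "((\<lambda>t. (g t i - g t0 i) / (t - t0)) \<longlongrightarrow> g' i) (at t0)"
      using d[of i] i by (simp add: has_field_derivative_iff)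
  qed
  moreover have "\<forall>\<^sub>F t in at t0. (\<Sum>i<n. \<beta> i (g t) * ((g t i - g t0 i) / (t - t0))) =
      (f (g t) - f (g t0)) / (t - t0)"
    using top by eventually_elim (simp add: \<beta>(1) sum_divide_distrib)
  ultimately show ?thesis
    unfolding has_field_derivative_iff by (rule Lim_transform_eventually)
qed

lemma continuous_map_into_Euclidean_space:
  assumes "\<And>j. j < m \<Longrightarrow> continuous_map X euclideanreal (\<lambda>x. G x j)"
    and "\<And>x. x \<in> topspace X \<Longrightarrow> G x \<in> topspace (Euclidean_space m)"
  shows "continuous_map X (Euclidean_space m) G"
proof -
  have "continuous_map X (Euclidean_space m) (\<lambda>x i. if i < m then G x i else 0)"
    unfolding continuous_map_componentwise_Euclidean_space using assms(1) by blast
  then show ?thesis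
    by (rule continuous_map_eq) (use assms(2) in \<open>auto simp: topspace_Euclidean_space\<close>)
qed

lemma smooth_open_compose:
  assumes f: "smooth_open m V f" and U: "openin (Euclidean_space n) U"
    and G: "\<And>j. j < m \<Longrightarrow> smooth_open n U (\<lambda>x. G x j)" and GV: "\<And>x. x \<in> U \<Longrightarrow> G x \<in> V"
  shows smooth_open_compose_smooth: "smooth_open n U (\<lambda>x. f (G x))"
    and partial_deriv_compose: "\<And>x i. x \<in> U \<Longrightarrow> i < n \<Longrightarrow> partial_deriv i (\<lambda>x. f (G x)) x =
      (\<Sum>j<m. partial_deriv j f (G x) * partial_deriv i (\<lambda>x. G x j) x)"
proof -
  have V: "V \<subseteq> topspace (Euclidean_space m)" using f smooth_open_imp_openin openin_subset by blast
  have d: "((\<lambda>t. h (G (x(i := t)))) has_real_derivative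
      (\<Sum>j<m. partial_deriv j h (G x) * partial_deriv i (\<lambda>x. G x j) x)) (at (x i))"
    if h: "smooth_open m V h" and x: "x \<in> U" and i: "i < n" for h x i
  proof -
    have "((\<lambda>t. h (G (x(i := t)))) has_real_derivative
      (\<Sum>j<m. partial_deriv j h (G (x(i := x i))) * partial_deriv i (\<lambda>x. G x j) x)) (at (x i))"
    proof (rule smooth_open_has_derivative_along[OF h])
      show "G (x(i := x i)) \<in> V" using GV x by simp
      have "\<forall>\<^sub>F t in at (x i). x(i := t) \<in> U"
        using cube_upd[OF U x i] eventually_at_filter eventually_mono by fastforce
      then show "\<forall>\<^sub>F t in at (x i). G (x(i := t)) \<in> topspace (Euclidean_space m)"
        by (rule eventually_mono) (use GV V in blast)
      show "((\<lambda>t. G (x(i := t)) j) has_real_derivative partial_deriv i (\<lambda>x. G x j) x) (at (x i))"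
        if "j < m" for j
        by (rule smooth_open_has_partial[OF G[OF that] i x])
    qed
    then show ?thesis by simp
  qed
  show "partial_deriv i (\<lambda>x. f (G x)) x =
      (\<Sum>j<m. partial_deriv j f (G x) * partial_deriv i (\<lambda>x. G x j) x)" if "x \<in> U" "i < n" for x i
    by (rule partial_deriv_unique) (rule d[OF f that])
  \<comment> \<open>By the chain rule, a derivative of a pullback \<open>h (G x)\<close> is a sum of
    pullbacks multiplied by derivatives of the coordinates of \<open>G\<close>, so these generators
    suffice.\<close>
  let ?A = "{h. smooth_open n U h} \<union> {\<lambda>x. h (G x) | h. smooth_open m V h}"
  have cG: "continuous_map (subtopology (Euclidean_space n) U) (subtopology (Euclidean_space m) V) G"
    by (intro continuous_map_into_subtopology continuous_map_into_Euclidean_space)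
       (use G GV V smooth_open_imp_continuous in auto)
  show "smooth_open n U (\<lambda>x. f (G x))"
  proof (rule smooth_open_alg[OF U, where A = ?A])
    show "alg ?A (\<lambda>x. f (G x))" by (rule alg_gen) (use f in blast)
    show "continuous_map (subtopology (Euclidean_space n) U) euclideanreal h" if "h \<in> ?A" for h
      using that smooth_open_imp_continuous continuous_map_compose[OF cG, unfolded comp_def]
      by blast
    show "\<exists>k. alg ?A k \<and> (\<forall>x\<in>U. ((\<lambda>t. h (x(i := t))) has_real_derivative k x) (at (x i)))"
      if h: "h \<in> ?A" and i: "i < n" for h i
    proof (cases "smooth_open n U h")
      case True
      then show ?thesis
        using smooth_open_has_partial[OF True i] smooth_open_partial_deriv[OF True i]
        by (intro exI[of _ "partial_deriv i h"]) (auto intro: alg_gen)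
    next
      case False
      then obtain h' where h': "h = (\<lambda>x. h' (G x))" "smooth_open m V h'" using h by blast
      have "alg ?A (\<lambda>x. \<Sum>j<m. partial_deriv j h' (G x) * partial_deriv i (\<lambda>x. G x j) x)"
        using smooth_open_const[OF U] smooth_open_partial_deriv[OF h'(2)] smooth_open_partial_deriv[OF G i]
        by (intro alg_sum alg_mult) (auto intro!: alg_gen)
      then show ?thesis using d[OF h'(2) _ i] unfolding h'(1) by blast
    qed
  qed
qed

text \<open>The sequence \<open>g\<close> lists the successive derivatives of \<open>g 0\<close>.
  Differentiating \<open>g m (h x)\<close> gives \<open>g (Suc m) (h x)\<close> times a partial
  derivative of \<open>h\<close>, so these composites and the smooth functions generate an algebra
  closed under differentiation.\<close>

lemma smooth_open_compose_real:
  assumes g: "\<And>m t. (g m has_real_derivative g (Suc m) t) (at t)" and h: "smooth_open n U h"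
  shows "smooth_open n U (\<lambda>x. g (0::nat) (h x))"
proof -
  let ?A = "{f. smooth_open n U f} \<union> {\<lambda>x. g m (h x) | m. True}"
  show ?thesis
  proof (rule smooth_open_alg[where A = ?A])
    show "openin (Euclidean_space n) U" using h by (rule smooth_open_imp_openin)
    show "alg ?A (\<lambda>x. g 0 (h x))" by (rule alg_gen) blast
    have "continuous_map euclideanreal euclideanreal (g m)" for m
      unfolding continuous_map_iff_continuous2[symmetric]
      using g DERIV_isCont continuous_at_imp_continuous_on by (metis continuous_map_iff_continuous2)
    then show "continuous_map (subtopology (Euclidean_space n) U) euclideanreal f" if "f \<in> ?A" for f
      using that smooth_open_imp_continuous
        continuous_map_compose[OF smooth_open_imp_continuous[OF h], unfolded comp_def] by blast
    show "\<exists>k. alg ?A k \<and> (\<forall>x\<in>U. ((\<lambda>t. f (x(i := t))) has_real_derivative k x) (at (x i)))"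
      if f: "f \<in> ?A" and i: "i < n" for f i
    proof (cases "smooth_open n U f")
      case True
      then show ?thesis
        using smooth_open_has_partial[OF True i] smooth_open_partial_deriv[OF True i]
        by (intro exI[of _ "partial_deriv i f"]) (auto intro: alg_gen)
    next
      case False
      then obtain m where m: "f = (\<lambda>x. g m (h x))" using f by blast
      have "alg ?A (\<lambda>x. g (Suc m) (h x) * partial_deriv i h x)"
        using smooth_open_partial_deriv[OF h i] by (intro alg_mult) (auto intro!: alg_gen)
      moreover have "((\<lambda>t. g m (h (x(i := t)))) has_real_derivative g (Suc m) (h x) * partial_deriv i h x) (at (x i))"
        if "x \<in> U" for x
        by (rule DERIV_chain2[of "g m"]) (use g smooth_open_has_partial[OF h i that] in auto)
      ultimately show ?thesis unfolding m by blast
    qed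
  qed
qed

text \<open>The derivatives of \<open>1 / h\<close> are polynomials in \<open>1 / h\<close> with
  smooth coefficients, so \<open>1 / h\<close> is the only generator to be added to the smooth
  functions.\<close>

lemma smooth_open_inverse:
  assumes h: "smooth_open n U h" and nz: "\<And>x. x \<in> U \<Longrightarrow> h x \<noteq> 0"
  shows "smooth_open n U (\<lambda>x. inverse (h x))"
proof -
  let ?A = "{f. smooth_open n U f} \<union> {\<lambda>x. inverse (h x)}"
  have op: "openin (Euclidean_space n) U" using h by (rule smooth_open_imp_openin)
  show ?thesis
  proof (rule smooth_open_alg[OF op, where A = ?A])
    show "alg ?A (\<lambda>x. inverse (h x))" by (rule alg_gen) blast
    show "continuous_map (subtopology (Euclidean_space n) U) euclideanreal f" if "f \<in> ?A" for f
      using that smooth_open_imp_continuous[OF h] smooth_open_imp_continuous nz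
      by (auto intro!: continuous_map_real_inverse)
    show "\<exists>k. alg ?A k \<and> (\<forall>x\<in>U. ((\<lambda>t. f (x(i := t))) has_real_derivative k x) (at (x i)))"
      if f: "f \<in> ?A" and i: "i < n" for f i
    proof (cases "smooth_open n U f")
      case True
      then show ?thesis
        using smooth_open_has_partial[OF True i] smooth_open_partial_deriv[OF True i]
        by (intro exI[of _ "partial_deriv i f"]) (auto intro: alg_gen)
    next
      case False
      then have m: "f = (\<lambda>x. inverse (h x))" using f by blast
      have "alg ?A (\<lambda>x. - 1 * partial_deriv i h x * (inverse (h x) * inverse (h x)))"
        using smooth_open_partial_deriv[OF h i] smooth_open_const[OF op]
        by (intro alg_mult) (auto intro!: alg_gen)
      moreover have "((\<lambda>t. inverse (h (x(i := t)))) has_real_derivative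
          - 1 * partial_deriv i h x * (inverse (h x) * inverse (h x))) (at (x i))"
        if "x \<in> U" for x
        using DERIV_inverse_fun[OF smooth_open_has_partial[OF h i that]] nz[OF that]
        by (simp add: mult_ac power2_eq_square)
      ultimately show ?thesis unfolding m by blast
    qed
  qed
qed

lemma smooth_open_exp: "smooth_open n U h \<Longrightarrow> smooth_open n U (\<lambda>x. exp (h x))"
  by (rule smooth_open_compose_real[where g = "\<lambda>m. exp"]) auto

section \<open>A smooth function that vanishes on a half line\<close>

definition flat_poly :: "real poly \<Rightarrow> real \<Rightarrow> real" where
  "flat_poly p x = (if x > 0 then poly p (1 / x) * exp (- 1 / x) else 0)"

lemma poly_exp_tendsto: "((\<lambda>y::real. poly p y * exp (- y)) \<longlongrightarrow> 0) at_top"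
proof (induction p)
  case (pCons a p)
  have "((\<lambda>y. a * exp (- y) + (\<Sum>i\<le>degree p. poly.coeff p i * (y ^ Suc i / exp y))) \<longlongrightarrow>
      a * 0 + (\<Sum>i\<le>degree p. poly.coeff p i * 0)) at_top"
    by (intro tendsto_intros tendsto_power_div_exp_0 filterlim_compose[OF exp_at_bot] filterlim_uminus_at_bot_at_top)
  moreover have "a * exp (- y) + (\<Sum>i\<le>degree p. poly.coeff p i * (y ^ Suc i / exp y)) =
      poly (pCons a p) y * exp (- y)" for y
    by (simp add: poly_altdef[of p] exp_minus field_simps sum_distrib_left sum_distrib_right)
  ultimately show ?case by simp
qed simp

text \<open>For positive \<open>x\<close> the derivative of \<open>p (1/x) * exp (-1/x)\<close> has
  the same form with \<open>p\<close> replaced by \<open>X^2 (p - p')\<close>. A family indexed by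
  all polynomials therefore provides all derivatives of the flat function at once.\<close>

lemma flat_poly_deriv:
  "(flat_poly p has_real_derivative flat_poly ([:0, 0, 1:] * (p - pderiv p)) x) (at x)"
proof (cases x "0::real" rule: linorder_cases)
  case less
  have "((\<lambda>x. 0) has_real_derivative 0) (at x)" by simp
  then have "(flat_poly p has_real_derivative 0) (at x)"
    by (rule has_field_derivative_transform_within_open[where S = "{..<0}"])
       (use less in \<open>auto simp: flat_poly_def\<close>)
  then show ?thesis using less by (simp add: flat_poly_def)
next
  case equal
  have *: "((\<lambda>h. flat_poly p h / h) \<longlongrightarrow> 0) (at_right 0)"
  proof -
    \<comment> \<open>Division by \<open>h\<close> multiplies the polynomial in \<open>1 / h\<close>
      by its variable, which gives \<open>pCons 0 p\<close>.\<close>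
    have "((\<lambda>h. poly (pCons 0 p) (inverse h) * exp (- inverse h)) \<longlongrightarrow> 0) (at_right (0::real))"
      by (rule filterlim_compose[OF poly_exp_tendsto filterlim_inverse_at_top_right])
    then show ?thesis
      by (rule Lim_transform_eventually)
         (auto simp: flat_poly_def eventually_at_filter field_simps)
  qed
  have "((\<lambda>h. flat_poly p h / h) \<longlongrightarrow> 0) (at_left 0)"
    by (rule tendsto_eventually) (auto simp: flat_poly_def eventually_at_filter)
  with * have "((\<lambda>h. flat_poly p h / h) \<longlongrightarrow> 0) (at 0)"
    by (simp add: filterlim_split_at)
  then show ?thesis using equal by (simp add: has_field_derivative_iff flat_poly_def)
next
  case greater
  have "((\<lambda>x. poly p (1 / x) * exp (- 1 / x)) has_real_derivative
      poly ([:0, 0, 1:] * (p - pderiv p)) (1 / x) * exp (- 1 / x)) (at x)"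
    using greater
    by (auto intro!: derivative_eq_intros poly_DERIV[THEN DERIV_chain2] simp: field_simps power2_eq_square)
  then have "(flat_poly p has_real_derivative
      poly ([:0, 0, 1:] * (p - pderiv p)) (1 / x) * exp (- 1 / x)) (at x)"
    by (rule has_field_derivative_transform_within_open[where S = "{0<..}"])
       (use greater in \<open>auto simp: flat_poly_def\<close>)
  then show ?thesis using greater by (simp add: flat_poly_def)
qed

definition flat :: "real \<Rightarrow> real" where "flat = flat_poly 1"

lemma flat_pos: "x > 0 \<Longrightarrow> flat x > 0" and flat_zero: "x \<le> 0 \<Longrightarrow> flat x = 0"
  and flat_nonneg: "flat x \<ge> 0"
  by (auto simp: flat_def flat_poly_def)

lemma smooth_open_flat: "smooth_open n U h \<Longrightarrow> smooth_open n U (\<lambda>x. flat (h x))"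
proof -
  define P where "P m = ((\<lambda>p. [:0, 0, 1:] * (p - pderiv p)) ^^ m) (1 :: real poly)" for m
  assume "smooth_open n U h"
  then have "smooth_open n U (\<lambda>x. flat_poly (P 0) (h x))"
    by (rule smooth_open_compose_real[where g = "\<lambda>m. flat_poly (P m)", rotated])
       (simp only: P_def flat_poly_deriv funpow.simps comp_def)
  then show ?thesis by (simp add: P_def flat_def)
qed

lemma cube_mono_dim:
  assumes "k \<le> n" "\<And>i. i \<ge> k \<Longrightarrow> x i = 0" "r > 0"
  shows "cube k x r \<subseteq> cube n x r"
  using assms by (auto simp: cube_def) (metis abs_zero diff_zero not_less)

lemma openin_Euclidean_space_restrict:
  assumes "openin (Euclidean_space n) V" "k \<le> n"
  shows "openin (Euclidean_space k) (V \<inter> topspace (Euclidean_space k))"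
  unfolding openin_Euclidean_space_cube
proof (intro conjI ballI)
  fix x assume x: "x \<in> V \<inter> topspace (Euclidean_space k)"
  then obtain r where "r > 0" "cube n x r \<subseteq> V" using assms openin_contains_cube by blast
  moreover have "cube k x r \<subseteq> topspace (Euclidean_space k)"
    by (auto simp: cube_def topspace_Euclidean_space)
  ultimately show "\<exists>r>0. cube k x r \<subseteq> V \<inter> topspace (Euclidean_space k)"
    using cube_mono_dim[OF assms(2), of x r] x
    by (intro exI[of _ r]) (auto simp: topspace_Euclidean_space)
qed auto

text \<open>Differentiation in directions below \<open>k\<close> stays inside Euclidean
  \<open>k\<close>-space and gives the same result as in the larger space. So smoothness on
  \<open>V\<close> itself serves as the class closed under differentiation.\<close>

lemma smooth_open_restrict:
  assumes "smooth_open n V f" "k \<le> n"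
  shows "smooth_open k (V \<inter> topspace (Euclidean_space k)) f"
proof (rule smooth_open_coinduct[where X = "smooth_open n V"])
  show op: "openin (Euclidean_space k) (V \<inter> topspace (Euclidean_space k))"
    using openin_Euclidean_space_restrict assms smooth_open_imp_openin by blast
  fix h assume h: "smooth_open n V h"
  show "continuous_map (subtopology (Euclidean_space k) (V \<inter> topspace (Euclidean_space k))) euclideanreal h"
    unfolding continuous_Euclidean_cube[OF op]
  proof (intro ballI allI impI)
    fix x e assume x: "x \<in> V \<inter> topspace (Euclidean_space k)" and e: "(e::real) > 0"
    then obtain r where r: "r > 0" "\<forall>y\<in>cube n x r. \<bar>h y - h x\<bar> < e"
      using smooth_open_imp_continuous[OF h]
      unfolding continuous_Euclidean_cube[OF smooth_open_imp_openin[OF h]] by blast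
    then show "\<exists>r>0. \<forall>y\<in>cube k x r. \<bar>h y - h x\<bar> < e"
      using cube_mono_dim[OF assms(2), of x r] x by (auto simp: topspace_Euclidean_space)
  qed
  fix i assume "i < k"
  then have i: "i < n" using assms(2) by simp
  show "\<exists>k'. smooth_open n V k' \<and> (\<forall>x\<in>V \<inter> topspace (Euclidean_space k).
      ((\<lambda>t. h (x(i := t))) has_real_derivative k' x) (at (x i)))"
    using smooth_open_partial_deriv[OF h i] smooth_open_has_partial[OF h i] by blast
qed (use assms in auto)

text \<open>Meant for isotopies, with time as coordinate \<open>k\<close>: the space derivatives of
  the map at time \<open>u\<close> are those of the joint map, evaluated at time \<open>u\<close>,
  so that joint smoothness controls them.\<close>

lemma partial_derivs_param:
  assumes "set is \<subseteq> {..<k}"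
  shows "partial_derivs is (\<lambda>y. f (y(k := u))) x = partial_derivs is f (x(k := u))"
  using assms
proof (induction "is" arbitrary: x)
  case (Cons i "is")
  then have "partial_derivs is (\<lambda>y. f (y(k := u))) = (\<lambda>x. partial_derivs is f (x(k := u)))" and ik: "i \<noteq> k"
    by (auto simp del: fun_upd_apply intro!: ext)
  moreover have "(x(i := t))(k := u) = (x(k := u))(i := t)" for t using ik by (rule fun_upd_twist)
  moreover have "(x(k := u)) i = x i" using ik by simp
  ultimately show ?case unfolding partial_derivs_Cons partial_deriv_def by presburger
qed simp

text \<open>The inverse function theorem for a map that alters one coordinate only. Monotonicity
  along vertical segments gives injectivity, invariance of domain gives an open image and a
  continuous inverse \<open>a\<close>, and implicit differentiation of \<open>b (a w) = w n\<close>
  gives the derivatives of \<open>a\<close>.\<close>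

lemma smooth_open_fibre_inverse:
  assumes b: "smooth_open (Suc n) V b" and pos: "\<And>z. z \<in> V \<Longrightarrow> partial_deriv n b z > 0"
    and z0: "z0 \<in> V"
  defines "g \<equiv> \<lambda>z. z(n := b z)"
  obtains \<Omega> where "openin (Euclidean_space (Suc n)) \<Omega>" "z0 \<in> \<Omega>" "\<Omega> \<subseteq> V" "inj_on g \<Omega>"
    "openin (Euclidean_space (Suc n)) (g ` \<Omega>)"
    "\<And>F. smooth_open (Suc n) \<Omega> F \<Longrightarrow> smooth_open (Suc n) (g ` \<Omega>) (\<lambda>w. F (inv_into \<Omega> g w))"
proof -
  let ?E = "Euclidean_space (Suc n)"
  have V: "openin ?E V" using b by (rule smooth_open_imp_openin)
  obtain r where r: "r > 0" "cube (Suc n) z0 r \<subseteq> V" using openin_contains_cube V z0 by blast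
  \<comment> \<open>A cube meets each vertical line in an interval, along which \<open>b\<close>
    increases.\<close>
  define \<Omega> where "\<Omega> = cube (Suc n) z0 r"
  have op: "openin ?E \<Omega>" unfolding \<Omega>_def by (rule openin_cube)
  have top: "\<Omega> \<subseteq> topspace ?E" using op openin_subset by blast
  have z0': "z0 \<in> \<Omega>" using z0 V openin_subset[OF V] r(1)
    by (auto simp: \<Omega>_def cube_def topspace_Euclidean_space)
  have bs: "smooth_open (Suc n) \<Omega> b" using smooth_open_subset[OF b op] r(2) by (simp add: \<Omega>_def)
  have inj: "inj_on g \<Omega>"
  proof (rule inj_onI)
    fix y z assume y: "y \<in> \<Omega>" and z: "z \<in> \<Omega>" and e: "g y = g z"
    have yz: "y j = z j" if "j \<noteq> n" for j using fun_cong[OF e, of j] that by (simp add: g_def)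
    have be: "b y = b z" using fun_cong[OF e, of n] by (simp add: g_def)
    have zu: "z = y(n := z n)" using yz by auto
    have lt: "b (y(n := u)) < b (y(n := w))"
      if "u < w" "y(n := u) \<in> \<Omega>" "y(n := w) \<in> \<Omega>" for u w
    proof (rule DERIV_pos_imp_increasing[OF that(1)])
      fix t assume t: "u \<le> t" "t \<le> w"
      have "\<bar>u - z0 n\<bar> < r" "\<bar>w - z0 n\<bar> < r"
        using that(2,3) unfolding \<Omega>_def cube_def by auto
      then have "\<bar>t - z0 n\<bar> < r" using t by linarith
      then have "y(n := t) \<in> \<Omega>" using that(2) unfolding \<Omega>_def cube_def by auto
      then show "\<exists>D. ((\<lambda>t. b (y(n := t))) has_real_derivative D) (at t) \<and> 0 < D"
        using smooth_open_has_partial[OF bs, of n "y(n := t)"] pos[of "y(n := t)"] r(2)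
        unfolding \<Omega>_def by auto
    qed
    have "\<not> y n < z n" using lt[of "y n" "z n"] y z zu be by auto
    moreover have "\<not> z n < y n" using lt[of "z n" "y n"] y z zu be by auto
    ultimately have "y n = z n" by simp
    then show "y = z" using zu by (metis fun_upd_triv)
  qed
  have gtop: "g z \<in> topspace ?E" if "z \<in> \<Omega>" for z
    using that top by (auto simp: g_def topspace_Euclidean_space)
  have cg: "continuous_map (subtopology ?E \<Omega>) ?E g"
  proof (rule continuous_map_into_Euclidean_space)
    show "continuous_map (subtopology ?E \<Omega>) euclideanreal (\<lambda>x. g x j)" for j
      using smooth_open_imp_continuous[OF bs] smooth_open_imp_continuous[OF smooth_open_coord[OF op, of j]]
      by (cases "j = n") (auto simp: g_def)
  qed (use gtop in auto)
  have opg: "openin ?E (g ` \<Omega>)"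
    by (rule invariance_of_domain_Euclidean_space[OF op cg inj])
  define a where "a = inv_into \<Omega> g"
  have ga: "g (a w) = w" "a w \<in> \<Omega>" if "w \<in> g ` \<Omega>" for w
    using that unfolding a_def by (simp_all add: f_inv_into_f inv_into_into)
  have ag: "a (g z) = z" if "z \<in> \<Omega>" for z using inj that by (simp add: a_def)
  have ca: "continuous_map (subtopology ?E (g ` \<Omega>)) (subtopology ?E \<Omega>) a"
    unfolding continuous_map_def
  proof (intro conjI allI impI)
    show "a \<in> topspace (subtopology ?E (g ` \<Omega>)) \<rightarrow> topspace (subtopology ?E \<Omega>)"
      using ga(2) top by auto
    fix T assume "openin (subtopology ?E \<Omega>) T"
    then have T: "openin ?E T" "T \<subseteq> \<Omega>" using openin_open_subtopology[OF op] by auto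
    have "openin ?E (g ` T)"
      by (rule invariance_of_domain_Euclidean_space[OF T(1)])
         (use cg T inj in \<open>auto intro: continuous_map_from_subtopology_mono inj_on_subset\<close>)
    moreover have "{x \<in> topspace (subtopology ?E (g ` \<Omega>)). a x \<in> T} = g ` T"
      using ga ag T(2) gtop by (auto simp: image_iff)
    ultimately show "openin (subtopology ?E (g ` \<Omega>)) {x \<in> topspace (subtopology ?E (g ` \<Omega>)). a x \<in> T}"
      using T(2) by (auto simp: openin_open_subtopology[OF opg])
  qed
  have an: "a w j = w j" if "w \<in> g ` \<Omega>" "j \<noteq> n" for w j
    using fun_cong[OF ga(1)[OF that(1)], of j] that(2) by (simp add: g_def)
  have ban: "b (a w) = w n" if "w \<in> g ` \<Omega>" for w
    using fun_cong[OF ga(1)[OF that(1)], of n] by (simp add: g_def)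
  \<comment> \<open>The functions on the image that factor through the inverse as
    \<open>F (a w)\<close>. Their derivatives are again of this form, because the derivatives of
    \<open>a\<close> turn out to be smooth expressions in the point \<open>a w\<close>.\<close>
  let ?X = "\<lambda>h. \<exists>F. smooth_open (Suc n) \<Omega> F \<and> (\<forall>w\<in>g ` \<Omega>. h w = F (a w))"
  have X: "smooth_open (Suc n) (g ` \<Omega>) h" if "?X h" for h
  proof (rule smooth_open_coinduct[OF opg, where X = ?X])
    show "?X h" by fact
    show "continuous_map (subtopology ?E (g ` \<Omega>)) euclideanreal h" if Xh: "?X h" for h
    proof -
      obtain F where F: "smooth_open (Suc n) \<Omega> F" "\<forall>w\<in>g ` \<Omega>. h w = F (a w)" using Xh by blast
      show ?thesis
        by (rule continuous_map_eq[OF continuous_map_compose[OF ca smooth_open_imp_continuous[OF F(1)]]])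
           (use F(2) in auto)
    qed
    fix h i assume "?X h" and i: "i < Suc n"
    then obtain F where F: "smooth_open (Suc n) \<Omega> F" "\<forall>w\<in>g ` \<Omega>. h w = F (a w)" by blast
    \<comment> \<open>The derivative in direction \<open>i\<close> of coordinate \<open>j\<close> of
      the inverse, written at the point \<open>z = a w\<close>. For \<open>j = n\<close> it solves
      the differentiated equation \<open>b (a w) = w n\<close>: it is \<open>1\<close> for
      \<open>i = n\<close>, and minus the derivative of \<open>b\<close> in direction
      \<open>i\<close> otherwise, divided by the derivative of \<open>b\<close> in direction
      \<open>n\<close>.\<close>
    define c where "c = (\<lambda>j z. if j = n then ((if i = n then 1 else 0) - (if i = n then 0 else partial_deriv i b z))
        * inverse (partial_deriv n b z) else if j = i then 1 else 0)"
    have cs: "smooth_open (Suc n) \<Omega> (c j)" for j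
    proof (cases "j = n")
      case False
      then show ?thesis using smooth_open_const[OF op, of "if j = i then 1 else 0"] by (simp add: c_def)
    next
      case True
      have nz: "partial_deriv n b z \<noteq> 0" if "z \<in> \<Omega>" for z
        using pos[of z] r(2) that by (auto simp: \<Omega>_def)
      have inv: "smooth_open (Suc n) \<Omega> (\<lambda>z. inverse (partial_deriv n b z))"
        by (rule smooth_open_inverse[OF smooth_open_partial_deriv[OF bs] nz]) simp
      have "smooth_open (Suc n) \<Omega> (\<lambda>z. - 1 * partial_deriv i b z * inverse (partial_deriv n b z))"
        by (intro smooth_open_mult inv smooth_open_const op smooth_open_partial_deriv[OF bs i])
      then show ?thesis using True inv by (cases "i = n") (simp_all add: c_def)
    qed
    have ad: "((\<lambda>t. a (w(i := t)) j) has_real_derivative c j (a w)) (at (w i))"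
      if w: "w \<in> g ` \<Omega>" and j: "j < Suc n" for w j
    proof -
      have ev: "\<forall>\<^sub>F t in at (w i). w(i := t) \<in> g ` \<Omega>"
        using cube_upd[OF opg w i] eventually_at_filter eventually_mono by fastforce
      show ?thesis
      proof (cases "j = n")
        case False
        have "((\<lambda>t. (w(i := t)) j) has_real_derivative c j (a w)) (at (w i))"
          using False by (cases "j = i") (auto simp: c_def)
        moreover have "\<forall>\<^sub>F t in nhds (w i). (w(i := t)) j = a (w(i := t)) j"
          using cube_upd[OF opg w i] by eventually_elim (use an False in auto)
        ultimately show ?thesis by (subst DERIV_cong_ev[OF refl _ refl, symmetric])
      next
        case True
        have aw: "a w \<in> \<Omega>" using ga(2) w by blast
        obtain \<beta> where \<beta>: "\<And>y. y \<in> topspace ?E \<Longrightarrow> b y - b (a w) = (\<Sum>j<Suc n. \<beta> j y * (y j - a w j))"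
          "\<And>e j. e > 0 \<Longrightarrow> j < Suc n \<Longrightarrow> \<exists>r>0. \<forall>y\<in>cube (Suc n) (a w) r. \<bar>\<beta> j y - partial_deriv j b (a w)\<bar> < e"
          using caratheodory_partial[OF bs aw] by blast
        have coordcont: "((\<lambda>t. a (w(i := t)) j) \<longlongrightarrow> a w j) (at (w i))" if "j < Suc n" for j
        proof (rule tendstoI)
          fix e :: real assume e: "e > 0"
          have cm: "continuous_map (subtopology ?E (g ` \<Omega>)) euclideanreal (\<lambda>x. a x j)"
            using continuous_map_compose[OF ca smooth_open_imp_continuous[OF smooth_open_coord[OF op, of j]]]
            by (simp add: comp_def)
          then obtain r' where r': "r' > 0" "\<forall>y\<in>cube (Suc n) w r'. \<bar>a y j - a w j\<bar> < e"
            using e w unfolding continuous_Euclidean_cube[OF opg] by blast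
          have "w \<in> cube (Suc n) w r'"
            using w openin_subset[OF opg] r'(1) by (auto simp: cube_def topspace_Euclidean_space)
          then have "\<forall>\<^sub>F t in nhds (w i). w(i := t) \<in> cube (Suc n) w r'"
            using cube_upd[OF openin_cube _ i] by blast
          then have "\<forall>\<^sub>F t in at (w i). w(i := t) \<in> cube (Suc n) w r'"
            using eventually_at_filter eventually_mono by fastforce
          then show "\<forall>\<^sub>F t in at (w i). dist (a (w(i := t)) j) (a w j) < e"
            by eventually_elim (use r'(2) in \<open>auto simp: dist_real_def\<close>)
        qed
        have evt: "\<forall>\<^sub>F t in at (w i). a (w(i := t)) \<in> topspace ?E"
          using ev by eventually_elim (use ga(2) top in blast)
        have lim\<beta>: "((\<lambda>t. \<beta> j (a (w(i := t)))) \<longlongrightarrow> partial_deriv j b (a w)) (at (w i))" if "j < Suc n" for j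
          by (rule tendsto_cube[OF coordcont evt]) (use \<beta>(2) that in auto)
        have pn: "partial_deriv n b (a w) > 0" using pos aw r(2) by (auto simp: \<Omega>_def)
        have evp: "\<forall>\<^sub>F t in at (w i). \<beta> n (a (w(i := t))) > 0"
          using order_tendstoD(1)[OF lim\<beta>[of n] pn] by simp
        \<comment> \<open>Only the coordinates \<open>i\<close> and \<open>n\<close> of
          \<open>a w\<close> can change with \<open>t\<close>. All other terms in the expansion of
          the increment of \<open>b\<close> vanish, and it can be solved for the increment of the
          last coordinate.\<close>
        have eq: "\<forall>\<^sub>F t in at (w i). ((if i = n then 1 else 0) - (if i = n then 0 else \<beta> i (a (w(i := t)))))
            * inverse (\<beta> n (a (w(i := t)))) = (a (w(i := t)) n - a w n) / (t - w i)"
          using ev evp eventually_neq_at_within[of "w i" "w i" UNIV]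
        proof eventually_elim
          case (elim t)
          let ?y = "a (w(i := t))"
          have y: "?y \<in> topspace ?E" using ga(2)[OF elim(1)] top by blast
          have "b ?y - b (a w) = (w(i := t)) n - w n" using ban elim(1) w by simp
          then have s: "(w(i := t)) n - w n = (\<Sum>j<n. \<beta> j ?y * (?y j - a w j)) + \<beta> n ?y * (?y n - a w n)"
            using \<beta>(1)[OF y] by simp
          have sj: "(\<Sum>j<n. \<beta> j ?y * (?y j - a w j)) = (\<Sum>j<n. if j = i then \<beta> i ?y * (t - w i) else 0)"
            by (rule sum.cong) (use an elim(1) w in auto)
          show ?case
          proof (cases "i = n")
            case True
            then have "t - w i = \<beta> n ?y * (?y n - a w n)" using s sj by simp
            then show ?thesis using True elim(2,3) by (simp add: field_simps)
          next
            case False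
            then have "0 = \<beta> i ?y * (t - w i) + \<beta> n ?y * (?y n - a w n)" using s sj i by simp
            then show ?thesis using False elim(2,3) by (simp add: field_simps)
          qed
        qed
        have "((\<lambda>t. ((if i = n then 1 else 0) - (if i = n then 0 else \<beta> i (a (w(i := t)))))
            * inverse (\<beta> n (a (w(i := t))))) \<longlongrightarrow> c n (a w)) (at (w i))"
          unfolding c_def using pn lim\<beta>[of n] lim\<beta>[of i] i by (auto intro!: tendsto_intros)
        then have "((\<lambda>t. (a (w(i := t)) n - a w n) / (t - w i)) \<longlongrightarrow> c n (a w)) (at (w i))"
          using eq by (rule Lim_transform_eventually)
        then show ?thesis using True by (simp add: has_field_derivative_iff)
      qed
    qed
    define k where "k w = (\<Sum>j<Suc n. partial_deriv j F w * c j w)" for w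
    have "alg {h. smooth_open (Suc n) \<Omega> h} k"
      unfolding k_def using smooth_open_partial_deriv[OF F(1)] cs smooth_open_const[OF op]
      by (intro alg_sum alg_mult) (auto intro: alg_gen)
    then have ks: "smooth_open (Suc n) \<Omega> k" by (rule smooth_open_alg_self[OF op])
    have "((\<lambda>t. h (w(i := t))) has_real_derivative k (a w)) (at (w i))" if w: "w \<in> g ` \<Omega>" for w
    proof -
      have "\<forall>\<^sub>F t in at (w i). w(i := t) \<in> g ` \<Omega>"
        using cube_upd[OF opg w i] eventually_at_filter eventually_mono by fastforce
      then have "\<forall>\<^sub>F t in at (w i). a (w(i := t)) \<in> topspace ?E"
        by eventually_elim (use ga(2) top in blast)
      then have "((\<lambda>t. F (a (w(i := t)))) has_real_derivative
          (\<Sum>j<Suc n. partial_deriv j F (a (w(i := w i))) * c j (a w))) (at (w i))"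
        by (intro smooth_open_has_derivative_along[OF F(1)]) (use ga(2) w ad[OF w] in auto)
      then have "((\<lambda>t. F (a (w(i := t)))) has_real_derivative k (a w)) (at (w i))" by (simp add: k_def)
      then show ?thesis
        by (subst has_partial_cong[OF opg w i, of h "\<lambda>w. F (a w)"]) (use F(2) in auto)
    qed
    then show "\<exists>k. ?X k \<and> (\<forall>x\<in>g ` \<Omega>. ((\<lambda>t. h (x(i := t))) has_real_derivative k x) (at (x i)))"
      using ks by (intro exI[of _ "\<lambda>w. k (a w)"]) auto
  qed
  have "smooth_open (Suc n) (g ` \<Omega>) (\<lambda>w. F (a w))" if "smooth_open (Suc n) \<Omega> F" for F
    by (rule X) (use that in auto)
  then show thesis
    using that[OF op z0' _ inj opg] r(2) by (auto simp: \<Omega>_def a_def)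
qed

section \<open>Smooth functions and maps on manifolds\<close>

definition smooth_manifold :: "'a manifold \<Rightarrow> bool" where
  "smooth_manifold M \<longleftrightarrow> Hausdorff_space (mtop M) \<and>
     (\<forall>c\<in>matlas M. is_chart (Euclidean_space (mdim M)) (mtop M) c) \<and>
     (\<Union>(U, \<phi>)\<in>matlas M. U) = topspace (mtop M) \<and>
     (\<forall>c\<in>matlas M. \<forall>c'\<in>matlas M. smooth_transition (mdim M) c c')"

lemma manifold_without_boundary_imp_smooth_manifold:
  "manifold_without_boundary M \<Longrightarrow> smooth_manifold M"
  by (simp add: manifold_without_boundary_def modelled_on_def smooth_manifold_def)

lemma smooth_on_open_iff:
  assumes "openin (Euclidean_space n) S"
  shows "smooth_on n S F \<longleftrightarrow> (\<forall>j. smooth_open n S (\<lambda>x. F x j))"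
proof
  assume R: "smooth_on n S F"
  show "\<forall>j. smooth_open n S (\<lambda>x. F x j)"
  proof (intro allI smooth_open_local[OF assms])
    fix j x assume "x \<in> S"
    then obtain U g where "x \<in> U" "smooth_open n U g" "\<forall>y\<in>U \<inter> S. F y j = g y"
      using R unfolding smooth_on_def by blast
    then show "\<exists>V g. x \<in> V \<and> smooth_open n V g \<and> (\<forall>y\<in>S \<inter> V. F y j = g y)" by blast
  qed
next
  assume "\<forall>j. smooth_open n S (\<lambda>x. F x j)"
  then show "smooth_on n S F" unfolding smooth_on_def by blast
qed

lemma is_chart_props:
  assumes "is_chart H X (U, \<phi>)"
  shows chart_openin: "openin X U" and chart_inj: "inj_on \<phi> U"
    and chart_image: "openin H (\<phi> ` U)"
    and chart_open_map: "\<And>T. openin X T \<Longrightarrow> T \<subseteq> U \<Longrightarrow> openin H (\<phi> ` T)"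
    and chart_preimage: "\<And>S. openin H S \<Longrightarrow> openin X {p \<in> U. \<phi> p \<in> S}"
    and chart_continuous: "continuous_map (subtopology X U) (subtopology H (\<phi> ` U)) \<phi>"
proof -
  have U: "openin X U" and I: "openin H (\<phi> ` U)"
    and h: "homeomorphic_map (subtopology X U) (subtopology H (\<phi> ` U)) \<phi>"
    using assms by (auto simp: is_chart_def)
  show "openin X U" "openin H (\<phi> ` U)" by fact+
  have tU: "topspace (subtopology X U) = U" using openin_subset[OF U] by auto
  show "inj_on \<phi> U" using homeomorphic_imp_injective_map[OF h] tU by simp
  show c: "continuous_map (subtopology X U) (subtopology H (\<phi> ` U)) \<phi>"
    using h by (rule homeomorphic_imp_continuous_map)
  show "openin H (\<phi> ` T)" if "openin X T" "T \<subseteq> U" for T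
  proof -
    have "openin (subtopology X U) T" using that U by (simp add: openin_open_subtopology)
    then have "openin (subtopology H (\<phi> ` U)) (\<phi> ` T)"
      using homeomorphic_imp_open_map[OF h] by (simp add: open_map_def)
    then show ?thesis using I by (simp add: openin_open_subtopology)
  qed
  show "openin X {p \<in> U. \<phi> p \<in> S}" if "openin H S" for S
  proof -
    have "openin (subtopology H (\<phi> ` U)) (S \<inter> \<phi> ` U)"
      using that I by (simp add: openin_open_subtopology openin_Int)
    then have "openin (subtopology X U) {p \<in> topspace (subtopology X U). \<phi> p \<in> S \<inter> \<phi> ` U}"
      by (rule openin_continuous_map_preimage[OF c])
    then have "openin X {p \<in> topspace (subtopology X U). \<phi> p \<in> S \<inter> \<phi> ` U}"
      using U by (simp add: openin_open_subtopology)
    moreover have "{p \<in> topspace (subtopology X U). \<phi> p \<in> S \<inter> \<phi> ` U} = {p \<in> U. \<phi> p \<in> S}"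
      unfolding tU by blast
    ultimately show ?thesis by simp
  qed
qed

lemma chart_inv_continuous:
  assumes ch: "is_chart H X (U, \<phi>)"
  shows "continuous_map (subtopology H (\<phi> ` U)) X (inv_into U \<phi>)"
  unfolding continuous_map_def
proof (intro conjI allI impI)
  have t: "topspace (subtopology H (\<phi> ` U)) = \<phi> ` U" using openin_subset[OF chart_image[OF ch]] by auto
  have inj: "inj_on \<phi> U" and U: "openin X U" by (rule chart_inj[OF ch] chart_openin[OF ch])+
  show "inv_into U \<phi> \<in> topspace (subtopology H (\<phi> ` U)) \<rightarrow> topspace X"
    unfolding t using openin_subset[OF U] inj by auto
  fix T assume T: "openin X T"
  have "{x \<in> \<phi> ` U. inv_into U \<phi> x \<in> T} = \<phi> ` (U \<inter> T)" using inj by auto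
  then show "openin (subtopology H (\<phi> ` U)) {x \<in> topspace (subtopology H (\<phi> ` U)). inv_into U \<phi> x \<in> T}"
    unfolding t openin_open_subtopology[OF chart_image[OF ch]]
    using chart_open_map[OF ch, of "U \<inter> T"] U T by auto
qed

text \<open>Smoothness is tested in the given charts and concerns only the values on the open set
  \<open>T\<close>, so a formula that is meaningful on a part of the manifold can be used without
  passing to an open submanifold.\<close>

definition sfun :: "'a manifold \<Rightarrow> 'a set \<Rightarrow> ('a \<Rightarrow> real) \<Rightarrow> bool" where
  "sfun M T f \<longleftrightarrow> openin (mtop M) T \<and>
     (\<forall>(U, \<phi>)\<in>matlas M. smooth_open (mdim M) (\<phi> ` (U \<inter> T)) (\<lambda>x. f (inv_into U \<phi> x)))"

lemma sfunI:
  assumes "openin (mtop M) T"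
    and "\<And>U \<phi>. (U, \<phi>) \<in> matlas M \<Longrightarrow> smooth_open (mdim M) (\<phi> ` (U \<inter> T)) (\<lambda>x. f (inv_into U \<phi> x))"
  shows "sfun M T f"
  using assms unfolding sfun_def by blast

lemma sfunD:
  "sfun M T f \<Longrightarrow> (U, \<phi>) \<in> matlas M \<Longrightarrow> smooth_open (mdim M) (\<phi> ` (U \<inter> T)) (\<lambda>x. f (inv_into U \<phi> x))"
  unfolding sfun_def by blast

lemma sfun_openin: "sfun M T f \<Longrightarrow> openin (mtop M) T"
  by (simp add: sfun_def)

lemma smooth_manifold_charts:
  assumes "smooth_manifold M"
  shows smooth_manifold_is_chart: "c \<in> matlas M \<Longrightarrow> is_chart (Euclidean_space (mdim M)) (mtop M) c"
    and smooth_manifold_transition: "c \<in> matlas M \<Longrightarrow> c' \<in> matlas M \<Longrightarrow> smooth_transition (mdim M) c c'"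
    and smooth_manifold_cover: "p \<in> topspace (mtop M) \<Longrightarrow> \<exists>U \<phi>. (U, \<phi>) \<in> matlas M \<and> p \<in> U"
    and smooth_manifold_Hausdorff: "Hausdorff_space (mtop M)"
  using assms unfolding smooth_manifold_def by blast+

lemma image_openin_chart:
  assumes "smooth_manifold M" "(U, \<phi>) \<in> matlas M" "openin (mtop M) T"
  shows "openin (Euclidean_space (mdim M)) (\<phi> ` (U \<inter> T))"
  using chart_open_map[OF smooth_manifold_is_chart[OF assms(1,2)], of "U \<inter> T"]
    chart_openin[OF smooth_manifold_is_chart[OF assms(1,2)]] assms(3) by blast

lemma sfun_const: "smooth_manifold M \<Longrightarrow> openin (mtop M) T \<Longrightarrow> sfun M T (\<lambda>p. c)"
  unfolding sfun_def by (auto intro!: smooth_open_const image_openin_chart)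

lemma sfun_add: "sfun M T f \<Longrightarrow> sfun M T g \<Longrightarrow> sfun M T (\<lambda>p. f p + g p)"
  unfolding sfun_def by (fastforce intro!: smooth_open_add)

lemma sfun_mult: "sfun M T f \<Longrightarrow> sfun M T g \<Longrightarrow> sfun M T (\<lambda>p. f p * g p)"
  unfolding sfun_def by (fastforce intro!: smooth_open_mult)

lemma inv_into_chart_mem:
  "x \<in> \<phi> ` (U \<inter> T) \<Longrightarrow> inj_on \<phi> U \<Longrightarrow> inv_into U \<phi> x \<in> U \<inter> T"
  by auto

lemma sfun_inverse:
  assumes M: "smooth_manifold M" and f: "sfun M T f" and nz: "\<And>p. p \<in> T \<Longrightarrow> f p \<noteq> 0"
  shows "sfun M T (\<lambda>p. inverse (f p))"
proof (rule sfunI)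
  show "openin (mtop M) T" using f by (rule sfun_openin)
  fix U \<phi> assume c: "(U, \<phi>) \<in> matlas M"
  show "smooth_open (mdim M) (\<phi> ` (U \<inter> T)) (\<lambda>x. inverse (f (inv_into U \<phi> x)))"
  proof (rule smooth_open_inverse)
    show "smooth_open (mdim M) (\<phi> ` (U \<inter> T)) (\<lambda>x. f (inv_into U \<phi> x))"
      using f c unfolding sfun_def by blast
    show "f (inv_into U \<phi> x) \<noteq> 0" if "x \<in> \<phi> ` (U \<inter> T)" for x
      using inv_into_chart_mem[OF that chart_inj[OF smooth_manifold_is_chart[OF M c]]] nz by blast
  qed
qed

lemma sfun_exp: "sfun M T f \<Longrightarrow> sfun M T (\<lambda>p. exp (f p))"
  unfolding sfun_def by (fastforce intro!: smooth_open_exp)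

lemma sfun_flat: "sfun M T f \<Longrightarrow> sfun M T (\<lambda>p. flat (f p))"
  unfolding sfun_def by (fastforce intro!: smooth_open_flat)

lemma sfun_cmult: "smooth_manifold M \<Longrightarrow> sfun M T f \<Longrightarrow> sfun M T (\<lambda>p. c * f p)"
  by (intro sfun_mult sfun_const sfun_openin)

lemma sfun_diff:
  assumes "smooth_manifold M" "sfun M T f" "sfun M T g"
  shows "sfun M T (\<lambda>p. f p - g p)"
  using sfun_add[OF assms(2) sfun_cmult[OF assms(1,3), of "-1"]] by simp

lemma sfun_divide:
  assumes "smooth_manifold M" "sfun M T f" "sfun M T g" "\<And>p. p \<in> T \<Longrightarrow> g p \<noteq> 0"
  shows "sfun M T (\<lambda>p. f p / g p)"
  using sfun_mult[OF assms(2) sfun_inverse[OF assms(1,3,4)]] by (simp add: divide_inverse)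

lemma sfun_prod:
  assumes "smooth_manifold M" "openin (mtop M) T" "finite I" "\<And>i. i \<in> I \<Longrightarrow> sfun M T (f i)"
  shows "sfun M T (\<lambda>p. \<Prod>i\<in>I. f i p)"
  using assms(3,4) by (induction I rule: finite_induct) (auto intro!: sfun_const sfun_mult assms(1,2))

lemma sfun_sum:
  assumes "smooth_manifold M" "openin (mtop M) T" "finite I" "\<And>i. i \<in> I \<Longrightarrow> sfun M T (f i)"
  shows "sfun M T (\<lambda>p. \<Sum>i\<in>I. f i p)"
  using assms(3,4) by (induction I rule: finite_induct) (auto intro!: sfun_const sfun_add assms(1,2))

lemma sfun_local:
  assumes M: "smooth_manifold M" and T: "openin (mtop M) T"
    and loc: "\<And>p. p \<in> T \<Longrightarrow> \<exists>S g. p \<in> S \<and> sfun M S g \<and> (\<forall>q\<in>T \<inter> S. f q = g q)"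
  shows "sfun M T f"
proof (rule sfunI[OF T])
  fix U \<phi> assume c: "(U, \<phi>) \<in> matlas M"
  have inj: "inj_on \<phi> U" by (rule chart_inj[OF smooth_manifold_is_chart[OF M c]])
  show "smooth_open (mdim M) (\<phi> ` (U \<inter> T)) (\<lambda>x. f (inv_into U \<phi> x))"
  proof (rule smooth_open_local[OF image_openin_chart[OF M c T]])
    fix x assume "x \<in> \<phi> ` (U \<inter> T)"
    then obtain p where p: "p \<in> U \<inter> T" "x = \<phi> p" by blast
    then obtain S g where S: "p \<in> S" "sfun M S g" "\<forall>q\<in>T \<inter> S. f q = g q" using loc by blast
    show "\<exists>V g. x \<in> V \<and> smooth_open (mdim M) V g \<and>
        (\<forall>y\<in>\<phi> ` (U \<inter> T) \<inter> V. f (inv_into U \<phi> y) = g y)"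
      using S c p inj unfolding sfun_def
      by (intro exI[of _ "\<phi> ` (U \<inter> S)"] exI[of _ "\<lambda>x. g (inv_into U \<phi> x)"])
         (auto simp: inj_on_eq_iff)
  qed
qed

lemma sfun_subset:
  assumes "smooth_manifold M" "sfun M T f" "openin (mtop M) S" "S \<subseteq> T" "\<And>p. p \<in> S \<Longrightarrow> f p = g p"
  shows "sfun M S g"
  by (rule sfun_local[OF assms(1,3)], rule exI[of _ T], rule exI[of _ f])
     (use assms(2,4,5) in auto)

lemma sfun_cong: "smooth_manifold M \<Longrightarrow> sfun M T f \<Longrightarrow> (\<And>p. p \<in> T \<Longrightarrow> f p = g p) \<Longrightarrow> sfun M T g"
  using sfun_subset[of M T f T g] sfun_openin[of M T f] by blast

lemma sfun_preimage:
  assumes M: "smooth_manifold M" and f: "sfun M T f" and V: "open V"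
  shows "openin (mtop M) {p \<in> T. f p \<in> V}"
proof (subst openin_subopen, intro ballI)
  fix p assume p: "p \<in> {p \<in> T. f p \<in> V}"
  then obtain U \<phi> where c: "(U, \<phi>) \<in> matlas M" "p \<in> U"
    using smooth_manifold_cover[OF M] openin_subset[OF sfun_openin[OF f]] by blast
  have ch: "is_chart (Euclidean_space (mdim M)) (mtop M) (U, \<phi>)" by (rule smooth_manifold_is_chart[OF M c(1)])
  define S where "S = \<phi> ` (U \<inter> T)"
  have so: "smooth_open (mdim M) S (\<lambda>x. f (inv_into U \<phi> x))" using f c unfolding sfun_def S_def by blast
  have S: "openin (Euclidean_space (mdim M)) S" using so by (rule smooth_open_imp_openin)
  have "openin (subtopology (Euclidean_space (mdim M)) S)
      {x \<in> topspace (subtopology (Euclidean_space (mdim M)) S). f (inv_into U \<phi> x) \<in> V}"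
    using openin_continuous_map_preimage[OF smooth_open_imp_continuous[OF so]] V by simp
  then have "openin (Euclidean_space (mdim M)) {x \<in> S. f (inv_into U \<phi> x) \<in> V}"
    unfolding topspace_subtopology_subset[OF openin_subset[OF S]] openin_open_subtopology[OF S] by blast
  from chart_preimage[OF ch this] have op: "openin (mtop M) {p \<in> U. \<phi> p \<in> {x \<in> S. f (inv_into U \<phi> x) \<in> V}}" .
  have "{p \<in> U. \<phi> p \<in> {x \<in> S. f (inv_into U \<phi> x) \<in> V}} = {p \<in> U \<inter> T. f p \<in> V}"
    using chart_inj[OF ch] by (auto simp: S_def inj_on_eq_iff)
  then show "\<exists>S. openin (mtop M) S \<and> p \<in> S \<and> S \<subseteq> {p \<in> T. f p \<in> V}"
    using op p c(2) by (intro exI[of _ "{p \<in> U \<inter> T. f p \<in> V}"]) auto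
qed

lemma sfun_continuous:
  assumes "smooth_manifold M" "sfun M T f"
  shows "continuous_map (subtopology (mtop M) T) euclideanreal f"
  unfolding continuous_map_def
proof (intro conjI allI impI)
  fix V :: "real set" assume "openin euclideanreal V"
  then have "openin (mtop M) {p \<in> T. f p \<in> V}" using sfun_preimage[OF assms] by simp
  then show "openin (subtopology (mtop M) T) {x \<in> topspace (subtopology (mtop M) T). f x \<in> V}"
    unfolding topspace_subtopology_subset[OF openin_subset[OF sfun_openin[OF assms(2)]]]
      openin_open_subtopology[OF sfun_openin[OF assms(2)]] by blast
qed auto

lemma sfun_chart_coord:
  assumes M: "smooth_manifold M" and c: "(U, \<phi>) \<in> matlas M"
  shows "sfun M U (\<lambda>p. \<phi> p j)"
proof (rule sfunI)
  show op: "openin (mtop M) U" by (rule chart_openin[OF smooth_manifold_is_chart[OF M c]])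
  fix V \<psi> assume c': "(V, \<psi>) \<in> matlas M"
  have "smooth_on (mdim M) (\<psi> ` (V \<inter> U)) (\<lambda>x. \<phi> (inv_into V \<psi> x))"
    using smooth_manifold_transition[OF M c' c] by (simp add: smooth_transition_def)
  then show "smooth_open (mdim M) (\<psi> ` (V \<inter> U)) (\<lambda>x. \<phi> (inv_into V \<psi> x) j)"
    unfolding smooth_on_open_iff[OF image_openin_chart[OF M c' op]] by blast
qed

text \<open>A description of the maximal atlas by functions instead of transition maps. In this form
  charts are pulled back along diffeomorphisms and restricted to smaller sets by transporting
  functions.\<close>

lemma max_atlas_iff:
  assumes M: "smooth_manifold M"
  shows "(U, \<phi>) \<in> max_atlas M \<longleftrightarrow> openin (mtop M) U \<and> inj_on \<phi> U \<and> (\<forall>j. sfun M U (\<lambda>p. \<phi> p j)) \<and>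
     (\<forall>T f. sfun M T f \<longrightarrow> smooth_open (mdim M) (\<phi> ` (U \<inter> T)) (\<lambda>x. f (inv_into U \<phi> x)))"
    (is "_ \<longleftrightarrow> ?R")
proof
  let ?E = "Euclidean_space (mdim M)"
  assume A: "(U, \<phi>) \<in> max_atlas M"
  have ch: "is_chart ?E (mtop M) (U, \<phi>)" using A by (simp add: max_atlas_def)
  have inj: "inj_on \<phi> U" and U: "openin (mtop M) U" by (rule chart_inj[OF ch] chart_openin[OF ch])+
  have tr: "smooth_transition (mdim M) (U, \<phi>) c" "smooth_transition (mdim M) c (U, \<phi>)" if "c \<in> matlas M" for c
    using A that by (auto simp: max_atlas_def)
  have co: "sfun M U (\<lambda>p. \<phi> p j)" for j
  proof (rule sfunI[OF U])
    fix V \<psi> assume c': "(V, \<psi>) \<in> matlas M"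
    have "smooth_on (mdim M) (\<psi> ` (V \<inter> U)) (\<lambda>x. \<phi> (inv_into V \<psi> x))"
      using tr(2)[OF c'] by (simp add: smooth_transition_def)
    then show "smooth_open (mdim M) (\<psi> ` (V \<inter> U)) (\<lambda>x. \<phi> (inv_into V \<psi> x) j)"
      unfolding smooth_on_open_iff[OF image_openin_chart[OF M c' U]] by blast
  qed
  have "smooth_open (mdim M) (\<phi> ` (U \<inter> T)) (\<lambda>x. f (inv_into U \<phi> x))" if f: "sfun M T f" for T f
  proof (rule smooth_open_local)
    have T: "openin (mtop M) T" using f by (rule sfun_openin)
    show "openin ?E (\<phi> ` (U \<inter> T))"
      using chart_open_map[OF ch, of "U \<inter> T"] U T by blast
    fix x assume "x \<in> \<phi> ` (U \<inter> T)"
    then obtain p where p: "p \<in> U \<inter> T" "x = \<phi> p" by blast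
    then obtain V \<psi> where c': "(V, \<psi>) \<in> matlas M" "p \<in> V"
      using smooth_manifold_cover[OF M] openin_subset[OF T] by blast
    have ch': "is_chart ?E (mtop M) (V, \<psi>)" by (rule smooth_manifold_is_chart[OF M c'(1)])
    have inj': "inj_on \<psi> V" by (rule chart_inj[OF ch'])
    have op: "openin ?E (\<phi> ` (U \<inter> V \<inter> T))"
      using chart_open_map[OF ch, of "U \<inter> V \<inter> T"] U T chart_openin[OF ch'] by blast
    have op2: "openin ?E (\<phi> ` (U \<inter> V))"
      using chart_open_map[OF ch, of "U \<inter> V"] U chart_openin[OF ch'] by blast
    have "smooth_on (mdim M) (\<phi> ` (U \<inter> V)) (\<lambda>x. \<psi> (inv_into U \<phi> x))"
      using tr(1)[OF c'(1)] by (simp add: smooth_transition_def)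
    then have s: "smooth_open (mdim M) (\<phi> ` (U \<inter> V)) (\<lambda>x. \<psi> (inv_into U \<phi> x) j)" for j
      unfolding smooth_on_open_iff[OF op2] by blast
    have "smooth_open (mdim M) (\<phi> ` (U \<inter> V \<inter> T)) (\<lambda>x. f (inv_into V \<psi> (\<psi> (inv_into U \<phi> x))))"
    proof (rule smooth_open_compose_smooth[where f = "\<lambda>y. f (inv_into V \<psi> y)"])
      show "smooth_open (mdim M) (\<psi> ` (V \<inter> T)) (\<lambda>y. f (inv_into V \<psi> y))"
        using f c' unfolding sfun_def by blast
      show "smooth_open (mdim M) (\<phi> ` (U \<inter> V \<inter> T)) (\<lambda>x. \<psi> (inv_into U \<phi> x) j)" for j
        by (rule smooth_open_subset[OF s op]) auto
      show "\<psi> (inv_into U \<phi> x) \<in> \<psi> ` (V \<inter> T)" if "x \<in> \<phi> ` (U \<inter> V \<inter> T)" for x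
        using that inj by auto
    qed (rule op)
    then show "\<exists>V g. x \<in> V \<and> smooth_open (mdim M) V g \<and> (\<forall>y\<in>\<phi> ` (U \<inter> T) \<inter> V. f (inv_into U \<phi> y) = g y)"
      using p c' inj inj' by (intro exI conjI) (auto simp: inj_on_eq_iff)
  qed
  then show ?R using U inj co by blast
next
  let ?E = "Euclidean_space (mdim M)"
  assume R: ?R
  then have U: "openin (mtop M) U" and inj: "inj_on \<phi> U" and co: "\<And>j. sfun M U (\<lambda>p. \<phi> p j)"
    and sm: "\<And>T f. sfun M T f \<Longrightarrow> smooth_open (mdim M) (\<phi> ` (U \<inter> T)) (\<lambda>x. f (inv_into U \<phi> x))" by blast+
  \<comment> \<open>Applied to constants, the condition on functions says that images of open sets
    are open.\<close>
  have op: "openin ?E (\<phi> ` (U \<inter> T))" if "openin (mtop M) T" for T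
    using smooth_open_imp_openin[OF sm[OF sfun_const[OF M that]]] .
  have oU: "openin ?E (\<phi> ` U)" using op[OF U] by simp
  have tU: "topspace (subtopology (mtop M) U) = U" using openin_subset[OF U] by auto
  have tI: "topspace (subtopology ?E (\<phi> ` U)) = \<phi> ` U" using openin_subset[OF oU] by auto
  have "continuous_map (subtopology (mtop M) U) ?E \<phi>"
    by (rule continuous_map_into_Euclidean_space)
       (use sfun_continuous[OF M co] openin_subset[OF oU] tU in auto)
  then have cont: "continuous_map (subtopology (mtop M) U) (subtopology ?E (\<phi> ` U)) \<phi>"
    using tU by (auto intro: continuous_map_into_subtopology)
  have "open_map (subtopology (mtop M) U) (subtopology ?E (\<phi> ` U)) \<phi>"
    unfolding open_map_def openin_open_subtopology[OF U] openin_open_subtopology[OF oU]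
    using op by (metis image_mono inf.absorb2)
  then have "homeomorphic_map (subtopology (mtop M) U) (subtopology ?E (\<phi> ` U)) \<phi>"
    using cont inj tU tI by (simp add: bijective_open_imp_homeomorphic_map)
  then have ch: "is_chart ?E (mtop M) (U, \<phi>)" using U oU by (simp add: is_chart_def)
  have "smooth_transition (mdim M) (U, \<phi>) (V, \<psi>) \<and> smooth_transition (mdim M) (V, \<psi>) (U, \<phi>)"
    if c': "(V, \<psi>) \<in> matlas M" for V \<psi>
  proof -
    have V: "openin (mtop M) V" by (rule chart_openin[OF smooth_manifold_is_chart[OF M c']])
    show ?thesis
      unfolding smooth_transition_def prod.case smooth_on_open_iff[OF op[OF V]]
        smooth_on_open_iff[OF image_openin_chart[OF M c' U]]
      using sm[OF sfun_chart_coord[OF M c']] sfunD[OF co c'] by auto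
  qed
  then show "(U, \<phi>) \<in> max_atlas M" using ch by (auto simp: max_atlas_def)
qed

lemma matlas_subset_max_atlas: "smooth_manifold M \<Longrightarrow> c \<in> matlas M \<Longrightarrow> c \<in> max_atlas M"
  by (auto simp: max_atlas_def smooth_manifold_charts)

lemma max_atlas_is_chart: "c \<in> max_atlas M \<Longrightarrow> is_chart (Euclidean_space (mdim M)) (mtop M) c"
  by (simp add: max_atlas_def)

lemma sfun_compose_chart:
  assumes M: "smooth_manifold M" and c: "(U, \<phi>) \<in> max_atlas M" and h: "smooth_open (mdim M) S h"
  shows "sfun M {p \<in> U. \<phi> p \<in> S} (\<lambda>p. h (\<phi> p))"
proof (rule sfunI)
  let ?T = "{p \<in> U. \<phi> p \<in> S}"
  show T: "openin (mtop M) ?T"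
    by (rule chart_preimage[OF max_atlas_is_chart[OF c] smooth_open_imp_openin[OF h]])
  fix V \<psi> assume c': "(V, \<psi>) \<in> matlas M"
  have inj: "inj_on \<psi> V" by (rule chart_inj[OF smooth_manifold_is_chart[OF M c']])
  have s: "smooth_open (mdim M) (\<psi> ` (V \<inter> U)) (\<lambda>x. \<phi> (inv_into V \<psi> x) j)" for j
    using c c' unfolding max_atlas_iff[OF M] sfun_def by blast
  show "smooth_open (mdim M) (\<psi> ` (V \<inter> ?T)) (\<lambda>x. h (\<phi> (inv_into V \<psi> x)))"
  proof (rule smooth_open_compose_smooth[OF h image_openin_chart[OF M c' T]])
    show "smooth_open (mdim M) (\<psi> ` (V \<inter> ?T)) (\<lambda>x. \<phi> (inv_into V \<psi> x) j)" for j
      by (rule smooth_open_subset[OF s image_openin_chart[OF M c' T]]) auto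
    show "\<phi> (inv_into V \<psi> x) \<in> S" if "x \<in> \<psi> ` (V \<inter> ?T)" for x using that inj by auto
  qed
qed

text \<open>Smooth maps are encoded as those that pull smooth functions back to smooth functions.
  Composition is then immediate, and openness of the domain and continuity travel along with
  it.\<close>

definition smap :: "'a manifold \<Rightarrow> 'a set \<Rightarrow> 'b manifold \<Rightarrow> ('a \<Rightarrow> 'b) \<Rightarrow> bool" where
  "smap M A N F \<longleftrightarrow> openin (mtop M) A \<and> F ` A \<subseteq> topspace (mtop N) \<and>
     (\<forall>T. openin (mtop N) T \<longrightarrow> openin (mtop M) {p \<in> A. F p \<in> T}) \<and>
     (\<forall>T f. sfun N T f \<longrightarrow> sfun M {p \<in> A. F p \<in> T} (\<lambda>p. f (F p)))"

lemma smapD: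
  assumes "smap M A N F"
  shows smap_openin: "openin (mtop M) A" and smap_in_topspace: "p \<in> A \<Longrightarrow> F p \<in> topspace (mtop N)"
    and smap_preimage: "openin (mtop N) T \<Longrightarrow> openin (mtop M) {p \<in> A. F p \<in> T}"
    and smap_sfun: "sfun N T f \<Longrightarrow> sfun M {p \<in> A. F p \<in> T} (\<lambda>p. f (F p))"
  using assms unfolding smap_def by blast+

lemma smap_continuous:
  assumes "smap M A N F"
  shows "continuous_map (subtopology (mtop M) A) (mtop N) F"
proof -
  have t: "topspace (subtopology (mtop M) A) = A"
    by (rule topspace_subtopology_subset[OF openin_subset[OF smap_openin[OF assms]]])
  show ?thesis
    unfolding continuous_map_def t openin_open_subtopology[OF smap_openin[OF assms]]
    using smap_in_topspace[OF assms] smap_preimage[OF assms] by auto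
qed

lemma smap_compose:
  assumes F: "smap M A N F" and G: "smap N B L G" and AB: "\<And>p. p \<in> A \<Longrightarrow> F p \<in> B"
  shows "smap M A L (\<lambda>p. G (F p))"
proof -
  have "{p \<in> A. F p \<in> {q \<in> B. G q \<in> T}} = {p \<in> A. G (F p) \<in> T}" for T using AB by auto
  then show ?thesis
    unfolding smap_def using smap_openin[OF F] AB smap_in_topspace[OF G]
      smap_preimage[OF F smap_preimage[OF G]] smap_sfun[OF F smap_sfun[OF G]] by auto
qed

lemma smap_id: "smooth_manifold M \<Longrightarrow> openin (mtop M) A \<Longrightarrow> smap M A M (\<lambda>p. p)"
  unfolding smap_def Int_def[symmetric]
  by (auto dest: openin_subset intro: sfun_subset sfun_openin)

lemma smap_local:
  assumes M: "smooth_manifold M" and A: "openin (mtop M) A"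
    and loc: "\<And>p. p \<in> A \<Longrightarrow> \<exists>S G. p \<in> S \<and> smap M S N G \<and> (\<forall>q\<in>A \<inter> S. F q = G q)"
  shows "smap M A N F"
  unfolding smap_def
proof (intro conjI A allI impI)
  show "F ` A \<subseteq> topspace (mtop N)" using loc smap_in_topspace by fastforce
  show op: "openin (mtop M) {p \<in> A. F p \<in> T}" if T: "openin (mtop N) T" for T
  proof (subst openin_subopen, intro ballI)
    fix p assume p: "p \<in> {p \<in> A. F p \<in> T}"
    then obtain S G where S: "p \<in> S" "smap M S N G" "\<forall>q\<in>A \<inter> S. F q = G q" using loc by blast
    then show "\<exists>T'. openin (mtop M) T' \<and> p \<in> T' \<and> T' \<subseteq> {p \<in> A. F p \<in> T}"
      using openin_Int[OF A smap_preimage[OF S(2) T]] p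
      by (intro exI[of _ "A \<inter> {p \<in> S. G p \<in> T}"]) auto
  qed
  fix T f assume f: "sfun N T f"
  show "sfun M {p \<in> A. F p \<in> T} (\<lambda>p. f (F p))"
  proof (rule sfun_local[OF M op[OF sfun_openin[OF f]]])
    fix p assume p: "p \<in> {p \<in> A. F p \<in> T}"
    then obtain S G where S: "p \<in> S" "smap M S N G" "\<forall>q\<in>A \<inter> S. F q = G q" using loc by blast
    then show "\<exists>S g. p \<in> S \<and> sfun M S g \<and> (\<forall>q\<in>{p \<in> A. F p \<in> T} \<inter> S. f (F q) = g q)"
      using smap_sfun[OF S(2) f] p
      by (intro exI[of _ "{p \<in> S. G p \<in> T}"] exI[of _ "\<lambda>p. f (G p)"]) auto
  qed
qed

lemma smap_subset:
  assumes "smooth_manifold M" "smap M A N F" "openin (mtop M) B" "B \<subseteq> A" "\<And>p. p \<in> B \<Longrightarrow> F p = G p"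
  shows "smap M B N G"
  by (rule smap_local[OF assms(1,3)], rule exI[of _ A], rule exI[of _ F])
     (use assms(2,4,5) in auto)

text \<open>The way from coordinates to pullbacks: a pulled back function is the composite of its
  chart expression with the coordinates of \<open>F\<close>, so the chain rule applies. Preimages of
  open sets are open because the coordinate map is continuous and the chart is injective and
  open.\<close>

lemma smap_chartsI:
  assumes M: "smooth_manifold M" and N: "smooth_manifold N" and A: "openin (mtop M) A"
    and loc: "\<And>p. p \<in> A \<Longrightarrow> \<exists>V \<psi> S. (V, \<psi>) \<in> matlas N \<and> p \<in> S \<and> S \<subseteq> A \<and> openin (mtop M) S \<and> F ` S \<subseteq> V \<and>
        (\<forall>j<mdim N. sfun M S (\<lambda>q. \<psi> (F q) j))"
  shows "smap M A N F"
proof (rule smap_local[OF M A])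
  fix p assume p: "p \<in> A"
  let ?E = "Euclidean_space (mdim N)"
  obtain V \<psi> S where c: "(V, \<psi>) \<in> matlas N" and S: "p \<in> S" "S \<subseteq> A" "openin (mtop M) S" "F ` S \<subseteq> V"
    and s: "\<And>j. j < mdim N \<Longrightarrow> sfun M S (\<lambda>q. \<psi> (F q) j)"
    using loc[OF p] by blast
  have ch: "is_chart ?E (mtop N) (V, \<psi>)" by (rule smooth_manifold_is_chart[OF N c])
  have inj: "inj_on \<psi> V" by (rule chart_inj[OF ch])
  have V: "openin (mtop N) V" by (rule chart_openin[OF ch])
  have tS: "topspace (subtopology (mtop M) S) = S" using openin_subset[OF S(3)] by auto
  have cont: "continuous_map (subtopology (mtop M) S) ?E (\<lambda>q. \<psi> (F q))"
  proof (rule continuous_map_into_Euclidean_space)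
    show "continuous_map (subtopology (mtop M) S) euclideanreal (\<lambda>q. \<psi> (F q) j)" if "j < mdim N" for j
      using sfun_continuous[OF M s[OF that]] .
    show "\<psi> (F q) \<in> topspace ?E" if "q \<in> topspace (subtopology (mtop M) S)" for q
      using that tS S(4) openin_subset[OF chart_image[OF ch]] by auto
  qed
  have op: "openin (mtop M) {q \<in> S. F q \<in> T}" if T: "openin (mtop N) T" for T
  proof -
    have "openin ?E (\<psi> ` (V \<inter> T))" by (rule image_openin_chart[OF N c T])
    from openin_continuous_map_preimage[OF cont this]
    have "openin (mtop M) {q \<in> S. \<psi> (F q) \<in> \<psi> ` (V \<inter> T)}"
      unfolding tS openin_open_subtopology[OF S(3)] by blast
    moreover have "{q \<in> S. \<psi> (F q) \<in> \<psi> ` (V \<inter> T)} = {q \<in> S. F q \<in> T}"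
      using S(4) inj by (auto simp: inj_on_eq_iff image_subset_iff)
    ultimately show ?thesis by simp
  qed
  have "smap M S N F"
    unfolding smap_def
  proof (intro conjI S(3) allI impI op)
    show "F ` S \<subseteq> topspace (mtop N)" using S(4) openin_subset[OF V] by blast
    fix T f assume f: "sfun N T f"
    let ?S = "{q \<in> S. F q \<in> T}"
    have opS: "openin (mtop M) ?S" by (rule op[OF sfun_openin[OF f]])
    show "sfun M ?S (\<lambda>p. f (F p))"
    proof (rule sfunI[OF opS])
      fix U \<phi> assume c': "(U, \<phi>) \<in> matlas M"
      have inj': "inj_on \<phi> U" by (rule chart_inj[OF smooth_manifold_is_chart[OF M c']])
      have "smooth_open (mdim M) (\<phi> ` (U \<inter> ?S)) (\<lambda>x. f (inv_into V \<psi> (\<psi> (F (inv_into U \<phi> x)))))"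
      proof (rule smooth_open_compose_smooth[where f = "\<lambda>y. f (inv_into V \<psi> y)" and m = "mdim N"])
        show "smooth_open (mdim N) (\<psi> ` (V \<inter> T)) (\<lambda>y. f (inv_into V \<psi> y))"
          using f c unfolding sfun_def by blast
        show "smooth_open (mdim M) (\<phi> ` (U \<inter> ?S)) (\<lambda>x. \<psi> (F (inv_into U \<phi> x)) j)" if "j < mdim N" for j
          by (rule sfunD[OF sfun_subset[OF M s[OF that] opS] c']) auto
        show "\<psi> (F (inv_into U \<phi> x)) \<in> \<psi> ` (V \<inter> T)" if "x \<in> \<phi> ` (U \<inter> ?S)" for x
          using that inj' S(4) by auto
      qed (rule image_openin_chart[OF M c' opS])
      then show "smooth_open (mdim M) (\<phi> ` (U \<inter> ?S)) (\<lambda>x. f (F (inv_into U \<phi> x)))"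
        by (rule smooth_open_subset[OF _ image_openin_chart[OF M c' opS]])
           (use inj inj' S(4) in \<open>auto simp: image_subset_iff\<close>)
    qed
  qed
  then show "\<exists>S G. p \<in> S \<and> smap M S N G \<and> (\<forall>q\<in>A \<inter> S. F q = G q)" using S(1) by blast
qed

text \<open>Connects the definition by charts, on which the statement of the theorem rests, with
  pullbacks of functions.\<close>

lemma smooth_map_iff_smap:
  assumes M: "smooth_manifold M" and N: "smooth_manifold N"
  shows "smooth_map M N F \<longleftrightarrow> smap M (topspace (mtop M)) N F"
proof
  assume R: "smooth_map M N F"
  then have cont: "continuous_map (mtop M) (mtop N) F" by (simp add: smooth_map_def)
  show "smap M (topspace (mtop M)) N F"
  proof (rule smap_chartsI[OF M N])
    fix p assume p: "p \<in> topspace (mtop M)"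
    then obtain V \<psi> where c: "(V, \<psi>) \<in> matlas N" "F p \<in> V"
      using smooth_manifold_cover[OF N] continuous_map_image_subset_topspace[OF cont] by blast
    define S where "S = {q \<in> topspace (mtop M). F q \<in> V}"
    have S: "openin (mtop M) S"
      unfolding S_def by (rule openin_continuous_map_preimage[OF cont chart_openin[OF smooth_manifold_is_chart[OF N c(1)]]])
    have "sfun M S (\<lambda>q. \<psi> (F q) j)" for j
    proof (rule sfunI[OF S])
      fix U \<phi> assume c': "(U, \<phi>) \<in> matlas M"
      have U: "openin (mtop M) U" by (rule chart_openin[OF smooth_manifold_is_chart[OF M c']])
      have "{p \<in> U. F p \<in> V} = U \<inter> S" using openin_subset[OF U] by (auto simp: S_def)
      moreover have "smooth_on (mdim M) (\<phi> ` {p \<in> U. F p \<in> V}) (\<lambda>x. \<psi> (F (inv_into U \<phi> x)))"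
        using R c' c(1) by (auto simp: smooth_map_def)
      ultimately show "smooth_open (mdim M) (\<phi> ` (U \<inter> S)) (\<lambda>x. \<psi> (F (inv_into U \<phi> x)) j)"
        using smooth_on_open_iff[OF image_openin_chart[OF M c' S]] by auto
    qed
    then show "\<exists>V \<psi> S. (V, \<psi>) \<in> matlas N \<and> p \<in> S \<and> S \<subseteq> topspace (mtop M) \<and> openin (mtop M) S \<and> F ` S \<subseteq> V \<and>
        (\<forall>j<mdim N. sfun M S (\<lambda>q. \<psi> (F q) j))"
      using c S p openin_subset[OF S] by (intro exI[of _ V] exI[of _ \<psi>] exI[of _ S]) (auto simp: S_def)
  qed simp
next
  assume R: "smap M (topspace (mtop M)) N F"
  have "smooth_on (mdim M) (\<phi> ` {p \<in> U. F p \<in> V}) (\<lambda>x. \<psi> (F (inv_into U \<phi> x)))"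
    if c': "(U, \<phi>) \<in> matlas M" and c: "(V, \<psi>) \<in> matlas N" for U \<phi> V \<psi>
  proof -
    define S where "S = {q \<in> topspace (mtop M). F q \<in> V}"
    have s: "sfun M S (\<lambda>q. \<psi> (F q) j)" for j
      unfolding S_def by (rule smap_sfun[OF R sfun_chart_coord[OF N c]])
    have U: "openin (mtop M) U" by (rule chart_openin[OF smooth_manifold_is_chart[OF M c']])
    have eq: "{p \<in> U. F p \<in> V} = U \<inter> S" using openin_subset[OF U] by (auto simp: S_def)
    show ?thesis
      unfolding eq smooth_on_open_iff[OF image_openin_chart[OF M c' sfun_openin[OF s]]]
      using s c' unfolding sfun_def by blast
  qed
  then show "smooth_map M N F"
    unfolding smooth_map_def using smap_continuous[OF R] by auto
qed

section \<open>Products with an interval\<close>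

lemma mdim_times_interval[simp]: "mdim (times_interval B J) = Suc (mdim B)"
  and mtop_times_interval: "mtop (times_interval B J) = prod_topology (mtop B) (subtopology euclideanreal J)"
  and topspace_times_interval[simp]: "topspace (mtop (times_interval B J)) = topspace (mtop B) \<times> J"
  by (simp_all add: times_interval_def)

lemma matlas_times_interval:
  "(U, \<phi>) \<in> matlas B \<Longrightarrow> (U \<times> J, \<lambda>(x, t). (\<phi> x)(mdim B := t)) \<in> matlas (times_interval B J)"
  by (force simp: times_interval_def)

lemma matlas_times_intervalE:
  assumes "c \<in> matlas (times_interval B J)"
  obtains U \<phi> where "(U, \<phi>) \<in> matlas B" "c = (U \<times> J, \<lambda>(x, t). (\<phi> x)(mdim B := t))"
  using assms by (force simp: times_interval_def)

text \<open>Points of Euclidean \<open>n\<close>-space have coordinate \<open>n\<close> equal to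
  \<open>0\<close>. This slot can therefore hold the interval coordinate, and resetting it to
  \<open>0\<close> recovers the value of the base chart.\<close>

lemma product_chart:
  assumes ch: "is_chart (Euclidean_space n) X (U, \<phi>)" and J: "open J"
  defines "\<psi> \<equiv> \<lambda>(x, t). (\<phi> x)(n := t)"
  shows product_chart_is_chart: "is_chart (Euclidean_space (Suc n)) (prod_topology X (subtopology euclideanreal J)) (U \<times> J, \<psi>)"
    and product_chart_inv: "\<And>x t. x \<in> U \<Longrightarrow> t \<in> J \<Longrightarrow> inv_into (U \<times> J) \<psi> ((\<phi> x)(n := t)) = (x, t)"
    and product_chart_zero: "\<And>x t. x \<in> U \<Longrightarrow> ((\<phi> x)(n := t))(n := 0) = \<phi> x"
proof -
  let ?E = "Euclidean_space n" and ?E' = "Euclidean_space (Suc n)"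
  let ?P = "prod_topology X (subtopology euclideanreal J)"
  have U: "openin X U" and inj: "inj_on \<phi> U" by (rule chart_openin[OF ch] chart_inj[OF ch])+
  have tE: "\<phi> x j = 0" if "x \<in> U" "j \<ge> n" for x j
    using openin_subset[OF chart_image[OF ch]] that by (auto simp: topspace_Euclidean_space image_subset_iff)
  show z: "((\<phi> x)(n := t))(n := 0) = \<phi> x" if "x \<in> U" for x t
    using tE[OF that, of n] by (simp add: fun_upd_idem)
  have inj\<psi>: "inj_on \<psi> (U \<times> J)"
  proof (rule inj_onI, clarify)
    fix x t y u assume a: "x \<in> U" "t \<in> J" "y \<in> U" "u \<in> J" "\<psi> (x, t) = \<psi> (y, u)"
    then have e: "(\<phi> x)(n := t) = (\<phi> y)(n := u)" by (simp add: \<psi>_def)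
    have "\<phi> x = \<phi> y" using arg_cong[OF e, of "\<lambda>z. z(n := 0)"] z a by simp
    moreover have "t = u" using fun_cong[OF e, of n] by simp
    ultimately show "x = y \<and> t = u" using inj a by (auto simp: inj_on_eq_iff)
  qed
  show inv: "inv_into (U \<times> J) \<psi> ((\<phi> x)(n := t)) = (x, t)" if "x \<in> U" "t \<in> J" for x t
    using inv_into_f_f[OF inj\<psi>, of "(x, t)"] that by (simp add: \<psi>_def)
  have UJ: "openin ?P (U \<times> J)"
    using U J openin_subset[OF U] by (simp add: openin_prod_Times_iff openin_open_subtopology)
  have im: "\<psi> ` (U \<times> J) = {w. (\<forall>j\<ge>Suc n. w j = 0) \<and> w(n := 0) \<in> \<phi> ` U \<and> w n \<in> J}"
  proof (intro equalityI subsetI)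
    fix w assume "w \<in> \<psi> ` (U \<times> J)"
    then obtain x t where xt: "x \<in> U" "t \<in> J" "w = (\<phi> x)(n := t)" by (auto simp: \<psi>_def)
    show "w \<in> {w. (\<forall>j\<ge>Suc n. w j = 0) \<and> w(n := 0) \<in> \<phi> ` U \<and> w n \<in> J}"
      using xt z[of x t] tE[of x] by auto
  next
    fix w assume "w \<in> {w. (\<forall>j\<ge>Suc n. w j = 0) \<and> w(n := 0) \<in> \<phi> ` U \<and> w n \<in> J}"
    then obtain x where x: "x \<in> U" "w(n := 0) = \<phi> x" "w n \<in> J" by auto
    have "w = (w(n := 0))(n := w n)" by simp
    then have "w = \<psi> (x, w n)" using x(2) by (simp add: \<psi>_def)
    then show "w \<in> \<psi> ` (U \<times> J)" using x by blast
  qed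
  have cz: "continuous_map ?E' ?E (\<lambda>w. w(n := 0))"
  proof (rule continuous_map_into_Euclidean_space)
    show "continuous_map ?E' euclideanreal (\<lambda>w. (w(n := 0)) j)" if "j < n" for j
      using smooth_open_imp_continuous[OF smooth_open_coord[OF openin_topspace, of "Suc n" j]] that
      by (simp add: subtopology_topspace)
  qed (auto simp: topspace_Euclidean_space)
  have cn: "continuous_map ?E' euclideanreal (\<lambda>w. w n)"
    using smooth_open_imp_continuous[OF smooth_open_coord[OF openin_topspace, of "Suc n" n]]
    by (simp add: subtopology_topspace)
  have oim: "openin ?E' (\<psi> ` (U \<times> J))"
  proof -
    have "openin ?E' ({w \<in> topspace ?E'. w(n := 0) \<in> \<phi> ` U} \<inter> {w \<in> topspace ?E'. w n \<in> J})"
      using openin_continuous_map_preimage[OF cz chart_image[OF ch]]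
        openin_continuous_map_preimage[OF cn] J by (intro openin_Int) auto
    moreover have "{w \<in> topspace ?E'. w(n := 0) \<in> \<phi> ` U} \<inter> {w \<in> topspace ?E'. w n \<in> J} = \<psi> ` (U \<times> J)"
      unfolding im topspace_Euclidean_space by blast
    ultimately show ?thesis by simp
  qed
  have tU: "topspace (subtopology ?P (U \<times> J)) = U \<times> J" using openin_subset[OF UJ] by auto
  have tI: "topspace (subtopology ?E' (\<psi> ` (U \<times> J))) = \<psi> ` (U \<times> J)" using openin_subset[OF oim] by auto
  have cf: "continuous_map (subtopology ?P (U \<times> J)) (subtopology X U) fst"
    by (rule continuous_map_into_subtopology)
       (auto intro: continuous_map_from_subtopology continuous_map_fst)
  have cs: "continuous_map (subtopology ?P (U \<times> J)) euclideanreal snd"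
    using continuous_map_into_fulltopology[OF continuous_map_snd[of X "subtopology euclideanreal J"]]
    by (rule continuous_map_from_subtopology)
  have c\<phi>: "continuous_map (subtopology X U) ?E \<phi>"
    using chart_continuous[OF ch] continuous_map_into_fulltopology by blast
  have "continuous_map (subtopology X U) euclideanreal (\<lambda>x. \<phi> x j)" for j
    using continuous_map_compose[OF c\<phi>, of euclideanreal "\<lambda>w. w j"]
      smooth_open_imp_continuous[OF smooth_open_coord[OF openin_topspace, of n j]]
    by (simp add: subtopology_topspace comp_def)
  then have c1: "continuous_map (subtopology ?P (U \<times> J)) euclideanreal (\<lambda>p. \<phi> (fst p) j)" for j
    using continuous_map_compose[OF cf] by (fastforce simp: comp_def)
  have "continuous_map (subtopology ?P (U \<times> J)) ?E' \<psi>"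
  proof (rule continuous_map_into_Euclidean_space)
    show "continuous_map (subtopology ?P (U \<times> J)) euclideanreal (\<lambda>p. \<psi> p j)" for j
      using c1[of j] cs by (cases "j = n") (auto simp: \<psi>_def case_prod_beta)
  qed (use tU oim openin_subset in blast)
  then have c: "continuous_map (subtopology ?P (U \<times> J)) (subtopology ?E' (\<psi> ` (U \<times> J))) \<psi>"
    using tU by (auto intro: continuous_map_into_subtopology)
  note ic\<phi> = chart_inv_continuous[OF ch]
  have "continuous_map (subtopology ?E' (\<psi> ` (U \<times> J))) (subtopology ?E (\<phi> ` U)) (\<lambda>w. w(n := 0))"
    by (rule continuous_map_into_subtopology)
       (auto intro: continuous_map_from_subtopology cz simp: im)
  then have i1: "continuous_map (subtopology ?E' (\<psi> ` (U \<times> J))) X (\<lambda>w. inv_into U \<phi> (w(n := 0)))"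
    using continuous_map_compose[OF _ ic\<phi>] by (fastforce simp: comp_def)
  have i2: "continuous_map (subtopology ?E' (\<psi> ` (U \<times> J))) (subtopology euclideanreal J) (\<lambda>w. w n)"
    by (rule continuous_map_into_subtopology)
       (auto intro: continuous_map_from_subtopology cn simp: im)
  have "continuous_map (subtopology ?E' (\<psi> ` (U \<times> J))) ?P (\<lambda>w. (inv_into U \<phi> (w(n := 0)), w n))"
    using i1 i2 by (simp add: continuous_map_pairwise comp_def)
  then have c': "continuous_map (subtopology ?E' (\<psi> ` (U \<times> J))) (subtopology ?P (U \<times> J))
      (\<lambda>w. (inv_into U \<phi> (w(n := 0)), w n))"
    by (rule continuous_map_into_subtopology) (use inj in \<open>auto simp: im\<close>)
  have "homeomorphic_maps (subtopology ?P (U \<times> J)) (subtopology ?E' (\<psi> ` (U \<times> J))) \<psi>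
      (\<lambda>w. (inv_into U \<phi> (w(n := 0)), w n))"
    unfolding homeomorphic_maps_def tU tI using c c' z inj by (auto simp: \<psi>_def)
  then show "is_chart ?E' ?P (U \<times> J, \<psi>)"
    using UJ oim unfolding is_chart_def by (auto intro: homeomorphic_maps_imp_map)
qed

lemma smooth_manifold_times_interval:
  assumes B: "smooth_manifold B" and J: "open J"
  shows "smooth_manifold (times_interval B J)"
  unfolding smooth_manifold_def
proof (intro conjI ballI)
  let ?n = "mdim B"
  show "Hausdorff_space (mtop (times_interval B J))"
    unfolding mtop_times_interval Hausdorff_space_prod_topology
    using smooth_manifold_Hausdorff[OF B] by (simp add: Hausdorff_space_subtopology)
  show "is_chart (Euclidean_space (mdim (times_interval B J))) (mtop (times_interval B J)) c"
    if "c \<in> matlas (times_interval B J)" for c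
    using that by (rule matlas_times_intervalE)
      (use product_chart_is_chart[OF smooth_manifold_is_chart[OF B] J] in \<open>simp add: mtop_times_interval\<close>)
  have "(\<Union>(U, \<phi>)\<in>matlas B. U) = topspace (mtop B)" using B by (simp add: smooth_manifold_def)
  then show "(\<Union>(U, \<phi>)\<in>matlas (times_interval B J). U) = topspace (mtop (times_interval B J))"
    by (auto simp: times_interval_def)
  fix c c' assume "c \<in> matlas (times_interval B J)" "c' \<in> matlas (times_interval B J)"
  then obtain U \<phi> V \<psi> where c: "(U, \<phi>) \<in> matlas B" "c = (U \<times> J, \<lambda>(x, t). (\<phi> x)(?n := t))"
    and c': "(V, \<psi>) \<in> matlas B" "c' = (V \<times> J, \<lambda>(x, t). (\<psi> x)(?n := t))"
    by (metis matlas_times_intervalE)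
  define \<Phi> where "\<Phi> = (\<lambda>(x, t). (\<phi> x)(?n := t))"
  note ch = smooth_manifold_is_chart[OF B c(1)]
  note chP = product_chart_is_chart[OF ch J, folded \<Phi>_def] and invP = product_chart_inv[OF ch J, folded \<Phi>_def]
  note zP = product_chart_zero[OF ch J]
  have V: "openin (mtop B) V" by (rule chart_openin[OF smooth_manifold_is_chart[OF B c'(1)]])
  have U: "openin (mtop B) U" by (rule chart_openin[OF ch])
  have inj: "inj_on \<phi> U" by (rule chart_inj[OF ch])
  have op: "openin (Euclidean_space (Suc ?n)) (\<Phi> ` ((U \<times> J) \<inter> (V \<times> J)))"
    by (rule chart_open_map[OF chP])
       (use U V J openin_subset in \<open>auto simp: Times_Int_Times openin_prod_Times_iff openin_open_subtopology\<close>)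
  have mem: "x \<in> \<Phi> ` ((U \<times> J) \<inter> (V \<times> J)) \<Longrightarrow> x(?n := 0) \<in> \<phi> ` (U \<inter> V)" for x
    using zP unfolding \<Phi>_def by (fastforce intro: image_eqI)
  have "smooth_open (Suc ?n) (\<Phi> ` ((U \<times> J) \<inter> (V \<times> J)))
      (\<lambda>w. ((\<lambda>(x, t). (\<psi> x)(?n := t)) (inv_into (U \<times> J) \<Phi> w)) j)" for j
  proof (cases "j = ?n")
    case True
    show ?thesis
      by (rule smooth_open_subset[OF smooth_open_coord[OF op, of j] op])
         (use True invP in \<open>auto simp: \<Phi>_def\<close>)
  next
    case False
    have tr: "smooth_open ?n (\<phi> ` (U \<inter> V)) (\<lambda>x. \<psi> (inv_into U \<phi> x) j)"
      using smooth_manifold_transition[OF B c(1) c'(1)]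
        smooth_on_open_iff[OF image_openin_chart[OF B c(1) V]] by (simp add: smooth_transition_def)
    have "smooth_open (Suc ?n) (\<Phi> ` ((U \<times> J) \<inter> (V \<times> J))) (\<lambda>w. \<psi> (inv_into U \<phi> (w(?n := 0))) j)"
      by (rule smooth_open_compose_smooth[OF tr op]) (use mem smooth_open_coord[OF op] in auto)
    then show ?thesis
      by (rule smooth_open_subset[OF _ op]) (use False invP zP inj in \<open>auto simp: \<Phi>_def\<close>)
  qed
  then show "smooth_transition (mdim (times_interval B J)) c c'"
    unfolding smooth_transition_def c(2) c'(2) prod.case \<Phi>_def[symmetric] mdim_times_interval smooth_on_open_iff[OF op]
    by blast
qed

lemma openin_times_interval:
  "openin (mtop B) T \<Longrightarrow> openin (mtop (times_interval B J)) (T \<times> J)"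
  using openin_subset unfolding mtop_times_interval openin_prod_Times_iff
  by (metis inf_top_left openin_topspace topspace_euclidean topspace_subtopology)

lemma sfun_times_interval:
  assumes B: "smooth_manifold B" and J: "open J"
  shows sfun_snd: "sfun (times_interval B J) (topspace (mtop B) \<times> J) snd"
    and sfun_fst: "sfun B T f \<Longrightarrow> sfun (times_interval B J) (T \<times> J) (\<lambda>p. f (fst p))"
proof -
  let ?n = "mdim B" and ?W = "times_interval B J"
  have W: "smooth_manifold ?W" by (rule smooth_manifold_times_interval[OF B J])
  show "sfun ?W (topspace (mtop B) \<times> J) snd"
  proof (rule sfunI)
    show tp: "openin (mtop ?W) (topspace (mtop B) \<times> J)" by (intro openin_times_interval openin_topspace)
    fix U \<Phi> assume c: "(U, \<Phi>) \<in> matlas ?W"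
    then obtain V \<phi> where c': "(V, \<phi>) \<in> matlas B" "U = V \<times> J" "\<Phi> = (\<lambda>(x, t). (\<phi> x)(?n := t))"
      by (rule matlas_times_intervalE) auto
    note inv = product_chart_inv[OF smooth_manifold_is_chart[OF B c'(1)] J, folded c'(3)]
    note op = image_openin_chart[OF W c tp]
    show "smooth_open (mdim ?W) (\<Phi> ` (U \<inter> topspace (mtop B) \<times> J)) (\<lambda>x. snd (inv_into U \<Phi> x))"
      by (rule smooth_open_subset[OF smooth_open_coord[OF op, of ?n] op])
         (use inv in \<open>auto simp: c'(2) c'(3)\<close>)
  qed
  show "sfun ?W (T \<times> J) (\<lambda>p. f (fst p))" if f: "sfun B T f"
  proof (rule sfunI)
    show tp: "openin (mtop ?W) (T \<times> J)" by (intro openin_times_interval sfun_openin[OF f])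
    fix U \<Phi> assume c: "(U, \<Phi>) \<in> matlas ?W"
    then obtain V \<phi> where c': "(V, \<phi>) \<in> matlas B" "U = V \<times> J" "\<Phi> = (\<lambda>(x, t). (\<phi> x)(?n := t))"
      by (rule matlas_times_intervalE) auto
    note ch = smooth_manifold_is_chart[OF B c'(1)]
    note inv = product_chart_inv[OF ch J, folded c'(3)] and z = product_chart_zero[OF ch J]
    note op = image_openin_chart[OF W c tp]
    have fs: "smooth_open ?n (\<phi> ` (V \<inter> T)) (\<lambda>x. f (inv_into V \<phi> x))" using f c'(1) unfolding sfun_def by blast
    have "smooth_open (mdim ?W) (\<Phi> ` (U \<inter> T \<times> J)) (\<lambda>w. f (inv_into V \<phi> (w(?n := 0))))"
      by (rule smooth_open_compose_smooth[OF fs op])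
         (use smooth_open_coord[OF op] z in \<open>auto simp: c'(2) c'(3)\<close>)
    then show "smooth_open (mdim ?W) (\<Phi> ` (U \<inter> T \<times> J)) (\<lambda>x. f (fst (inv_into U \<Phi> x)))"
      by (rule smooth_open_subset[OF _ op])
         (use inv z chart_inj[OF ch] in \<open>auto simp: c'(2) c'(3)\<close>)
  qed
qed

lemma smap_fst:
  assumes "smooth_manifold B" "open J"
  shows "smap (times_interval B J) (topspace (mtop B) \<times> J) B fst"
proof -
  have eq: "{p \<in> topspace (mtop B) \<times> J. fst p \<in> T} = T \<times> J" if "openin (mtop B) T" for T
    using openin_subset[OF that] by auto
  show ?thesis
    unfolding smap_def
  proof (intro conjI allI impI)
    show "openin (mtop (times_interval B J)) (topspace (mtop B) \<times> J)"
      by (intro openin_times_interval openin_topspace)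
    show "openin (mtop (times_interval B J)) {p \<in> topspace (mtop B) \<times> J. fst p \<in> T}"
      if "openin (mtop B) T" for T
      unfolding eq[OF that] by (rule openin_times_interval[OF that])
    show "sfun (times_interval B J) {p \<in> topspace (mtop B) \<times> J. fst p \<in> T} (\<lambda>p. f (fst p))"
      if "sfun B T f" for T f
      unfolding eq[OF sfun_openin[OF that]] by (rule sfun_fst[OF assms that])
  qed auto
qed

lemma smap_Pair:
  assumes M: "smooth_manifold M" and B: "smooth_manifold B" and J: "open J"
    and F: "smap M A B F" and g: "sfun M A g" and gJ: "\<And>p. p \<in> A \<Longrightarrow> g p \<in> J"
  shows "smap M A (times_interval B J) (\<lambda>p. (F p, g p))"
proof (rule smap_chartsI[OF M smooth_manifold_times_interval[OF B J] smap_openin[OF F]])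
  fix p assume p: "p \<in> A"
  then obtain V \<psi> where c: "(V, \<psi>) \<in> matlas B" "F p \<in> V"
    using smooth_manifold_cover[OF B smap_in_topspace[OF F]] by blast
  have V: "openin (mtop B) V" by (rule chart_openin[OF smooth_manifold_is_chart[OF B c(1)]])
  define S where "S = {q \<in> A. F q \<in> V}"
  have s: "sfun M S (\<lambda>q. \<psi> (F q) j)" for j
    unfolding S_def by (rule smap_sfun[OF F sfun_chart_coord[OF B c(1)]])
  have sg: "sfun M S g" by (rule sfun_subset[OF M g sfun_openin[OF s]]) (auto simp: S_def)
  have "sfun M S (\<lambda>q. ((\<psi> (F q))(mdim B := g q)) j)" for j
    using s[of j] sg by (cases "j = mdim B") auto
  then show "\<exists>V \<psi> S. (V, \<psi>) \<in> matlas (times_interval B J) \<and> p \<in> S \<and> S \<subseteq> A \<and> openin (mtop M) S \<and>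
      (\<lambda>p. (F p, g p)) ` S \<subseteq> V \<and> (\<forall>j<mdim (times_interval B J). sfun M S (\<lambda>q. \<psi> (F q, g q) j))"
    using matlas_times_interval[OF c(1), of J] p c(2) gJ sfun_openin[OF sg]
    by (intro exI[of _ "V \<times> J"] exI[of _ "\<lambda>(x, t). (\<psi> x)(mdim B := t)"] exI[of _ S]) (auto simp: S_def)
qed

section \<open>Local diffeomorphisms\<close>

text \<open>The last conjunct contains that the image of \<open>A\<close> is open. The dimensions
  are compared explicitly so that charts of the target can serve as charts of the source.\<close>

definition diffeo_on :: "'a manifold \<Rightarrow> 'a set \<Rightarrow> 'b manifold \<Rightarrow> ('a \<Rightarrow> 'b) \<Rightarrow> bool" where
  "diffeo_on M A N F \<longleftrightarrow> mdim M = mdim N \<and> smap M A N F \<and> inj_on F A \<and> smap N (F ` A) M (inv_into A F)"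

definition local_diffeo :: "'a manifold \<Rightarrow> 'a set \<Rightarrow> 'b manifold \<Rightarrow> ('a \<Rightarrow> 'b) \<Rightarrow> bool" where
  "local_diffeo M A N F \<longleftrightarrow> openin (mtop M) A \<and> (\<forall>p\<in>A. \<exists>S. p \<in> S \<and> S \<subseteq> A \<and> diffeo_on M S N F)"

lemma diffeo_onD:
  assumes "diffeo_on M A N F"
  shows diffeo_on_mdim: "mdim M = mdim N" and diffeo_on_smap: "smap M A N F"
    and diffeo_on_inj: "inj_on F A" and diffeo_on_inv: "smap N (F ` A) M (inv_into A F)"
    and diffeo_on_openin: "openin (mtop M) A" and diffeo_on_image: "openin (mtop N) (F ` A)"
  using assms smap_openin unfolding diffeo_on_def by blast+

lemma diffeo_on_subset:
  assumes M: "smooth_manifold M" and N: "smooth_manifold N" and F: "diffeo_on M A N F"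
    and B: "openin (mtop M) B" "B \<subseteq> A" and FG: "\<And>p. p \<in> B \<Longrightarrow> F p = G p"
  shows "diffeo_on M B N G"
proof -
  note inj = diffeo_on_inj[OF F]
  have im: "G ` B = {q \<in> F ` A. inv_into A F q \<in> B}"
  proof (intro equalityI subsetI)
    fix q assume "q \<in> G ` B"
    then obtain p where p: "p \<in> B" "q = F p" using FG by auto
    then show "q \<in> {q \<in> F ` A. inv_into A F q \<in> B}" using B(2) inv_into_f_f[OF inj, of p] by auto
  next
    fix q assume "q \<in> {q \<in> F ` A. inv_into A F q \<in> B}"
    then show "q \<in> G ` B" using FG f_inv_into_f[of q F A] by (metis (mono_tags, lifting) imageI mem_Collect_eq)
  qed
  have op: "openin (mtop N) (G ` B)"
    unfolding im by (rule smap_preimage[OF diffeo_on_inv[OF F] B(1)])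
  have injG: "inj_on G B" using inj_on_subset[OF inj B(2)] FG by (simp add: inj_on_def)
  have "smap N (G ` B) M (inv_into B G)"
  proof (rule smap_subset[OF N diffeo_on_inv[OF F] op])
    show "G ` B \<subseteq> F ` A" using im by blast
    show "inv_into A F q = inv_into B G q" if q: "q \<in> G ` B" for q
    proof -
      obtain p where p: "p \<in> B" "q = G p" using q by blast
      then have "inv_into A F q = p" using inv_into_f_f[OF inj, of p] B(2) FG by auto
      then show ?thesis using p inv_into_f_f[OF injG p(1)] by simp
    qed
  qed
  then show ?thesis
    unfolding diffeo_on_def
    using diffeo_on_mdim[OF F] injG smap_subset[OF M diffeo_on_smap[OF F] B FG] by blast
qed

lemma diffeo_on_imp_local_diffeo: "diffeo_on M A N F \<Longrightarrow> local_diffeo M A N F"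
  unfolding local_diffeo_def using diffeo_on_openin by blast

lemma diffeo_on_compose:
  assumes M: "smooth_manifold M" and N: "smooth_manifold N" and L: "smooth_manifold L"
    and F: "diffeo_on M A N F" and G: "diffeo_on N B L G" and AB: "F ` A \<subseteq> B"
  shows "diffeo_on M A L (\<lambda>p. G (F p))"
proof -
  have G': "diffeo_on N (F ` A) L G"
    by (rule diffeo_on_subset[OF N L G diffeo_on_image[OF F] AB]) simp
  note injF = diffeo_on_inj[OF F] and injG = diffeo_on_inj[OF G']
  have inj: "inj_on (\<lambda>p. G (F p)) A" using comp_inj_on[OF injF injG] by (simp add: comp_def)
  have im: "(\<lambda>p. G (F p)) ` A = G ` (F ` A)" by blast
  have "smap L (G ` F ` A) M (\<lambda>q. inv_into A F (inv_into (F ` A) G q))"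
    by (rule smap_compose[OF diffeo_on_inv[OF G'] diffeo_on_inv[OF F]]) (rule inv_into_into)
  then have "smap L ((\<lambda>p. G (F p)) ` A) M (inv_into A (\<lambda>p. G (F p)))"
    unfolding im
  proof (rule smap_subset[OF L])
    show "inv_into A F (inv_into (F ` A) G q) = inv_into A (\<lambda>p. G (F p)) q" if "q \<in> G ` F ` A" for q
    proof -
      obtain p where p: "p \<in> A" "q = G (F p)" using \<open>q \<in> _\<close> by blast
      then show ?thesis
        using inv_into_f_f[OF inj p(1)] inv_into_f_f[OF injG, of "F p"] inv_into_f_f[OF injF p(1)] by auto
    qed
  qed (use diffeo_on_image[OF G'] in auto)
  moreover have "smap M A L (\<lambda>p. G (F p))"
    by (rule smap_compose[OF diffeo_on_smap[OF F] diffeo_on_smap[OF G']]) blast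
  ultimately show ?thesis
    unfolding diffeo_on_def using diffeo_on_mdim[OF F] diffeo_on_mdim[OF G'] inj by simp
qed

lemma local_diffeo_openin: "local_diffeo M A N F \<Longrightarrow> openin (mtop M) A"
  by (simp add: local_diffeo_def)

lemma local_diffeo_smap:
  assumes M: "smooth_manifold M" and F: "local_diffeo M A N F"
  shows "smap M A N F"
proof (rule smap_local[OF M local_diffeo_openin[OF F]])
  fix p assume "p \<in> A"
  then obtain S where "p \<in> S" "diffeo_on M S N F" using F unfolding local_diffeo_def by blast
  then show "\<exists>S G. p \<in> S \<and> smap M S N G \<and> (\<forall>q\<in>A \<inter> S. F q = G q)"
    using diffeo_on_smap by blast
qed

lemma local_diffeo_local:
  assumes M: "smooth_manifold M" and N: "smooth_manifold N" and A: "openin (mtop M) A"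
    and loc: "\<And>p. p \<in> A \<Longrightarrow> \<exists>S G. p \<in> S \<and> local_diffeo M S N G \<and> (\<forall>q\<in>A \<inter> S. F q = G q)"
  shows "local_diffeo M A N F"
  unfolding local_diffeo_def
proof (intro conjI A ballI)
  fix p assume p: "p \<in> A"
  then obtain S G where S: "p \<in> S" "local_diffeo M S N G" "\<forall>q\<in>A \<inter> S. F q = G q" using loc by blast
  then obtain T where T: "p \<in> T" "T \<subseteq> S" "diffeo_on M T N G" unfolding local_diffeo_def by blast
  have "diffeo_on M (A \<inter> T) N F"
  proof (rule diffeo_on_subset[OF M N T(3)])
    show "openin (mtop M) (A \<inter> T)" using A diffeo_on_openin[OF T(3)] by blast
    show "G q = F q" if "q \<in> A \<inter> T" for q
    proof -
      have "q \<in> A \<inter> S" using that T(2) by blast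
      then show ?thesis using S(3) by simp
    qed
  qed simp
  then have "p \<in> A \<inter> T \<and> A \<inter> T \<subseteq> A \<and> diffeo_on M (A \<inter> T) N F" using p T(1) by simp
  then show "\<exists>S. p \<in> S \<and> S \<subseteq> A \<and> diffeo_on M S N F" by (rule exI[of _ "A \<inter> T"])
qed

lemma local_diffeo_subset:
  assumes M: "smooth_manifold M" and N: "smooth_manifold N" and F: "local_diffeo M A N F"
    and B: "openin (mtop M) B" "B \<subseteq> A" and FG: "\<And>p. p \<in> B \<Longrightarrow> F p = G p"
  shows "local_diffeo M B N G"
proof (rule local_diffeo_local[OF M N B(1)])
  fix p assume "p \<in> B"
  then have "p \<in> A \<and> local_diffeo M A N F \<and> (\<forall>q\<in>B \<inter> A. G q = F q)"
    using F B(2) FG[symmetric] by blast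
  then show "\<exists>S F. p \<in> S \<and> local_diffeo M S N F \<and> (\<forall>q\<in>B \<inter> S. G q = F q)" by blast
qed

lemma local_diffeo_compose:
  assumes M: "smooth_manifold M" and N: "smooth_manifold N" and L: "smooth_manifold L"
    and F: "local_diffeo M A N F" and G: "local_diffeo N B L G" and AB: "\<And>p. p \<in> A \<Longrightarrow> F p \<in> B"
  shows "local_diffeo M A L (\<lambda>p. G (F p))"
  unfolding local_diffeo_def
proof (intro conjI local_diffeo_openin[OF F] ballI)
  fix p assume p: "p \<in> A"
  obtain S where S: "p \<in> S" "S \<subseteq> A" "diffeo_on M S N F" using F p unfolding local_diffeo_def by blast
  obtain T where T: "F p \<in> T" "T \<subseteq> B" "diffeo_on N T L G" using G AB[OF p] unfolding local_diffeo_def by blast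
  define S' where "S' = {q \<in> S. F q \<in> T}"
  have "openin (mtop M) S'"
    unfolding S'_def by (rule smap_preimage[OF diffeo_on_smap[OF S(3)] diffeo_on_openin[OF T(3)]])
  then have "diffeo_on M S' N F"
    by (rule diffeo_on_subset[OF M N S(3)]) (auto simp: S'_def)
  then have "diffeo_on M S' L (\<lambda>p. G (F p))"
    by (rule diffeo_on_compose[OF M N L _ T(3)]) (auto simp: S'_def)
  then show "\<exists>S. p \<in> S \<and> S \<subseteq> A \<and> diffeo_on M S L (\<lambda>p. G (F p))"
    using S T(1) by (intro exI[of _ S']) (auto simp: S'_def)
qed

text \<open>Injectivity on all of \<open>A\<close> makes the global inverse agree, near each point
  of the image, with the inverse of a local piece.\<close>

lemma local_diffeo_inj_imp_diffeo_on:
  assumes M: "smooth_manifold M" and N: "smooth_manifold N"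
    and F: "local_diffeo M A N F" and inj: "inj_on F A" and d: "mdim M = mdim N"
  shows "diffeo_on M A N F"
proof -
  have loc: "\<exists>S. q \<in> F ` S \<and> S \<subseteq> A \<and> diffeo_on M S N F" if "q \<in> F ` A" for q
    using that F unfolding local_diffeo_def by blast
  have op: "openin (mtop N) (F ` A)"
  proof (subst openin_subopen, intro ballI)
    fix q assume "q \<in> F ` A"
    then show "\<exists>T. openin (mtop N) T \<and> q \<in> T \<and> T \<subseteq> F ` A"
      using loc diffeo_on_image by (metis image_mono)
  qed
  have "smap N (F ` A) M (inv_into A F)"
  proof (rule smap_local[OF N op])
    fix q assume "q \<in> F ` A"
    then obtain S where S: "q \<in> F ` S" "S \<subseteq> A" "diffeo_on M S N F" using loc by blast
    have "inv_into A F r = inv_into S F r" if "r \<in> F ` S" for r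
    proof -
      obtain p where "p \<in> S" "r = F p" using \<open>r \<in> F ` S\<close> by blast
      then show ?thesis using inv_into_f_f[OF inj, of p] inv_into_f_f[OF diffeo_on_inj[OF S(3)], of p] S(2) by auto
    qed
    then show "\<exists>T G. q \<in> T \<and> smap N T M G \<and> (\<forall>r\<in>F ` A \<inter> T. inv_into A F r = G r)"
      using S(1) diffeo_on_inv[OF S(3)] by blast
  qed
  then show ?thesis
    unfolding diffeo_on_def using inj d local_diffeo_smap[OF M F] by blast
qed

text \<open>In a product chart the fibre coordinate is the last one, so that the fibre derivative is
  a partial derivative.\<close>

lemma sfun_vertical_deriv:
  assumes Y: "smooth_manifold Y" and b: "sfun (times_interval Y UNIV) A b"
  shows has_vertical_deriv: "(y, s) \<in> A \<Longrightarrow>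
      ((\<lambda>s. b (y, s)) has_real_derivative deriv (\<lambda>s. b (y, s)) s) (at s)"
    and sfun_deriv: "sfun (times_interval Y UNIV) A (\<lambda>(y, s). deriv (\<lambda>s. b (y, s)) s)"
proof -
  let ?n = "mdim Y" and ?W = "times_interval Y UNIV"
  have W: "smooth_manifold ?W" by (rule smooth_manifold_times_interval[OF Y open_UNIV])
  have A: "openin (mtop ?W) A" using b by (rule sfun_openin)
  have key: "((\<lambda>s. b (y, s)) has_real_derivative partial_deriv ?n (\<lambda>x. b (inv_into (U \<times> UNIV) \<Phi> x)) (\<Phi> (y, s))) (at s)"
    if c: "(U, \<phi>) \<in> matlas Y" and y: "y \<in> U" "(y, s) \<in> A" and \<Phi>: "\<Phi> = (\<lambda>(x, t). (\<phi> x)(?n := t))" for U \<phi> y s \<Phi>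
  proof -
    note inv = product_chart_inv[OF smooth_manifold_is_chart[OF Y c] open_UNIV, folded \<Phi>]
    have so: "smooth_open (Suc ?n) (\<Phi> ` (U \<times> UNIV \<inter> A)) (\<lambda>x. b (inv_into (U \<times> UNIV) \<Phi> x))"
      using sfunD[OF b matlas_times_interval[OF c, of UNIV, folded \<Phi>]] by simp
    have "\<Phi> (y, s) \<in> \<Phi> ` (U \<times> UNIV \<inter> A)" using y by blast
    from smooth_open_has_partial[OF so _ this, of ?n]
    show ?thesis using inv[OF y(1)] by (simp add: \<Phi>)
  qed
  show "((\<lambda>s. b (y, s)) has_real_derivative deriv (\<lambda>s. b (y, s)) s) (at s)" if ys: "(y, s) \<in> A" for y s
  proof -
    have "y \<in> topspace (mtop Y)" using openin_subset[OF A] ys by auto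
    then obtain U \<phi> where c: "(U, \<phi>) \<in> matlas Y" "y \<in> U" using smooth_manifold_cover[OF Y] by blast
    show ?thesis using key[OF c ys refl] DERIV_imp_deriv by metis
  qed
  show "sfun ?W A (\<lambda>(y, s). deriv (\<lambda>s. b (y, s)) s)"
  proof (rule sfunI[OF A])
    fix U \<Phi> assume c: "(U, \<Phi>) \<in> matlas ?W"
    then obtain V \<phi> where c': "(V, \<phi>) \<in> matlas Y" "U = V \<times> UNIV" "\<Phi> = (\<lambda>(x, t). (\<phi> x)(?n := t))"
      by (rule matlas_times_intervalE) auto
    have inj: "inj_on \<Phi> U" by (rule chart_inj[OF smooth_manifold_is_chart[OF W c]])
    have so: "smooth_open (Suc ?n) (\<Phi> ` (U \<inter> A)) (\<lambda>x. b (inv_into U \<Phi> x))"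
      using sfunD[OF b c] by simp
    have "smooth_open (Suc ?n) (\<Phi> ` (U \<inter> A)) (partial_deriv ?n (\<lambda>x. b (inv_into U \<Phi> x)))"
      by (rule smooth_open_partial_deriv[OF so]) simp
    then show "smooth_open (mdim ?W) (\<Phi> ` (U \<inter> A)) (\<lambda>x. case inv_into U \<Phi> x of (y, s) \<Rightarrow> deriv (\<lambda>s. b (y, s)) s)"
      unfolding mdim_times_interval
    proof (rule smooth_open_subset[OF _ smooth_open_imp_openin[OF so]])
      fix x assume "x \<in> \<Phi> ` (U \<inter> A)"
      then obtain y s where ys: "(y, s) \<in> U \<inter> A" "x = \<Phi> (y, s)" by auto
      then show "partial_deriv ?n (\<lambda>x. b (inv_into U \<Phi> x)) x =
          (case inv_into U \<Phi> x of (y, s) \<Rightarrow> deriv (\<lambda>s. b (y, s)) s)"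
        using DERIV_imp_deriv[OF key[OF c'(1) _ _ c'(3), of y s]] c'(2) inv_into_f_f[OF inj, of "(y, s)"] by auto
    qed auto
  qed
qed

text \<open>In a product chart the map replaces the last coordinate by the value of
  \<open>b\<close>, which is the situation of \<open>smooth_open_fibre_inverse\<close>. The moves of
  the proof take this form once the moving coordinate has been made the last one.\<close>

lemma local_diffeo_fibre:
  assumes Y: "smooth_manifold Y" and b: "sfun (times_interval Y UNIV) A b"
    and pos: "\<And>y s. (y, s) \<in> A \<Longrightarrow> deriv (\<lambda>s. b (y, s)) s > 0"
  shows "local_diffeo (times_interval Y UNIV) A (times_interval Y UNIV) (\<lambda>(y, s). (y, b (y, s)))"
  unfolding local_diffeo_def
proof (intro conjI ballI)
  let ?n = "mdim Y" and ?W = "times_interval Y UNIV"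
  let ?E = "Euclidean_space (Suc ?n)"
  define G where "G = (\<lambda>(y, s). (y, b (y, s)))"
  have W: "smooth_manifold ?W" by (rule smooth_manifold_times_interval[OF Y open_UNIV])
  show A: "openin (mtop ?W) A" using b by (rule sfun_openin)
  have At: "A \<subseteq> topspace (mtop Y) \<times> UNIV" using openin_subset[OF A] by simp
  have G: "smap ?W A ?W G"
  proof -
    have "smap ?W A Y fst"
      by (rule smap_subset[OF W smap_fst[OF Y open_UNIV] A At]) simp
    from smap_Pair[OF W Y open_UNIV this b] show ?thesis by (simp add: G_def case_prod_beta')
  qed
  fix p assume p: "p \<in> A"
  obtain y0 s0 where ys: "p = (y0, s0)" by (cases p)
  then obtain U \<phi> where c: "(U, \<phi>) \<in> matlas Y" "y0 \<in> U" using p At smooth_manifold_cover[OF Y] by blast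
  define \<Phi> where "\<Phi> = (\<lambda>(x, t). (\<phi> x)(?n := t))"
  note chY = smooth_manifold_is_chart[OF Y c(1)]
  note inv = product_chart_inv[OF chY open_UNIV, folded \<Phi>_def]
  have c': "(U \<times> UNIV, \<Phi>) \<in> matlas ?W" unfolding \<Phi>_def by (rule matlas_times_interval[OF c(1)])
  have ch: "is_chart ?E (mtop ?W) (U \<times> UNIV, \<Phi>)" using smooth_manifold_is_chart[OF W c'] by simp
  have inj: "inj_on \<Phi> (U \<times> UNIV)" by (rule chart_inj[OF ch])
  define V where "V = \<Phi> ` (U \<times> UNIV \<inter> A)"
  define bh where "bh x = b (inv_into (U \<times> UNIV) \<Phi> x)" for x
  have so: "smooth_open (Suc ?n) V bh" using sfunD[OF b c'] by (simp add: V_def bh_def[abs_def])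
  have bh\<Phi>: "bh (\<Phi> q) = b q" if "q \<in> U \<times> UNIV" for q
    using inv_into_f_f[OF inj that] by (simp add: bh_def)
  have pp: "partial_deriv ?n bh z > 0" if "z \<in> V" for z
  proof -
    obtain y s where q: "(y, s) \<in> A" "y \<in> U" "z = \<Phi> (y, s)" using \<open>z \<in> V\<close> by (auto simp: V_def)
    have "partial_deriv ?n bh z = deriv (\<lambda>s. b (y, s)) s"
      using inv[OF q(2)] by (simp add: partial_deriv_def q(3) \<Phi>_def bh_def)
    then show ?thesis using pos[OF q(1)] by simp
  qed
  have pV: "\<Phi> p \<in> V" using p c(2) ys by (auto simp: V_def)
  define g where "g z = z(?n := bh z)" for z
  obtain \<Omega> where \<Omega>: "openin ?E \<Omega>" "\<Phi> p \<in> \<Omega>" "\<Omega> \<subseteq> V" "inj_on g \<Omega>" "openin ?E (g ` \<Omega>)"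
    "\<And>F. smooth_open (Suc ?n) \<Omega> F \<Longrightarrow> smooth_open (Suc ?n) (g ` \<Omega>) (\<lambda>w. F (inv_into \<Omega> g w))"
    using smooth_open_fibre_inverse[OF so pp pV] unfolding g_def by blast
  define S where "S = {q \<in> U \<times> UNIV. \<Phi> q \<in> \<Omega>}"
  have S: "openin (mtop ?W) S" unfolding S_def by (rule chart_preimage[OF ch \<Omega>(1)])
  have SA: "S \<subseteq> A" using \<Omega>(3) inj unfolding S_def V_def by (force simp: inj_on_def)
  have \<Phi>G: "\<Phi> (G q) = g (\<Phi> q)" "G q \<in> U \<times> UNIV" if "q \<in> U \<times> UNIV" for q
    using that bh\<Phi>[OF that] by (auto simp: \<Phi>_def G_def g_def)
  have \<Phi>S: "\<Phi> ` S = \<Omega>" using \<Omega>(3) by (auto simp: S_def V_def)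
  have injG: "inj_on G S"
  proof (rule inj_onI)
    fix q r assume qr: "q \<in> S" "r \<in> S" "G q = G r"
    then have "g (\<Phi> q) = g (\<Phi> r)" using \<Phi>G by (metis (mono_tags) S_def mem_Collect_eq)
    then have "\<Phi> q = \<Phi> r" using \<Omega>(4) qr \<Phi>S by (auto simp: inj_on_def)
    then show "q = r" using inj qr by (auto simp: S_def inj_on_def)
  qed
  have GS: "G ` S = {q \<in> U \<times> UNIV. \<Phi> q \<in> g ` \<Omega>}"
  proof (intro equalityI subsetI)
    fix q assume "q \<in> G ` S"
    then obtain r where r: "r \<in> U \<times> UNIV" "\<Phi> r \<in> \<Omega>" "q = G r" by (auto simp: S_def)
    show "q \<in> {q \<in> U \<times> UNIV. \<Phi> q \<in> g ` \<Omega>}" using \<Phi>G[OF r(1)] r(2,3) by auto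
  next
    fix q assume "q \<in> {q \<in> U \<times> UNIV. \<Phi> q \<in> g ` \<Omega>}"
    then obtain r where r: "q \<in> U \<times> UNIV" "r \<in> S" "\<Phi> q = g (\<Phi> r)" using \<Phi>S by blast
    then have "\<Phi> q = \<Phi> (G r)" "G r \<in> U \<times> UNIV" using \<Phi>G[of r] by (auto simp: S_def)
    then have "q = G r" using inj_onD[OF inj] r by metis
    then show "q \<in> G ` S" using r(2) by blast
  qed
  have opG: "openin (mtop ?W) (G ` S)" unfolding GS by (rule chart_preimage[OF ch \<Omega>(5)])
  have "smap ?W (G ` S) ?W (inv_into S G)"
  proof (rule smap_chartsI[OF W W opG])
    have "sfun ?W (G ` S) (\<lambda>q. \<Phi> (inv_into S G q) j)" for j
    proof -
      have "smooth_open (Suc ?n) (g ` \<Omega>) (\<lambda>w. inv_into \<Omega> g w j)"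
        by (rule \<Omega>(6)[OF smooth_open_coord[OF \<Omega>(1)]])
      then have "sfun ?W {q \<in> U \<times> UNIV. \<Phi> q \<in> g ` \<Omega>} (\<lambda>q. inv_into \<Omega> g (\<Phi> q) j)"
        using sfun_compose_chart[OF W matlas_subset_max_atlas[OF W c']] by simp
      then show ?thesis
        unfolding GS[symmetric]
      proof (rule sfun_cong[OF W])
        fix q assume "q \<in> G ` S"
        then obtain r where r: "r \<in> S" "q = G r" by blast
        then have "\<Phi> q = g (\<Phi> r)" using \<Phi>G[of r] by (auto simp: S_def)
        then show "inv_into \<Omega> g (\<Phi> q) j = \<Phi> (inv_into S G q) j"
          using r inv_into_f_f[OF injG r(1)] inv_into_f_f[OF \<Omega>(4), of "\<Phi> r"] \<Phi>S by auto
      qed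
    qed
    moreover have "inv_into S G ` (G ` S) \<subseteq> U \<times> UNIV" using injG by (auto simp: S_def)
    ultimately show "\<exists>V \<psi> T. (V, \<psi>) \<in> matlas ?W \<and> q \<in> T \<and> T \<subseteq> G ` S \<and> openin (mtop ?W) T \<and>
        inv_into S G ` T \<subseteq> V \<and> (\<forall>j<mdim ?W. sfun ?W T (\<lambda>q. \<psi> (inv_into S G q) j))" if "q \<in> G ` S" for q
      using c' opG that by (intro exI[of _ "U \<times> UNIV"] exI[of _ \<Phi>] exI[of _ "G ` S"]) auto
  qed
  moreover have "smap ?W S ?W G" by (rule smap_subset[OF W G S SA]) simp
  ultimately have "diffeo_on ?W S ?W G" unfolding diffeo_on_def using injG by blast
  moreover have "p \<in> S" using \<Omega>(2) c(2) ys by (simp add: S_def)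
  ultimately show "\<exists>S. p \<in> S \<and> S \<subseteq> A \<and> diffeo_on ?W S ?W (\<lambda>(y, s). (y, b (y, s)))"
    using SA unfolding G_def by blast
qed

section \<open>Submanifolds and their preimages\<close>

text \<open>Transport of functions along \<open>F\<close> and its inverse turns the criterion of
  \<open>max_atlas_iff\<close> for \<open>\<psi>\<close> into the one for the composite
  chart.\<close>

lemma max_atlas_pullback:
  assumes M: "smooth_manifold M" and N: "smooth_manifold N" and F: "diffeo_on M A N F"
    and c: "(V, \<psi>) \<in> max_atlas N" and VA: "V \<subseteq> F ` A"
  shows "({p \<in> A. F p \<in> V}, \<lambda>p. \<psi> (F p)) \<in> max_atlas M"
  unfolding max_atlas_iff[OF M]
proof (intro conjI allI impI)
  let ?U = "{p \<in> A. F p \<in> V}"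
  have V: "openin (mtop N) V" and inj\<psi>: "inj_on \<psi> V" and co: "\<And>j. sfun N V (\<lambda>p. \<psi> p j)"
    and sm: "\<And>T f. sfun N T f \<Longrightarrow> smooth_open (mdim N) (\<psi> ` (V \<inter> T)) (\<lambda>x. f (inv_into V \<psi> x))"
    using c unfolding max_atlas_iff[OF N] by blast+
  note injF = diffeo_on_inj[OF F]
  show U: "openin (mtop M) ?U" by (rule smap_preimage[OF diffeo_on_smap[OF F] V])
  show inj: "inj_on (\<lambda>p. \<psi> (F p)) ?U" using injF inj\<psi> by (auto simp: inj_on_def)
  show "sfun M ?U (\<lambda>p. \<psi> (F p) j)" for j by (rule smap_sfun[OF diffeo_on_smap[OF F] co])
  fix T f assume f: "sfun M T f"
  have "sfun N {q \<in> F ` A. inv_into A F q \<in> T} (\<lambda>q. f (inv_into A F q))"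
    by (rule smap_sfun[OF diffeo_on_inv[OF F] f])
  from sm[OF this] have s: "smooth_open (mdim N) (\<psi> ` (V \<inter> {q \<in> F ` A. inv_into A F q \<in> T}))
      (\<lambda>x. f (inv_into A F (inv_into V \<psi> x)))" .
  have eq: "\<psi> ` (V \<inter> {q \<in> F ` A. inv_into A F q \<in> T}) = (\<lambda>p. \<psi> (F p)) ` (?U \<inter> T)"
    using injF VA by (force simp: image_iff)
  show "smooth_open (mdim M) ((\<lambda>p. \<psi> (F p)) ` (?U \<inter> T)) (\<lambda>x. f (inv_into ?U (\<lambda>p. \<psi> (F p)) x))"
    unfolding diffeo_on_mdim[OF F]
  proof (rule smooth_open_subset[OF s[unfolded eq] smooth_open_imp_openin[OF s[unfolded eq]]])
    fix x assume "x \<in> (\<lambda>p. \<psi> (F p)) ` (?U \<inter> T)"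
    then obtain p where p: "p \<in> A" "F p \<in> V" "x = \<psi> (F p)" by blast
    have "inv_into ?U (\<lambda>p. \<psi> (F p)) x = p" using inv_into_f_f[OF inj, of p] p by simp
    moreover have "inv_into V \<psi> x = F p" using inv_into_f_f[OF inj\<psi> p(2)] p by simp
    moreover have "inv_into A F (F p) = p" by (rule inv_into_f_f[OF injF p(1)])
    ultimately show "f (inv_into A F (inv_into V \<psi> x)) = f (inv_into ?U (\<lambda>p. \<psi> (F p)) x)" by simp
  qed auto
qed

lemma max_atlas_subset:
  assumes M: "smooth_manifold M" and c: "(V, \<psi>) \<in> max_atlas M" and U: "openin (mtop M) U" "U \<subseteq> V"
  shows "(U, \<psi>) \<in> max_atlas M"
  unfolding max_atlas_iff[OF M]
proof (intro conjI allI impI U(1))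
  have inj: "inj_on \<psi> V" and co: "\<And>j. sfun M V (\<lambda>p. \<psi> p j)"
    and sm: "\<And>T f. sfun M T f \<Longrightarrow> smooth_open (mdim M) (\<psi> ` (V \<inter> T)) (\<lambda>x. f (inv_into V \<psi> x))"
    using c unfolding max_atlas_iff[OF M] by blast+
  show inj': "inj_on \<psi> U" by (rule inj_on_subset[OF inj U(2)])
  show "sfun M U (\<lambda>p. \<psi> p j)" for j by (rule sfun_subset[OF M co U]) simp
  fix T f assume f: "sfun M T f"
  have "sfun M (U \<inter> T) f"
    by (rule sfun_subset[OF M f]) (use U sfun_openin[OF f] in auto)
  from sm[OF this] have s: "smooth_open (mdim M) (\<psi> ` (U \<inter> T)) (\<lambda>x. f (inv_into V \<psi> x))"
    using U(2) by (simp add: Int_absorb1 flip: Int_assoc)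
  show "smooth_open (mdim M) (\<psi> ` (U \<inter> T)) (\<lambda>x. f (inv_into U \<psi> x))"
  proof (rule smooth_open_subset[OF s smooth_open_imp_openin[OF s]])
    fix x assume "x \<in> \<psi> ` (U \<inter> T)"
    then obtain p where "p \<in> U" "x = \<psi> p" by blast
    then show "f (inv_into V \<psi> x) = f (inv_into U \<psi> x)"
      using inv_into_f_f[OF inj, of p] inv_into_f_f[OF inj', of p] U(2) by auto
  qed simp
qed

lemma Psi_set_vimage:
  assumes M: "smooth_manifold M" and N: "smooth_manifold N"
    and F: "local_diffeo M (topspace (mtop M)) N F" and P: "P \<in> Psi_set k N"
  shows "{p \<in> topspace (mtop M). F p \<in> P} \<in> Psi_set k M"
proof -
  let ?P = "{p \<in> topspace (mtop M). F p \<in> P}"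
  have s: "smap M (topspace (mtop M)) N F" by (rule local_diffeo_smap[OF M F])
  have "continuous_map (mtop M) (mtop N) F" using smap_continuous[OF s] by simp
  then have "closedin (mtop M) ?P" using P by (auto simp: Psi_set_def intro: closedin_continuous_map_preimage)
  moreover have "is_submanifold k M ?P"
    unfolding is_submanifold_def
  proof (intro conjI ballI)
    fix p assume p: "p \<in> ?P"
    then obtain V \<psi> where c: "(V, \<psi>) \<in> slice_charts k N P" "F p \<in> V"
      using P unfolding Psi_set_def is_submanifold_def by blast
    obtain A where A: "p \<in> A" "A \<subseteq> topspace (mtop M)" "diffeo_on M A N F"
      using F p unfolding local_diffeo_def by blast
    have cm: "(V, \<psi>) \<in> max_atlas N" and kd: "k \<le> mdim N"
      and sl: "\<psi> ` (V \<inter> P) = \<psi> ` V \<inter> topspace (Euclidean_space k)"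
      using c(1) by (auto simp: slice_charts_def)
    \<comment> \<open>Shrinking the target chart to the image of a piece on which \<open>F\<close>
      is a diffeomorphism makes its pullback a chart.\<close>
    define V' where "V' = V \<inter> F ` A"
    define U where "U = {p \<in> A. F p \<in> V'}"
    have inj: "inj_on \<psi> V" by (rule chart_inj[OF max_atlas_is_chart[OF cm]])
    have cm': "(V', \<psi>) \<in> max_atlas N"
      unfolding V'_def
      by (rule max_atlas_subset[OF N cm])
         (use chart_openin[OF max_atlas_is_chart[OF cm]] diffeo_on_image[OF A(3)] in auto)
    have "(U, \<lambda>p. \<psi> (F p)) \<in> max_atlas M"
      unfolding U_def by (rule max_atlas_pullback[OF M N A(3) cm']) (simp add: V'_def)
    moreover have "(\<lambda>p. \<psi> (F p)) ` (U \<inter> ?P) = (\<lambda>p. \<psi> (F p)) ` U \<inter> topspace (Euclidean_space k)"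
    proof (intro equalityI subsetI)
      fix x assume "x \<in> (\<lambda>p. \<psi> (F p)) ` (U \<inter> ?P)"
      then obtain q where q: "q \<in> U" "F q \<in> P" "x = \<psi> (F q)" by blast
      then have "x \<in> \<psi> ` (V \<inter> P)" by (auto simp: U_def V'_def)
      then show "x \<in> (\<lambda>p. \<psi> (F p)) ` U \<inter> topspace (Euclidean_space k)" using sl q by blast
    next
      fix x assume x: "x \<in> (\<lambda>p. \<psi> (F p)) ` U \<inter> topspace (Euclidean_space k)"
      then obtain q where q: "q \<in> U" "x = \<psi> (F q)" by blast
      then have V: "F q \<in> V" by (auto simp: U_def V'_def)
      then have "x \<in> \<psi> ` (V \<inter> P)" using sl x q by blast
      then have "F q \<in> P" using inj V q by (auto simp: inj_on_def)
      then show "x \<in> (\<lambda>p. \<psi> (F p)) ` (U \<inter> ?P)" using q A(2) by (auto simp: U_def)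
    qed
    ultimately have "(U, \<lambda>p. \<psi> (F p)) \<in> slice_charts k M ?P"
      using kd diffeo_on_mdim[OF A(3)] by (simp add: slice_charts_def)
    moreover have "p \<in> U" using A(1) c(2) by (simp add: U_def V'_def)
    ultimately show "\<exists>(U, \<phi>)\<in>slice_charts k M ?P. p \<in> U" by blast
  qed auto
  ultimately show ?thesis by (simp add: Psi_set_def)
qed

lemma submanifold_simps[simp]:
  "mdim (submanifold k W P) = k" "mtop (submanifold k W P) = subtopology (mtop W) P"
  by (simp_all add: submanifold_def)

text \<open>A slice chart restricts to a chart with values in Euclidean \<open>k\<close>-space, and
  smooth functions restrict by \<open>smooth_open_restrict\<close>. This gives access to the atlas
  of the submanifold, to which the topology on embeddings refers.\<close>

lemma submanifold_props:
  assumes W: "smooth_manifold W" and P: "is_submanifold k W P"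
  shows smooth_manifold_submanifold: "smooth_manifold (submanifold k W P)"
    and smap_submanifold: "smap (submanifold k W P) P W (\<lambda>p. p)"
proof -
  let ?S = "submanifold k W P" and ?Ek = "Euclidean_space k" and ?En = "Euclidean_space (mdim W)"
  have Pt: "P \<subseteq> topspace (mtop W)" using P by (simp add: is_submanifold_def)
  have tS: "topspace (mtop ?S) = P" using Pt by auto
  have slD: "(U, \<phi>) \<in> max_atlas W" "k \<le> mdim W" "\<phi> ` (U \<inter> P) = \<phi> ` U \<inter> topspace ?Ek"
    if "(U, \<phi>) \<in> slice_charts k W P" for U \<phi>
    using that by (auto simp: slice_charts_def)
  have Ek: "?Ek = subtopology ?En (topspace ?Ek)" if "k \<le> mdim W"
    by (metis Euclidean_space_def that inf.absorb_iff2 subset_Euclidean_space subtopology_subtopology topspace_Euclidean_space)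
  have atl: "matlas ?S = (\<lambda>(U, \<phi>). (U \<inter> P, \<phi>)) ` slice_charts k W P" by (simp add: submanifold_def)
  have chart: "is_chart ?Ek (mtop ?S) (U \<inter> P, \<phi>)" if c: "(U, \<phi>) \<in> slice_charts k W P" for U \<phi>
  proof -
    note cm = slD(1)[OF c] and k = slD(2)[OF c] and sl = slD(3)[OF c]
    have ch: "is_chart ?En (mtop W) (U, \<phi>)" by (rule max_atlas_is_chart[OF cm])
    note U = chart_openin[OF ch] and I = chart_image[OF ch]
    have h: "homeomorphic_map (subtopology (mtop W) U) (subtopology ?En (\<phi> ` U)) \<phi>"
      using ch by (simp add: is_chart_def)
    have "openin (subtopology (mtop W) P) (U \<inter> P)" using U by (auto simp: openin_subtopology)
    moreover have oI: "openin ?Ek (\<phi> ` (U \<inter> P))"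
      unfolding sl by (rule openin_Euclidean_space_restrict[OF I k])
    moreover have "homeomorphic_map (subtopology (subtopology (mtop W) U) (U \<inter> P))
        (subtopology (subtopology ?En (\<phi> ` U)) (\<phi> ` (U \<inter> P))) \<phi>"
      by (rule homeomorphic_map_subtopologies[OF h])
         (use openin_subset[OF U] openin_subset[OF I] in \<open>simp only: topspace_subtopology_subset\<close>, blast)
    moreover have "subtopology (subtopology (mtop W) U) (U \<inter> P) = subtopology (subtopology (mtop W) P) (U \<inter> P)"
      by (simp add: subtopology_subtopology Int_ac)
    moreover have "subtopology (subtopology ?En (\<phi> ` U)) (\<phi> ` (U \<inter> P)) = subtopology ?Ek (\<phi> ` (U \<inter> P))"
    proof -
      have "\<phi> ` (U \<inter> P) \<subseteq> \<phi> ` U" "\<phi> ` (U \<inter> P) \<subseteq> topspace ?Ek" using sl by blast+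
      then show ?thesis by (subst Ek[OF k]) (simp add: subtopology_subtopology Int_absorb1)
    qed
    ultimately show ?thesis by (simp add: is_chart_def)
  qed
  have invP: "inv_into (U \<inter> P) \<phi> x = inv_into U \<phi> x" if c: "(U, \<phi>) \<in> slice_charts k W P" and x: "x \<in> \<phi> ` (U \<inter> P)" for U \<phi> x
  proof -
    have inj: "inj_on \<phi> U" by (rule chart_inj[OF max_atlas_is_chart[OF slD(1)[OF c]]])
    obtain p where "p \<in> U \<inter> P" "x = \<phi> p" using x by blast
    then show ?thesis using inv_into_f_f[OF inj, of p] inv_into_f_f[OF inj_on_subset[OF inj], of "U \<inter> P" p] by auto
  qed
  have restr: "smooth_open k (\<phi> ` ((U \<inter> P) \<inter> T)) (\<lambda>x. f (inv_into (U \<inter> P) \<phi> x))"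
    if c: "(U, \<phi>) \<in> slice_charts k W P" and f: "sfun W T f" for U \<phi> T f
  proof -
    note cm = slD(1)[OF c] and k = slD(2)[OF c] and sl = slD(3)[OF c]
    have inj: "inj_on \<phi> U" by (rule chart_inj[OF max_atlas_is_chart[OF cm]])
    have s: "smooth_open (mdim W) (\<phi> ` (U \<inter> T)) (\<lambda>x. f (inv_into U \<phi> x))"
      using cm f unfolding max_atlas_iff[OF W] by blast
    have eq: "\<phi> ` ((U \<inter> P) \<inter> T) = \<phi> ` (U \<inter> T) \<inter> topspace ?Ek"
    proof (intro equalityI subsetI)
      fix x assume "x \<in> \<phi> ` ((U \<inter> P) \<inter> T)"
      then show "x \<in> \<phi> ` (U \<inter> T) \<inter> topspace ?Ek" using sl by blast
    next
      fix x assume x: "x \<in> \<phi> ` (U \<inter> T) \<inter> topspace ?Ek"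
      then obtain p where p: "p \<in> U" "p \<in> T" "x = \<phi> p" by blast
      then have "x \<in> \<phi> ` (U \<inter> P)" using sl x by blast
      then have "p \<in> P" using inj p by (auto simp: inj_on_eq_iff)
      then show "x \<in> \<phi> ` ((U \<inter> P) \<inter> T)" using p by blast
    qed
    have r: "smooth_open k (\<phi> ` (U \<inter> T) \<inter> topspace ?Ek) (\<lambda>x. f (inv_into U \<phi> x))"
      by (rule smooth_open_restrict[OF s k])
    show ?thesis
      unfolding eq
    proof (rule smooth_open_subset[OF r smooth_open_imp_openin[OF r]])
      fix x assume "x \<in> \<phi> ` (U \<inter> T) \<inter> topspace ?Ek"
      then have "x \<in> \<phi> ` (U \<inter> P)" unfolding eq[symmetric] by blast
      then show "f (inv_into U \<phi> x) = f (inv_into (U \<inter> P) \<phi> x)" by (simp add: invP[OF c])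
    qed simp
  qed
  show S: "smooth_manifold ?S"
    unfolding smooth_manifold_def
  proof (intro conjI ballI)
    show "Hausdorff_space (mtop ?S)"
      using smooth_manifold_Hausdorff[OF W] by (simp add: Hausdorff_space_subtopology)
    show "is_chart (Euclidean_space (mdim ?S)) (mtop ?S) c" if "c \<in> matlas ?S" for c
      using that chart unfolding atl by auto
    show "(\<Union>(U, \<phi>)\<in>matlas ?S. U) = topspace (mtop ?S)"
      unfolding tS atl using P unfolding is_submanifold_def by fastforce
    fix c c' assume "c \<in> matlas ?S" "c' \<in> matlas ?S"
    then obtain U \<phi> V \<psi> where c: "(U, \<phi>) \<in> slice_charts k W P" "c = (U \<inter> P, \<phi>)"
      and c': "(V, \<psi>) \<in> slice_charts k W P" "c' = (V \<inter> P, \<psi>)" unfolding atl by auto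
    have eq: "\<phi> ` ((U \<inter> P) \<inter> (V \<inter> P)) = \<phi> ` ((U \<inter> P) \<inter> V)" by (auto simp: Int_ac)
    have "sfun W V (\<lambda>p. \<psi> p j)" for j using slD(1)[OF c'(1)] unfolding max_atlas_iff[OF W] by blast
    from restr[OF c(1) this] show "smooth_transition (mdim ?S) c c'"
      unfolding smooth_transition_def c(2) c'(2) prod.case submanifold_simps eq
      using smooth_on_open_iff[OF smooth_open_imp_openin] by metis
  qed
  show "smap ?S P W (\<lambda>p. p)"
    unfolding smap_def
  proof (intro conjI allI impI)
    show "openin (mtop ?S) P" using openin_topspace[of "mtop ?S"] tS by simp
    show "(\<lambda>p. p) ` P \<subseteq> topspace (mtop W)" using Pt by simp
    show op: "openin (mtop ?S) {p \<in> P. p \<in> T}" if "openin (mtop W) T" for T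
      using that by (auto simp: openin_subtopology)
    show "sfun ?S {p \<in> P. p \<in> T} f" if f: "sfun W T f" for T f
    proof (rule sfunI[OF op[OF sfun_openin[OF f]]])
      fix U' \<phi> assume "(U', \<phi>) \<in> matlas ?S"
      then obtain U where U: "(U, \<phi>) \<in> slice_charts k W P" "U' = U \<inter> P" unfolding atl by auto
      have "U' \<inter> {p \<in> P. p \<in> T} = (U \<inter> P) \<inter> T" using U(2) by blast
      then show "smooth_open (mdim ?S) (\<phi> ` (U' \<inter> {p \<in> P. p \<in> T})) (\<lambda>x. f (inv_into U' \<phi> x))"
        using restr[OF U(1) f] U(2) by simp
    qed
  qed
qed

section \<open>The boundary of a manifold\<close>

text \<open>Invariance of the boundary. If this chart sent \<open>p\<close> into the interior of the
  half space, the transition to a chart that exhibits \<open>p\<close> as a boundary point would be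
  injective and continuous on an open set of the full space. Its image would then be open there,
  although it lies in the half space and contains a point of the bounding hyperplane.\<close>

lemma boundary_points_chart:
  assumes M: "manifold_with_boundary M" and c: "(U, \<phi>) \<in> matlas M" and p: "p \<in> U" "p \<in> boundary_points M"
  shows "\<phi> p (mdim M - 1) = 0"
proof (rule ccontr)
  let ?d = "mdim M"
  let ?E = "Euclidean_space ?d" and ?H = "half_space ?d"
  assume nz: "\<phi> p (?d - 1) \<noteq> 0"
  have d: "0 < ?d" and mod: "modelled_on ?H M" using M by (auto simp: manifold_with_boundary_def)
  obtain V \<psi> where c': "(V, \<psi>) \<in> matlas M" "p \<in> V" "\<psi> p (?d - 1) = 0" using p(2) by (auto simp: boundary_points_def)
  have ch: "is_chart ?H (mtop M) (U, \<phi>)" "is_chart ?H (mtop M) (V, \<psi>)"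
    using mod c c'(1) by (auto simp: modelled_on_def)
  have tH: "topspace ?H = {x \<in> topspace ?E. x (?d - 1) \<ge> 0}" by (auto simp: half_space_def)
  define T where "T = \<phi> ` (U \<inter> V) \<inter> {x \<in> topspace ?E. x (?d - 1) > 0}"
  have UV: "openin (mtop M) (U \<inter> V)" using chart_openin[OF ch(1)] chart_openin[OF ch(2)] by blast
  have o1: "openin ?H (\<phi> ` (U \<inter> V))" by (rule chart_open_map[OF ch(1) UV]) simp
  have cd: "continuous_map ?E euclideanreal (\<lambda>x. x (?d - 1))"
    using smooth_open_imp_continuous[OF smooth_open_coord[OF openin_topspace, of ?d "?d - 1"]]
    by (simp add: subtopology_topspace)
  have o2: "openin ?E {x \<in> topspace ?E. x (?d - 1) > 0}"
    using openin_continuous_map_preimage[OF cd, of "{0<..}"] by simp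
  obtain T0 where T0: "openin ?E T0" "\<phi> ` (U \<inter> V) = T0 \<inter> {x. x (?d - 1) \<ge> 0}"
    using o1 unfolding half_space_def openin_subtopology by blast
  have "T = T0 \<inter> {x \<in> topspace ?E. x (?d - 1) > 0}" using T0(2) by (auto simp: T_def)
  then have oT: "openin ?E T" using T0(1) o2 by auto
  have inj: "inj_on \<phi> U" "inj_on \<psi> V" by (rule chart_inj[OF ch(1)] chart_inj[OF ch(2)])+
  define h where "h x = \<psi> (inv_into U \<phi> x)" for x
  have pT: "\<phi> p \<in> T"
    using nz p(1) c'(2) openin_subset[OF chart_image[OF ch(1)]] unfolding T_def tH by force
  have hV: "h x \<in> \<psi> ` V" "inv_into U \<phi> x \<in> U \<inter> V" "\<phi> (inv_into U \<phi> x) = x" if "x \<in> T" for x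
    using that inj by (auto simp: T_def h_def)
  have injh: "inj_on h T"
  proof (rule inj_onI)
    fix x y assume "x \<in> T" "y \<in> T" "h x = h y"
    then show "x = y" using hV(2,3) inj(2) unfolding h_def by (metis IntD2 inj_onD)
  qed
  have tr: "smooth_on ?d (\<phi> ` (U \<inter> V)) h"
    using mod c c'(1) unfolding modelled_on_def smooth_transition_def h_def by fast
  have sm: "smooth_open ?d T (\<lambda>x. h x j)" for j
  proof (rule smooth_open_local[OF oT])
    fix x assume x: "x \<in> T"
    then obtain S g where "x \<in> S" "smooth_open ?d S g" "\<forall>y\<in>S \<inter> \<phi> ` (U \<inter> V). h y j = g y"
      using tr unfolding smooth_on_def T_def by blast
    then show "\<exists>V g. x \<in> V \<and> smooth_open ?d V g \<and> (\<forall>y\<in>T \<inter> V. h y j = g y)"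
      unfolding T_def by blast
  qed
  have hE: "h x \<in> topspace ?E" "h x (?d - 1) \<ge> 0" if "x \<in> T" for x
    using hV(1)[OF that] openin_subset[OF chart_image[OF ch(2)]] unfolding tH by auto
  have "continuous_map (subtopology ?E T) ?E h"
    by (rule continuous_map_into_Euclidean_space)
       (use smooth_open_imp_continuous[OF sm] hE openin_subset[OF oT] in auto)
  then have "openin ?E (h ` T)" by (rule invariance_of_domain_Euclidean_space[OF oT _ injh])
  moreover have hp: "h (\<phi> p) \<in> h ` T" using pT by blast
  ultimately obtain r where r: "r > 0" "cube ?d (h (\<phi> p)) r \<subseteq> h ` T" by (rule openin_contains_cube)
  have h0: "h (\<phi> p) (?d - 1) = 0" using c'(3) inj p(1) by (simp add: h_def)
  \<comment> \<open>A point slightly below the hyperplane, which would have to lie in the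
    image.\<close>
  define w where "w = (h (\<phi> p))(?d - 1 := - r / 2)"
  have "w \<in> cube ?d (h (\<phi> p)) r"
    using hE(1)[OF pT] h0 r(1) d by (auto simp: w_def cube_def topspace_Euclidean_space)
  then have "w (?d - 1) \<ge> 0" using r(2) hE(2) by blast
  then show False using r(1) by (simp add: w_def)
qed

lemma smooth_manifold_boundary:
  assumes M: "manifold_with_boundary M"
  shows "smooth_manifold (boundary M)"
proof -
  let ?d = "mdim M"
  let ?H = "half_space ?d" and ?P = "boundary_points M"
  define e where "e = ?d - 1"
  let ?Ee = "Euclidean_space e"
  have d: "0 < ?d" and mod: "modelled_on ?H M" using M by (auto simp: manifold_with_boundary_def)
  have ed: "e \<le> ?d" "Suc e = ?d" using d by (auto simp: e_def)
  have ch: "is_chart ?H (mtop M) c" if "c \<in> matlas M" for c using mod that by (auto simp: modelled_on_def)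
  have tH: "topspace ?H = {x \<in> topspace (Euclidean_space ?d). x e \<ge> 0}" by (auto simp: half_space_def e_def)
  have EeH: "?Ee = subtopology ?H (topspace ?Ee)"
  proof -
    have "subtopology ?H (topspace ?Ee) = subtopology (Euclidean_space ?d) ({x. x e \<ge> 0} \<inter> topspace ?Ee)"
      by (simp add: half_space_def subtopology_subtopology e_def)
    also have "{x. x e \<ge> 0} \<inter> topspace ?Ee = topspace ?Ee" by (auto simp: topspace_Euclidean_space)
    also have "subtopology (Euclidean_space ?d) (topspace ?Ee) = ?Ee"
      by (metis Euclidean_space_def ed(1) inf.absorb_iff2 subset_Euclidean_space subtopology_subtopology topspace_Euclidean_space)
    finally show ?thesis by simp
  qed
  \<comment> \<open>Here the independence of the chart enters: every chart flattens the boundary to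
    Euclidean \<open>e\<close>-space, not only one that exhibits a given boundary point.\<close>
  have bd: "\<phi> ` (U \<inter> ?P) = \<phi> ` U \<inter> topspace ?Ee" if c: "(U, \<phi>) \<in> matlas M" for U \<phi>
  proof (intro equalityI subsetI)
    fix x assume "x \<in> \<phi> ` (U \<inter> ?P)"
    then obtain p where p: "p \<in> U" "p \<in> ?P" "x = \<phi> p" by blast
    have "x e = 0" using boundary_points_chart[OF M c p(1,2)] p(3) by (simp add: e_def)
    moreover have "\<forall>i\<ge>?d. x i = 0"
      using openin_subset[OF chart_image[OF ch[OF c]]] p tH by (auto simp: topspace_Euclidean_space)
    ultimately have "\<forall>i\<ge>e. x i = 0" using ed(2) by (metis le_less_Suc_eq not_less_eq_eq nle_le)
    then show "x \<in> \<phi> ` U \<inter> topspace ?Ee" using p by (auto simp: topspace_Euclidean_space)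
  next
    fix x assume x: "x \<in> \<phi> ` U \<inter> topspace ?Ee"
    then obtain p where p: "p \<in> U" "x = \<phi> p" by blast
    then have "p \<in> ?P" using c x by (auto simp: boundary_points_def topspace_Euclidean_space e_def)
    then show "x \<in> \<phi> ` (U \<inter> ?P)" using p by blast
  qed
  have bs: "mdim (boundary M) = e" "mtop (boundary M) = subtopology (mtop M) ?P"
    "matlas (boundary M) = (\<lambda>(U, \<phi>). (U \<inter> ?P, \<phi>)) ` matlas M"
    by (simp_all add: boundary_def e_def)
  show ?thesis
    unfolding smooth_manifold_def bs
  proof (intro conjI ballI)
    show "Hausdorff_space (subtopology (mtop M) ?P)"
      using mod by (simp add: modelled_on_def Hausdorff_space_subtopology)
    have cov: "(\<Union>(U, \<phi>)\<in>matlas M. U) = topspace (mtop M)" using mod by (simp add: modelled_on_def)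
    show "(\<Union>(U, \<phi>)\<in>(\<lambda>(U, \<phi>). (U \<inter> ?P, \<phi>)) ` matlas M. U) = topspace (subtopology (mtop M) ?P)"
      unfolding topspace_subtopology cov[symmetric] by fastforce
    fix c assume "c \<in> (\<lambda>(U, \<phi>). (U \<inter> ?P, \<phi>)) ` matlas M"
    then obtain U \<phi> where c: "(U, \<phi>) \<in> matlas M" "c = (U \<inter> ?P, \<phi>)" by auto
    note U = chart_openin[OF ch[OF c(1)]] and I = chart_image[OF ch[OF c(1)]] and inj = chart_inj[OF ch[OF c(1)]]
    have h: "homeomorphic_map (subtopology (mtop M) U) (subtopology ?H (\<phi> ` U)) \<phi>"
      using ch[OF c(1)] by (simp add: is_chart_def)
    have o1: "openin (subtopology (mtop M) ?P) (U \<inter> ?P)" using U by (auto simp: openin_subtopology)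
    have o2: "openin ?Ee (\<phi> ` (U \<inter> ?P))"
      unfolding bd[OF c(1)] by (subst EeH) (use I in \<open>auto simp: openin_subtopology\<close>)
    have "homeomorphic_map (subtopology (subtopology (mtop M) U) (U \<inter> ?P))
        (subtopology (subtopology ?H (\<phi> ` U)) (\<phi> ` (U \<inter> ?P))) \<phi>"
      by (rule homeomorphic_map_subtopologies[OF h])
         (use openin_subset[OF U] openin_subset[OF I] in \<open>simp only: topspace_subtopology_subset\<close>, blast)
    moreover have "subtopology (subtopology (mtop M) U) (U \<inter> ?P) = subtopology (subtopology (mtop M) ?P) (U \<inter> ?P)"
      by (simp add: subtopology_subtopology Int_ac)
    moreover have "subtopology (subtopology ?H (\<phi> ` U)) (\<phi> ` (U \<inter> ?P)) = subtopology ?Ee (\<phi> ` (U \<inter> ?P))"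
    proof -
      have "\<phi> ` (U \<inter> ?P) \<subseteq> \<phi> ` U" "\<phi> ` (U \<inter> ?P) \<subseteq> topspace ?Ee" using bd[OF c(1)] by blast+
      then show ?thesis by (subst EeH) (simp add: subtopology_subtopology Int_absorb1)
    qed
    ultimately show "is_chart ?Ee (subtopology (mtop M) ?P) c"
      using o1 o2 by (simp add: is_chart_def c(2))
    fix c' assume "c' \<in> (\<lambda>(U, \<phi>). (U \<inter> ?P, \<phi>)) ` matlas M"
    then obtain V \<psi> where c': "(V, \<psi>) \<in> matlas M" "c' = (V \<inter> ?P, \<psi>)" by auto
    have tr: "smooth_on ?d (\<phi> ` (U \<inter> V)) (\<lambda>x. \<psi> (inv_into U \<phi> x))"
      using mod c(1) c'(1) unfolding modelled_on_def smooth_transition_def by fast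
    have "smooth_on e (\<phi> ` ((U \<inter> ?P) \<inter> (V \<inter> ?P))) (\<lambda>x. \<psi> (inv_into (U \<inter> ?P) \<phi> x))"
      unfolding smooth_on_def
    proof (intro allI ballI)
      fix j x assume "x \<in> \<phi> ` ((U \<inter> ?P) \<inter> (V \<inter> ?P))"
      then obtain p where p: "p \<in> U" "p \<in> V" "p \<in> ?P" "x = \<phi> p" by blast
      then obtain S g where S: "x \<in> S" "smooth_open ?d S g"
        "\<forall>y\<in>S \<inter> \<phi> ` (U \<inter> V). \<psi> (inv_into U \<phi> y) j = g y"
        using tr unfolding smooth_on_def by blast
      have inv: "inv_into (U \<inter> ?P) \<phi> (\<phi> q) = inv_into U \<phi> (\<phi> q)" if "q \<in> U" "q \<in> ?P" for q
        using inv_into_f_f[OF inj, of q] inv_into_f_f[OF inj_on_subset[OF inj], of "U \<inter> ?P" q] that by auto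
      have "x \<in> topspace ?Ee" using p bd[OF c(1)] by blast
      then show "\<exists>Ua g. x \<in> Ua \<and> smooth_open e Ua g \<and>
          (\<forall>y\<in>Ua \<inter> \<phi> ` ((U \<inter> ?P) \<inter> (V \<inter> ?P)). \<psi> (inv_into (U \<inter> ?P) \<phi> y) j = g y)"
        using S smooth_open_restrict[OF S(2) ed(1)] inv
        by (intro exI[of _ "S \<inter> topspace ?Ee"] exI[of _ g]) auto
    qed
    then show "smooth_transition e c c'" by (simp add: smooth_transition_def c(2) c'(2))
  qed
qed

section \<open>Ambient isotopies and paths of submanifolds\<close>

text \<open>Time is centred at \<open>r\<close> and runs over an open interval, which may leave
  \<open>[0, 1]\<close>, so that the product with it has no boundary. The inverse \<open>H'\<close>
  is carried along as data. Joint smoothness in space and time is demanded of \<open>H\<close>,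
  whose derivatives have to be controlled uniformly in time.\<close>

definition ambient_isotopy ::
  "'a manifold \<Rightarrow> 'a set \<Rightarrow> real \<Rightarrow> real \<Rightarrow> 'a set \<Rightarrow> (real \<Rightarrow> 'a \<Rightarrow> 'a) \<Rightarrow> (real \<Rightarrow> 'a \<Rightarrow> 'a) \<Rightarrow> bool" where
  "ambient_isotopy W Z r e L H H' \<longleftrightarrow>
     smap (times_interval W {r - e<..<r + e}) (topspace (mtop W) \<times> {r - e<..<r + e}) W (\<lambda>(p, u). H u p) \<and>
     (\<forall>p\<in>topspace (mtop W). H r p = p) \<and>
     (\<forall>u\<in>{r - e<..<r + e}. smap W (topspace (mtop W)) W (H' u) \<and>
        (\<forall>p\<in>topspace (mtop W). H u p \<in> topspace (mtop W) \<and> H' u (H u p) = p \<and> H u (H' u p) = p \<and>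
           (p \<notin> L \<or> p \<in> Z \<longrightarrow> H u p = p)))"

text \<open>The isotopy is supported in any prescribed neighbourhood \<open>T\<close> of the compact set \<open>K\<close>. This is what
  makes the notion stable under preimages along open embeddings.\<close>

definition iso_path :: "nat \<Rightarrow> 'a manifold \<Rightarrow> 'a set \<Rightarrow> (real \<Rightarrow> 'a set) \<Rightarrow> bool" where
  "iso_path k W Z \<gamma> \<longleftrightarrow>
     (\<forall>u\<in>{0..1}. \<gamma> u \<in> Psi_set k W) \<and> (\<forall>u\<in>{0..1}. \<forall>v\<in>{0..1}. \<gamma> u \<inter> Z = \<gamma> v \<inter> Z) \<and>
     (\<forall>r\<in>{0..1}. \<forall>K T. compactin (mtop W) K \<longrightarrow> openin (mtop W) T \<longrightarrow> K \<subseteq> T \<longrightarrow>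
        (\<exists>H H' L e. e > 0 \<and> compactin (mtop W) L \<and> L \<subseteq> T \<and> ambient_isotopy W Z r e L H H' \<and>
           (\<forall>u\<in>{r - e<..<r + e} \<inter> {0..1}. \<forall>p\<in>K. p \<in> \<gamma> u \<longleftrightarrow> H' u p \<in> \<gamma> r)))"

lemma ambient_isotopy_mono:
  "ambient_isotopy W Z r e L H H' \<Longrightarrow> Z' \<subseteq> Z \<Longrightarrow> ambient_isotopy W Z' r e L H H'"
  unfolding ambient_isotopy_def by blast

lemma iso_path_mono:
  assumes \<gamma>: "iso_path k W Z \<gamma>" and Z: "Z' \<subseteq> Z"
  shows "iso_path k W Z' \<gamma>"
  unfolding iso_path_def
proof (intro conjI ballI allI impI)
  show "\<gamma> u \<in> Psi_set k W" if "u \<in> {0..1}" for u using \<gamma> that by (simp add: iso_path_def)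
  show "\<gamma> u \<inter> Z' = \<gamma> v \<inter> Z'" if "u \<in> {0..1}" "v \<in> {0..1}" for u v
  proof -
    have "\<gamma> u \<inter> Z = \<gamma> v \<inter> Z" using \<gamma> that unfolding iso_path_def by blast
    then show ?thesis using Z by blast
  qed
  fix r K T assume "r \<in> {0..1::real}" "compactin (mtop W) K" "openin (mtop W) T" "K \<subseteq> T"
  with \<gamma> obtain H H' L e where *: "e > 0" "compactin (mtop W) L" "L \<subseteq> T" "ambient_isotopy W Z r e L H H'"
    "\<forall>u\<in>{r - e<..<r + e} \<inter> {0..1}. \<forall>p\<in>K. p \<in> \<gamma> u \<longleftrightarrow> H' u p \<in> \<gamma> r"
    unfolding iso_path_def by metis
  show "\<exists>H H' L e. e > 0 \<and> compactin (mtop W) L \<and> L \<subseteq> T \<and> ambient_isotopy W Z' r e L H H' \<and>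
      (\<forall>u\<in>{r - e<..<r + e} \<inter> {0..1}. \<forall>p\<in>K. p \<in> \<gamma> u \<longleftrightarrow> H' u p \<in> \<gamma> r)"
    using *(1-3,5) ambient_isotopy_mono[OF *(4) Z] by blast
qed

lemma Psi_set_subset: "P \<in> Psi_set k W \<Longrightarrow> P \<subseteq> topspace (mtop W)"
  by (simp add: Psi_set_def is_submanifold_def)

lemma ambient_isotopyD:
  assumes "ambient_isotopy W Z r e L H H'"
  shows ambient_isotopy_smap:
      "smap (times_interval W {r - e<..<r + e}) (topspace (mtop W) \<times> {r - e<..<r + e}) W (\<lambda>(p, u). H u p)"
    and ambient_isotopy_centre: "p \<in> topspace (mtop W) \<Longrightarrow> H r p = p"
    and ambient_isotopy_inv_smap: "u \<in> {r - e<..<r + e} \<Longrightarrow> smap W (topspace (mtop W)) W (H' u)"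
    and ambient_isotopy_topspace: "u \<in> {r - e<..<r + e} \<Longrightarrow> p \<in> topspace (mtop W) \<Longrightarrow> H u p \<in> topspace (mtop W)"
    and ambient_isotopy_inv_topspace:
      "u \<in> {r - e<..<r + e} \<Longrightarrow> p \<in> topspace (mtop W) \<Longrightarrow> H' u p \<in> topspace (mtop W)"
    and ambient_isotopy_inv1: "u \<in> {r - e<..<r + e} \<Longrightarrow> p \<in> topspace (mtop W) \<Longrightarrow> H' u (H u p) = p"
    and ambient_isotopy_inv2: "u \<in> {r - e<..<r + e} \<Longrightarrow> p \<in> topspace (mtop W) \<Longrightarrow> H u (H' u p) = p"
    and ambient_isotopy_fixed:
      "u \<in> {r - e<..<r + e} \<Longrightarrow> p \<in> topspace (mtop W) \<Longrightarrow> p \<notin> L \<or> p \<in> Z \<Longrightarrow> H u p = p"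
    and ambient_isotopy_inv_fixed:
      "u \<in> {r - e<..<r + e} \<Longrightarrow> p \<in> topspace (mtop W) \<Longrightarrow> p \<notin> L \<or> p \<in> Z \<Longrightarrow> H' u p = p"
proof -
  note a = assms[unfolded ambient_isotopy_def]
  show "smap (times_interval W {r - e<..<r + e}) (topspace (mtop W) \<times> {r - e<..<r + e}) W (\<lambda>(p, u). H u p)"
    using a by blast
  show "H r p = p" if "p \<in> topspace (mtop W)" using a that by blast
  assume u: "u \<in> {r - e<..<r + e}"
  show s: "smap W (topspace (mtop W)) W (H' u)" using a u by blast
  assume p: "p \<in> topspace (mtop W)"
  show "H u p \<in> topspace (mtop W)" "H' u (H u p) = p" "H u (H' u p) = p" using a u p by blast+
  show "H' u p \<in> topspace (mtop W)" by (rule smap_in_topspace[OF s p])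
  assume f: "p \<notin> L \<or> p \<in> Z"
  show "H u p = p" using a u p f by blast
  then show "H' u p = p" using \<open>H' u (H u p) = p\<close> by simp
qed

lemma ambient_isotopy_smap_at:
  assumes W: "smooth_manifold W" and H: "ambient_isotopy W Z r e L H H'" and u: "u \<in> {r - e<..<r + e}"
  shows "smap W (topspace (mtop W)) W (H u)"
proof -
  let ?J = "{r - e<..<r + e}"
  have "smap W (topspace (mtop W)) (times_interval W ?J) (\<lambda>p. (p, u))"
    by (rule smap_Pair[OF W W _ smap_id[OF W openin_topspace] sfun_const[OF W openin_topspace]]) (use u in auto)
  from smap_compose[OF this ambient_isotopy_smap[OF H]] u show ?thesis by simp
qed

text \<open>Outside \<open>\<Omega>\<close>, where \<open>F\<close> may fail to be injective, its
  values lie in \<open>Z\<close>, and over \<open>Z\<close> the path is constant. So only the part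
  of \<open>K\<close> over the complement of \<open>Z\<close> has to be moved. It lies in
  \<open>\<Omega>\<close>, where the isotopy of the target lifts through the diffeomorphism, and the
  lift is extended by the identity.\<close>

lemma iso_path_vimage:
  assumes W1: "smooth_manifold W1" and W2: "smooth_manifold W2"
    and F: "local_diffeo W1 (topspace (mtop W1)) W2 F"
    and \<Omega>: "diffeo_on W1 \<Omega> W2 F" and Z: "openin (mtop W2) Z"
    and cov: "\<And>p. p \<in> topspace (mtop W1) \<Longrightarrow> p \<notin> \<Omega> \<Longrightarrow> F p \<in> Z"
    and \<gamma>: "iso_path k W2 Z \<gamma>"
  shows "iso_path k W1 {p \<in> topspace (mtop W1). F p \<in> Z} (\<lambda>u. {p \<in> topspace (mtop W1). F p \<in> \<gamma> u})"
  unfolding iso_path_def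
proof (intro conjI ballI allI impI)
  let ?top1 = "topspace (mtop W1)" and ?top2 = "topspace (mtop W2)"
  let ?Z1 = "{p \<in> ?top1. F p \<in> Z}"
  have sF: "smap W1 ?top1 W2 F" by (rule local_diffeo_smap[OF W1 F])
  have \<gamma>Psi: "\<gamma> u \<in> Psi_set k W2" if "u \<in> {0..1}" for u using \<gamma> that by (simp add: iso_path_def)
  have \<gamma>Z: "\<gamma> u \<inter> Z = \<gamma> v \<inter> Z" if "u \<in> {0..1}" "v \<in> {0..1}" for u v using \<gamma> that unfolding iso_path_def by blast
  show "{p \<in> ?top1. F p \<in> \<gamma> u} \<in> Psi_set k W1" if "u \<in> {0..1}" for u
    by (rule Psi_set_vimage[OF W1 W2 F \<gamma>Psi[OF that]])
  show "{p \<in> ?top1. F p \<in> \<gamma> u} \<inter> ?Z1 = {p \<in> ?top1. F p \<in> \<gamma> v} \<inter> ?Z1" if "u \<in> {0..1}" "v \<in> {0..1}" for u v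
    using \<gamma>Z[OF that] by blast
  fix r K T assume r: "r \<in> {0..1::real}" and K: "compactin (mtop W1) K" and T: "openin (mtop W1) T" and KT: "K \<subseteq> T"
  define G where "G = inv_into \<Omega> F"
  have \<Omega>o: "openin (mtop W1) \<Omega>" and injF: "inj_on F \<Omega>" and F\<Omega>: "openin (mtop W2) (F ` \<Omega>)"
    and sG: "smap W2 (F ` \<Omega>) W1 G"
    using diffeo_onD[OF \<Omega>] by (auto simp: G_def)
  have \<Omega>t: "\<Omega> \<subseteq> ?top1" by (rule openin_subset[OF \<Omega>o])
  have GF: "G (F p) = p" if "p \<in> \<Omega>" for p using inv_into_f_f[OF injF that] by (simp add: G_def)
  have FG: "F (G q) = q" "G q \<in> \<Omega>" if "q \<in> F ` \<Omega>" for q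
    using that by (auto simp: G_def f_inv_into_f inv_into_into)
  have Z1: "openin (mtop W1) ?Z1" by (rule smap_preimage[OF sF Z])
  \<comment> \<open>The part of \<open>K\<close> that may move. It is compact because the preimage
    of \<open>Z\<close> is open, and the covering hypothesis puts it into
    \<open>\<Omega>\<close>.\<close>
  define K' where "K' = K \<inter> (?top1 - ?Z1)"
  have K': "compactin (mtop W1) K'"
    unfolding K'_def by (rule compact_Int_closedin[OF K]) (use Z1 in blast)
  have K'\<Omega>: "K' \<subseteq> \<Omega> \<inter> T" using cov KT by (auto simp: K'_def)
  have FK': "compactin (mtop W2) (F ` K')"
    by (rule image_compactin[OF K']) (use smap_continuous[OF sF] in simp)
  have T2: "openin (mtop W2) (F ` (\<Omega> \<inter> T))"
    by (rule diffeo_on_image[OF diffeo_on_subset[OF W1 W2 \<Omega>]]) (use \<Omega>o T in auto)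
  have "F ` K' \<subseteq> F ` (\<Omega> \<inter> T)" using K'\<Omega> by blast
  \<comment> \<open>The freedom to prescribe a neighbourhood for the support is used here: the
    support stays inside the image of \<open>\<Omega>\<close>, so that the isotopy lifts.\<close>
  with \<gamma> r FK' T2 obtain H H' L e where e: "e > 0" and L: "compactin (mtop W2) L" "L \<subseteq> F ` (\<Omega> \<inter> T)"
    and H: "ambient_isotopy W2 Z r e L H H'"
    and eq: "\<And>u q. u \<in> {r - e<..<r + e} \<inter> {0..1} \<Longrightarrow> q \<in> F ` K' \<Longrightarrow> q \<in> \<gamma> u \<longleftrightarrow> H' u q \<in> \<gamma> r"
    unfolding iso_path_def by metis
  let ?J = "{r - e<..<r + e}"
  define L1 where "L1 = G ` L"
  have L1: "compactin (mtop W1) L1"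
    unfolding L1_def
    by (rule image_compactin[OF _ smap_continuous[OF sG]]) (use L in \<open>auto simp: compactin_subtopology\<close>)
  have L1T: "L1 \<subseteq> \<Omega> \<inter> T" using L(2) GF by (auto simp: L1_def)
  have FL1: "F p \<in> L \<longleftrightarrow> p \<in> L1" if "p \<in> \<Omega>" for p
    using that GF FG L(2) by (force simp: L1_def)
  have top2: "F p \<in> ?top2" if "p \<in> ?top1" for p by (rule smap_in_topspace[OF sF that])
  \<comment> \<open>A point leaving the image of \<open>\<Omega>\<close> would arrive outside the
    support, where \<open>H u\<close> is the identity. By injectivity of \<open>H u\<close> it would
    not have moved at all.\<close>
  have H\<Omega>: "H u q \<in> F ` \<Omega>" if "u \<in> ?J" "q \<in> F ` \<Omega>" for u q
  proof (rule ccontr)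
    assume n: "H u q \<notin> F ` \<Omega>"
    have q: "q \<in> ?top2" using that(2) openin_subset[OF F\<Omega>] by blast
    have "H u (H u q) = H u q"
      using ambient_isotopy_fixed[OF H that(1) ambient_isotopy_topspace[OF H that(1) q]] n L(2) by blast
    then have "H u q = q"
      using ambient_isotopy_inv1[OF H that(1)] ambient_isotopy_topspace[OF H that(1) q] q by metis
    then show False using n that(2) by simp
  qed
  have H'\<Omega>: "H' u q \<in> F ` \<Omega>" if "u \<in> ?J" "q \<in> F ` \<Omega>" for u q
  proof (rule ccontr)
    assume n: "H' u q \<notin> F ` \<Omega>"
    have q: "q \<in> ?top2" using that(2) openin_subset[OF F\<Omega>] by blast
    have "H u (H' u q) = H' u q"
      using ambient_isotopy_fixed[OF H that(1) ambient_isotopy_inv_topspace[OF H that(1) q]] n L(2) by blast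
    then show False using n that(2) ambient_isotopy_inv2[OF H that(1) q] by simp
  qed
  define H1 where "H1 u p = (if p \<in> \<Omega> then G (H u (F p)) else p)" for u p
  define H1' where "H1' u p = (if p \<in> \<Omega> then G (H' u (F p)) else p)" for u p
  have JW1: "smooth_manifold (times_interval W1 ?J)" by (rule smooth_manifold_times_interval[OF W1]) simp
  \<comment> \<open>Since \<open>L1\<close> is closed, \<open>\<Omega>\<close> and the complement of
    \<open>L1\<close> form an open cover. The extension is the smooth lift on the first set and the
    identity on the second.\<close>
  have L1c: "closedin (mtop W1) L1" by (rule compactin_imp_closedin[OF smooth_manifold_Hausdorff[OF W1] L1])
  have fix1: "H1 u p = p" if "u \<in> ?J" "p \<in> ?top1" "p \<notin> L1 \<or> p \<in> ?Z1" for u p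
    using ambient_isotopy_fixed[OF H that(1) top2[OF that(2)]] that(3) FL1[of p] GF[of p]
    by (auto simp: H1_def)
  have fix1': "H1' u p = p" if "u \<in> ?J" "p \<in> ?top1" "p \<notin> L1 \<or> p \<in> ?Z1" for u p
    using ambient_isotopy_inv_fixed[OF H that(1) top2[OF that(2)]] that(3) FL1[of p] GF[of p]
    by (auto simp: H1'_def)
  have "ambient_isotopy W1 ?Z1 r e L1 H1 H1'"
    unfolding ambient_isotopy_def
  proof (intro conjI ballI impI)
    have top: "openin (mtop (times_interval W1 ?J)) (?top1 \<times> ?J)" by (intro openin_times_interval openin_topspace)
    show "smap (times_interval W1 ?J) (?top1 \<times> ?J) W1 (\<lambda>(p, u). H1 u p)"
    proof (rule smap_local[OF JW1 top])
      fix q assume q: "q \<in> ?top1 \<times> ?J"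
      have o: "openin (mtop (times_interval W1 ?J)) (\<Omega> \<times> ?J)" by (rule openin_times_interval[OF \<Omega>o])
      have "smap (times_interval W1 ?J) (\<Omega> \<times> ?J) W1 fst"
        by (rule smap_subset[OF JW1 smap_fst[OF W1] o]) (use \<Omega>t in auto)
      then have "smap (times_interval W1 ?J) (\<Omega> \<times> ?J) W2 (\<lambda>q. F (fst q))"
        by (rule smap_compose[OF _ diffeo_on_smap[OF \<Omega>]]) auto
      moreover have "sfun (times_interval W1 ?J) (\<Omega> \<times> ?J) snd"
        by (rule sfun_subset[OF JW1 sfun_snd[OF W1] o]) (use \<Omega>t in auto)
      ultimately have "smap (times_interval W1 ?J) (\<Omega> \<times> ?J) (times_interval W2 ?J) (\<lambda>q. (F (fst q), snd q))"
        by (rule smap_Pair[OF JW1 W2 open_greaterThanLessThan]) auto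
      from smap_compose[OF this ambient_isotopy_smap[OF H]]
      have "smap (times_interval W1 ?J) (\<Omega> \<times> ?J) W2 (\<lambda>q. H (snd q) (F (fst q)))"
        using top2 \<Omega>t by force
      from smap_compose[OF this sG]
      have s1: "smap (times_interval W1 ?J) (\<Omega> \<times> ?J) W1 (\<lambda>q. G (H (snd q) (F (fst q))))"
        using H\<Omega> by force
      have o2: "openin (mtop (times_interval W1 ?J)) ((?top1 - L1) \<times> ?J)"
        by (rule openin_times_interval) (use L1c in blast)
      have s2: "smap (times_interval W1 ?J) ((?top1 - L1) \<times> ?J) W1 fst"
        by (rule smap_subset[OF JW1 smap_fst[OF W1] o2]) auto
      show "\<exists>S G. q \<in> S \<and> smap (times_interval W1 ?J) S W1 G \<and>
          (\<forall>q\<in>?top1 \<times> ?J \<inter> S. (case q of (p, u) \<Rightarrow> H1 u p) = G q)"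
      proof (cases "fst q \<in> \<Omega>")
        case True
        then show ?thesis
          using s1 q
          by (intro exI[of _ "\<Omega> \<times> ?J"] exI[of _ "\<lambda>q. G (H (snd q) (F (fst q)))"]) (auto simp: H1_def)
      next
        case False
        then show ?thesis
          using s2 q fix1 L1T
          by (intro exI[of _ "(?top1 - L1) \<times> ?J"] exI[of _ fst]) auto
      qed
    qed
    show "H1 r p = p" if "p \<in> ?top1" for p
      using ambient_isotopy_centre[OF H top2[OF that]] GF[of p] by (simp add: H1_def)
    fix u assume u: "u \<in> ?J"
    show "smap W1 ?top1 W1 (H1' u)"
    proof (rule smap_local[OF W1 openin_topspace])
      fix p assume p: "p \<in> ?top1"
      from smap_compose[OF diffeo_on_smap[OF \<Omega>] ambient_isotopy_inv_smap[OF H u]]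
      have "smap W1 \<Omega> W2 (\<lambda>p. H' u (F p))" using top2 \<Omega>t by blast
      from smap_compose[OF this sG] have s1: "smap W1 \<Omega> W1 (\<lambda>p. G (H' u (F p)))" using H'\<Omega>[OF u] by blast
      have s2: "smap W1 (?top1 - L1) W1 (\<lambda>p. p)" by (rule smap_id[OF W1]) (use L1c in blast)
      show "\<exists>S G. p \<in> S \<and> smap W1 S W1 G \<and> (\<forall>q\<in>?top1 \<inter> S. H1' u q = G q)"
      proof (cases "p \<in> \<Omega>")
        case True
        then show ?thesis
          using s1 by (intro exI[of _ \<Omega>] exI[of _ "\<lambda>p. G (H' u (F p))"]) (auto simp: H1'_def)
      next
        case False
        then show ?thesis
          using s2 p fix1'[OF u] L1T by (intro exI[of _ "?top1 - L1"] exI[of _ "\<lambda>p. p"]) auto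
      qed
    qed
    fix p assume p: "p \<in> ?top1"
    show "H1 u p \<in> ?top1"
      using p \<Omega>t FG(2)[OF H\<Omega>[OF u]] by (auto simp: H1_def)
    show "H1' u (H1 u p) = p"
      using p FG[OF H\<Omega>[OF u, of "F p"]] ambient_isotopy_inv1[OF H u top2[OF p]] GF[of p]
      by (auto simp: H1_def H1'_def)
    show "H1 u (H1' u p) = p"
      using p FG[OF H'\<Omega>[OF u, of "F p"]] ambient_isotopy_inv2[OF H u top2[OF p]] GF[of p]
      by (auto simp: H1_def H1'_def)
    show "H1 u p = p" if "p \<notin> L1 \<or> p \<in> ?Z1" by (rule fix1[OF u p that])
  qed
  moreover have "p \<in> {p \<in> ?top1. F p \<in> \<gamma> u} \<longleftrightarrow> H1' u p \<in> {p \<in> ?top1. F p \<in> \<gamma> r}"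
    if u: "u \<in> ?J \<inter> {0..1}" and p: "p \<in> K" for u p
  proof -
    have pt: "p \<in> ?top1" using K p compactin_subset_topspace by blast
    show ?thesis
    proof (cases "F p \<in> Z")
      case True
      then have "H1' u p = p" using fix1'[of u p] u pt by blast
      moreover have "F p \<in> \<gamma> u \<longleftrightarrow> F p \<in> \<gamma> r" using \<gamma>Z[of u r] u r True by blast
      ultimately show ?thesis using pt by simp
    next
      case False
      then have pK: "p \<in> K'" using p pt by (simp add: K'_def)
      then have p\<Omega>: "p \<in> \<Omega>" using K'\<Omega> by blast
      have H1'p: "H1' u p \<in> \<Omega>" "F (H1' u p) = H' u (F p)"
        using FG[OF H'\<Omega>[of u "F p"]] p\<Omega> u by (auto simp: H1'_def)
      have "F p \<in> \<gamma> u \<longleftrightarrow> H' u (F p) \<in> \<gamma> r" by (rule eq[OF u]) (use pK in blast)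
      then show ?thesis using pt H1'p \<Omega>t by auto
    qed
  qed
  ultimately show "\<exists>H H' L e. e > 0 \<and> compactin (mtop W1) L \<and> L \<subseteq> T \<and> ambient_isotopy W1 ?Z1 r e L H H' \<and>
      (\<forall>u\<in>{r - e<..<r + e} \<inter> {0..1}. \<forall>p\<in>K.
         p \<in> {p \<in> ?top1. F p \<in> \<gamma> u} \<longleftrightarrow> H' u p \<in> {p \<in> ?top1. F p \<in> \<gamma> r})"
    using e L1 L1T by blast
qed

section \<open>Closeness of ambient isotopies in the strong topology\<close>

lemma tube_times_interval:
  assumes C: "compactin (mtop W) C" and N: "openin (mtop (times_interval W J)) N"
    and J: "open J" "r \<in> J" and sub: "\<And>p. p \<in> C \<Longrightarrow> (p, r) \<in> N"
  shows "\<forall>\<^sub>F u in nhds r. \<forall>p\<in>C. (p, u) \<in> N"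
proof -
  obtain U V where UV: "openin (subtopology euclideanreal J) V" "C \<subseteq> U" "r \<in> V" "U \<times> V \<subseteq> N"
    using tube_lemma_left[OF N[unfolded mtop_times_interval] C, of r] J sub by auto
  have "open V" using UV(1) J(1) by (simp add: openin_open_subtopology)
  then show ?thesis
    using UV eventually_nhds by (smt (verit) SigmaI subsetD)
qed

lemma partial_derivs_cong:
  assumes U: "openin (Euclidean_space n) U" and fg: "\<And>y. y \<in> U \<Longrightarrow> f y = g y"
    and s: "set is \<subseteq> {..<n}" and x: "x \<in> U"
  shows "partial_derivs is f x = partial_derivs is g x"
  using s x
proof (induction "is" arbitrary: x)
  case (Cons i "is")
  have i: "i < n" using Cons.prems by simp
  have "\<forall>\<^sub>F t in nhds (x i). partial_derivs is f (x(i := t)) = partial_derivs is g (x(i := t))"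
    using cube_upd[OF U Cons.prems(2) i] by (rule eventually_mono) (use Cons in auto)
  then show ?case unfolding partial_derivs_Cons partial_deriv_def by (rule deriv_cong_ev) simp
qed (use fg in auto)

lemma smooth_open_partial_derivs:
  "smooth_open n U f \<Longrightarrow> set is \<subseteq> {..<n} \<Longrightarrow> smooth_open n U (partial_derivs is f)"
  by (induction "is") (auto simp: partial_derivs_Cons intro: smooth_open_partial_deriv)

text \<open>Replacing the atlas by the maximal one makes the charts of a manifold available in products
  with an interval.\<close>

lemma smooth_manifold_max_atlas:
  assumes M: "smooth_manifold M"
  defines "M' \<equiv> M\<lparr>matlas := max_atlas M\<rparr>"
  shows "smooth_manifold M'" and "sfun M' = sfun M" and "mtop M' = mtop M" and "mdim M' = mdim M"
    and "matlas M' = max_atlas M"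
proof -
  show simps: "mtop M' = mtop M" "mdim M' = mdim M" "matlas M' = max_atlas M" by (simp_all add: M'_def)
  show sf: "sfun M' = sfun M"
  proof (intro ext iffI)
    fix T f
    show "sfun M T f" if "sfun M' T f"
      using that matlas_subset_max_atlas[OF M] unfolding sfun_def simps by blast
    show "sfun M' T f" if f: "sfun M T f"
      using sfun_openin[OF f] f max_atlas_iff[OF M] unfolding sfun_def[of M'] simps by blast
  qed
  have cov: "(\<Union>(U, \<phi>)\<in>max_atlas M. U) = topspace (mtop M)"
  proof
    show "(\<Union>(U, \<phi>)\<in>max_atlas M. U) \<subseteq> topspace (mtop M)"
      using openin_subset chart_openin[OF max_atlas_is_chart] by blast
    show "topspace (mtop M) \<subseteq> (\<Union>(U, \<phi>)\<in>max_atlas M. U)"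
      using smooth_manifold_cover[OF M] matlas_subset_max_atlas[OF M] by blast
  qed
  have "smooth_transition (mdim M) c c'" if c: "c \<in> max_atlas M" "c' \<in> max_atlas M" for c c'
  proof -
    obtain U \<phi> V \<psi> where cc: "c = (U, \<phi>)" "c' = (V, \<psi>)" by (metis surj_pair)
    have ch: "is_chart (Euclidean_space (mdim M)) (mtop M) (U, \<phi>)" by (rule max_atlas_is_chart) (use c cc in simp)
    have "sfun M V (\<lambda>p. \<psi> p j)" for j using c(2) unfolding cc max_atlas_iff[OF M] by blast
    then have s: "smooth_open (mdim M) (\<phi> ` (U \<inter> V)) (\<lambda>x. \<psi> (inv_into U \<phi> x) j)" for j
      using c(1) unfolding cc max_atlas_iff[OF M] by blast
    then show ?thesis
      unfolding smooth_transition_def cc prod.case smooth_on_open_iff[OF smooth_open_imp_openin[OF s]] by blast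
  qed
  then show "smooth_manifold M'"
    unfolding smooth_manifold_def simps using cov smooth_manifold_Hausdorff[OF M] max_atlas_is_chart by blast
qed

text \<open>Read in charts, the inverse of \<open>H u\<close> is a left inverse of the coordinate
  expression of \<open>H u\<close>, so by the chain rule the derivative on the submanifold has no
  kernel. The homeomorphism onto the image is inherited from the ambient one.\<close>

lemma ambient_isotopy_embedding:
  assumes W: "smooth_manifold W" and P: "is_submanifold k W P"
    and H: "ambient_isotopy W Z r e L H H'" and u: "u \<in> {r - e<..<r + e}"
  shows "H u \<in> embeddings (submanifold k W P) W"
proof -
  let ?S = "submanifold k W P" and ?top = "topspace (mtop W)"
  have S: "smooth_manifold ?S" by (rule smooth_manifold_submanifold[OF W P])
  have Pt: "P \<subseteq> ?top" using P by (simp add: is_submanifold_def)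
  have tS: "topspace (mtop ?S) = P" using Pt by auto
  have sH: "smap W ?top W (H u)" by (rule ambient_isotopy_smap_at[OF W H u])
  have sH': "smap W ?top W (H' u)" by (rule ambient_isotopy_inv_smap[OF H u])
  have sHS: "smap ?S P W (H u)" by (rule smap_compose[OF smap_submanifold[OF W P] sH]) (use Pt in blast)
  have sm: "smooth_map ?S W (H u)" unfolding smooth_map_iff_smap[OF S W] tS by (rule sHS)
  have "v i = 0"
    if c: "(U, \<phi>) \<in> matlas ?S" and c': "(V, \<psi>) \<in> matlas W" and p: "p \<in> U" "H u p \<in> V"
      and v: "\<forall>j<mdim W. (\<Sum>i<k. v i * partial_deriv i (\<lambda>x. \<psi> (H u (inv_into U \<phi> x)) j) (\<phi> p)) = 0" and i: "i < k"
    for U \<phi> V \<psi> p v i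
  proof -
    obtain U0 where c0: "(U0, \<phi>) \<in> slice_charts k W P" "U = U0 \<inter> P" using c by (auto simp: submanifold_def)
    then have cm: "(U0, \<phi>) \<in> max_atlas W" by (simp add: slice_charts_def)
    have inj0: "inj_on \<phi> U0" by (rule chart_inj[OF max_atlas_is_chart[OF cm]])
    have inj: "inj_on \<phi> U" using inj0 c0(2) by (auto intro: inj_on_subset)
    have inj': "inj_on \<psi> V" by (rule chart_inj[OF smooth_manifold_is_chart[OF W c']])
    define S1 where "S1 = {q \<in> P. H u q \<in> V}"
    define A where "A = \<phi> ` (U \<inter> S1)"
    define a where "a x = \<psi> (H u (inv_into U \<phi> x))" for x
    have sa: "smooth_open k A (\<lambda>x. a x j)" for j
      using sfunD[OF smap_sfun[OF sHS sfun_chart_coord[OF W c']] c] by (simp add: A_def S1_def a_def)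
    \<comment> \<open>Coordinate \<open>i\<close> of the inverse. It uses the slice chart on the
      open set \<open>U0\<close> of \<open>W\<close> instead of its restriction to the submanifold,
      in order to be smooth on an open subset of the target chart.\<close>
    define b where "b y = \<phi> (H' u (inv_into V \<psi> y)) i" for y
    define S2 where "S2 = {q \<in> ?top. H' u q \<in> U0}"
    have "sfun W U0 (\<lambda>q. \<phi> q i)" using cm unfolding max_atlas_iff[OF W] by blast
    then have sb: "smooth_open (mdim W) (\<psi> ` (V \<inter> S2)) b"
      using sfunD[OF smap_sfun[OF sH'] c'] by (auto simp: S2_def b_def[abs_def])
    have inS: "q \<in> ?top" "a (\<phi> q) = \<psi> (H u q)" "a (\<phi> q) \<in> \<psi> ` (V \<inter> S2)" "b (a (\<phi> q)) = \<phi> q i"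
      if "q \<in> U \<inter> S1" for q
    proof -
      show q: "q \<in> ?top" using that Pt by (auto simp: S1_def)
      show aq: "a (\<phi> q) = \<psi> (H u q)" using that inv_into_f_f[OF inj, of q] by (simp add: a_def)
      have "H u q \<in> S2"
        using ambient_isotopy_topspace[OF H u q] ambient_isotopy_inv1[OF H u q] that c0(2) by (simp add: S2_def)
      then show "a (\<phi> q) \<in> \<psi> ` (V \<inter> S2)" using aq that by (auto simp: S1_def)
      show "b (a (\<phi> q)) = \<phi> q i"
        using inv_into_f_f[OF inj', of "H u q"] that ambient_isotopy_inv1[OF H u q] aq by (simp add: b_def S1_def)
    qed
    have pS: "p \<in> U \<inter> S1" using p c0(2) by (auto simp: S1_def)
    have xA: "\<phi> p \<in> A" using pS by (auto simp: A_def)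
    have oA: "openin (Euclidean_space k) A" by (rule smooth_open_imp_openin[OF sa])
    \<comment> \<open>Differentiation of \<open>b (a x) = x i\<close>. Weighted with the kernel
      vector \<open>v\<close> and summed over the directions, one side becomes \<open>0\<close> and
      the other \<open>v i\<close>.\<close>
    have chain: "(\<Sum>j<mdim W. partial_deriv j b (a (\<phi> p)) * partial_deriv l (\<lambda>x. a x j) (\<phi> p)) =
        (if l = i then 1 else 0)" if l: "l < k" for l
    proof -
      have "partial_deriv l (\<lambda>x. b (a x)) (\<phi> p) = (\<Sum>j<mdim W. partial_deriv j b (a (\<phi> p)) * partial_deriv l (\<lambda>x. a x j) (\<phi> p))"
        by (rule partial_deriv_compose[OF sb oA sa _ xA l]) (use inS in \<open>auto simp: A_def\<close>)
      moreover have "((\<lambda>t. b (a ((\<phi> p)(l := t)))) has_real_derivative (if l = i then 1 else 0)) (at (\<phi> p l))"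
        by (subst has_partial_cong[OF oA xA l, of "\<lambda>x. b (a x)" "\<lambda>x. x i"])
           (use inS in \<open>auto simp: A_def\<close>)
      ultimately show ?thesis using partial_deriv_unique[of "\<lambda>x. b (a x)"] by simp
    qed
    have "(\<Sum>l<k. v l * (if l = i then 1 else 0)) = (\<Sum>l<k. if l = i then v l else 0)"
      by (rule sum.cong) auto
    then have "v i = (\<Sum>l<k. v l * (if l = i then 1 else 0))" using i by simp
    also have "\<dots> = (\<Sum>l<k. v l * (\<Sum>j<mdim W. partial_deriv j b (a (\<phi> p)) * partial_deriv l (\<lambda>x. a x j) (\<phi> p)))"
      by (rule sum.cong) (use chain in auto)
    also have "\<dots> = (\<Sum>l<k. \<Sum>j<mdim W. partial_deriv j b (a (\<phi> p)) * (v l * partial_deriv l (\<lambda>x. a x j) (\<phi> p)))"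
      by (simp add: sum_distrib_left algebra_simps)
    also have "\<dots> = (\<Sum>j<mdim W. \<Sum>l<k. partial_deriv j b (a (\<phi> p)) * (v l * partial_deriv l (\<lambda>x. a x j) (\<phi> p)))"
      by (rule sum.swap)
    also have "\<dots> = (\<Sum>j<mdim W. partial_deriv j b (a (\<phi> p)) * (\<Sum>l<k. v l * partial_deriv l (\<lambda>x. a x j) (\<phi> p)))"
      by (simp add: sum_distrib_left)
    also have "\<dots> = 0" using v by (simp add: a_def)
    finally show ?thesis .
  qed
  then have imm: "immersion ?S W (H u)"
    unfolding immersion_def submanifold_simps(1) using sm by blast
  have "homeomorphic_maps (mtop W) (mtop W) (H u) (H' u)"
    unfolding homeomorphic_maps_def
    using smap_continuous[OF sH] smap_continuous[OF sH'] ambient_isotopy_inv1[OF H u] ambient_isotopy_inv2[OF H u]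
    by simp
  then have hom: "homeomorphic_map (mtop W) (mtop W) (H u)" by (rule homeomorphic_maps_imp_map)
  have "homeomorphic_map (subtopology (mtop W) P) (subtopology (mtop W) (H u ` P)) (H u)"
    by (rule homeomorphic_map_subtopologies[OF hom])
       (use Pt ambient_isotopy_topspace[OF H u] in auto)
  then have "embedding_map (mtop ?S) (mtop W) (H u)"
    unfolding embedding_map_def tS by simp
  then show ?thesis using imm by (simp add: embeddings_def)
qed

text \<open>A space derivative of the joint map is continuous in space and time, and its difference
  from the value at time \<open>r\<close> vanishes at time \<open>r\<close>. The tube lemma over the
  compact set \<open>C\<close> makes this difference small for all nearby times at once.\<close>

lemma ambient_isotopy_close_on_chart:
  assumes W: "smooth_manifold W" and P: "is_submanifold k W P"
    and H: "ambient_isotopy W Z r e L H H'" and e: "e > 0"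
    and c: "(U, \<phi>) \<in> max_atlas (submanifold k W P)" and c': "(V, \<psi>) \<in> max_atlas W"
    and C: "compactin (mtop (submanifold k W P)) C" "C \<subseteq> U" "C \<subseteq> V" and \<epsilon>: "\<epsilon> > 0"
    and s: "set is \<subseteq> {..<k}"
  shows "\<forall>\<^sub>F u in nhds r. H u ` C \<subseteq> V \<and> (\<forall>x\<in>\<phi> ` C.
      \<bar>partial_derivs is (\<lambda>y. \<psi> (H u (inv_into U \<phi> y)) j) x - partial_derivs is (\<lambda>y. \<psi> (inv_into U \<phi> y) j) x\<bar> < \<epsilon>)"
proof -
  let ?S = "submanifold k W P" and ?top = "topspace (mtop W)" and ?J = "{r - e<..<r + e}"
  have S: "smooth_manifold ?S" by (rule smooth_manifold_submanifold[OF W P])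
  have Pt: "P \<subseteq> ?top" using P by (simp add: is_submanifold_def)
  define S' where "S' = ?S\<lparr>matlas := max_atlas ?S\<rparr>"
  note S'p = smooth_manifold_max_atlas[OF S, folded S'_def]
  note S' = S'p(1)
  have tS': "topspace (mtop S') = P" using Pt S'p(3) by auto
  have incl: "smap S' P W (\<lambda>p. p)"
    using smap_submanifold[OF W P] unfolding smap_def S'p(2,3) .
  define SJ where "SJ = times_interval S' ?J"
  have SJ: "smooth_manifold SJ" unfolding SJ_def by (rule smooth_manifold_times_interval[OF S']) simp
  have J: "open ?J" "r \<in> ?J" using e by auto
  have dSJ: "mdim SJ = Suc k" using S'p(4) by (simp add: SJ_def)
  have sfst: "smap SJ (P \<times> ?J) S' fst"
    unfolding SJ_def using smap_fst[OF S' J(1)] by (simp only: tS')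
  have ssnd: "sfun SJ (P \<times> ?J) snd"
    unfolding SJ_def using sfun_snd[OF S' J(1)] by (simp only: tS')
  have "smap SJ (P \<times> ?J) W fst" by (rule smap_compose[OF sfst incl]) auto
  from smap_Pair[OF SJ W J(1) this ssnd]
  have "smap SJ (P \<times> ?J) (times_interval W ?J) (\<lambda>q. (fst q, snd q))" by auto
  from smap_compose[OF this ambient_isotopy_smap[OF H]]
  have sH: "smap SJ (P \<times> ?J) W (\<lambda>q. H (snd q) (fst q))" using Pt by (auto simp: case_prod_beta')
  define Q where "Q = {q \<in> P \<times> ?J. H (snd q) (fst q) \<in> V}"
  have "sfun W V (\<lambda>p. \<psi> p j)" using c' unfolding max_atlas_iff[OF W] by blast
  from smap_sfun[OF sH this] have sf: "sfun SJ Q (\<lambda>q. \<psi> (H (snd q) (fst q)) j)" by (simp add: Q_def)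
  define \<Phi> where "\<Phi> = (\<lambda>(x, t). (\<phi> x)(k := t))"
  have cS': "(U, \<phi>) \<in> matlas S'" using c S'p(5) by simp
  have c\<Phi>: "(U \<times> ?J, \<Phi>) \<in> matlas SJ"
    using matlas_times_interval[OF cS', of ?J] S'p(4) by (simp add: SJ_def \<Phi>_def)
  have chU: "is_chart (Euclidean_space k) (mtop S') (U, \<phi>)"
    using smooth_manifold_is_chart[OF S' cS'] S'p(4) by simp
  have inj: "inj_on \<phi> U" by (rule chart_inj[OF chU])
  note inv = product_chart_inv[OF chU J(1), folded \<Phi>_def]
  have inj\<Phi>: "inj_on \<Phi> (U \<times> ?J)" by (rule chart_inj[OF smooth_manifold_is_chart[OF SJ c\<Phi>]])
  define q where "q z = (\<lambda>q. \<psi> (H (snd q) (fst q)) j) (inv_into (U \<times> ?J) \<Phi> z)" for z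
  define V' where "V' = \<Phi> ` (U \<times> ?J \<inter> Q)"
  have "smooth_open (Suc k) V' q"
    using sfunD[OF sf c\<Phi>] by (simp add: V'_def q_def[abs_def] dSJ)
  then have dq: "smooth_open (mdim SJ) V' (partial_derivs is q)"
    unfolding dSJ by (rule smooth_open_partial_derivs) (use s in auto)
  define Q' where "Q' = {w \<in> U \<times> ?J. \<Phi> w \<in> V'}"
  have Q'eq: "Q' = U \<times> ?J \<inter> Q" using inj\<Phi> by (auto simp: Q'_def V'_def inj_on_def)
  \<comment> \<open>The space derivatives of \<open>H\<close> as one smooth function on the product
    with time. By \<open>partial_derivs_param\<close> its value at \<open>(p, u)\<close> is the
    derivative of \<open>H u\<close> at \<open>p\<close>.\<close>
  define g where "g w = partial_derivs is q (\<Phi> w)" for w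
  have sg: "sfun SJ Q' g"
    unfolding Q'_def g_def by (rule sfun_compose_chart[OF SJ matlas_subset_max_atlas[OF SJ c\<Phi>] dq])
  have "smap SJ (P \<times> ?J) SJ (\<lambda>q. (fst q, r))"
    unfolding SJ_def
    by (rule smap_Pair[OF SJ[unfolded SJ_def] S' J(1) sfst[unfolded SJ_def]
          sfun_const[OF SJ[unfolded SJ_def] sfun_openin[OF ssnd[unfolded SJ_def]]]])
       (use J in auto)
  from smap_sfun[OF this sg] have sgr: "sfun SJ {w \<in> P \<times> ?J. (fst w, r) \<in> Q'} (\<lambda>w. g (fst w, r))" .
  define Q2 where "Q2 = Q' \<inter> {w \<in> P \<times> ?J. (fst w, r) \<in> Q'}"
  have Q2o: "openin (mtop SJ) Q2" unfolding Q2_def using sfun_openin[OF sg] sfun_openin[OF sgr] by blast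
  have "sfun SJ Q2 (\<lambda>w. g w - g (fst w, r))"
    by (rule sfun_diff[OF SJ sfun_subset[OF SJ sg Q2o] sfun_subset[OF SJ sgr Q2o]]) (auto simp: Q2_def)
  then have N: "openin (mtop SJ) {w \<in> Q2. g w - g (fst w, r) \<in> {-\<epsilon><..<\<epsilon>}}"
    by (rule sfun_preimage[OF SJ]) simp
  have Ct: "C \<subseteq> P" using compactin_subset_topspace[OF C(1)] by auto
  have Cr: "(p, r) \<in> Q'" if "p \<in> C" for p
  proof -
    have "p \<in> U" "p \<in> V" "p \<in> P" "p \<in> ?top" using that C Ct Pt by blast+
    then show ?thesis using J(2) ambient_isotopy_centre[OF H, of p] by (simp add: Q'eq Q_def)
  qed
  have "\<forall>\<^sub>F u in nhds r. \<forall>p\<in>C. (p, u) \<in> {w \<in> Q2. g w - g (fst w, r) \<in> {-\<epsilon><..<\<epsilon>}}"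
  proof (rule tube_times_interval[of S', OF _ N[unfolded SJ_def] J])
    show "compactin (mtop S') C" using C(1) S'p(3) by simp
    show "(p, r) \<in> {w \<in> Q2. g w - g (fst w, r) \<in> {-\<epsilon><..<\<epsilon>}}" if "p \<in> C" for p
      using that Cr[OF that] Ct J(2) \<epsilon> by (auto simp: Q2_def)
  qed
  moreover have "\<forall>\<^sub>F u in nhds r. u \<in> ?J" by (rule eventually_nhds_in_open[OF J])
  ultimately show ?thesis
  proof eventually_elim
    case (elim u)
    have gv: "g (p, u) = partial_derivs is (\<lambda>y. \<psi> (H u (inv_into U \<phi> y)) j) (\<phi> p)"
      if u: "u \<in> ?J" and p: "p \<in> U" for u p
    proof -
      have "g (p, u) = partial_derivs is (\<lambda>y. q (y(k := u))) (\<phi> p)"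
        unfolding g_def \<Phi>_def prod.case by (rule partial_derivs_param[OF s, symmetric])
      also have "\<dots> = partial_derivs is (\<lambda>y. \<psi> (H u (inv_into U \<phi> y)) j) (\<phi> p)"
      proof (rule partial_derivs_cong[OF chart_image[OF chU] _ s])
        fix y assume "y \<in> \<phi> ` U"
        then obtain x where x: "x \<in> U" "y = \<phi> x" by blast
        then show "q (y(k := u)) = \<psi> (H u (inv_into U \<phi> y)) j"
          using inv[OF x(1) u] inv_into_f_f[OF inj x(1)] by (simp add: q_def)
      qed (use p in blast)
      finally show ?thesis .
    qed
    have g0: "g (p, r) = partial_derivs is (\<lambda>y. \<psi> (inv_into U \<phi> y) j) (\<phi> p)" if p: "p \<in> U" for p
    proof -
      have "H r (inv_into U \<phi> y) = inv_into U \<phi> y" if "y \<in> \<phi> ` U" for y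
      proof -
        have "inv_into U \<phi> y \<in> U" by (rule inv_into_into[OF that])
        moreover have "U \<subseteq> P" using openin_subset[OF chart_openin[OF chU]] tS' by simp
        ultimately show ?thesis using Pt by (blast intro: ambient_isotopy_centre[OF H])
      qed
      then have "partial_derivs is (\<lambda>y. \<psi> (H r (inv_into U \<phi> y)) j) (\<phi> p) = partial_derivs is (\<lambda>y. \<psi> (inv_into U \<phi> y) j) (\<phi> p)"
        by (intro partial_derivs_cong[OF chart_image[OF chU] _ s]) (use p in auto)
      then show ?thesis using gv[OF J(2) p] by simp
    qed
    have "H u p \<in> V \<and> \<bar>partial_derivs is (\<lambda>y. \<psi> (H u (inv_into U \<phi> y)) j) (\<phi> p)
        - partial_derivs is (\<lambda>y. \<psi> (inv_into U \<phi> y) j) (\<phi> p)\<bar> < \<epsilon>" if p: "p \<in> C" for p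
    proof -
      have *: "(p, u) \<in> Q2" "g (p, u) - g (p, r) \<in> {-\<epsilon><..<\<epsilon>}" using elim(1) p by auto
      have "p \<in> U" using p C(2) by blast
      then show ?thesis using * gv[OF elim(2)] g0 by (auto simp: Q2_def Q'eq Q_def)
    qed
    then show ?case by blast
  qed
qed

text \<open>Finitely many of the neighbourhoods provided by local finiteness cover the compact
  set.\<close>

lemma strong_data_finite_meet:
  assumes D: "is_strong_data S W f D" and K: "compactin (mtop S) K"
  shows "finite {(U, z) \<in> D. U \<inter> K \<noteq> {}}"
proof -
  have "\<forall>p\<in>K. \<exists>G. openin (mtop S) G \<and> p \<in> G \<and> finite {(U, z) \<in> D. U \<inter> G \<noteq> {}}"
    using D compactin_subset_topspace[OF K] unfolding is_strong_data_def by blast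
  from bchoice[OF this] obtain G where G: "\<And>p. p \<in> K \<Longrightarrow> openin (mtop S) (G p)" "\<And>p. p \<in> K \<Longrightarrow> p \<in> G p"
    "\<And>p. p \<in> K \<Longrightarrow> finite {(U, z) \<in> D. U \<inter> G p \<noteq> {}}" by blast
  obtain \<F> where \<F>: "finite \<F>" "\<F> \<subseteq> G ` K" "K \<subseteq> \<Union>\<F>"
    using compactinD[OF K, of "G ` K"] G by blast
  have "{(U, z) \<in> D. U \<inter> K \<noteq> {}} \<subseteq> (\<Union>X\<in>\<F>. {(U, z) \<in> D. U \<inter> X \<noteq> {}})"
    using \<F>(3) by blast
  moreover have "finite (\<Union>X\<in>\<F>. {(U, z) \<in> D. U \<inter> X \<noteq> {}})"
    using \<F> G(3) by blast
  ultimately show ?thesis by (rule finite_subset)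
qed

text \<open>The support meets only finitely many members of the locally finite data, and each of
  these is controlled for times near \<open>r\<close>. All others belong to charts on which
  \<open>H u\<close> is the identity. This is where compact support meets the demands of the strong
  topology.\<close>

lemma ambient_isotopy_strong_basic:
  assumes W: "smooth_manifold W" and P: "is_submanifold k W P" and Pc: "closedin (mtop W) P"
    and H: "ambient_isotopy W Z r e L H H'" and e: "e > 0" and L: "compactin (mtop W) L"
    and D: "is_strong_data (submanifold k W P) W (\<lambda>x. x) D"
  shows "\<forall>\<^sub>F u in nhds r. H u \<in> strong_basic (submanifold k W P) W (\<lambda>x. x) D m"
proof -
  let ?S = "submanifold k W P" and ?J = "{r - e<..<r + e}"
  have S: "smooth_manifold ?S" by (rule smooth_manifold_submanifold[OF W P])
  have Pt: "P \<subseteq> topspace (mtop W)" using P by (simp add: is_submanifold_def)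
  define good where "good = (\<lambda>u (U, \<phi>, C, V, \<psi>, \<epsilon>). H u ` C \<subseteq> V \<and>
     (\<forall>x\<in>\<phi> ` C. \<forall>is. set is \<subseteq> {..<k} \<and> length is \<le> m \<longrightarrow> (\<forall>j<mdim W.
        \<bar>partial_derivs is (\<lambda>y. \<psi> (H u (inv_into U \<phi> y)) j) x - partial_derivs is (\<lambda>y. \<psi> (inv_into U \<phi> y) j) x\<bar> < \<epsilon>)))"
  have tup: "(U, \<phi>) \<in> max_atlas ?S" "(V, \<psi>) \<in> max_atlas W" "compactin (mtop ?S) C" "C \<subseteq> U" "C \<subseteq> V" "\<epsilon> > 0"
    if "(U, \<phi>, C, V, \<psi>, \<epsilon>) \<in> D" for U \<phi> C V \<psi> \<epsilon>
    using D that unfolding is_strong_data_def by auto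
  \<comment> \<open>Closedness of \<open>P\<close> enters here: it makes the moved part of the
    submanifold compact.\<close>
  have "compactin (mtop ?S) (L \<inter> P)"
    using compact_Int_closedin[OF L Pc] by (simp add: compactin_subtopology)
  from strong_data_finite_meet[OF D this] have fin: "finite {(U, z) \<in> D. U \<inter> (L \<inter> P) \<noteq> {}}" .
  have fl: "finite {is::nat list. set is \<subseteq> {..<k} \<and> length is \<le> m}"
    by (rule finite_lists_length_le) simp
  have "\<forall>\<^sub>F u in nhds r. good u t" if t: "t \<in> D" for t
  proof -
    obtain U \<phi> C V \<psi> \<epsilon> where teq: "t = (U, \<phi>, C, V, \<psi>, \<epsilon>)" by (metis surj_pair)
    note tu = tup[OF t[unfolded teq]]
    have ev: "\<forall>\<^sub>F u in nhds r. H u ` C \<subseteq> V \<and> (\<forall>x\<in>\<phi> ` C.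
        \<bar>partial_derivs is (\<lambda>y. \<psi> (H u (inv_into U \<phi> y)) j) x - partial_derivs is (\<lambda>y. \<psi> (inv_into U \<phi> y) j) x\<bar> < \<epsilon>)"
      if "set is \<subseteq> {..<k}" for "is" j
      by (rule ambient_isotopy_close_on_chart[OF W P H e tu that])
    have "\<forall>\<^sub>F u in nhds r. \<forall>is\<in>{is. set is \<subseteq> {..<k} \<and> length is \<le> m}. \<forall>j\<in>{..<mdim W}.
        H u ` C \<subseteq> V \<and> (\<forall>x\<in>\<phi> ` C.
        \<bar>partial_derivs is (\<lambda>y. \<psi> (H u (inv_into U \<phi> y)) j) x - partial_derivs is (\<lambda>y. \<psi> (inv_into U \<phi> y) j) x\<bar> < \<epsilon>)"
      by (intro eventually_ball_finite fl ballI finite_lessThan ev) auto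
    moreover have "\<forall>\<^sub>F u in nhds r. H u ` C \<subseteq> V" using ev[of "[]"] by (rule eventually_mono) auto
    ultimately show ?thesis
      unfolding good_def teq prod.case by eventually_elim auto
  qed
  then have "\<forall>\<^sub>F u in nhds r. \<forall>t\<in>{(U, z) \<in> D. U \<inter> (L \<inter> P) \<noteq> {}}. good u t"
    by (intro eventually_ball_finite[OF fin]) auto
  moreover have "\<forall>\<^sub>F u in nhds r. u \<in> ?J" by (rule eventually_nhds_in_open) (use e in auto)
  ultimately show ?thesis
  proof eventually_elim
    case (elim u)
    have "H u \<in> embeddings ?S W" by (rule ambient_isotopy_embedding[OF W P H elim(2)])
    then have sm: "smooth_map ?S W (H u)" by (simp add: embeddings_def immersion_def)
    have "good u t" if t: "t \<in> D" for t
    proof (cases "t \<in> {(U, z) \<in> D. U \<inter> (L \<inter> P) \<noteq> {}}")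
      case True
      then show ?thesis using elim(1) by blast
    next
      case False
      obtain U \<phi> C V \<psi> \<epsilon> where teq: "t = (U, \<phi>, C, V, \<psi>, \<epsilon>)" by (metis surj_pair)
      note tu = tup[OF t[unfolded teq]]
      have ch: "is_chart (Euclidean_space k) (mtop ?S) (U, \<phi>)" using max_atlas_is_chart[OF tu(1)] by simp
      have UP: "U \<subseteq> P" using openin_subset[OF chart_openin[OF ch]] by simp
      have fixU: "H u p = p" if "p \<in> U" for p
        by (rule ambient_isotopy_fixed[OF H elim(2)]) (use that UP Pt False t teq in auto)
      have "partial_derivs is (\<lambda>y. \<psi> (H u (inv_into U \<phi> y)) j) x = partial_derivs is (\<lambda>y. \<psi> (inv_into U \<phi> y) j) x"
        if "x \<in> \<phi> ` C" "set is \<subseteq> {..<k}" for x "is" j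
        by (rule partial_derivs_cong[OF chart_image[OF ch] _ that(2)])
           (use that(1) tu(4) fixU inv_into_into[of _ \<phi> U] in auto)
      moreover have "H u ` C \<subseteq> V" using fixU tu(4,5) by (metis image_subsetI subsetD)
      ultimately show ?thesis unfolding good_def teq prod.case using tu(6) by simp
    qed
    then show ?case
      unfolding strong_basic_def good_def using sm by auto
  qed
qed

text \<open>The compact set of a basic neighbourhood of \<open>\<gamma> r\<close> is handed to
  \<open>iso_path\<close>. On it, \<open>\<gamma> u\<close> coincides for nearby \<open>u\<close>
  with the image of \<open>\<gamma> r\<close> under \<open>H u\<close>, and \<open>H u\<close>
  restricted to \<open>\<gamma> r\<close> is strongly close to the inclusion.\<close>

lemma iso_path_imp_pathin:
  assumes W: "smooth_manifold W" and \<gamma>: "iso_path k W Z \<gamma>"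
  shows "pathin (Psi_space k W) \<gamma>"
  unfolding pathin_def continuous_map_def
proof (intro conjI allI impI)
  have \<gamma>P: "\<gamma> u \<in> Psi_set k W" if "u \<in> {0..1}" for u using \<gamma> that by (simp add: iso_path_def)
  show "\<gamma> \<in> topspace (top_of_set {0..1}) \<rightarrow> topspace (Psi_space k W)"
    using \<gamma>P by (auto simp: topspace_Psi_space)
  fix \<U> assume U: "openin (Psi_space k W) \<U>"
  have "\<exists>d>0. \<forall>u\<in>{0..1}. \<bar>u - r\<bar> < d \<longrightarrow> \<gamma> u \<in> \<U>" if r: "r \<in> {0..1}" "\<gamma> r \<in> \<U>" for r
  proof -
    obtain K A where K: "compactin (mtop W) K" and A: "emb_neighbourhood (submanifold k W (\<gamma> r)) W (\<lambda>x. x) A"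
      and sub: "Psi_nbhd k W K A (\<gamma> r) \<subseteq> \<U>"
      using U r(2) unfolding openin_Psi_space Psi_open_def by blast
    have P: "is_submanifold k W (\<gamma> r)" "closedin (mtop W) (\<gamma> r)" using \<gamma>P[OF r(1)] by (auto simp: Psi_set_def)
    obtain H H' L e where e: "e > 0" and L: "compactin (mtop W) L" and H: "ambient_isotopy W Z r e L H H'"
      and eq: "\<And>u p. u \<in> {r - e<..<r + e} \<inter> {0..1} \<Longrightarrow> p \<in> K \<Longrightarrow> p \<in> \<gamma> u \<longleftrightarrow> H' u p \<in> \<gamma> r"
      using \<gamma> r(1) K compactin_subset_topspace[OF K] unfolding iso_path_def by (metis openin_topspace)
    obtain D m where D: "is_strong_data (submanifold k W (\<gamma> r)) W (\<lambda>x. x) D"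
      "strong_basic (submanifold k W (\<gamma> r)) W (\<lambda>x. x) D m \<inter> embeddings (submanifold k W (\<gamma> r)) W \<subseteq> A"
      using A unfolding emb_neighbourhood_def by blast
    have "\<forall>\<^sub>F u in nhds r. H u \<in> strong_basic (submanifold k W (\<gamma> r)) W (\<lambda>x. x) D m"
      by (rule ambient_isotopy_strong_basic[OF W P H e L D(1)])
    then obtain d where d: "d > 0" "\<And>u. dist u r < d \<Longrightarrow> H u \<in> strong_basic (submanifold k W (\<gamma> r)) W (\<lambda>x. x) D m"
      unfolding eventually_nhds_metric by blast
    have "\<gamma> u \<in> \<U>" if u: "u \<in> {0..1}" "\<bar>u - r\<bar> < min d e" for u
    proof -
      have uJ: "u \<in> {r - e<..<r + e}" using u(2) by auto
      have "H u \<in> A"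
        using D(2) d(2)[of u] u(2) ambient_isotopy_embedding[OF W P(1) H uJ] by (auto simp: dist_real_def)
      moreover have "\<gamma> u \<inter> K = H u ` \<gamma> r \<inter> K"
      proof -
        have "p \<in> \<gamma> u \<longleftrightarrow> p \<in> H u ` \<gamma> r" if p: "p \<in> K" for p
        proof -
          have pt: "p \<in> topspace (mtop W)" using p compactin_subset_topspace[OF K] by blast
          have "p \<in> H u ` \<gamma> r \<longleftrightarrow> H' u p \<in> \<gamma> r"
          proof
            assume "p \<in> H u ` \<gamma> r"
            then obtain q where "q \<in> \<gamma> r" "p = H u q" by blast
            then show "H' u p \<in> \<gamma> r"
              using ambient_isotopy_inv1[OF H uJ, of q] Psi_set_subset[OF \<gamma>P[OF r(1)]] by auto
          next
            assume "H' u p \<in> \<gamma> r"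
            then show "p \<in> H u ` \<gamma> r" using ambient_isotopy_inv2[OF H uJ pt] by (metis imageI)
          qed
          then show ?thesis using eq[of u p] uJ u(1) p by blast
        qed
        then show ?thesis by blast
      qed
      ultimately have "\<gamma> u \<in> Psi_nbhd k W K A (\<gamma> r)" using \<gamma>P[OF u(1)] by (auto simp: Psi_nbhd_def)
      then show ?thesis using sub by blast
    qed
    then show ?thesis using d(1) e by (intro exI[of _ "min d e"]) auto
  qed
  then show "openin (top_of_set {0..1}) {x \<in> topspace (top_of_set {0..1}). \<gamma> x \<in> \<U>}"
    unfolding openin_euclidean_subtopology_iff dist_real_def by auto
qed

section \<open>Bump functions\<close>

lemma compactin_closed_cube:
  "compactin (Euclidean_space n) {y. (\<forall>i\<ge>n. y i = 0) \<and> (\<forall>i<n. \<bar>y i - x i\<bar> \<le> r)}"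
proof -
  define S where "S i = (if i < n then {x i - r..x i + r} else {0::real})" for i
  have "{y. (\<forall>i\<ge>n. y i = 0) \<and> (\<forall>i<n. \<bar>y i - x i\<bar> \<le> r)} = Pi\<^sub>E UNIV S"
    by (auto simp: S_def PiE_iff abs_diff_le_iff split: if_splits)
  moreover have "compactin (powertop_real UNIV) (Pi\<^sub>E UNIV S)"
    unfolding compactin_PiE by (auto simp: S_def)
  ultimately show ?thesis
    unfolding Euclidean_space_def by (auto simp: compactin_subtopology)
qed

definition smooth_step :: "real \<Rightarrow> real" where
  "smooth_step x = flat x / (flat x + flat (1 - x))"

lemma smooth_step_denom: "flat x + flat (1 - x) > 0"
  using flat_pos[of x] flat_pos[of "1 - x"] flat_nonneg[of x] flat_nonneg[of "1 - x"]
  by (cases "x > 0") linarith+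

lemma smooth_step_bounds: "0 \<le> smooth_step x" "smooth_step x \<le> 1"
  using smooth_step_denom[of x] flat_nonneg[of x] flat_nonneg[of "1 - x"]
  by (auto simp: smooth_step_def divide_simps)

lemma smooth_step_0: "x \<le> 0 \<Longrightarrow> smooth_step x = 0"
  by (simp add: smooth_step_def flat_zero)

lemma smooth_step_1: "x \<ge> 1 \<Longrightarrow> smooth_step x = 1"
  using smooth_step_denom[of x] by (simp add: smooth_step_def flat_zero)

lemma sfun_smooth_step:
  assumes M: "smooth_manifold M" and f: "sfun M T f"
  shows "sfun M T (\<lambda>p. smooth_step (f p))"
proof -
  have "sfun M T (\<lambda>p. flat (f p) / (flat (f p) + flat (1 - f p)))"
    by (rule sfun_divide[OF M sfun_flat[OF f] sfun_add[OF sfun_flat[OF f] sfun_flat[OF sfun_diff[OF M sfun_const f]]]])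
       (use M sfun_openin[OF f] smooth_step_denom in \<open>auto simp: less_le\<close>)
  then show ?thesis by (simp add: smooth_step_def)
qed

lemma bump_at_point:
  assumes W: "smooth_manifold W" and T: "openin (mtop W) T" and p: "p \<in> T"
  obtains \<rho> L where "sfun W (topspace (mtop W)) \<rho>" "compactin (mtop W) L" "L \<subseteq> T" "\<rho> p > 0"
    "\<And>q. \<rho> q \<ge> 0" "\<And>q. q \<in> topspace (mtop W) \<Longrightarrow> q \<notin> L \<Longrightarrow> \<rho> q = 0"
proof -
  let ?top = "topspace (mtop W)" and ?n = "mdim W"
  have "p \<in> ?top" using openin_subset[OF T] p by blast
  then obtain U \<phi> where c: "(U, \<phi>) \<in> matlas W" "p \<in> U" using smooth_manifold_cover[OF W] by blast
  have ch: "is_chart (Euclidean_space ?n) (mtop W) (U, \<phi>)" by (rule smooth_manifold_is_chart[OF W c(1)])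
  have inj: "inj_on \<phi> U" by (rule chart_inj[OF ch])
  have "openin (Euclidean_space ?n) (\<phi> ` (U \<inter> T))" by (rule image_openin_chart[OF W c(1) T])
  moreover have "\<phi> p \<in> \<phi> ` (U \<inter> T)" using p c by blast
  ultimately obtain r where r: "r > 0" "cube ?n (\<phi> p) r \<subseteq> \<phi> ` (U \<inter> T)" by (rule openin_contains_cube)
  define B where "B = {y. (\<forall>i\<ge>?n. y i = 0) \<and> (\<forall>i<?n. \<bar>y i - \<phi> p i\<bar> \<le> r / 2)}"
  have BU: "B \<subseteq> \<phi> ` (U \<inter> T)" using r by (force simp: B_def cube_def)
  define L where "L = inv_into U \<phi> ` B"
  have "compactin (subtopology (Euclidean_space ?n) (\<phi> ` U)) B"
    unfolding compactin_subtopology using compactin_closed_cube[of ?n "\<phi> p" "r / 2", folded B_def] BU by blast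
  then have L: "compactin (mtop W) L"
    unfolding L_def by (rule image_compactin[OF _ chart_inv_continuous[OF ch]])
  have LT: "L \<subseteq> U \<inter> T" using BU inj unfolding L_def by auto
  \<comment> \<open>The two factors for coordinate \<open>i\<close> are both positive exactly if
    this coordinate differs from that of \<open>p\<close> by less than \<open>r / 2\<close>, so the
    product vanishes off the closed cube of half the size.\<close>
  define \<rho> where "\<rho> q = (if q \<in> U then \<Prod>i<?n. flat (1 - (2 / r) * (\<phi> q i - \<phi> p i)) * flat (1 + (2 / r) * (\<phi> q i - \<phi> p i)) else 0)" for q
  have zero: "\<rho> q = 0" if "q \<notin> L" for q
  proof (cases "q \<in> U")
    case True
    have "\<forall>i\<ge>?n. \<phi> q i = 0" using openin_subset[OF chart_image[OF ch]] True by (auto simp: topspace_Euclidean_space)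
    moreover have "\<phi> q \<notin> B"
    proof
      assume "\<phi> q \<in> B"
      then have "inv_into U \<phi> (\<phi> q) \<in> L" by (simp add: L_def)
      then show False using that inv_into_f_f[OF inj True] by simp
    qed
    ultimately obtain i where i: "i < ?n" "\<bar>\<phi> q i - \<phi> p i\<bar> > r / 2" by (auto simp: B_def not_le)
    have "1 - (2 / r) * (\<phi> q i - \<phi> p i) \<le> 0 \<or> 1 + (2 / r) * (\<phi> q i - \<phi> p i) \<le> 0"
      using i(2) r(1) by (auto simp: field_simps abs_if split: if_splits)
    then have "flat (1 - (2 / r) * (\<phi> q i - \<phi> p i)) * flat (1 + (2 / r) * (\<phi> q i - \<phi> p i)) = 0"
      using flat_zero by auto
    then show ?thesis using i(1) True unfolding \<rho>_def by (auto intro!: prod_zero)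
  qed (simp add: \<rho>_def)
  have Lc: "closedin (mtop W) L" by (rule compactin_imp_closedin[OF smooth_manifold_Hausdorff[OF W] L])
  have sU: "sfun W U (\<lambda>q. \<Prod>i<?n. flat (1 - (2 / r) * (\<phi> q i - \<phi> p i)) * flat (1 + (2 / r) * (\<phi> q i - \<phi> p i)))"
    by (intro sfun_prod sfun_mult sfun_flat sfun_add sfun_diff sfun_const sfun_chart_coord W c(1) chart_openin[OF ch]) simp
  have "sfun W ?top \<rho>"
  proof (rule sfun_local[OF W openin_topspace])
    fix q assume q: "q \<in> ?top"
    have L0: "openin (mtop W) (?top - L)" using Lc by blast
    show "\<exists>S g. q \<in> S \<and> sfun W S g \<and> (\<forall>x\<in>?top \<inter> S. \<rho> x = g x)"
    proof (cases "q \<in> U")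
      case True
      show ?thesis
        by (rule exI[of _ U], rule exI[of _ "\<lambda>q. \<Prod>i<?n. flat (1 - (2 / r) * (\<phi> q i - \<phi> p i)) * flat (1 + (2 / r) * (\<phi> q i - \<phi> p i))"])
           (use True sU in \<open>auto simp: \<rho>_def\<close>)
    next
      case False
      then have "q \<in> ?top - L" using q LT by blast
      then show ?thesis
        using sfun_const[OF W L0, of 0] zero by (intro exI[of _ "?top - L"] exI[of _ "\<lambda>q. 0"]) auto
    qed
  qed
  moreover have "\<rho> p > 0" using c(2) flat_pos[of 1] by (auto simp: \<rho>_def intro!: prod_pos)
  moreover have "\<rho> q \<ge> 0" for q using flat_nonneg by (auto simp: \<rho>_def intro!: prod_nonneg)
  ultimately show thesis using that[of \<rho> L] L LT zero by auto
qed

text \<open>Finitely many pointwise bumps suffice by compactness. They are scaled so that their sum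
  is at least \<open>1\<close> on \<open>K\<close>, and \<open>smooth_step\<close> turns this into
  the value \<open>1\<close>.\<close>

lemma bump_function:
  assumes W: "smooth_manifold W" and K: "compactin (mtop W) K" and T: "openin (mtop W) T" and KT: "K \<subseteq> T"
  obtains \<beta> L where "sfun W (topspace (mtop W)) \<beta>" "compactin (mtop W) L" "L \<subseteq> T"
    "\<And>p. p \<in> K \<Longrightarrow> \<beta> p = 1" "\<And>p. p \<in> topspace (mtop W) \<Longrightarrow> p \<notin> L \<Longrightarrow> \<beta> p = 0"
proof -
  let ?top = "topspace (mtop W)"
  have "\<forall>p\<in>K. \<exists>\<rho> L. sfun W ?top \<rho> \<and> compactin (mtop W) L \<and> L \<subseteq> T \<and> \<rho> p > 0 \<and> (\<forall>q. \<rho> q \<ge> 0) \<and>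
      (\<forall>q\<in>?top. q \<notin> L \<longrightarrow> \<rho> q = 0)"
  proof
    fix p assume "p \<in> K"
    then have "p \<in> T" using KT by blast
    then show "\<exists>\<rho> L. sfun W ?top \<rho> \<and> compactin (mtop W) L \<and> L \<subseteq> T \<and> \<rho> p > 0 \<and> (\<forall>q. \<rho> q \<ge> 0) \<and>
      (\<forall>q\<in>?top. q \<notin> L \<longrightarrow> \<rho> q = 0)"
      by (rule bump_at_point[OF W T]) blast
  qed
  from bchoice[OF this] obtain \<rho> where "\<forall>p\<in>K. \<exists>L. sfun W ?top (\<rho> p) \<and> compactin (mtop W) L \<and> L \<subseteq> T \<and>
      \<rho> p p > 0 \<and> (\<forall>q. \<rho> p q \<ge> 0) \<and> (\<forall>q\<in>?top. q \<notin> L \<longrightarrow> \<rho> p q = 0)" by blast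
  from bchoice[OF this] obtain L where \<rho>: "\<And>p. p \<in> K \<Longrightarrow> sfun W ?top (\<rho> p)" "\<And>p. p \<in> K \<Longrightarrow> compactin (mtop W) (L p)"
    "\<And>p. p \<in> K \<Longrightarrow> L p \<subseteq> T" "\<And>p. p \<in> K \<Longrightarrow> \<rho> p p > 0" "\<And>p q. p \<in> K \<Longrightarrow> \<rho> p q \<ge> 0"
    "\<And>p q. p \<in> K \<Longrightarrow> q \<in> ?top \<Longrightarrow> q \<notin> L p \<Longrightarrow> \<rho> p q = 0" by blast
  \<comment> \<open>On this open set the bump of \<open>p\<close> has an explicit lower bound, whose
    inverse \<open>Suc n\<close> will be the scaling factor.\<close>
  define G where "G p n = {q \<in> ?top. \<rho> p q \<in> {1 / real (Suc n)<..}}" for p n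
  have G: "openin (mtop W) (G p n)" if "p \<in> K" for p n
    unfolding G_def by (rule sfun_preimage[OF W \<rho>(1)[OF that]]) simp
  have cov: "K \<subseteq> \<Union>((\<lambda>(p, n). G p n) ` (K \<times> UNIV))"
  proof
    fix p assume p: "p \<in> K"
    obtain n where "inverse (of_nat (Suc n)) < \<rho> p p" using reals_Archimedean[OF \<rho>(4)[OF p]] by blast
    then have "p \<in> G p n" using p compactin_subset_topspace[OF K] by (auto simp: G_def inverse_eq_divide)
    then show "p \<in> \<Union>((\<lambda>(p, n). G p n) ` (K \<times> UNIV))" using p by blast
  qed
  have "openin (mtop W) X" if "X \<in> (\<lambda>(p, n). G p n) ` (K \<times> UNIV)" for X using that G by auto
  from compactinD[OF K this cov]
  obtain \<F> where "finite \<F>" "\<F> \<subseteq> (\<lambda>(p, n). G p n) ` (K \<times> UNIV)" "K \<subseteq> \<Union>\<F>" by blast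
  then obtain I where I: "finite I" "I \<subseteq> K \<times> UNIV" "K \<subseteq> (\<Union>(p, n)\<in>I. G p n)"
    using finite_subset_image[of \<F> "\<lambda>(p, n). G p n"] by (metis (no_types, lifting))
  define f where "f q = (\<Sum>(p, n)\<in>I. real (Suc n) * \<rho> p q)" for q
  have sf: "sfun W ?top f"
    unfolding f_def case_prod_beta
    by (intro sfun_sum sfun_cmult W I(1) openin_topspace \<rho>(1)) (use I(2) in auto)
  define \<beta> where "\<beta> q = smooth_step (f q)" for q
  define L' where "L' = (\<Union>(p, n)\<in>I. L p)"
  have "compactin (mtop W) L'"
  proof -
    have "compactin (mtop W) (\<Union>((\<lambda>(p, n). L p) ` I))"
      by (rule compactin_Union) (use I \<rho>(2) in auto)
    then show ?thesis by (simp add: L'_def)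
  qed
  moreover have "L' \<subseteq> T" using I(2) \<rho>(3) by (fastforce simp: L'_def)
  moreover have "\<beta> q = 1" if q: "q \<in> K" for q
  proof -
    obtain p n where pn: "(p, n) \<in> I" "q \<in> G p n" using I(3) q by blast
    have "1 \<le> real (Suc n) * \<rho> p q" using pn(2) by (auto simp: G_def field_simps)
    also have "\<dots> = (\<lambda>(p, n). real (Suc n) * \<rho> p q) (p, n)" by simp
    also have "\<dots> \<le> f q"
      unfolding f_def
    proof (rule member_le_sum[OF pn(1) _ I(1)])
      show "0 \<le> (\<lambda>(p, n). real (Suc n) * \<rho> p q) x" if "x \<in> I - {(p, n)}" for x
        using that I(2) \<rho>(5) by (cases x) auto
    qed
    finally show ?thesis by (simp add: \<beta>_def smooth_step_1)
  qed
  moreover have "\<beta> q = 0" if q: "q \<in> ?top" "q \<notin> L'" for q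
  proof -
    have "f q = 0"
      unfolding f_def by (rule sum.neutral) (use q I(2) \<rho>(6) in \<open>fastforce simp: L'_def\<close>)
    then show ?thesis by (simp add: \<beta>_def smooth_step_0)
  qed
  moreover have "sfun W ?top \<beta>" unfolding \<beta>_def by (rule sfun_smooth_step[OF W sf])
  ultimately show thesis using that by blast
qed

section \<open>Sliding a submanifold along the fibres of a product\<close>

text \<open>An application of the intermediate value theorem. A fibre map and its cut-off version
  agree far out on the line and hence have the same range, so that each can be composed with the
  inverse of the other.\<close>

lemma increasing_agree_at_ends_range:
  fixes f g :: "real \<Rightarrow> real"
  assumes f: "continuous_on UNIV f" and g: "mono g" and eq: "\<And>s. \<bar>s\<bar> > B \<Longrightarrow> f s = g s"
  shows "\<exists>s'. f s' = g s"
proof (cases "\<bar>s\<bar> > B")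
  case True
  then show ?thesis using eq by blast
next
  case False
  let ?a = "- \<bar>B\<bar> - 1" and ?b = "\<bar>B\<bar> + 1"
  have "f ?a = g ?a" "f ?b = g ?b" by (rule eq; linarith)+
  moreover have "g ?a \<le> g s" "g s \<le> g ?b" using False by (auto intro!: monoD[OF g])
  ultimately show ?thesis
    using IVT'[of f ?a "g s" ?b] continuous_on_subset[OF f] by fastforce
qed

text \<open>The time is cut off: \<open>\<mu> u\<close> is the fibre map \<open>\<sigma>\<close>
  taken at a time that is \<open>u\<close> on \<open>K\<close> and \<open>r\<close> outside a
  compact set. The isotopy \<open>H u\<close> applies \<open>\<sigma> r\<close> and then the inverse
  of \<open>\<mu> u\<close> on each fibre. Its inverse applies \<open>\<mu> u\<close> first, which
  on \<open>K\<close> is \<open>\<sigma> u\<close>, and therefore compares membership in the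
  preimages of \<open>P\<close> at the times \<open>u\<close> and \<open>r\<close>.\<close>

lemma iso_path_fibre:
  fixes \<sigma> :: "real \<Rightarrow> 'a \<Rightarrow> real \<Rightarrow> real"
  assumes Y: "smooth_manifold Y"
    and \<sigma>: "sfun (times_interval (times_interval Y UNIV) UNIV) (topspace (mtop (times_interval (times_interval Y UNIV) UNIV)))
       (\<lambda>((y, s), u). \<sigma> u y s)"
    and pos: "\<And>u y s. u \<in> {0..1} \<Longrightarrow> y \<in> topspace (mtop Y) \<Longrightarrow> deriv (\<sigma> u y) s > 0"
    and P: "P \<in> Psi_set k (times_interval Y UNIV)"
    and Z: "\<And>y s u. (y, s) \<in> Z \<Longrightarrow> \<sigma> u y s = \<sigma> 0 y s"
  shows "iso_path k (times_interval Y UNIV) Z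
      (\<lambda>u. {(y, s). y \<in> topspace (mtop Y) \<and> (y, \<sigma> u y s) \<in> P})"
  unfolding iso_path_def
proof (intro conjI ballI allI impI)
  let ?W = "times_interval Y UNIV" and ?tY = "topspace (mtop Y)"
  let ?top = "topspace (mtop ?W)"
  have W: "smooth_manifold ?W" by (rule smooth_manifold_times_interval[OF Y open_UNIV])
  have top: "?top = ?tY \<times> UNIV" by simp
  have WU: "smooth_manifold (times_interval ?W UNIV)" by (rule smooth_manifold_times_interval[OF W open_UNIV])
  define g where "g u = (\<lambda>(y, s). (y, \<sigma> u y s))" for u
  have sfst: "smap ?W ?top Y fst" and ssnd: "sfun ?W ?top snd"
    unfolding top by (rule smap_fst[OF Y open_UNIV], rule sfun_snd[OF Y open_UNIV])
  have s\<sigma>: "sfun M A (\<lambda>q. \<sigma> (h q) (fst (f q)) (snd (f q)))"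
    if M: "smooth_manifold M" and f: "smap M A ?W f" and h: "sfun M A h" for M :: "'d manifold" and A f h
  proof -
    have s: "smap M A (times_interval ?W UNIV) (\<lambda>q. (f q, h q))" by (rule smap_Pair[OF M W open_UNIV f h]) simp
    have eq: "{p \<in> A. (f p, h p) \<in> topspace (mtop (times_interval ?W UNIV))} = A"
      using smap_in_topspace[OF s] by blast
    show ?thesis using smap_sfun[OF s \<sigma>] unfolding eq by (simp add: case_prod_beta)
  qed
  have s\<sigma>u: "sfun ?W ?top (\<lambda>(y, s). \<sigma> u y s)" for u
    using s\<sigma>[OF W smap_id[OF W openin_topspace] sfun_const[OF W openin_topspace, of u]]
    by (simp add: case_prod_beta')
  have ld: "local_diffeo ?W ?top ?W (g u)" if "u \<in> {0..1}" for u
    using local_diffeo_fibre[OF Y s\<sigma>u[of u]] pos[OF that] by (simp add: g_def)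
  have \<gamma>eq: "{(y, s). y \<in> ?tY \<and> (y, \<sigma> u y s) \<in> P} = {p \<in> ?top. g u p \<in> P}" for u by (auto simp: g_def)
  show "{(y, s). y \<in> ?tY \<and> (y, \<sigma> u y s) \<in> P} \<in> Psi_set k ?W" if "u \<in> {0..1}" for u
    unfolding \<gamma>eq by (rule Psi_set_vimage[OF W W ld[OF that] P])
  show "{(y, s). y \<in> ?tY \<and> (y, \<sigma> u y s) \<in> P} \<inter> Z = {(y, s). y \<in> ?tY \<and> (y, \<sigma> v y s) \<in> P} \<inter> Z" for u v
  proof -
    have "(y, \<sigma> u y s) \<in> P \<longleftrightarrow> (y, \<sigma> v y s) \<in> P" if "(y, s) \<in> Z" for y s
      using Z[OF that, of u] Z[OF that, of v] by simp
    then show ?thesis by auto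
  qed
  fix r K T assume r: "r \<in> {0..1::real}" and K: "compactin (mtop ?W) K" and T: "openin (mtop ?W) T" and KT: "K \<subseteq> T"
  obtain \<beta> L where \<beta>: "sfun ?W ?top \<beta>" and L: "compactin (mtop ?W) L" "L \<subseteq> T"
    and \<beta>1: "\<And>p. p \<in> K \<Longrightarrow> \<beta> p = 1" and \<beta>0: "\<And>p. p \<in> ?top \<Longrightarrow> p \<notin> L \<Longrightarrow> \<beta> p = 0"
    using bump_function[OF W K T KT] by blast
  have Lc: "closedin (mtop ?W) L" by (rule compactin_imp_closedin[OF smooth_manifold_Hausdorff[OF W] L(1)])
  \<comment> \<open>Equal to \<open>\<sigma> u\<close> where \<open>\<beta>\<close> is
    \<open>1\<close>, equal to \<open>\<sigma> r\<close> where \<open>\<beta>\<close> is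
    \<open>0\<close>, and constant in \<open>u\<close> on \<open>Z\<close>, where
    \<open>\<sigma>\<close> does not depend on time.\<close>
  define \<mu> where "\<mu> u y s = \<sigma> (r + (u - r) * \<beta> (y, s)) y s" for u y s
  have \<mu>r: "\<mu> r y s = \<sigma> r y s" for y s by (simp add: \<mu>_def)
  have \<mu>L: "\<mu> u y s = \<sigma> r y s" if "y \<in> ?tY" "(y, s) \<notin> L" for u y s
    using \<beta>0[of "(y, s)"] that by (simp add: \<mu>_def)
  have s\<mu>: "sfun M A (\<lambda>q. \<mu> (h q) (fst (f q)) (snd (f q)))"
    if M: "smooth_manifold M" and f: "smap M A ?W f" and h: "sfun M A h" for M :: "'d manifold" and A f h
  proof -
    have eq: "{p \<in> A. f p \<in> ?top} = A" using smap_in_topspace[OF f] by blast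
    have b: "sfun M A (\<lambda>q. \<beta> (f q))" using smap_sfun[OF f \<beta>] unfolding eq .
    have "sfun M A (\<lambda>q. r + (h q - r) * \<beta> (f q))"
      by (intro sfun_add sfun_mult sfun_diff sfun_const M b h sfun_openin[OF b])
    from s\<sigma>[OF M f this] show ?thesis by (simp add: \<mu>_def)
  qed
  have s\<mu>u: "sfun ?W ?top (\<lambda>(y, s). \<mu> u y s)" for u
    using s\<mu>[OF W smap_id[OF W openin_topspace] sfun_const[OF W openin_topspace, of u]]
    by (simp add: case_prod_beta')
  have deriv\<mu>: "((\<lambda>s. \<mu> u y s) has_real_derivative deriv (\<mu> u y) s) (at s)" if "y \<in> ?tY" for u y s
    using has_vertical_deriv[OF Y s\<mu>u] that by simp
  have deriv\<sigma>: "((\<lambda>s. \<sigma> u y s) has_real_derivative deriv (\<sigma> u y) s) (at s)" if "y \<in> ?tY" for u y s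
    using has_vertical_deriv[OF Y s\<sigma>u] that by simp
  have dL: "deriv (\<mu> u y) s = deriv (\<sigma> r y) s" if ys: "y \<in> ?tY" "(y, s) \<notin> L" for u y s
  proof (rule deriv_cong_ev)
    have "openin (mtop ?W) (?top - L)" using Lc by blast
    moreover have "continuous_map euclideanreal (mtop ?W) (\<lambda>s. (y, s))"
      unfolding mtop_times_interval using ys(1) by (simp add: continuous_map_pairwise comp_def)
    ultimately have "openin euclideanreal {s \<in> topspace euclideanreal. (y, s) \<in> ?top - L}"
      by (intro openin_continuous_map_preimage)
    then have "open {s. (y, s) \<in> ?top - L}" by simp
    then have "\<forall>\<^sub>F s' in nhds s. s' \<in> {s. (y, s) \<in> ?top - L}"
      by (rule eventually_nhds_in_open) (use ys in auto)
    then show "\<forall>\<^sub>F s' in nhds s. \<mu> u y s' = \<sigma> r y s'"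
      by (rule eventually_mono) (use \<mu>L ys in auto)
  qed simp
  let ?YU = "times_interval Y UNIV :: ('a \<times> real) manifold"
  let ?X = "times_interval ?YU UNIV"
  \<comment> \<open>The fibre coordinate \<open>s\<close> has to be the last one and time a
    parameter, because \<open>local_diffeo_fibre\<close> inverts in the last coordinate. Inverting
    with time as a parameter yields joint smoothness of the isotopy.\<close>
  have swap: "smap (times_interval ?W J) (?top \<times> J) (times_interval (times_interval Y J) UNIV) (\<lambda>((y, s), u). ((y, u), s))"
    if J: "open J" for J
  proof -
    have WJ: "smooth_manifold (times_interval ?W J)" by (rule smooth_manifold_times_interval[OF W J])
    have f: "smap (times_interval ?W J) (?top \<times> J) ?W fst" by (rule smap_fst[OF W J])
    have u: "sfun (times_interval ?W J) (?top \<times> J) snd" by (rule sfun_snd[OF W J])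
    have y: "smap (times_interval ?W J) (?top \<times> J) Y (\<lambda>q. fst (fst q))"
      by (rule smap_compose[OF f sfst]) auto
    have eq: "{p \<in> ?top \<times> J. fst p \<in> ?top} = ?top \<times> J" by auto
    have s: "sfun (times_interval ?W J) (?top \<times> J) (\<lambda>q. snd (fst q))"
      using smap_sfun[OF f ssnd] unfolding eq .
    have "smap (times_interval ?W J) (?top \<times> J) (times_interval (times_interval Y J) UNIV) (\<lambda>q. ((fst (fst q), snd q), snd (fst q)))"
      by (rule smap_Pair[OF WJ smooth_manifold_times_interval[OF Y J] open_UNIV smap_Pair[OF WJ Y J y u] s]) auto
    then show ?thesis by (simp add: case_prod_beta')
  qed
  have unswap: "smap (times_interval (times_interval Y J) UNIV) ((?tY \<times> J) \<times> UNIV) ?W (\<lambda>((y, u), s). (y, s))"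
    and sfunu: "sfun (times_interval (times_interval Y J) UNIV) ((?tY \<times> J) \<times> UNIV) (\<lambda>((y, u), s). u)"
    if J: "open J" for J
  proof -
    let ?YJ = "times_interval Y J"
    have YJ: "smooth_manifold ?YJ" by (rule smooth_manifold_times_interval[OF Y J])
    have XJ: "smooth_manifold (times_interval ?YJ UNIV)" by (rule smooth_manifold_times_interval[OF YJ open_UNIV])
    have f: "smap (times_interval ?YJ UNIV) ((?tY \<times> J) \<times> UNIV) ?YJ fst"
      using smap_fst[OF YJ open_UNIV] by simp
    have s: "sfun (times_interval ?YJ UNIV) ((?tY \<times> J) \<times> UNIV) snd"
      using sfun_snd[OF YJ open_UNIV] by simp
    have y: "smap (times_interval ?YJ UNIV) ((?tY \<times> J) \<times> UNIV) Y (\<lambda>q. fst (fst q))"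
      by (rule smap_compose[OF f smap_fst[OF Y J]]) auto
    have "smap (times_interval ?YJ UNIV) ((?tY \<times> J) \<times> UNIV) ?W (\<lambda>q. (fst (fst q), snd q))"
      by (rule smap_Pair[OF XJ Y open_UNIV y s]) simp
    then show "smap (times_interval ?YJ UNIV) ((?tY \<times> J) \<times> UNIV) ?W (\<lambda>((y, u), s). (y, s))"
      by (simp add: case_prod_beta')
    have eq: "{p \<in> (?tY \<times> J) \<times> UNIV. fst p \<in> ?tY \<times> J} = (?tY \<times> J) \<times> UNIV" by auto
    show "sfun (times_interval ?YJ UNIV) ((?tY \<times> J) \<times> UNIV) (\<lambda>((y, u), s). u)"
      using smap_sfun[OF f sfun_snd[OF Y J]] unfolding eq by (simp add: case_prod_beta')
  qed
  have s\<mu>X: "sfun (times_interval (times_interval Y J) UNIV) ((?tY \<times> J) \<times> UNIV) (\<lambda>(q, s). \<mu> (snd q) (fst q) s)"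
    and s\<sigma>X: "sfun (times_interval (times_interval Y J) UNIV) ((?tY \<times> J) \<times> UNIV) (\<lambda>(q, s). \<sigma> r (fst q) s)"
    if J: "open J" for J
  proof -
    have XJ: "smooth_manifold (times_interval (times_interval Y J) UNIV)"
      by (intro smooth_manifold_times_interval Y J open_UNIV)
    show "sfun (times_interval (times_interval Y J) UNIV) ((?tY \<times> J) \<times> UNIV) (\<lambda>(q, s). \<mu> (snd q) (fst q) s)"
      using s\<mu>[OF XJ unswap[OF J] sfunu[OF J]] by (simp add: case_prod_beta')
    show "sfun (times_interval (times_interval Y J) UNIV) ((?tY \<times> J) \<times> UNIV) (\<lambda>(q, s). \<sigma> r (fst q) s)"
      using s\<sigma>[OF XJ unswap[OF J] sfun_const[OF XJ smap_openin[OF unswap[OF J]], of r]] by (simp add: case_prod_beta')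
  qed
  have YU: "smooth_manifold ?YU" by (rule W)
  have X: "smooth_manifold ?X" by (rule WU)
  have "sfun ?X ((?tY \<times> UNIV) \<times> UNIV) (\<lambda>(q, s). deriv (\<lambda>s. \<mu> (snd q) (fst q) s) s)"
    using sfun_deriv[OF YU s\<mu>X[OF open_UNIV]] by simp
  note sd = smap_sfun[OF swap[OF open_UNIV] this]
  have "{p \<in> ?top \<times> UNIV. (case p of (x, xa) \<Rightarrow> (case x of (y, s) \<Rightarrow> \<lambda>u. ((y, u), s)) xa) \<in> (?tY \<times> UNIV) \<times> UNIV} =
      ?top \<times> (UNIV :: real set)" by auto
  with sd have "sfun (times_interval ?W UNIV) (?top \<times> UNIV) (\<lambda>((y, s), u). deriv (\<mu> u y) s)"
    by (simp only: case_prod_beta' fst_conv snd_conv)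
  from sfun_preimage[OF WU this, of "{0<..}"]
  have N: "openin (mtop (times_interval ?W UNIV)) {q \<in> ?top \<times> UNIV. (case q of ((y, s), u) \<Rightarrow> deriv (\<mu> u y) s) \<in> {0<..}}"
    by (simp add: case_prod_beta')
  \<comment> \<open>The variation of \<open>\<beta>\<close> along the fibre contributes to the
    derivative of \<open>\<mu> u\<close>, but this contribution vanishes at time \<open>r\<close>.
    On the compact set \<open>L\<close> positivity persists for nearby times.\<close>
  have "\<forall>\<^sub>F u in nhds r. \<forall>p\<in>L. (p, u) \<in> {q \<in> ?top \<times> UNIV. (case q of ((y, s), u) \<Rightarrow> deriv (\<mu> u y) s) \<in> {0<..}}"
  proof (rule tube_times_interval[OF L(1) N open_UNIV])
    fix p assume "p \<in> L"
    then have "p \<in> ?top" using compactin_subset_topspace[OF L(1)] by blast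
    then show "(p, r) \<in> {q \<in> ?top \<times> UNIV. (case q of ((y, s), u) \<Rightarrow> deriv (\<mu> u y) s) \<in> {0<..}}"
      using pos[OF r] by (cases p) (auto simp: \<mu>r[abs_def])
  qed simp
  then obtain e where e: "e > 0" and eL: "\<And>u y s. dist u r < e \<Longrightarrow> (y, s) \<in> L \<Longrightarrow> deriv (\<mu> u y) s > 0"
    unfolding eventually_nhds_metric by fastforce
  define J where "J = {r - e<..<r + e}"
  have J: "open J" "r \<in> J" using e by (auto simp: J_def)
  \<comment> \<open>Times outside \<open>[0, 1]\<close> are included: on \<open>L\<close> positivity
    comes from the choice of \<open>e\<close>, and off \<open>L\<close> the derivative is the one at
    time \<open>r\<close>.\<close>
  have pos\<mu>: "deriv (\<mu> u y) s > 0" if "u \<in> J" "y \<in> ?tY" for u y s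
  proof (cases "(y, s) \<in> L")
    case True
    then show ?thesis using eL[of u y s] that(1) by (auto simp: J_def dist_real_def)
  next
    case False
    then show ?thesis using dL[of y s u] pos[OF r that(2)] that(2) by simp
  qed
  have incr: "f s < f s'" if "s < s'" "\<And>s. (f has_real_derivative f' s) (at s)" "\<And>s. f' s > 0" for f f' :: "real \<Rightarrow> real" and s s'
    by (rule DERIV_pos_imp_increasing[OF that(1)]) (use that(2,3) in blast)
  have \<mu>less: "\<mu> u y s < \<mu> u y s'" if "u \<in> J" "y \<in> ?tY" "s < s'" for u y s s'
    by (rule incr[OF that(3) deriv\<mu>[OF that(2)] pos\<mu>[OF that(1,2)]])
  have \<sigma>less: "\<sigma> r y s < \<sigma> r y s'" if "y \<in> ?tY" "s < s'" for y s s'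
    by (rule incr[OF that(2) deriv\<sigma>[OF that(1)] pos[OF r that(1)]])
  have \<mu>inj: "s = s'" if "u \<in> J" "y \<in> ?tY" "\<mu> u y s = \<mu> u y s'" for u y s s'
    using \<mu>less[OF that(1,2), of s s'] \<mu>less[OF that(1,2), of s' s] that(3) by (metis less_irrefl linorder_neqE)
  have \<sigma>inj: "s = s'" if "y \<in> ?tY" "\<sigma> r y s = \<sigma> r y s'" for y s s'
    using \<sigma>less[OF that(1), of s s'] \<sigma>less[OF that(1), of s' s] that(2) by (metis less_irrefl linorder_neqE)
  have "compactin euclideanreal (snd ` L)"
    by (rule image_compactin[OF L(1)]) (simp add: mtop_times_interval continuous_map_snd)
  then have "bounded (snd ` L)" by (simp add: compact_imp_bounded)
  then obtain B where B: "\<And>y s. (y, s) \<in> L \<Longrightarrow> \<bar>s\<bar> \<le> B" unfolding bounded_iff by (force simp: image_iff)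
  have range1: "\<exists>s'. \<mu> u y s' = \<sigma> r y s" and range2: "\<exists>s'. \<sigma> r y s' = \<mu> u y s" if "u \<in> J" "y \<in> ?tY" for u y s
  proof -
    have m: "mono (\<mu> u y)" "mono (\<sigma> r y)"
      using \<mu>less[OF that] \<sigma>less[OF that(2)] by (auto intro!: monoI simp: le_less)
    have c: "continuous_on UNIV (\<mu> u y)" "continuous_on UNIV (\<sigma> r y)"
      using deriv\<mu>[OF that(2)] deriv\<sigma>[OF that(2)] by (meson DERIV_isCont continuous_at_imp_continuous_on)+
    have eq: "\<mu> u y s = \<sigma> r y s" if "\<bar>s\<bar> > B" for s
      using \<mu>L[OF \<open>y \<in> ?tY\<close>, of s u] B[of y s] that by fastforce
    show "\<exists>s'. \<mu> u y s' = \<sigma> r y s" by (rule increasing_agree_at_ends_range[OF c(1) m(2) eq])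
    show "\<exists>s'. \<sigma> r y s' = \<mu> u y s" by (rule increasing_agree_at_ends_range[OF c(2) m(1) eq[symmetric]])
  qed
  let ?YJ = "times_interval Y J"
  let ?XJ = "times_interval ?YJ UNIV"
  let ?tXJ = "(?tY \<times> J) \<times> (UNIV :: real set)"
  have YJ: "smooth_manifold ?YJ" by (rule smooth_manifold_times_interval[OF Y J(1)])
  have XJ: "smooth_manifold ?XJ" by (rule smooth_manifold_times_interval[OF YJ open_UNIV])
  define m where "m = (\<lambda>(q, s). (q, \<mu> (snd q) (fst q) s))"
  define g' where "g' = (\<lambda>(q::'a \<times> real, s). (q, \<sigma> r (fst q) s))"
  have ldm: "local_diffeo ?XJ ?tXJ ?XJ m"
  proof -
    have "deriv (\<lambda>s. (case (q, s) of (q, s) \<Rightarrow> \<mu> (snd q) (fst q) s)) s > 0" if "(q, s) \<in> ?tXJ" for q s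
      using that pos\<mu> by auto
    from local_diffeo_fibre[OF YJ s\<mu>X[OF J(1)] this] show ?thesis by (simp add: m_def)
  qed
  have ldg: "local_diffeo ?XJ ?tXJ ?XJ g'"
  proof -
    have "deriv (\<lambda>s. (case (q, s) of (q, s) \<Rightarrow> \<sigma> r (fst q) s)) s > 0" if "(q, s) \<in> ?tXJ" for q s
      using that pos[OF r] by auto
    from local_diffeo_fibre[OF YJ s\<sigma>X[OF J(1)] this] show ?thesis by (simp add: g'_def)
  qed
  have injm: "inj_on m ?tXJ"
  proof (rule inj_onI)
    fix p q assume a: "p \<in> ?tXJ" "q \<in> ?tXJ" "m p = m q"
    then have "fst (fst p) \<in> ?tY" "snd (fst p) \<in> J" "fst q = fst p"
      "\<mu> (snd (fst p)) (fst (fst p)) (snd p) = \<mu> (snd (fst p)) (fst (fst p)) (snd q)"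
      by (auto simp: m_def case_prod_beta)
    then show "p = q" using \<mu>inj by (metis prod_eqI)
  qed
  have dm: "diffeo_on ?XJ ?tXJ ?XJ m" by (rule local_diffeo_inj_imp_diffeo_on[OF XJ XJ ldm injm refl])
  define m' where "m' = inv_into ?tXJ m"
  have sm': "smap ?XJ (m ` ?tXJ) ?XJ m'" unfolding m'_def by (rule diffeo_on_inv[OF dm])
  have g'm: "g' q \<in> m ` ?tXJ" if qX: "q \<in> ?tXJ" for q
  proof -
    obtain y u s where q: "q = ((y, u), s)" "y \<in> ?tY" "u \<in> J" using qX by auto
    obtain s' where "\<mu> u y s' = \<sigma> r y s" using range1[OF q(3,2)] by blast
    then have "g' q = m ((y, u), s')" by (simp add: g'_def m_def q(1))
    then show ?thesis using q by blast
  qed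
  have m'eq: "m' ((y, u), \<mu> u y s) = ((y, u), s)" if "y \<in> ?tY" "u \<in> J" for y u s
    using inv_into_f_f[OF injm, of "((y, u), s)"] that by (simp add: m'_def m_def)
  have sh: "smap ?XJ ?tXJ ?XJ (\<lambda>q. m' (g' q))"
    by (rule smap_compose[OF local_diffeo_smap[OF XJ ldg] sm' g'm])
  define H where "H u p = (fst p, snd (m' (g' ((fst p, u), snd p))))" for u p
  have Heq: "H u (y, s) = (y, s')" if "y \<in> ?tY" "u \<in> J" "\<mu> u y s' = \<sigma> r y s" for u y s s'
    using m'eq[OF that(1,2), of s'] that(3) by (simp add: H_def g'_def)
  have WJ: "smooth_manifold (times_interval ?W J)" by (rule smooth_manifold_times_interval[OF W J(1)])
  have sHJ: "smap (times_interval ?W J) (?top \<times> J) ?W (\<lambda>(p, u). H u p)"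
  proof -
    have "smap (times_interval ?W J) (?top \<times> J) ?XJ (\<lambda>q. m' (g' ((\<lambda>((y, s), u). ((y, u), s)) q)))"
      by (rule smap_compose[OF swap[OF J(1)] sh]) auto
    then have 1: "smap (times_interval ?W J) (?top \<times> J) ?W (\<lambda>q. (\<lambda>((y, u), s). (y, s)) (m' (g' ((\<lambda>((y, s), u). ((y, u), s)) q))))"
      by (rule smap_compose[OF _ unswap[OF J(1)]])
         (use smap_in_topspace[OF sh] in \<open>fastforce simp: case_prod_beta\<close>)
    show ?thesis
    proof (rule smap_subset[OF WJ 1])
      fix q assume "q \<in> ?top \<times> J"
      then obtain y s u where q: "q = ((y, s), u)" "y \<in> ?tY" "u \<in> J" by auto
      obtain s' where s': "\<mu> u y s' = \<sigma> r y s" using range1[OF q(3,2)] by blast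
      show "(\<lambda>((y, u), s). (y, s)) (m' (g' ((\<lambda>((y, s), u). ((y, u), s)) q))) = (case q of (p, u) \<Rightarrow> H u p)"
        using Heq[OF q(2,3) s'] m'eq[OF q(2,3), of s'] s' by (simp add: q(1) g'_def)
    qed (use smap_openin[OF 1] in auto)
  qed
  have injg: "inj_on (g r) ?top"
  proof (rule inj_onI)
    fix p q assume a: "p \<in> ?top" "q \<in> ?top" "g r p = g r q"
    then have "fst p \<in> ?tY" "fst q = fst p" "\<sigma> r (fst p) (snd p) = \<sigma> r (fst p) (snd q)"
      by (auto simp: g_def case_prod_beta)
    then show "p = q" using \<sigma>inj by (metis prod_eqI)
  qed
  have dg: "diffeo_on ?W ?top ?W (g r)" by (rule local_diffeo_inj_imp_diffeo_on[OF W W ld[OF r] injg refl])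
  \<comment> \<open>A fibre may be mapped by \<open>\<sigma> r\<close> onto a proper interval, so
    the inverse is taken on the range, which contains the values of \<open>\<mu> u\<close> by
    \<open>range2\<close>.\<close>
  define H' where "H' u = (\<lambda>(y, s). inv_into ?top (g r) (y, \<mu> u y s))" for u
  have H'eq: "H' u (y, s) = (y, s')" if "y \<in> ?tY" "\<sigma> r y s' = \<mu> u y s" for u y s s'
    using inv_into_f_f[OF injg, of "(y, s')"] that by (simp add: H'_def g_def)
  have sH': "smap ?W ?top ?W (H' u)" if u: "u \<in> J" for u
  proof -
    have "smap ?W ?top ?W (\<lambda>p. (fst p, (\<lambda>(y, s). \<mu> u y s) p))"
      by (rule smap_Pair[OF W Y open_UNIV sfst s\<mu>u]) simp
    then have "smap ?W ?top ?W (\<lambda>p. inv_into ?top (g r) (fst p, (\<lambda>(y, s). \<mu> u y s) p))"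
    proof (rule smap_compose[OF _ diffeo_on_inv[OF dg]])
      fix p assume "p \<in> ?top"
      then obtain y s where p: "p = (y, s)" "y \<in> ?tY" by auto
      obtain s' where "\<sigma> r y s' = \<mu> u y s" using range2[OF u p(2)] by blast
      then have "(fst p, (\<lambda>(y, s). \<mu> u y s) p) = g r (y, s')" by (simp add: g_def p)
      then show "(fst p, (\<lambda>(y, s). \<mu> u y s) p) \<in> g r ` ?top" using p by auto
    qed
    then show ?thesis by (simp add: H'_def case_prod_beta')
  qed
  have "ambient_isotopy ?W Z r e L H H'"
    unfolding ambient_isotopy_def J_def[symmetric]
  proof (intro conjI ballI impI sHJ sH')
    fix p assume p: "p \<in> ?top"
    then obtain y s where ys: "p = (y, s)" "y \<in> ?tY" by auto
    show "H r p = p" using Heq[OF ys(2) J(2), of s s] by (simp add: \<mu>r ys)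
    fix u assume u: "u \<in> J"
    obtain s' where s': "\<mu> u y s' = \<sigma> r y s" using range1[OF u ys(2)] by blast
    obtain s2 where s2: "\<sigma> r y s2 = \<mu> u y s" using range2[OF u ys(2)] by blast
    show "H u p \<in> ?top" using Heq[OF ys(2) u s'] ys by simp
    show "H' u (H u p) = p" using Heq[OF ys(2) u s'] H'eq[OF ys(2), of s u s'] s' ys(1) by simp
    show "H u (H' u p) = p" using H'eq[OF ys(2) s2] Heq[OF ys(2) u, of s s2] s2 ys(1) by simp
    assume f: "p \<notin> L \<or> p \<in> Z"
    have "\<mu> u y s = \<sigma> r y s"
    proof (cases "p \<in> L")
      case True
      then have "(y, s) \<in> Z" using f ys by simp
      from Z[OF this] show ?thesis unfolding \<mu>_def by metis
    qed (use \<mu>L[OF ys(2)] ys in simp)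
    then show "H u p = p" using Heq[OF ys(2) u, of s s] ys by simp
  qed
  moreover have "p \<in> {(y, s). y \<in> ?tY \<and> (y, \<sigma> u y s) \<in> P} \<longleftrightarrow> H' u p \<in> {(y, s). y \<in> ?tY \<and> (y, \<sigma> r y s) \<in> P}"
    if uJ: "u \<in> J \<inter> {0..1}" and pK: "p \<in> K" for u p
  proof -
    have "p \<in> ?top" using pK compactin_subset_topspace[OF K] by blast
    then obtain y s where ys: "p = (y, s)" "y \<in> ?tY" by auto
    obtain s2 where s2: "\<sigma> r y s2 = \<mu> u y s" using range2[of u y s] uJ ys(2) by blast
    have "\<mu> u y s = \<sigma> u y s" using \<beta>1[OF pK] ys(1) by (simp add: \<mu>_def)
    then show ?thesis using H'eq[OF ys(2) s2] s2 ys by simp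
  qed
  ultimately have *: "e > 0 \<and> compactin (mtop ?W) L \<and> L \<subseteq> T \<and> ambient_isotopy ?W Z r e L H H' \<and>
      (\<forall>u\<in>{r - e<..<r + e} \<inter> {0..1}. \<forall>p\<in>K.
        p \<in> {(y, s). y \<in> ?tY \<and> (y, \<sigma> u y s) \<in> P} \<longleftrightarrow> H' u p \<in> {(y, s). y \<in> ?tY \<and> (y, \<sigma> r y s) \<in> P})"
    using e L unfolding J_def by presburger
  show "\<exists>H H' L e. e > 0 \<and> compactin (mtop ?W) L \<and> L \<subseteq> T \<and> ambient_isotopy ?W Z r e L H H' \<and>
      (\<forall>u\<in>{r - e<..<r + e} \<inter> {0..1}. \<forall>p\<in>K.
        p \<in> {(y, s). y \<in> ?tY \<and> (y, \<sigma> u y s) \<in> P} \<longleftrightarrow> H' u p \<in> {(y, s). y \<in> ?tY \<and> (y, \<sigma> r y s) \<in> P})"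
    by (rule exI[of _ H], rule exI[of _ H'], rule exI[of _ L], rule exI[of _ e], rule *)
qed

section \<open>Auxiliary functions of one real variable\<close>

lemma flat_mono: "x \<le> y \<Longrightarrow> flat x \<le> flat y"
  by (auto simp: flat_def flat_poly_def field_simps)

lemma smooth_step_mono: "x \<le> y \<Longrightarrow> smooth_step x \<le> smooth_step y"
proof -
  assume xy: "x \<le> y"
  have "flat x \<le> flat y" "flat (1 - y) \<le> flat (1 - x)" using flat_mono xy by auto
  then have "flat x * flat (1 - y) \<le> flat y * flat (1 - x)" by (intro mult_mono flat_nonneg)
  then show ?thesis
    unfolding smooth_step_def using smooth_step_denom[of x] smooth_step_denom[of y]
    by (simp add: divide_simps algebra_simps)
qed

lemma smooth_step_deriv: obtains D where "D \<ge> 0" "(smooth_step has_real_derivative D) (at x)"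
proof -
  have f: "(flat has_real_derivative flat_poly ([:0, 0, 1:] * (1 - pderiv 1)) x) (at x)" for x
    unfolding flat_def by (rule flat_poly_deriv)
  obtain a where a: "(flat has_real_derivative a) (at x)" using f by blast
  obtain b where b: "(flat has_real_derivative b) (at (1 - x))" using f by blast
  have b': "((\<lambda>x. flat (1 - x)) has_real_derivative b * (- 1)) (at x)"
    by (rule DERIV_chain2[of flat b "\<lambda>x. 1 - x" x, OF b]) (auto intro!: derivative_eq_intros)
  have "\<exists>D. ((\<lambda>x. flat x / (flat x + flat (1 - x))) has_real_derivative D) (at x)"
    using DERIV_divide[OF a DERIV_add[OF a b']] smooth_step_denom[of x] by (metis less_irrefl)
  then obtain D where D: "(smooth_step has_real_derivative D) (at x)"
    unfolding smooth_step_def[abs_def] by blast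
  have "D \<ge> 0"
    by (rule mono_on_imp_deriv_nonneg[OF _ D, of UNIV]) (auto intro!: mono_onI smooth_step_mono)
  then show thesis using D that by blast
qed

definition logistic :: "real \<Rightarrow> real" where "logistic s = inverse (1 + exp (- s))"

lemma logistic_bounds: "0 < logistic s" "logistic s < 1"
  by (auto simp: logistic_def add_pos_pos field_simps)

lemma logistic_deriv:
  "(logistic has_real_derivative exp (- s) / (1 + exp (- s))\<^sup>2) (at s)" "exp (- s) / (1 + exp (- s))\<^sup>2 > 0"
proof -
  have nz: "1 + exp (- s) \<noteq> 0" by (smt (verit) exp_gt_zero)
  show "(logistic has_real_derivative exp (- s) / (1 + exp (- s))\<^sup>2) (at s)"
    unfolding logistic_def[abs_def]
    by (rule DERIV_cong[OF DERIV_inverse_fun[where d = "- exp (- s)"]])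
       (use nz in \<open>auto intro!: derivative_eq_intros simp: field_simps power2_eq_square\<close>)
  show "exp (- s) / (1 + exp (- s))\<^sup>2 > 0" using nz by simp
qed

lemma sfun_logistic:
  assumes M: "smooth_manifold M" and f: "sfun M T f"
  shows "sfun M T (\<lambda>p. logistic (f p))"
  unfolding logistic_def
proof (rule sfun_inverse[OF M])
  have "sfun M T (\<lambda>p. 1 + exp (-1 * f p))"
    by (intro sfun_add sfun_const sfun_exp sfun_mult M f sfun_openin[OF f])
  then show "sfun M T (\<lambda>p. 1 + exp (- f p))" by simp
  show "1 + exp (- f p) \<noteq> 0" for p by (smt (verit) exp_gt_zero)
qed

text \<open>An increasing map of the line into the part below \<open>b\<close> which is the identity
  up to \<open>a\<close>. The switch to the logistic branch is complete at the midpoint of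
  \<open>a\<close> and \<open>b\<close>, and up to there the logistic branch lies above the
  identity.\<close>

definition squash :: "real \<Rightarrow> real \<Rightarrow> real \<Rightarrow> real" where
  "squash a b t = (1 - smooth_step (2 * (t - a) / (b - a))) * t +
     smooth_step (2 * (t - a) / (b - a)) * ((a + b) / 2 + (b - a) / 2 * logistic t)"

lemma squash_id: "a < b \<Longrightarrow> t \<le> a \<Longrightarrow> squash a b t = t"
  by (simp add: squash_def smooth_step_0 divide_simps)

lemma squash_less:
  assumes ab: "a < b"
  shows "squash a b t < b"
proof -
  let ?l = "smooth_step (2 * (t - a) / (b - a))" and ?m = "(a + b) / 2 + (b - a) / 2 * logistic t"
  have "(b - a) / 2 * logistic t < (b - a) / 2 * 1"
    by (rule mult_strict_left_mono) (use ab logistic_bounds in auto)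
  then have m: "?m < b" using ab by (simp add: field_simps)
  show ?thesis
  proof (cases "t \<ge> (a + b) / 2")
    case True
    then have "2 * (t - a) / (b - a) \<ge> 1" using ab by (simp add: field_simps)
    then have "?l = 1" by (rule smooth_step_1)
    then show ?thesis using m by (simp add: squash_def)
  next
    case False
    then have t: "t < b" using ab by simp
    have "(1 - ?l) * t + ?l * ?m < b"
      by (rule convex_bound_lt[OF t m]) (use smooth_step_bounds in auto)
    then show ?thesis by (simp add: squash_def)
  qed
qed

lemma squash_deriv:
  assumes ab: "a < b"
  obtains D where "D > 0" "(squash a b has_real_derivative D) (at t)"
proof -
  let ?x = "\<lambda>t. 2 * (t - a) / (b - a)" and ?m = "\<lambda>t. (a + b) / 2 + (b - a) / 2 * logistic t"
  obtain D where D: "D \<ge> 0" "(smooth_step has_real_derivative D) (at (?x t))" by (rule smooth_step_deriv)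
  have x: "(?x has_real_derivative 2 / (b - a)) (at t)"
  proof -
    have "((\<lambda>t. 2 * (t - a)) has_real_derivative 2) (at t)" by (auto intro!: derivative_eq_intros)
    then show ?thesis by (rule DERIV_cdivide)
  qed
  have l: "((\<lambda>t. smooth_step (?x t)) has_real_derivative D * (2 / (b - a))) (at t)"
    by (rule DERIV_chain2[OF D(2) x])
  define k where "k = exp (- t) / (1 + exp (- t))\<^sup>2"
  have kp: "k > 0" unfolding k_def by (rule logistic_deriv(2))
  have m: "(?m has_real_derivative (b - a) / 2 * k) (at t)"
    using logistic_deriv(1)[of t] by (auto intro!: derivative_eq_intros simp: k_def)
  let ?l = "smooth_step (?x t)"
  have "(squash a b has_real_derivative
      ((0 - D * (2 / (b - a))) * t + 1 * (1 - ?l)) + (D * (2 / (b - a)) * ?m t + (b - a) / 2 * k * ?l)) (at t)"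
    unfolding squash_def[abs_def]
    by (intro DERIV_add DERIV_mult DERIV_diff DERIV_const DERIV_ident l m)
  moreover have "((0 - D * (2 / (b - a))) * t + 1 * (1 - ?l)) + (D * (2 / (b - a)) * ?m t + (b - a) / 2 * k * ?l) =
      (1 - ?l) + (b - a) / 2 * k * ?l + D * (2 / (b - a)) * (?m t - t)"
    by (simp add: algebra_simps)
  \<comment> \<open>The contribution of the changing weight: up to the midpoint the branch that is
    faded in lies above \<open>t\<close>, and beyond the midpoint the weight is constant.\<close>
  moreover have "D * (2 / (b - a)) * (?m t - t) \<ge> 0"
  proof (cases "t \<le> (a + b) / 2")
    case True
    have "(b - a) / 2 * logistic t \<ge> 0" using ab logistic_bounds(1)[of t] by simp
    then have "?m t - t \<ge> 0" using True by linarith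
    then show ?thesis using D(1) ab by (intro mult_nonneg_nonneg) auto
  next
    case False
    then have x1: "?x t > 1" using ab by (simp add: field_simps)
    have "(smooth_step has_real_derivative 0) (at (?x t))"
      by (rule has_field_derivative_transform_within_open[of "\<lambda>_. 1" _ _ "{1<..}"])
         (use x1 smooth_step_1 in auto)
    then have "D = 0" using D(2) DERIV_unique by blast
    then show ?thesis by simp
  qed
  moreover have "(1 - ?l) + (b - a) / 2 * k * ?l > 0"
  proof (cases "?l = 1")
    case True
    have "(b - a) / 2 * k > 0" using ab kp by simp
    then show ?thesis using True by simp
  next
    case False
    then have "1 - ?l > 0" using smooth_step_bounds(2)[of "?x t"] by simp
    moreover have "(b - a) / 2 * k * ?l \<ge> 0"
      using ab kp smooth_step_bounds(1)[of "?x t"] by simp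
    ultimately show ?thesis by linarith
  qed
  ultimately show thesis using that by (metis add_pos_nonneg)
qed

lemma sfun_squash:
  assumes M: "smooth_manifold M" and f: "sfun M T f"
  shows "sfun M T (\<lambda>p. squash a b (f p))"
proof -
  have o: "openin (mtop M) T" by (rule sfun_openin[OF f])
  have "sfun M T (\<lambda>p. 2 / (b - a) * (f p - a))"
    by (intro sfun_mult sfun_diff sfun_const M f o)
  then have l: "sfun M T (\<lambda>p. smooth_step (2 * (f p - a) / (b - a)))"
    by (intro sfun_smooth_step M) simp
  show ?thesis
    unfolding squash_def
    by (intro sfun_add sfun_mult[of M T "\<lambda>p. 1 - smooth_step (2 * (f p - a) / (b - a))"]
        sfun_mult[of M T "\<lambda>p. smooth_step (2 * (f p - a) / (b - a))"] sfun_mult[of M T "\<lambda>_. (b - a) / 2"]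
        sfun_diff sfun_const sfun_logistic M f o l)
qed

text \<open>The first coordinate of the immersed channel: for \<open>1.1 \<le> t \<le> 1.8\<close> the line is compressed to
  an interval of length one, which moves from \<open>(0, 1)\<close> to \<open>(10, 11)\<close>.\<close>

definition pinch :: "real \<Rightarrow> real" where
  "pinch t = smooth_step (20 * t - 21) * (1 - smooth_step (10 * t - 18))"

text \<open>The motion happens for \<open>t\<close> between \<open>13/10\<close> and
  \<open>8/5\<close>, well inside the period in which the line is fully compressed.\<close>

definition drift :: "real \<Rightarrow> real" where "drift t = 10 * smooth_step ((10 * t - 13) / 3)"

definition channel :: "real \<Rightarrow> real \<Rightarrow> real" where
  "channel s t = (1 - pinch t) * s + pinch t * (logistic s + drift t)"

text \<open>The descent lies between the two stops of the channel. Its depth \<open>3\<close> takes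
  every \<open>t\<close> below \<open>2\<close> to a value below \<open>-1\<close>, where
  \<open>squash (-1) 0\<close> is still the identity.\<close>

definition drop_height :: "real \<Rightarrow> real" where "drop_height s = - 3 * smooth_step ((s - 3) / 4)"

lemma pinch_bounds: "0 \<le> pinch t" "pinch t \<le> 1"
  using smooth_step_bounds[of "20 * t - 21"] smooth_step_bounds[of "10 * t - 18"]
  by (auto simp: pinch_def mult_le_one)

lemma pinch_0: "t \<le> 21/20 \<or> t \<ge> 19/10 \<Longrightarrow> pinch t = 0"
  by (auto simp: pinch_def smooth_step_0 smooth_step_1)

lemma pinch_1: "11/10 \<le> t \<Longrightarrow> t \<le> 9/5 \<Longrightarrow> pinch t = 1"
  by (simp add: pinch_def smooth_step_0 smooth_step_1)

lemma channel_id: "t \<le> 21/20 \<or> t \<ge> 19/10 \<Longrightarrow> channel s t = s"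
  by (simp add: channel_def pinch_0)

text \<open>The second alternative serves the compressed strip, where the argument lies in
  \<open>(0, 1)\<close> before \<open>pinch\<close> has reached \<open>1\<close>. A convex
  combination of two points of this interval stays in it.\<close>

lemma channel_start:
  assumes "t \<le> 13/10" and "11/10 \<le> t \<or> (0 < s \<and> s < 1)"
  shows "0 < channel s t" "channel s t < 1"
proof -
  have d: "drift t = 0" using assms(1) by (simp add: drift_def smooth_step_0)
  have l: "0 < logistic s" "logistic s < 1" by (rule logistic_bounds)+
  have "0 < channel s t \<and> channel s t < 1"
  proof (cases "11/10 \<le> t")
    case True
    then show ?thesis using assms(1) pinch_1[of t] l d by (simp add: channel_def)
  next
    case False
    then have s: "- s < 0" "s < 1" using assms(2) by auto
    have "(1 - pinch t) * (- s) + pinch t * (- logistic s) < 0"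
      by (rule convex_bound_lt[OF s(1)]) (use l pinch_bounds[of t] in auto)
    moreover have "(1 - pinch t) * s + pinch t * logistic s < 1"
      by (rule convex_bound_lt[OF s(2)]) (use l pinch_bounds[of t] in auto)
    ultimately show ?thesis using d by (simp add: channel_def algebra_simps)
  qed
  then show "0 < channel s t" "channel s t < 1" by auto
qed

lemma channel_end:
  assumes "8/5 \<le> t" "t \<le> 9/5"
  shows "channel s t > 10"
  using assms pinch_1[of t] logistic_bounds[of s] by (simp add: channel_def drift_def smooth_step_1)

lemma channel_deriv:
  obtains D where "D > 0" "((\<lambda>s. channel s t) has_real_derivative D) (at s)"
proof -
  define k where "k = exp (- s) / (1 + exp (- s))\<^sup>2"
  have k: "k > 0" "(logistic has_real_derivative k) (at s)" using logistic_deriv by (auto simp: k_def)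
  have "((\<lambda>s. channel s t) has_real_derivative (1 - pinch t) * 1 + pinch t * (k + 0)) (at s)"
    unfolding channel_def by (intro DERIV_add DERIV_cmult DERIV_ident DERIV_const k(2))
  moreover have "(1 - pinch t) * 1 + pinch t * (k + 0) > 0"
  proof (cases "pinch t = 0")
    case False
    then have "pinch t * k > 0" using pinch_bounds[of t] k(1) by simp
    then show ?thesis using pinch_bounds[of t] by simp
  qed simp
  ultimately show thesis using that by blast
qed

lemma drop_height_0: "s \<le> 3 \<Longrightarrow> drop_height s = 0"
  and drop_height_3: "s \<ge> 7 \<Longrightarrow> drop_height s = - 3"
  by (auto simp: drop_height_def smooth_step_0 smooth_step_1)

lemma sfun_pinch:
  assumes M: "smooth_manifold M" and f: "sfun M T f"
  shows "sfun M T (\<lambda>p. pinch (f p))"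
  unfolding pinch_def
  by (intro sfun_mult[of M T "\<lambda>p. smooth_step (20 * f p - 21)"] sfun_smooth_step sfun_diff
      sfun_mult[of M T "\<lambda>_. 20"] sfun_mult[of M T "\<lambda>_. 10"] sfun_const M f sfun_openin[OF f])

lemma sfun_channel:
  assumes M: "smooth_manifold M" and f: "sfun M T f" and g: "sfun M T g"
  shows "sfun M T (\<lambda>p. channel (f p) (g p))"
proof -
  have o: "openin (mtop M) T" by (rule sfun_openin[OF f])
  have "sfun M T (\<lambda>p. 1 / 3 * (10 * g p - 13))"
    by (intro sfun_mult[of M T "\<lambda>_. 1/3"] sfun_mult[of M T "\<lambda>_. 10"] sfun_diff sfun_const M g o)
  then have "sfun M T (\<lambda>p. drift (g p))"
    unfolding drift_def by (intro sfun_mult sfun_const sfun_smooth_step M o) simp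
  then show ?thesis
    unfolding channel_def
    by (intro sfun_add sfun_mult sfun_diff sfun_const sfun_pinch sfun_logistic M f g o)
qed

lemma sfun_drop_height:
  assumes M: "smooth_manifold M" and f: "sfun M T f"
  shows "sfun M T (\<lambda>p. drop_height (f p))"
proof -
  have "sfun M T (\<lambda>p. 1 / 4 * (f p - 3))"
    by (intro sfun_mult sfun_diff sfun_const M f sfun_openin[OF f])
  then show ?thesis
    unfolding drop_height_def
    by (intro sfun_mult sfun_const sfun_smooth_step M sfun_openin[OF f]) simp
qed

section \<open>The doubled bordism is isotopic to a product\<close>

definition isotopic :: "nat \<Rightarrow> 'a manifold \<Rightarrow> 'a set \<Rightarrow> 'a set \<Rightarrow> 'a set \<Rightarrow> bool" where
  "isotopic k W Z P Q \<longleftrightarrow> (\<exists>\<gamma>. iso_path k W Z \<gamma> \<and> \<gamma> 0 = P \<and> \<gamma> 1 = Q)"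

lemma isotopic_imp_path_component:
  assumes W: "smooth_manifold W" and P: "isotopic k W Z P Q"
  shows "path_component_of (subtopology (Psi_space k W) {R. R \<inter> Z = P \<inter> Z}) P Q"
proof -
  obtain \<gamma> where \<gamma>: "iso_path k W Z \<gamma>" "\<gamma> 0 = P" "\<gamma> 1 = Q" using P by (auto simp: isotopic_def)
  have "\<gamma> u \<inter> Z = P \<inter> Z" if "u \<in> {0..1}" for u
  proof -
    have "\<gamma> u \<inter> Z = \<gamma> 0 \<inter> Z" using \<gamma>(1) that unfolding iso_path_def by (meson atLeastAtMost_iff order_refl zero_le_one)
    then show ?thesis using \<gamma>(2) by simp
  qed
  then show ?thesis
    unfolding path_component_of_def pathin_subtopology using iso_path_imp_pathin[OF W \<gamma>(1)] \<gamma>(2,3) by blast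
qed

text \<open>The stages are joined inside the subspace of sections with a fixed part in
  \<open>Z\<close>. Transitivity of its path components takes care of concatenation and keeps the
  result constant over \<open>Z\<close>.\<close>

lemma isotopic_chain_path:
  assumes W: "smooth_manifold W" and P: "isotopic k W Z P0 P1" "isotopic k W Z P1 P2" "isotopic k W Z P2 P3"
  obtains \<gamma> where "pathin (Psi_space k W) \<gamma>" "\<gamma> 0 = P0" "\<gamma> 1 = P3" "\<And>t. t \<in> {0..1} \<Longrightarrow> \<gamma> t \<inter> Z = P0 \<inter> Z"
proof -
  have eq: "Q \<inter> Z = P \<inter> Z" if "isotopic k W Z P Q" for P Q
    using that unfolding isotopic_def iso_path_def by (metis atLeastAtMost_iff order_refl zero_le_one)
  let ?X = "subtopology (Psi_space k W) {R. R \<inter> Z = P0 \<inter> Z}"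
  have "path_component_of ?X P0 P1" by (rule isotopic_imp_path_component[OF W P(1)])
  moreover have "path_component_of ?X P1 P2"
    using isotopic_imp_path_component[OF W P(2)] eq[OF P(1)] by simp
  moreover have "path_component_of ?X P2 P3"
    using isotopic_imp_path_component[OF W P(3)] eq[OF P(1)] eq[OF P(2)] by simp
  ultimately have "path_component_of ?X P0 P3" by (blast intro: path_component_of_trans)
  then obtain \<gamma> where \<gamma>: "pathin (Psi_space k W) \<gamma>" "\<forall>t\<in>{0..1}. \<gamma> t \<in> {R. R \<inter> Z = P0 \<inter> Z}" "\<gamma> 0 = P0" "\<gamma> 1 = P3"
    unfolding path_component_of_def pathin_subtopology by blast
  show thesis by (rule that[OF \<gamma>(1,3,4)]) (use \<gamma>(2) in blast)
qed

lemma isotopic_vimage: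
  assumes "smooth_manifold W1" "smooth_manifold W2" and F: "diffeo_on W1 (topspace (mtop W1)) W2 F"
    and Z: "openin (mtop W2) Z" and P: "isotopic k W2 Z P Q"
  shows "isotopic k W1 {p \<in> topspace (mtop W1). F p \<in> Z} {p \<in> topspace (mtop W1). F p \<in> P} {p \<in> topspace (mtop W1). F p \<in> Q}"
proof -
  obtain \<gamma> where \<gamma>: "iso_path k W2 Z \<gamma>" "\<gamma> 0 = P" "\<gamma> 1 = Q" using P by (auto simp: isotopic_def)
  have "iso_path k W1 {p \<in> topspace (mtop W1). F p \<in> Z} (\<lambda>u. {p \<in> topspace (mtop W1). F p \<in> \<gamma> u})"
    by (rule iso_path_vimage[OF assms(1,2) diffeo_on_imp_local_diffeo[OF F] F Z _ \<gamma>(1)]) auto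
  then show ?thesis unfolding isotopic_def using \<gamma>(2,3) by auto
qed

locale split_line =
  fixes B :: "'a manifold" and N :: "'b manifold" and \<theta> :: "'a \<Rightarrow> 'b \<times> real"
  assumes B: "smooth_manifold B" and N: "smooth_manifold N"
    and \<theta>: "diffeo_on B (topspace (mtop B)) (times_interval N UNIV) \<theta>"
    and \<theta>_onto: "\<theta> ` topspace (mtop B) = topspace (mtop N) \<times> UNIV"
begin

abbreviation "W \<equiv> times_interval B UNIV"
abbreviation "NR \<equiv> times_interval N UNIV"
abbreviation "V \<equiv> times_interval NR UNIV"
abbreviation "tB \<equiv> topspace (mtop B)"
abbreviation "tN \<equiv> topspace (mtop N)"
abbreviation "tW \<equiv> tB \<times> (UNIV :: real set)"
abbreviation "tV \<equiv> (tN \<times> (UNIV :: real set)) \<times> (UNIV :: real set)"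

definition height :: "'a \<Rightarrow> real" where "height b = snd (\<theta> b)"

definition slide :: "'a \<Rightarrow> real \<Rightarrow> 'a" where "slide b s = inv_into tB \<theta> (fst (\<theta> b), s)"

lemma smooth_W: "smooth_manifold W" by (rule smooth_manifold_times_interval[OF B open_UNIV])
lemma smooth_NR: "smooth_manifold NR" by (rule smooth_manifold_times_interval[OF N open_UNIV])
lemma smooth_V: "smooth_manifold V" by (rule smooth_manifold_times_interval[OF smooth_NR open_UNIV])

lemma fst_\<theta>: "b \<in> tB \<Longrightarrow> fst (\<theta> b) \<in> tN"
  using \<theta>_onto by (metis imageI mem_Times_iff)

lemma \<theta>_slide: "b \<in> tB \<Longrightarrow> \<theta> (slide b s) = (fst (\<theta> b), s)" and slide_in: "b \<in> tB \<Longrightarrow> slide b s \<in> tB"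
proof -
  assume b: "b \<in> tB"
  have "(fst (\<theta> b), s) \<in> \<theta> ` tB" using fst_\<theta>[OF b] \<theta>_onto by simp
  then show "\<theta> (slide b s) = (fst (\<theta> b), s)" "slide b s \<in> tB"
    unfolding slide_def by (auto simp: f_inv_into_f inv_into_into)
qed

lemma height_slide[simp]: "b \<in> tB \<Longrightarrow> height (slide b s) = s"
  by (simp add: height_def \<theta>_slide)

lemma slide_slide[simp]: "b \<in> tB \<Longrightarrow> slide (slide b s) s' = slide b s'"
  by (simp add: slide_def[of _ s'] \<theta>_slide)

lemma slide_height[simp]: "b \<in> tB \<Longrightarrow> slide b (height b) = b"
  using inv_into_f_f[OF diffeo_on_inj[OF \<theta>]] by (simp add: slide_def height_def)

lemma slide_eqD: "slide b s = slide b' s' \<Longrightarrow> b \<in> tB \<Longrightarrow> b' \<in> tB \<Longrightarrow> s = s' \<and> fst (\<theta> b) = fst (\<theta> b')"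
  using \<theta>_slide[of b s] \<theta>_slide[of b' s'] by simp

lemma height_eqD: "b \<in> tB \<Longrightarrow> b' \<in> tB \<Longrightarrow> fst (\<theta> b) = fst (\<theta> b') \<Longrightarrow> height b = height b' \<Longrightarrow> b = b'"
  using inj_onD[OF diffeo_on_inj[OF \<theta>]] by (simp add: height_def prod_eq_iff)

lemma sfun_height: "sfun B tB height"
proof -
  have "{p \<in> tB. \<theta> p \<in> tN \<times> UNIV} = tB" using \<theta>_onto by blast
  then show ?thesis
    using smap_sfun[OF diffeo_on_smap[OF \<theta>] sfun_snd[OF N open_UNIV]] by (simp add: height_def[abs_def])
qed

lemma sfun_W_coords: "sfun W tW (\<lambda>p. height (fst p))" "sfun W tW snd"
  using sfun_fst[OF B open_UNIV sfun_height] sfun_snd[OF B open_UNIV] by auto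

lemma openin_W_time: "open T \<Longrightarrow> openin (mtop W) {p \<in> tW. snd p \<in> T}"
  by (rule sfun_preimage[OF smooth_W sfun_W_coords(2)])

text \<open>Makes the line factor of the boundary the last coordinate and the time a parameter, the
  order in which the results on fibre maps apply to slides.\<close>

definition split :: "'a \<times> real \<Rightarrow> ('b \<times> real) \<times> real" where
  "split = (\<lambda>(b, t). ((fst (\<theta> b), t), height b))"

definition unsplit :: "('b \<times> real) \<times> real \<Rightarrow> 'a \<times> real" where
  "unsplit = (\<lambda>((x, t), s). (inv_into tB \<theta> (x, s), t))"

lemma split_unsplit: "p \<in> tW \<Longrightarrow> split p \<in> tV \<and> unsplit (split p) = p"
  using fst_\<theta> inv_into_f_f[OF diffeo_on_inj[OF \<theta>]] by (auto simp: split_def unsplit_def height_def)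

lemma unsplit_split: "q \<in> tV \<Longrightarrow> unsplit q \<in> tW \<and> split (unsplit q) = q"
proof -
  assume "q \<in> tV"
  then obtain x t s where q: "q = ((x, t), s)" "x \<in> tN" by auto
  have "(x, s) \<in> \<theta> ` tB" using q(2) \<theta>_onto by simp
  then show ?thesis by (simp add: q split_def unsplit_def height_def f_inv_into_f inv_into_into)
qed

lemma diffeo_split: "diffeo_on W tW V split" and diffeo_unsplit: "diffeo_on V tV W unsplit"
proof -
  have f: "smap W tW B fst" and u: "sfun W tW snd"
    by (rule smap_fst[OF B open_UNIV], rule sfun_snd[OF B open_UNIV])
  have "smap W tW NR (\<lambda>p. \<theta> (fst p))" by (rule smap_compose[OF f diffeo_on_smap[OF \<theta>]]) auto
  then have "smap W tW N (\<lambda>p. fst (\<theta> (fst p)))"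
    by (rule smap_compose[OF _ smap_fst[OF N open_UNIV]]) (use fst_\<theta> in \<open>auto simp: mem_Times_iff\<close>)
  from smap_Pair[OF smooth_W smooth_NR open_UNIV smap_Pair[OF smooth_W N open_UNIV this u] sfun_W_coords(1)]
  have s1: "smap W tW V split" by (simp add: split_def case_prod_beta')
  have f': "smap V tV NR fst" and s': "sfun V tV snd"
    using smap_fst[OF smooth_NR open_UNIV] sfun_snd[OF smooth_NR open_UNIV] by auto
  have x: "smap V tV N (\<lambda>q. fst (fst q))" by (rule smap_compose[OF f' smap_fst[OF N open_UNIV]]) auto
  have eq: "{p \<in> tV. fst p \<in> tN \<times> UNIV} = tV" by auto
  have t: "sfun V tV (\<lambda>q. snd (fst q))" using smap_sfun[OF f' sfun_snd[OF N open_UNIV]] unfolding eq .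
  have "smap V tV NR (\<lambda>q. (fst (fst q), snd q))" by (rule smap_Pair[OF smooth_V N open_UNIV x s']) simp
  then have "smap V tV B (\<lambda>q. inv_into tB \<theta> (fst (fst q), snd q))"
    by (rule smap_compose[OF _ diffeo_on_inv[OF \<theta>]]) (use \<theta>_onto in auto)
  from smap_Pair[OF smooth_V B open_UNIV this t]
  have s2: "smap V tV W unsplit" by (simp add: unsplit_def case_prod_beta')
  have d: "mdim W = mdim V" using diffeo_on_mdim[OF \<theta>] by simp
  have inj1: "inj_on split tW" using split_unsplit by (metis inj_onI)
  have inj2: "inj_on unsplit tV" using unsplit_split by (metis inj_onI)
  have im1: "split ` tW = tV"
  proof (intro subset_antisym subsetI)
    show "q \<in> tV" if "q \<in> split ` tW" for q using that split_unsplit by blast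
    show "q \<in> split ` tW" if "q \<in> tV" for q
      using unsplit_split[OF that] by (intro image_eqI[of _ _ "unsplit q"]) auto
  qed
  have im2: "unsplit ` tV = tW"
  proof (intro subset_antisym subsetI)
    show "q \<in> tW" if "q \<in> unsplit ` tV" for q using that unsplit_split by blast
    show "q \<in> unsplit ` tV" if "q \<in> tW" for q
      using split_unsplit[OF that] by (intro image_eqI[of _ _ "split q"]) auto
  qed
  have "inv_into tW split q = unsplit q" if "q \<in> tV" for q
    using inv_into_f_f[OF inj1, of "unsplit q"] unsplit_split[OF that] by simp
  then have "smap V (split ` tW) W (inv_into tW split)"
    unfolding im1 using smap_subset[OF smooth_V s2 smap_openin[OF s2]] by simp
  then show "diffeo_on W tW V split" unfolding diffeo_on_def using d s1 inj1 by blast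
  have "inv_into tV unsplit q = split q" if "q \<in> tW" for q
    using inv_into_f_f[OF inj2, of "split q"] split_unsplit[OF that] by simp
  then have "smap W (unsplit ` tV) V (inv_into tV unsplit)"
    unfolding im2 using smap_subset[OF smooth_W s1 smap_openin[OF s1]] by simp
  then show "diffeo_on V tV W unsplit" unfolding diffeo_on_def using d s2 inj2 by metis
qed

lemma sfun_V_coords: "sfun V tV snd" "sfun V tV (\<lambda>q. snd (fst q))"
proof -
  show "sfun V tV snd" using sfun_snd[OF smooth_NR open_UNIV] by simp
  have eq: "{p \<in> tV. fst p \<in> tN \<times> UNIV} = tV" by auto
  have f': "smap V tV NR fst" using smap_fst[OF smooth_NR open_UNIV] by simp
  show "sfun V tV (\<lambda>q. snd (fst q))" using smap_sfun[OF f' sfun_snd[OF N open_UNIV]] unfolding eq .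
qed

text \<open>Conjugation by \<open>split\<close> turns a slide into a map that changes the last
  coordinate only.\<close>

lemma local_diffeo_slide:
  assumes f: "sfun V tV (\<lambda>q. f (snd q) (snd (fst q)))"
    and pos: "\<And>s t. \<exists>D>0. ((\<lambda>s. f s t) has_real_derivative D) (at s)"
  shows "local_diffeo W tW W (\<lambda>(b, t). (slide b (f (height b) t), t))"
proof -
  let ?g = "\<lambda>(q, s). (q, (\<lambda>(q, s). f s (snd q)) (q, s))"
  have f': "sfun V tV (\<lambda>(q, s). f s (snd q))" using f by (simp add: case_prod_beta')
  have p: "deriv (\<lambda>s. (\<lambda>(q, s). f s (snd q)) (q, s)) s > 0" if "(q, s) \<in> tV" for q s
    using pos[of "snd q" s] DERIV_imp_deriv by auto
  have g: "local_diffeo V tV V ?g" using local_diffeo_fibre[OF smooth_NR f' p] by simp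
  have "local_diffeo W tW V (\<lambda>p. ?g (split p))"
    by (rule local_diffeo_compose[OF smooth_W smooth_V smooth_V diffeo_on_imp_local_diffeo[OF diffeo_split] g])
       (use split_unsplit in blast)
  then have "local_diffeo W tW W (\<lambda>p. unsplit (?g (split p)))"
    by (rule local_diffeo_compose[OF smooth_W smooth_V smooth_W _ diffeo_on_imp_local_diffeo[OF diffeo_unsplit]])
       (use fst_\<theta> in \<open>auto simp: split_def\<close>)
  moreover have "(\<lambda>p. unsplit (?g (split p))) = (\<lambda>(b, t). (slide b (f (height b) t), t))"
    by (auto simp: fun_eq_iff split_def unsplit_def slide_def)
  ultimately show ?thesis by simp
qed

text \<open>The conjugation by \<open>split\<close> carries the slides over to
  \<open>iso_path_fibre\<close>. Over times in \<open>T\<close> the slide does not depend on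
  \<open>u\<close>, so the path is constant there.\<close>

lemma iso_path_slide:
  assumes f: "sfun (times_interval V UNIV) (tV \<times> UNIV) (\<lambda>q. f (snd q) (snd (fst q)) (snd (fst (fst q))))"
    and pos: "\<And>u s t. u \<in> {0..1} \<Longrightarrow> \<exists>D>0. ((\<lambda>s. f u s t) has_real_derivative D) (at s)"
    and T: "open T" and fT: "\<And>u s t. t \<in> T \<Longrightarrow> f u s t = f 0 s t" and P: "P \<in> Psi_set k W"
  shows "iso_path k W {p \<in> tW. snd p \<in> T} (\<lambda>u. {(b, t). b \<in> tB \<and> (slide b (f u (height b) t), t) \<in> P})"
proof -
  define P' where "P' = {q \<in> tV. unsplit q \<in> P}"
  have P': "P' \<in> Psi_set k V"
    using Psi_set_vimage[OF smooth_V smooth_W _ P, of unsplit] diffeo_on_imp_local_diffeo[OF diffeo_unsplit]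
    by (simp add: P'_def)
  define Z where "Z = {q \<in> tV. snd (fst q) \<in> T}"
  have Z: "openin (mtop V) Z" unfolding Z_def by (rule sfun_preimage[OF smooth_V sfun_V_coords(2) T])
  have "iso_path k V Z (\<lambda>u. {(q, s). q \<in> topspace (mtop NR) \<and> (q, f u s (snd q)) \<in> P'})"
  proof (rule iso_path_fibre[OF smooth_NR _ _ P'])
    show "sfun (times_interval V UNIV) (topspace (mtop (times_interval V UNIV))) (\<lambda>((q, s), u). f u s (snd q))"
      using f by (simp add: case_prod_beta')
    show "deriv (\<lambda>s. f u s (snd q)) s > 0" if "u \<in> {0..1}" for u q s
      using pos[OF that, of "snd q" s] DERIV_imp_deriv by auto
    show "f u s (snd q) = f 0 s (snd q)" if "(q, s) \<in> Z" for q s u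
      using that by (auto simp: Z_def intro: fT)
  qed
  from iso_path_vimage[OF smooth_W smooth_V _ _ Z _ this, of split tW]
  have iso: "iso_path k W {p \<in> tW. split p \<in> Z}
      (\<lambda>u. {p \<in> tW. split p \<in> {(q, s). q \<in> topspace (mtop NR) \<and> (q, f u s (snd q)) \<in> P'}})"
    using diffeo_split diffeo_on_imp_local_diffeo[OF diffeo_split] by simp
  have "{p \<in> tW. split p \<in> Z} = {p \<in> tW. snd p \<in> T}"
    using fst_\<theta> by (auto simp: Z_def split_def)
  moreover have "{p \<in> tW. split p \<in> {(q, s). q \<in> topspace (mtop NR) \<and> (q, f u s (snd q)) \<in> P'}} =
      {(b, t). b \<in> tB \<and> (slide b (f u (height b) t), t) \<in> P}" for u
    using fst_\<theta> by (auto simp: P'_def split_def unsplit_def slide_def)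
  ultimately show ?thesis using iso by simp
qed

lemma local_diffeo_time:
  assumes f: "sfun W A (\<lambda>p. f (fst p) (snd p))"
    and pos: "\<And>b t. (b, t) \<in> A \<Longrightarrow> \<exists>D>0. ((\<lambda>t. f b t) has_real_derivative D) (at t)"
  shows "local_diffeo W A W (\<lambda>(b, t). (b, f b t))"
proof -
  have f': "sfun W A (\<lambda>(b, t). f b t)" using f by (simp add: case_prod_beta')
  have p: "deriv (\<lambda>t. (\<lambda>(b, t). f b t) (b, t)) t > 0" if "(b, t) \<in> A" for b t
    using pos[OF that] DERIV_imp_deriv by auto
  show ?thesis using local_diffeo_fibre[OF B f' p] by simp
qed

text \<open>The cases of \<open>fold_time\<close> fit together smoothly only on the image of \<open>channel\<close>: there \<open>drop_height\<close>
  vanishes near \<open>t = 1.2\<close> and equals \<open>-3\<close> near \<open>t = 1.7\<close>.\<close>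

definition fold_time :: "real \<Rightarrow> real \<Rightarrow> real" where
  "fold_time s t = (if t < 6/5 then t else if t < 17/10 then t + drop_height s else squash (-1) 0 (t - 3))"

text \<open>The immersion \<open>F\<close> of the overview. The new time is computed from the
  coordinate that has already been slid, so \<open>F\<close> is a slide followed by a change of
  time, and each of the two steps changes one coordinate only.\<close>

definition fold_map :: "'a \<times> real \<Rightarrow> 'a \<times> real" where
  "fold_map = (\<lambda>(b, t). let s = channel (height b) t in (slide b s, fold_time s t))"

lemma squash_shift: "t \<le> 2 \<Longrightarrow> squash (-1) 0 (t - 3) = t - 3"
  by (rule squash_id) auto

lemma fold_time_channel:
  assumes "23/20 < t" "t < 7/4"
  shows "fold_time (channel s t) t = t + drop_height (channel s t)"
proof -
  consider "t < 6/5" | "6/5 \<le> t" "t < 17/10" | "17/10 \<le> t" by linarith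
  then show ?thesis
  proof cases
    case 1
    then have "channel s t < 1" using assms by (intro channel_start) auto
    then show ?thesis using 1 by (simp add: fold_time_def drop_height_0)
  next
    case 3
    then have "channel s t > 10" using assms by (intro channel_end) auto
    then show ?thesis using 3 assms by (simp add: fold_time_def drop_height_3 squash_shift)
  qed (simp add: fold_time_def)
qed

lemma sfun_time_functions:
  "sfun W tW (\<lambda>p. snd p)" "sfun W tW (\<lambda>p. snd p + drop_height (height (fst p)))" "sfun W tW (\<lambda>p. squash (-1) 0 (snd p - 3))"
  by (intro sfun_W_coords sfun_add sfun_drop_height sfun_squash sfun_diff sfun_const smooth_W sfun_openin[OF sfun_W_coords(2)])+

text \<open>On each of three overlapping time intervals, \<open>fold_map\<close> is the slide
  followed by a single smooth formula for the time. On the overlaps the formulas agree by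
  \<open>fold_time_channel\<close> and \<open>channel_end\<close>.\<close>

lemma local_diffeo_fold_map: "local_diffeo W tW W fold_map"
proof (rule local_diffeo_local[OF smooth_W smooth_W sfun_openin[OF sfun_W_coords(2)]])
  define S where "S = (\<lambda>(b, t). (slide b (channel (height b) t), t))"
  have S: "local_diffeo W tW W S"
    unfolding S_def
  proof (rule local_diffeo_slide)
    show "sfun V tV (\<lambda>q. channel (snd q) (snd (fst q)))"
      by (intro sfun_channel smooth_V sfun_V_coords)
    show "\<exists>D>0. ((\<lambda>s. channel s t) has_real_derivative D) (at s)" for s t by (metis channel_deriv)
  qed
  have S_in: "S p \<in> tW" if "p \<in> tW" for p using that slide_in by (auto simp: S_def)
  define T2 where "T2 = (\<lambda>(b, t). (b::'a, t + drop_height (height b)))"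
  define T3 where "T3 = (\<lambda>(b::'a, t). (b, squash (-1) 0 (t - 3)))"
  have T2: "local_diffeo W tW W T2"
    unfolding T2_def
    by (rule local_diffeo_time[OF sfun_time_functions(2)])
       (auto intro!: exI[of _ 1] derivative_eq_intros)
  have T3: "local_diffeo W tW W T3"
    unfolding T3_def
  proof (rule local_diffeo_time[OF sfun_time_functions(3)])
    fix t :: real
    obtain D where D: "D > 0" "(squash (-1) 0 has_real_derivative D) (at (t - 3))" by (rule squash_deriv[of "-1" 0]) auto
    have "((\<lambda>t. squash (-1) 0 (t - 3)) has_real_derivative D * 1) (at t)"
      by (rule DERIV_chain2[of "squash (-1) 0" D "\<lambda>t. t - 3" t, OF D(2)]) (auto intro!: derivative_eq_intros)
    then show "\<exists>D>0. ((\<lambda>t. squash (-1) 0 (t - 3)) has_real_derivative D) (at t)" using D(1) by auto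
  qed
  have S2: "local_diffeo W tW W (\<lambda>p. T2 (S p))"
    by (rule local_diffeo_compose[OF smooth_W smooth_W smooth_W S T2 S_in])
  have S3: "local_diffeo W tW W (\<lambda>p. T3 (S p))"
    by (rule local_diffeo_compose[OF smooth_W smooth_W smooth_W S T3 S_in])
  fix p assume p: "p \<in> tW"
  have o: "openin (mtop W) {p \<in> tW. snd p \<in> X}" if "open X" for X by (rule openin_W_time[OF that])
  consider "snd p < 6/5" | "23/20 < snd p" "snd p < 7/4" | "17/10 \<le> snd p" by linarith
  then show "\<exists>S G. p \<in> S \<and> local_diffeo W S W G \<and> (\<forall>q\<in>tW \<inter> S. fold_map q = G q)"
  proof cases
    case 1
    have "local_diffeo W {p \<in> tW. snd p \<in> {..<6/5}} W S"
      by (rule local_diffeo_subset[OF smooth_W smooth_W S o]) auto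
    then show ?thesis
      using 1 p by (intro exI[of _ "{p \<in> tW. snd p \<in> {..<6/5}}"] exI[of _ S])
        (auto simp: fold_map_def S_def fold_time_def Let_def)
  next
    case 2
    have "local_diffeo W {p \<in> tW. snd p \<in> {23/20<..<7/4}} W (\<lambda>p. T2 (S p))"
      by (rule local_diffeo_subset[OF smooth_W smooth_W S2 o]) auto
    then show ?thesis
      using 2 p by (intro exI[of _ "{p \<in> tW. snd p \<in> {23/20<..<7/4}}"] exI[of _ "\<lambda>p. T2 (S p)"])
        (auto simp: fold_map_def S_def T2_def Let_def fold_time_channel)
  next
    case 3
    have l: "local_diffeo W {p \<in> tW. snd p \<in> {33/20<..}} W (\<lambda>p. T3 (S p))"
      by (rule local_diffeo_subset[OF smooth_W smooth_W S3 o]) auto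
    have "fold_map (b, t) = T3 (S (b, t))" if "b \<in> tB" "33/20 < t" for b t
    proof (cases "t < 17/10")
      case True
      have "channel (height b) t > 10" by (rule channel_end) (use that True in auto)
      then show ?thesis using True that
        by (simp add: fold_map_def S_def T3_def Let_def fold_time_def drop_height_3 squash_shift)
    qed (use that in \<open>simp add: fold_map_def S_def T3_def Let_def fold_time_def\<close>)
    then show ?thesis
      using l 3 p by (intro exI[of _ "{p \<in> tW. snd p \<in> {33/20<..}}"] exI[of _ "\<lambda>p. T3 (S p)"]) auto
  qed
qed

text \<open>The weight of the additional compression: \<open>0\<close> up to \<open>z / 2\<close>,
  \<open>1\<close> from \<open>z\<close> to \<open>13/10\<close>, and \<open>0\<close> again from
  \<open>27/20\<close> on. It fades out at times at which \<open>pinch\<close> is \<open>1\<close>,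
  that is, when the channel itself has taken over.\<close>

definition squeeze :: "real \<Rightarrow> real \<Rightarrow> real" where
  "squeeze z t = smooth_step ((2 / z) * t - 1) * (1 - smooth_step (20 * t - 26))"

definition narrow :: "real \<Rightarrow> real \<Rightarrow> real \<Rightarrow> real \<Rightarrow> real" where
  "narrow z u s t = (1 - u * squeeze z t) * s + (u * squeeze z t) * logistic s"

lemma squeeze_bounds: "0 \<le> squeeze z t" "squeeze z t \<le> 1"
  using smooth_step_bounds[of "(2 / z) * t - 1"] smooth_step_bounds[of "20 * t - 26"]
  by (auto simp: squeeze_def mult_le_one)

lemma squeeze_0: "z > 0 \<Longrightarrow> t \<le> z / 2 \<or> t \<ge> 27/20 \<Longrightarrow> squeeze z t = 0"
  by (auto simp: squeeze_def smooth_step_0 smooth_step_1 field_simps)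

lemma squeeze_1: "z > 0 \<Longrightarrow> z \<le> t \<Longrightarrow> t \<le> 13/10 \<Longrightarrow> squeeze z t = 1"
  by (simp add: squeeze_def smooth_step_0 smooth_step_1 field_simps)

lemma narrow_deriv:
  assumes u: "u \<in> {0..1}"
  obtains D where "D > 0" "((\<lambda>s. narrow z u s t) has_real_derivative D) (at s)"
proof -
  define k where "k = exp (- s) / (1 + exp (- s))\<^sup>2"
  have k: "k > 0" "(logistic has_real_derivative k) (at s)" using logistic_deriv by (auto simp: k_def)
  let ?c = "u * squeeze z t"
  have c: "0 \<le> ?c" "?c \<le> 1" using u squeeze_bounds[of z t] by (auto simp: mult_le_one)
  have "((\<lambda>s. narrow z u s t) has_real_derivative (1 - ?c) * 1 + ?c * k) (at s)"
    unfolding narrow_def by (intro DERIV_add DERIV_cmult DERIV_ident k(2))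
  moreover have "(1 - ?c) * 1 + ?c * k > 0"
  proof (cases "?c = 0")
    case False
    then have "?c > 0" using c by linarith
    then have "?c * k > 0" using k(1) by (rule mult_pos_pos)
    then show ?thesis using c by simp
  next
    case True
    then show ?thesis unfolding True by simp
  qed
  ultimately show thesis using that by blast
qed

lemma sfun_narrow:
  assumes M: "smooth_manifold M" and u: "sfun M T u" and f: "sfun M T f" and g: "sfun M T g"
  shows "sfun M T (\<lambda>p. narrow z (u p) (f p) (g p))"
proof -
  have o: "openin (mtop M) T" by (rule sfun_openin[OF f])
  have "sfun M T (\<lambda>p. squeeze z (g p))"
    unfolding squeeze_def
    by (intro sfun_mult[of M T "\<lambda>p. smooth_step ((2 / z) * g p - 1)"] sfun_smooth_step sfun_diff
        sfun_mult[of M T "\<lambda>_. 2 / z"] sfun_mult[of M T "\<lambda>_. 20"] sfun_const M g o)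
  then show ?thesis
    unfolding narrow_def by (intro sfun_add sfun_mult sfun_diff sfun_const sfun_logistic M f u o)
qed

end

lemma strict_mono_if_deriv_pos:
  fixes f :: "real \<Rightarrow> real"
  assumes "\<And>s. \<exists>D>0. (f has_real_derivative D) (at s)"
  shows "strict_mono f"
  by (rule strict_monoI, rule DERIV_pos_imp_increasing) (use assms in \<open>blast+\<close>)

context split_line
begin

lemma sfun_VU_coords:
  "sfun (times_interval V UNIV) (tV \<times> UNIV) snd"
  "sfun (times_interval V UNIV) (tV \<times> UNIV) (\<lambda>q. snd (fst q))"
  "sfun (times_interval V UNIV) (tV \<times> UNIV) (\<lambda>q. snd (fst (fst q)))"
  using sfun_snd[OF smooth_V open_UNIV] sfun_fst[OF smooth_V open_UNIV sfun_V_coords(1)]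
    sfun_fst[OF smooth_V open_UNIV sfun_V_coords(2)] by simp_all

text \<open>The region \<open>Z\<close> is the one over which the path of a right inverse has to be
  constant. Stating the result as a chain of isotopies relative to \<open>Z\<close> also allows it
  to be reflected, which is how left inverses arise.\<close>

lemma fold_chain:
  assumes G: "G \<in> Psi_set k W" and e: "0 < e" "e \<le> 1/20"
    and G0: "\<And>b t. b \<in> tB \<Longrightarrow> t < e \<Longrightarrow> (b, t) \<in> G \<longleftrightarrow> (b, 0) \<in> G"
  defines "\<delta> \<equiv> e / 8"
  defines "Z \<equiv> {p \<in> tW. snd p \<in> {..<\<delta>} \<union> {2 - \<delta><..}}"
  obtains R Q1 Q2 where "R \<in> Psi_set k W"
    "\<And>b t. b \<in> tB \<Longrightarrow> t < 1 + \<delta> \<Longrightarrow> (b, t) \<in> R \<longleftrightarrow> (b, t) \<in> G"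
    "\<And>b t. b \<in> tB \<Longrightarrow> \<bar>t\<bar> < \<delta> \<Longrightarrow> (b, t + 2) \<in> R \<longleftrightarrow> (b, t) \<in> G"
    "isotopic k W Z R Q1" "isotopic k W Z Q1 Q2" "isotopic k W Z Q2 {(b, t). b \<in> tB \<and> (b, 0) \<in> G}"
    "{(b, t). b \<in> tB \<and> (b, 0) \<in> G} \<in> Psi_set k W"
proof -
  \<comment> \<open>Three thresholds below \<open>e\<close> keep the stages apart: the narrowing
    sets in between \<open>\<delta>\<close> and \<open>z1\<close>, the set \<open>\<Omega>\<close>
    of injectivity starts at \<open>z1\<close>, and \<open>G\<close> is moved only above
    \<open>z0\<close>. Between \<open>z0\<close> and \<open>e\<close> there is room to squash all
    times into the part where \<open>G\<close> is a product.\<close>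
  define z0 where "z0 = e / 2"
  define z1 where "z1 = e / 4"
  have z: "0 < z1" "z1 < z0" "z0 < e" "\<delta> = z1 / 2" "\<delta> < 1/20" "z1 < 13/10"
    using e by (auto simp: z0_def z1_def \<delta>_def)
  define T0 where "T0 = {..<\<delta>} \<union> {2 - \<delta><..}"
  have T0: "open T0" by (auto simp: T0_def)
  have T0D: "t \<le> z1 / 2 \<or> t \<ge> 27/20" "t \<le> 21/20 \<or> t \<ge> 19/10" if "t \<in> T0" for t
    using that z by (auto simp: T0_def)
  define D0 where "D0 = {p \<in> tW. fold_map p \<in> G}"
  have D0: "D0 \<in> Psi_set k W"
    using Psi_set_vimage[OF smooth_W smooth_W _ G, of fold_map] local_diffeo_fold_map by (simp add: D0_def)
  have memD0: "(b, t) \<in> D0 \<longleftrightarrow> b \<in> tB \<and> (slide b (channel (height b) t), fold_time (channel (height b) t) t) \<in> G" for b t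
    by (auto simp: D0_def fold_map_def Let_def)
  have D0_low: "(b, t) \<in> D0 \<longleftrightarrow> (b, t) \<in> G" if "b \<in> tB" "t < 1 + \<delta>" for b t
    using that z by (simp add: memD0 channel_id fold_time_def)
  \<comment> \<open>From \<open>19/10\<close> on, the line is no longer compressed and the time is
    squashed below \<open>0\<close>, where \<open>G\<close> is a product. So this section ends with
    the slice of \<open>G\<close> at \<open>0\<close>.\<close>
  have D0_high: "(b, t) \<in> D0 \<longleftrightarrow> (b, 0) \<in> G" if "b \<in> tB" "t \<ge> 19/10" for b t
    using that G0[of b "squash (-1) 0 (t - 3)"] squash_less[of "-1" 0 "t - 3"] e
    by (simp add: memD0 channel_id fold_time_def)
  \<comment> \<open>The narrowing acts before the fold, so that it compresses the part on which
    \<open>fold_map\<close> is the identity while \<open>fold_map\<close> itself is kept.\<close>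
  define \<gamma>1 where "\<gamma>1 u = {(b, t). b \<in> tB \<and> (slide b (narrow z1 u (height b) t), t) \<in> D0}" for u
  have nd: "\<exists>D>0. ((\<lambda>s. narrow z1 u s t) has_real_derivative D) (at s)" if "u \<in> {0..1}" for u s t
    by (rule narrow_deriv[OF that]) blast
  have iso1: "iso_path k W {p \<in> tW. snd p \<in> T0} \<gamma>1"
    unfolding \<gamma>1_def
  proof (rule iso_path_slide[OF _ nd T0 _ D0])
    show "sfun (times_interval V UNIV) (tV \<times> UNIV) (\<lambda>q. narrow z1 (snd q) (snd (fst q)) (snd (fst (fst q))))"
      by (intro sfun_narrow smooth_manifold_times_interval smooth_V open_UNIV sfun_VU_coords)
    show "narrow z1 u s t = narrow z1 0 s t" if "t \<in> T0" for u s t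
      using squeeze_0[OF z(1) T0D(1)[OF that]] by (simp add: narrow_def)
  qed
  define n where "n = (\<lambda>(b, t). (slide b (narrow z1 1 (height b) t), t))"
  define \<sigma> where "\<sigma> s t = channel (narrow z1 1 s t) t" for s t
  define Fn where "Fn p = fold_map (n p)" for p
  have Fn: "Fn (b, t) = (slide b (\<sigma> (height b) t), fold_time (\<sigma> (height b) t) t)" if "b \<in> tB" for b t
    using that by (simp add: Fn_def n_def fold_map_def \<sigma>_def Let_def)
  have n_in: "n p \<in> tW" if "p \<in> tW" for p using that slide_in by (auto simp: n_def)
  have ldn: "local_diffeo W tW W n"
    unfolding n_def
  proof (rule local_diffeo_slide)
    show "sfun V tV (\<lambda>q. narrow z1 1 (snd q) (snd (fst q)))"
      by (intro sfun_narrow smooth_V sfun_V_coords sfun_const sfun_openin[OF sfun_V_coords(1)])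
  qed (use nd in auto)
  have ldF: "local_diffeo W tW W Fn"
    unfolding Fn_def by (rule local_diffeo_compose[OF smooth_W smooth_W smooth_W ldn local_diffeo_fold_map n_in])
  have g10: "\<gamma>1 0 = D0"
    by (auto simp: \<gamma>1_def narrow_def memD0)
  have g11: "\<gamma>1 1 = {p \<in> tW. Fn p \<in> G}"
    using n_in by (auto simp: \<gamma>1_def D0_def Fn_def n_def)
  \<comment> \<open>The squashing starts at \<open>z0\<close>, so this path is constant over
    \<open>Z2\<close>. For the lift through \<open>Fn\<close>, such constancy is required over all
    values taken outside \<open>\<Omega>\<close>.\<close>
  define \<gamma>2 where "\<gamma>2 u = {(b, t). b \<in> tB \<and> (b, (1 - u) * t + u * squash z0 e t) \<in> G}" for u
  define Z2 where "Z2 = {p \<in> tW. snd p \<in> {..<z0}}"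
  have iso2: "iso_path k W Z2 \<gamma>2"
    unfolding \<gamma>2_def
  proof (rule iso_path_fibre[OF B _ _ G])
    have WU: "smooth_manifold (times_interval W UNIV)" by (rule smooth_manifold_times_interval[OF smooth_W open_UNIV])
    have c: "sfun (times_interval W UNIV) (tW \<times> UNIV) snd" "sfun (times_interval W UNIV) (tW \<times> UNIV) (\<lambda>q. snd (fst q))"
      using sfun_snd[OF smooth_W open_UNIV] sfun_fst[OF smooth_W open_UNIV sfun_W_coords(2)] by simp_all
    have "sfun (times_interval W UNIV) (tW \<times> UNIV) (\<lambda>q. (1 - snd q) * snd (fst q) + snd q * squash z0 e (snd (fst q)))"
      by (intro sfun_add sfun_mult sfun_diff sfun_const sfun_squash WU c sfun_openin[OF c(1)])
    then show "sfun (times_interval W UNIV) (topspace (mtop (times_interval W UNIV)))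
        (\<lambda>((y, s), u). (1 - u) * s + u * squash z0 e s)" by (simp add: case_prod_beta')
    show "deriv (\<lambda>s. (1 - u) * s + u * squash z0 e s) s > 0" if u: "u \<in> {0..1}" for u s
    proof -
      obtain D where D: "D > 0" "(squash z0 e has_real_derivative D) (at s)" using squash_deriv[OF z(3)] by blast
      have "((\<lambda>s. (1 - u) * s + u * squash z0 e s) has_real_derivative (1 - u) * 1 + u * D) (at s)"
        by (intro DERIV_add DERIV_cmult DERIV_ident D(2))
      moreover have "(1 - u) * 1 + u * D > 0"
      proof (cases "u = 0")
        case False
        then have "u * D > 0" using u D(1) by simp
        then show ?thesis using u by simp
      qed simp
      ultimately show ?thesis using DERIV_imp_deriv by metis
    qed
    show "(1 - u) * s + u * squash z0 e s = (1 - 0) * s + 0 * squash z0 e s" if "(y, s) \<in> Z2" for y s u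
      using that squash_id[OF z(3), of s] by (simp add: Z2_def algebra_simps)
  qed
  have \<sigma>start: "\<sigma> s t < 1" if "z1 < t" "t \<le> 13/10" for s t
    unfolding \<sigma>_def
    by (rule channel_start) (use that squeeze_1[OF z(1), of t] logistic_bounds[of s] in \<open>auto simp: narrow_def\<close>)
  \<comment> \<open>The purpose of the narrowing: from \<open>z1\<close> to \<open>13/10\<close> the
    values of \<open>\<sigma>\<close> stay below \<open>1\<close>, where nothing drops, so that one
    formula for the time holds on all of \<open>\<Omega>\<close>.\<close>
  have ft: "fold_time (\<sigma> s t) t = t + drop_height (\<sigma> s t)" if "z1 < t" "t < 7/4" for s t
  proof (cases "23/20 < t")
    case True
    then show ?thesis unfolding \<sigma>_def by (rule fold_time_channel[OF _ that(2)])
  next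
    case False
    then show ?thesis using \<sigma>start[OF that(1), of s] by (simp add: fold_time_def drop_height_0)
  qed
  have \<sigma>mono: "strict_mono (\<lambda>s. \<sigma> s t)" for t
  proof -
    have "strict_mono (\<lambda>s. narrow z1 1 s t)" by (rule strict_mono_if_deriv_pos) (use nd in auto)
    moreover have "strict_mono (\<lambda>s. channel s t)"
      by (rule strict_mono_if_deriv_pos) (metis channel_deriv)
    ultimately show ?thesis unfolding \<sigma>_def strict_mono_def by blast
  qed
  define \<Omega> where "\<Omega> = {p \<in> tW. snd p \<in> {z1<..<7/4}}"
  have \<Omega>: "diffeo_on W \<Omega> W Fn"
  proof (rule local_diffeo_inj_imp_diffeo_on[OF smooth_W smooth_W _ _ refl])
    show "local_diffeo W \<Omega> W Fn"
      unfolding \<Omega>_def by (rule local_diffeo_subset[OF smooth_W smooth_W ldF openin_W_time]) auto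
    \<comment> \<open>If the slid coordinates agree, so do the drops, and then the times. At equal
      times \<open>\<sigma>\<close> is strictly monotone in the height.\<close>
    show "inj_on Fn \<Omega>"
    proof (rule inj_onI)
      fix p p' assume a: "p \<in> \<Omega>" "p' \<in> \<Omega>" and eq: "Fn p = Fn p'"
      obtain b t b' t' where p: "p = (b, t)" "p' = (b', t')" by (metis surj_pair)
      have b: "b \<in> tB" "b' \<in> tB" and t: "z1 < t" "t < 7/4" "z1 < t'" "t' < 7/4"
        using a p by (auto simp: \<Omega>_def)
      have s: "\<sigma> (height b) t = \<sigma> (height b') t'" "fst (\<theta> b) = fst (\<theta> b')"
        using eq slide_eqD[OF _ b] by (auto simp: p Fn b)
      have "t + drop_height (\<sigma> (height b) t) = t' + drop_height (\<sigma> (height b') t')"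
        using eq ft[OF t(1,2)] ft[OF t(3,4)] by (simp add: p Fn b)
      then have tt: "t = t'" using s(1) by simp
      then have "height b = height b'" using s(1) strict_mono_eq[OF \<sigma>mono[of t]] by simp
      then show "p = p'" using height_eqD[OF b s(2)] tt p by simp
    qed
  qed
  have Z2o: "openin (mtop W) Z2" unfolding Z2_def by (rule openin_W_time) simp
  \<comment> \<open>Outside \<open>\<Omega>\<close> the time is either unchanged and at most
    \<open>z1\<close>, or squashed below \<open>0\<close>. In both cases it lies in the range that
    \<open>\<gamma>2\<close> leaves alone.\<close>
  have Fn_time: "snd (Fn (b, t)) < z0" if "b \<in> tB" "t \<le> z1 \<or> t \<ge> 17/10" for b t
    using that z squash_less[of "-1" 0 "t - 3"] by (auto simp: Fn fold_time_def)
  have Fn_in: "Fn p \<in> tW" if "p \<in> tW" for p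
    using that slide_in by (auto simp: Fn)
  have "iso_path k W {p \<in> topspace (mtop W). Fn p \<in> Z2} (\<lambda>u. {p \<in> topspace (mtop W). Fn p \<in> \<gamma>2 u})"
  proof (rule iso_path_vimage[OF smooth_W smooth_W _ \<Omega> Z2o _ iso2])
    show "local_diffeo W (topspace (mtop W)) W Fn" using ldF by simp
    fix p assume "p \<in> topspace (mtop W)" "p \<notin> \<Omega>"
    then show "Fn p \<in> Z2" using Fn_time[of "fst p" "snd p"] Fn_in[of p] by (cases p) (auto simp: \<Omega>_def Z2_def)
  qed
  then have "iso_path k W {p \<in> tW. Fn p \<in> Z2} (\<lambda>u. {p \<in> tW. Fn p \<in> \<gamma>2 u})"
    by (simp only: topspace_times_interval)
  then have iso2': "iso_path k W {p \<in> tW. snd p \<in> T0} (\<lambda>u. {p \<in> tW. Fn p \<in> \<gamma>2 u})"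
  proof (rule iso_path_mono)
    show "{p \<in> tW. snd p \<in> T0} \<subseteq> {p \<in> tW. Fn p \<in> Z2}"
    proof
      fix p assume p: "p \<in> {p \<in> tW. snd p \<in> T0}"
      obtain b t where bt: "p = (b, t)" by (cases p)
      have b: "b \<in> tB" and "t \<le> z1 \<or> t \<ge> 17/10" using p z by (auto simp: T0_def bt)
      then show "p \<in> {p \<in> tW. Fn p \<in> Z2}" using Fn_time[OF b] Fn_in[of "(b, t)"] by (auto simp: Z2_def bt)
    qed
  qed
  \<comment> \<open>The second stage ends with a set that does not depend on time, because
    \<open>squash\<close> puts every time below \<open>e\<close>, where the slices of
    \<open>G\<close> are all equal.\<close>
  define P3 where "P3 = {(b, t::real). b \<in> tB \<and> (b, 0::real) \<in> G}"
  have P3_alt: "\<gamma>2 1 = P3"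
    using G0 squash_less[OF z(3)] by (auto simp: \<gamma>2_def P3_def)
  have P3: "P3 \<in> Psi_set k W" using iso2 unfolding P3_alt[symmetric] iso_path_def by auto
  have g20: "{p \<in> tW. Fn p \<in> \<gamma>2 0} = \<gamma>1 1"
    unfolding g11 using slide_in by (auto simp: \<gamma>2_def Fn)
  \<comment> \<open>A convex combination of functions with positive derivative has positive
    derivative, so the interpolation between \<open>\<sigma>\<close> and the identity stays among
    local diffeomorphisms. Over \<open>T0\<close> both agree already.\<close>
  define \<gamma>3 where "\<gamma>3 u = {(b, t). b \<in> tB \<and> (slide b ((1 - u) * \<sigma> (height b) t + u * height b), t) \<in> P3}" for u
  have iso3: "iso_path k W {p \<in> tW. snd p \<in> T0} \<gamma>3"
    unfolding \<gamma>3_def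
  proof (rule iso_path_slide[where f = "\<lambda>u s t. (1 - u) * \<sigma> s t + u * s", OF _ _ T0 _ P3])
    have VU: "smooth_manifold (times_interval V UNIV)" by (rule smooth_manifold_times_interval[OF smooth_V open_UNIV])
    show "sfun (times_interval V UNIV) (tV \<times> UNIV)
        (\<lambda>q. (1 - snd q) * \<sigma> (snd (fst q)) (snd (fst (fst q))) + snd q * snd (fst q))"
      unfolding \<sigma>_def
      by (intro sfun_add sfun_mult sfun_diff sfun_const sfun_channel sfun_narrow VU sfun_VU_coords sfun_openin[OF sfun_VU_coords(1)])
    show "(1 - u) * \<sigma> s t + u * s = (1 - 0) * \<sigma> s t + 0 * s" if "t \<in> T0" for u s t
    proof -
      have "\<sigma> s t = s"
        using squeeze_0[OF z(1) T0D(1)[OF that]] channel_id[OF T0D(2)[OF that]] by (simp add: \<sigma>_def narrow_def)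
      then show ?thesis by (simp add: algebra_simps)
    qed
    fix u s t :: real assume u: "u \<in> {0..1}"
    obtain D where D: "D > 0" "((\<lambda>s. narrow z1 1 s t) has_real_derivative D) (at s)" using nd[of 1 t s] by auto
    obtain D' where D': "D' > 0" "((\<lambda>s. channel s t) has_real_derivative D') (at (narrow z1 1 s t))" by (rule channel_deriv)
    have "((\<lambda>s. \<sigma> s t) has_real_derivative D' * D) (at s)"
      unfolding \<sigma>_def by (rule DERIV_chain2[where f = "\<lambda>s. channel s t", OF D'(2) D(2)])
    then have "((\<lambda>s. (1 - u) * \<sigma> s t + u * s) has_real_derivative (1 - u) * (D' * D) + u * 1) (at s)"
      by (intro DERIV_add DERIV_cmult DERIV_ident)
    moreover have "(1 - u) * (D' * D) + u * 1 > 0"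
    proof (cases "u = 1")
      case False
      then have "(1 - u) * (D' * D) > 0" using u D(1) D'(1) by simp
      then show ?thesis using u by simp
    qed simp
    ultimately show "\<exists>D>0. ((\<lambda>s. (1 - u) * \<sigma> s t + u * s) has_real_derivative D) (at s)" by blast
  qed
  have g30: "\<gamma>3 0 = {p \<in> tW. Fn p \<in> \<gamma>2 1}"
    unfolding P3_alt using slide_in by (auto simp: \<gamma>3_def Fn P3_def)
  have g31: "\<gamma>3 1 = P3"
    by (auto simp: \<gamma>3_def P3_def)
  have Zeq: "Z = {p \<in> tW. snd p \<in> T0}" by (simp add: Z_def T0_def)
  show thesis
  proof (rule that[OF D0 D0_low])
    show "(b, t + 2) \<in> D0 \<longleftrightarrow> (b, t) \<in> G" if "b \<in> tB" "\<bar>t\<bar> < \<delta>" for b t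
      using D0_high[OF that(1), of "t + 2"] G0[OF that(1), of t] that(2) z e by (auto simp: abs_less_iff)
    show "isotopic k W Z D0 (\<gamma>1 1)" unfolding isotopic_def Zeq using iso1 g10 by blast
    show "isotopic k W Z (\<gamma>1 1) (\<gamma>3 0)" unfolding isotopic_def Zeq using iso2' g20 g30 by blast
    show "isotopic k W Z (\<gamma>3 0) {(b, t). b \<in> tB \<and> (b, 0) \<in> G}"
      unfolding isotopic_def Zeq using iso3 g31 by (auto simp: P3_def)
    show "{(b, t). b \<in> tB \<and> (b, 0) \<in> G} \<in> Psi_set k W" using P3 by (simp add: P3_def)
  qed
qed

end

section \<open>Orthogonality and the group like condition\<close>

lemma restr_Psi: "restr (Psi k) B G I = G \<inter> (topspace (mtop B) \<times> I)"
  by (auto simp: restr_def Psi_def)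

lemma pull_line_Psi:
  "pull_line (Psi k) B J' J \<alpha> G = {(b, t). b \<in> topspace (mtop B) \<and> t \<in> J' \<and> (b, \<alpha> t) \<in> G}"
  by (auto simp: pull_line_def Psi_def)

lemma bd_sections_Psi: "bd_sections (Psi k) B = Psi_space k (times_interval B UNIV)"
  by (simp add: bd_sections_def Psi_def)

lemma glue_Psi: "glue (Psi k) = (\<union>)"
  by (simp add: Psi_def)

lemma translate_Psi: "translate (Psi k) B u G = {(b, t). b \<in> topspace (mtop B) \<and> (b, t + u) \<in> G}"
  by (simp add: translate_def pull_line_Psi)

lemma perp_antimono: "I' \<subseteq> I \<Longrightarrow> perp F B I \<subseteq> perp F B I'"
  unfolding perp_def by blast

lemma perp_Psi_set: "G \<in> perp (Psi k) B I \<Longrightarrow> G \<in> Psi_set k (times_interval B UNIV)"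
  by (simp add: perp_def bd_sections_Psi topspace_Psi_space)

text \<open>Meant for \<open>inv_into\<close>, which is known to agree with the inverse translation
  only on the interval in question.\<close>

lemma smooth_real_cong:
  assumes J: "open J" and fg: "\<And>x. x \<in> J \<Longrightarrow> f x = g x" and f: "smooth_real J f"
  shows "smooth_real J g"
proof -
  have eq: "(deriv ^^ m) f x = (deriv ^^ m) g x" if "x \<in> J" for m x
    using that
  proof (induction m arbitrary: x)
    case (Suc m)
    have "\<forall>\<^sub>F y in nhds x. y \<in> J" by (rule eventually_nhds_in_open[OF J Suc.prems])
    then have "\<forall>\<^sub>F y in nhds x. (deriv ^^ m) f y = (deriv ^^ m) g y"
      by (rule eventually_mono) (rule Suc.IH)
    then show ?case by (simp add: deriv_cong_ev)
  qed (use fg in auto)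
  show ?thesis
    unfolding smooth_real_def
  proof (intro allI ballI)
    fix m t assume t: "t \<in> J"
    obtain D where "((deriv ^^ m) f has_field_derivative D) (at t)"
      using f t unfolding smooth_real_def field_differentiable_def by blast
    then have "((deriv ^^ m) g has_field_derivative D) (at t)"
      by (rule has_field_derivative_transform_within_open[OF _ J t eq])
    then show "(deriv ^^ m) g field_differentiable at t" by (auto simp: field_differentiable_def)
  qed
qed

lemma smooth_real_translation: "smooth_real J (\<lambda>x. x + c)"
proof -
  have d: "deriv (\<lambda>x::real. x + c) = (\<lambda>x. 1)"
    by (rule ext, rule DERIV_imp_deriv) (auto intro!: derivative_eq_intros)
  have "(deriv ^^ m) (\<lambda>x. x + c) \<in> {\<lambda>x. x + c, \<lambda>x. 1, \<lambda>x. 0}" for m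
    by (induction m) (auto simp: d)
  moreover have "f field_differentiable at t" if "f \<in> {\<lambda>x. x + c, \<lambda>x. 1, \<lambda>x. 0}" for f t
    using that by (auto intro!: field_differentiable_add field_differentiable_ident field_differentiable_const)
  ultimately have "(deriv ^^ m) (\<lambda>x. x + c) field_differentiable at t" for m t by blast
  then show ?thesis by (simp add: smooth_real_def)
qed

text \<open>Translations between small intervals round \<open>t'\<close> and \<open>t\<close> are
  among the diffeomorphisms in the definition of \<open>perp\<close>, and they compare the two
  slices.\<close>

lemma perp_PsiD:
  assumes G: "G \<in> perp (Psi k) B I" and I: "open I" and b: "b \<in> topspace (mtop B)" and t: "t \<in> I" "t' \<in> I"
  shows "(b, t) \<in> G \<longleftrightarrow> (b, t') \<in> G"
proof -
  obtain r1 where r1: "r1 > 0" "ball t r1 \<subseteq> I" using I t(1) open_contains_ball by blast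
  obtain r2 where r2: "r2 > 0" "ball t' r2 \<subseteq> I" using I t(2) open_contains_ball by blast
  define r where "r = min r1 r2"
  define J where "J = {t - r<..<t + r}"
  define J' where "J' = {t' - r<..<t' + r}"
  define \<alpha> where "\<alpha> x = x + (t - t')" for x
  have r: "r > 0" using r1 r2 by (simp add: r_def)
  have JI: "J \<subseteq> I" "J' \<subseteq> I"
    using r1(2) r2(2) by (auto simp: J_def J'_def r_def dist_real_def subset_iff)
  have bij: "bij_betw \<alpha> J' J"
    by (rule bij_betw_byWitness[of _ "\<lambda>x. x - (t - t')"]) (auto simp: \<alpha>_def J_def J'_def)
  have inv: "x + (t' - t) = inv_into J' \<alpha> x" if "x \<in> J" for x
  proof -
    have "x + (t' - t) \<in> J'" using that by (auto simp: J_def J'_def)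
    then show ?thesis
      using inv_into_f_f[OF bij_betw_imp_inj_on[OF bij], of "x + (t' - t)"] by (simp add: \<alpha>_def)
  qed
  have "smooth_real J (inv_into J' \<alpha>)"
    by (rule smooth_real_cong[OF _ inv smooth_real_translation]) (simp add: J_def)
  moreover have "smooth_real J' \<alpha>" using smooth_real_translation[of J' "t - t'"] by (simp add: \<alpha>_def[abs_def])
  moreover have "open J" "is_interval J" "open J'" "is_interval J'" by (simp_all add: J_def J'_def is_interval_oo)
  moreover have "strict_mono_on J' \<alpha>" by (simp add: strict_mono_on_def \<alpha>_def)
  ultimately have "restr (Psi k) B G J' = pull_line (Psi k) B J' J \<alpha> (restr (Psi k) B G J)"
    using G JI bij unfolding perp_def by blast
  then have "(b, t') \<in> restr (Psi k) B G J' \<longleftrightarrow> (b, t') \<in> pull_line (Psi k) B J' J \<alpha> (restr (Psi k) B G J)" by simp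
  then show ?thesis using b r by (auto simp: restr_Psi pull_line_Psi J_def J'_def \<alpha>_def)
qed

text \<open>When all slices over \<open>I\<close> are equal, no map between subintervals of
  \<open>I\<close> can change the section.\<close>

lemma perp_PsiI:
  assumes G: "G \<in> Psi_set k (times_interval B UNIV)"
    and c: "\<And>b t t'. b \<in> topspace (mtop B) \<Longrightarrow> t \<in> I \<Longrightarrow> t' \<in> I \<Longrightarrow> (b, t) \<in> G \<longleftrightarrow> (b, t') \<in> G"
  shows "G \<in> perp (Psi k) B I"
  unfolding perp_def mem_Collect_eq
proof (intro conjI allI impI; (elim conjE)?)
  show "G \<in> topspace (bd_sections (Psi k) B)" using G by (simp add: bd_sections_Psi topspace_Psi_space)
  fix J J' \<alpha> assume J: "J \<subseteq> I" "J' \<subseteq> I" and bij: "bij_betw \<alpha> J' (J :: real set)"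
  have "\<alpha> t \<in> J" if "t \<in> J'" for t using bij that bij_betwE by blast
  then show "restr (Psi k) B G J' = pull_line (Psi k) B J' J \<alpha> (restr (Psi k) B G J)"
    using c J unfolding restr_Psi pull_line_Psi by fastforce
qed

context split_line
begin

lemma right_inverse_exists:
  assumes e: "0 < e" and G: "G \<in> perp (Psi k) B {..<e}" "G \<in> perp (Psi k) B {1 - e<..}"
  shows "\<exists>R. right_inverse (Psi k) B G R"
proof -
  define e' where "e' = min e (1/20)"
  have e': "0 < e'" "e' \<le> 1/20" "e' \<le> e" using e by (auto simp: e'_def)
  define \<delta> where "\<delta> = e' / 8"
  have \<delta>: "0 < \<delta>" "\<delta> < 1/20" "\<delta> < e" using e' by (auto simp: \<delta>_def)
  have GP: "G \<in> Psi_set k W" by (rule perp_Psi_set[OF G(1)])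
  have G0: "(b, t) \<in> G \<longleftrightarrow> (b, 0) \<in> G" if "b \<in> tB" "t < e'" for b t
    by (rule perp_PsiD[OF G(1)]) (use that e' e in auto)
  let ?Z = "{p \<in> tW. snd p \<in> {..<\<delta>} \<union> {2 - \<delta><..}}"
  let ?P = "{(b, t::real). b \<in> tB \<and> (b, 0::real) \<in> G}"
  obtain R Q1 Q2 where R: "R \<in> Psi_set k W"
    and low: "\<And>b t. b \<in> tB \<Longrightarrow> t < 1 + \<delta> \<Longrightarrow> (b, t) \<in> R \<longleftrightarrow> (b, t) \<in> G"
    and high: "\<And>b t. b \<in> tB \<Longrightarrow> \<bar>t\<bar> < \<delta> \<Longrightarrow> (b, t + 2) \<in> R \<longleftrightarrow> (b, t) \<in> G"
    and chain: "isotopic k W ?Z R Q1" "isotopic k W ?Z Q1 Q2" "isotopic k W ?Z Q2 ?P"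
    and P: "?P \<in> Psi_set k W"
    using fold_chain[OF GP e'(1,2) G0, folded \<delta>_def] by blast
  obtain \<gamma> where \<gamma>: "pathin (Psi_space k W) \<gamma>" "\<gamma> 0 = R" "\<gamma> 1 = ?P" "\<And>t. t \<in> {0..1} \<Longrightarrow> \<gamma> t \<inter> ?Z = R \<inter> ?Z"
    using isotopic_chain_path[OF smooth_W chain] by blast
  have Rt: "R \<subseteq> tW" using Psi_set_subset[OF R] by simp
  have "right_inverse (Psi k) B G R"
    unfolding right_inverse_def bd_sections_Psi topspace_Psi_space
  proof (intro conjI exI[of _ \<delta>] exI[of _ \<gamma>] R \<gamma>(1) \<delta>(1) ballI IntI)
    show "G \<in> perp_at (Psi k) B 0"
      unfolding perp_at_def using perp_antimono[of "{0 - e<..<0 + e}" "{..<e}" "Psi k" B] G(1) e by force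
    show "G \<in> perp_at (Psi k) B 1"
      unfolding perp_at_def using perp_antimono[of "{1 - e<..<1 + e}" "{1 - e<..}" "Psi k" B] G(2) e by force
    show "restr (Psi k) B R {1 - \<delta><..<1 + \<delta>} = restr (Psi k) B G {1 - \<delta><..<1 + \<delta>}"
      using low by (auto simp: restr_Psi)
    show "restr (Psi k) B (translate (Psi k) B 2 R) {- \<delta><..<\<delta>} = restr (Psi k) B G {- \<delta><..<\<delta>}"
      using high by (auto simp: restr_Psi translate_Psi)
    \<comment> \<open>Both pieces are parts of \<open>R\<close>, since \<open>R\<close> agrees with
      \<open>G\<close> below \<open>1 + \<delta>\<close>, and together they cover all times.\<close>
    show "\<gamma> 0 = glue (Psi k) (restr (Psi k) B G {..<1 + \<delta>}) (restr (Psi k) B R {1 - \<delta><..})"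
      using low Rt \<delta>(1) by (force simp: \<gamma>(2) glue_Psi restr_Psi)
    show "\<gamma> 1 \<in> perp (Psi k) B {- \<delta><..<2 + \<delta>}"
      unfolding \<gamma>(3) by (rule perp_PsiI[OF P]) simp
    fix t :: real assume t: "t \<in> {0..1}"
    have eq: "(b, s) \<in> \<gamma> t \<longleftrightarrow> (b, s) \<in> R" if "b \<in> tB" "s < \<delta> \<or> s > 2 - \<delta>" for b s
    proof -
      have "(b, s) \<in> ?Z" using that by simp
      then show ?thesis using eqset_imp_iff[OF \<gamma>(4)[OF t], of "(b, s)"] by (simp only: Int_iff simp_thms)
    qed
    show "restr (Psi k) B (\<gamma> t) {..<\<delta>} = restr (Psi k) B G {..<\<delta>}"
      using eq low by (auto simp: restr_Psi)
    show "restr (Psi k) B (\<gamma> t) {2 - \<delta><..} = restr (Psi k) B R {2 - \<delta><..}"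
      using eq by (auto simp: restr_Psi)
  qed
  then show ?thesis by blast
qed

text \<open>This reflection exchanges \<open>0\<close> and \<open>1\<close> and takes
  \<open>2\<close> to \<open>-1\<close>, so it exchanges the places at which right and left inverses
  are subject to conditions.\<close>

definition reflect :: "'a \<times> real \<Rightarrow> 'a \<times> real" where "reflect = (\<lambda>(b, t). (b, 1 - t))"

lemma diffeo_reflect: "diffeo_on W tW W reflect"
proof -
  have "sfun W tW (\<lambda>p. 1 - snd p)"
    by (intro sfun_diff sfun_const smooth_W sfun_W_coords(2) sfun_openin[OF sfun_W_coords(2)])
  then have s: "smap W tW W reflect"
    using smap_Pair[OF smooth_W B open_UNIV smap_fst[OF B open_UNIV]] by (simp add: reflect_def case_prod_beta')
  have inj: "inj_on reflect tW" by (auto simp: reflect_def inj_on_def)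
  have im: "reflect ` tW = tW"
  proof (intro subset_antisym subsetI)
    show "q \<in> tW" if "q \<in> reflect ` tW" for q using that by (auto simp: reflect_def)
    show "q \<in> reflect ` tW" if "q \<in> tW" for q
      using that by (intro image_eqI[of _ _ "reflect q"]) (auto simp: reflect_def)
  qed
  have "inv_into tW reflect q = reflect q" if "q \<in> tW" for q
    using inv_into_f_f[OF inj, of "reflect q"] that by (auto simp: reflect_def)
  then have "smap W (reflect ` tW) W (inv_into tW reflect)"
    unfolding im using smap_subset[OF smooth_W s smap_openin[OF s]] by simp
  then show ?thesis using s inj by (simp add: diffeo_on_def)
qed

text \<open>Reversing time turns the product part of \<open>G\<close> beyond \<open>1\<close> into a
  product part below \<open>0\<close>, so \<open>fold_chain\<close> applies to the reflected
  section. Sections and isotopies return by taking preimages under the same reflection, which is its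
  own inverse.\<close>

lemma left_inverse_exists:
  assumes e: "0 < e" and G: "G \<in> perp (Psi k) B {..<e}" "G \<in> perp (Psi k) B {1 - e<..}"
  shows "\<exists>L. left_inverse (Psi k) B G L"
proof -
  define e' where "e' = min e (1/20)"
  have e': "0 < e'" "e' \<le> 1/20" "e' \<le> e" using e by (auto simp: e'_def)
  define \<delta> where "\<delta> = e' / 8"
  have \<delta>: "0 < \<delta>" "\<delta> < 1/20" "\<delta> < e" using e' by (auto simp: \<delta>_def)
  have GP: "G \<in> Psi_set k W" by (rule perp_Psi_set[OF G(1)])
  have ref: "{p \<in> tW. reflect p \<in> X} \<in> Psi_set k W" if "X \<in> Psi_set k W" for X
    using Psi_set_vimage[OF smooth_W smooth_W _ that, of reflect] diffeo_on_imp_local_diffeo[OF diffeo_reflect] by simp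
  define G' where "G' = {p \<in> tW. reflect p \<in> G}"
  have G'P: "G' \<in> Psi_set k W" unfolding G'_def by (rule ref[OF GP])
  have G': "(b, t) \<in> G' \<longleftrightarrow> (b, 1 - t) \<in> G" if "b \<in> tB" for b t using that by (simp add: G'_def reflect_def)
  have G0: "(b, t) \<in> G' \<longleftrightarrow> (b, 0) \<in> G'" if "b \<in> tB" "t < e'" for b t
    unfolding G'[OF that(1)] by (rule perp_PsiD[OF G(2)]) (use that e' e in auto)
  let ?Z = "{p \<in> tW. snd p \<in> {..<\<delta>} \<union> {2 - \<delta><..}}"
  let ?P = "{(b, t::real). b \<in> tB \<and> (b, 0::real) \<in> G'}"
  obtain R Q1 Q2 where R: "R \<in> Psi_set k W"
    and low: "\<And>b t. b \<in> tB \<Longrightarrow> t < 1 + \<delta> \<Longrightarrow> (b, t) \<in> R \<longleftrightarrow> (b, t) \<in> G'"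
    and high: "\<And>b t. b \<in> tB \<Longrightarrow> \<bar>t\<bar> < \<delta> \<Longrightarrow> (b, t + 2) \<in> R \<longleftrightarrow> (b, t) \<in> G'"
    and chain: "isotopic k W ?Z R Q1" "isotopic k W ?Z Q1 Q2" "isotopic k W ?Z Q2 ?P"
    and P: "?P \<in> Psi_set k W"
    using fold_chain[OF G'P e'(1,2) G0, folded \<delta>_def] by blast
  define L where "L = {p \<in> tW. reflect p \<in> R}"
  have LR: "(b, t) \<in> L \<longleftrightarrow> (b, 1 - t) \<in> R" if "b \<in> tB" for b t using that by (simp add: L_def reflect_def)
  have LP: "L \<in> Psi_set k W" unfolding L_def by (rule ref[OF R])
  have Zo: "openin (mtop W) ?Z" by (rule openin_W_time) auto
  let ?Z' = "{p \<in> tW. reflect p \<in> ?Z}"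
  have iso: "isotopic k W ?Z' {p \<in> tW. reflect p \<in> X} {p \<in> tW. reflect p \<in> Y}" if "isotopic k W ?Z X Y" for X Y
    using isotopic_vimage[OF smooth_W smooth_W _ Zo that, of reflect] diffeo_reflect by simp
  obtain \<gamma> where \<gamma>: "pathin (Psi_space k W) \<gamma>" "\<gamma> 0 = L" "\<gamma> 1 = {p \<in> tW. reflect p \<in> ?P}"
    "\<And>t. t \<in> {0..1} \<Longrightarrow> \<gamma> t \<inter> ?Z' = L \<inter> ?Z'"
    using isotopic_chain_path[OF smooth_W iso[OF chain(1)] iso[OF chain(2)] iso[OF chain(3)]] unfolding L_def by blast
  have Lt: "L \<subseteq> tW" by (auto simp: L_def)
  have lowL: "(b, t) \<in> L \<longleftrightarrow> (b, t) \<in> G" if "b \<in> tB" "t > - \<delta>" for b t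
    using low[OF that(1), of "1 - t"] that G' LR by simp
  \<comment> \<open>A shift of the reflected time \<open>1 - t\<close> by \<open>2\<close> is a
    shift of \<open>t\<close> by \<open>-2\<close>.\<close>
  have highL: "(b, t - 2) \<in> L \<longleftrightarrow> (b, t) \<in> G" if "b \<in> tB" "\<bar>t - 1\<bar> < \<delta>" for b t
    using high[OF that(1), of "1 - t"] that G' LR by (simp add: abs_minus_commute)
  have "left_inverse (Psi k) B G L"
    unfolding left_inverse_def bd_sections_Psi topspace_Psi_space
  proof (intro conjI exI[of _ \<delta>] exI[of _ \<gamma>] LP \<gamma>(1) \<delta>(1) ballI IntI)
    show "G \<in> perp_at (Psi k) B 0"
      unfolding perp_at_def using perp_antimono[of "{0 - e<..<0 + e}" "{..<e}" "Psi k" B] G(1) e by force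
    show "G \<in> perp_at (Psi k) B 1"
      unfolding perp_at_def using perp_antimono[of "{1 - e<..<1 + e}" "{1 - e<..}" "Psi k" B] G(2) e by force
    show "restr (Psi k) B L {- \<delta><..<\<delta>} = restr (Psi k) B G {- \<delta><..<\<delta>}"
      using lowL by (auto simp: restr_Psi)
    show "restr (Psi k) B (translate (Psi k) B (- 2) L) {1 - \<delta><..<1 + \<delta>} = restr (Psi k) B G {1 - \<delta><..<1 + \<delta>}"
      using highL by (auto simp: restr_Psi translate_Psi abs_less_iff)
    show "\<gamma> 0 = glue (Psi k) (restr (Psi k) B L {..<\<delta>}) (restr (Psi k) B G {- \<delta><..})"
      using lowL Lt \<delta>(1) by (force simp: \<gamma>(2) glue_Psi restr_Psi)
    show "\<gamma> 1 \<in> perp (Psi k) B {- 1 - \<delta><..<1 + \<delta>}"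
      unfolding \<gamma>(3) by (rule perp_PsiI[OF ref[OF P]]) (simp add: reflect_def)
    fix t :: real assume t: "t \<in> {0..1}"
    have eq: "(b, s) \<in> \<gamma> t \<longleftrightarrow> (b, s) \<in> L" if "b \<in> tB" "s > 1 - \<delta> \<or> s < - 1 + \<delta>" for b s
    proof -
      have "(b, s) \<in> ?Z'" using that by (auto simp: reflect_def)
      then show ?thesis using eqset_imp_iff[OF \<gamma>(4)[OF t], of "(b, s)"] by (simp only: Int_iff simp_thms)
    qed
    show "restr (Psi k) B (\<gamma> t) {..<- 1 + \<delta>} = restr (Psi k) B L {..<- 1 + \<delta>}"
      using eq by (auto simp: restr_Psi)
    show "restr (Psi k) B (\<gamma> t) {1 - \<delta><..} = restr (Psi k) B G {1 - \<delta><..}"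
      using eq lowL \<delta>(2) by (auto simp: restr_Psi)
  qed
  then show ?thesis by blast
qed

end

theorem proposition4p7:
  fixes M :: "'a manifold" and N :: "'b manifold" and c :: "'a \<times> real \<Rightarrow> 'a" and d k :: nat
  assumes "manifold_with_boundary M" and "mdim M = d" and "collar M c"
    and "manifold_without_boundary N" and "mdim N + 2 = d"
    and "diffeomorphic (boundary M) (times_interval N UNIV)"
  shows "group_like (Psi k) M"
proof -
  let ?B = "boundary M" and ?NR = "times_interval N UNIV"
  have B: "smooth_manifold ?B" by (rule smooth_manifold_boundary[OF assms(1)])
  have N: "smooth_manifold N" by (rule manifold_without_boundary_imp_smooth_manifold[OF assms(4)])
  have NR: "smooth_manifold ?NR" by (rule smooth_manifold_times_interval[OF N open_UNIV])
  obtain \<theta> where \<theta>: "diffeomorphism ?B ?NR \<theta>" using assms(6) by (auto simp: diffeomorphic_def)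
  have hom: "homeomorphic_map (mtop ?B) (mtop ?NR) \<theta>" using \<theta> by (simp add: diffeomorphism_def)
  have onto: "\<theta> ` topspace (mtop ?B) = topspace (mtop ?NR)" by (rule homeomorphic_imp_surjective_map[OF hom])
  \<comment> \<open>The dimension of the boundary is \<open>d - 1\<close> and that of the product is
    \<open>mdim N + 1\<close>; they agree by \<open>mdim N + 2 = d\<close>.\<close>
  have "diffeo_on ?B (topspace (mtop ?B)) ?NR \<theta>"
    unfolding diffeo_on_def onto
    using \<theta> homeomorphic_imp_injective_map[OF hom] smooth_map_iff_smap[OF B NR] smooth_map_iff_smap[OF NR B] assms(2,5)
    by (auto simp: diffeomorphism_def boundary_def)
  then interpret split_line ?B N \<theta>
    using B N onto by unfold_locales simp_all
  show ?thesis
    unfolding group_like_def using right_inverse_exists left_inverse_exists by blast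
qed

end
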